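(* Let $(M^n,g,\phi)$ and $(\widehat{M}^n,\widehat{g},\widehat{\phi})$ be manifolds with density. Let $\gamma:[0,S]\to M$ and $\widehat{\gamma}:[0,S]\to\widehat{M}$ be, respectively, a $\phi$-geodesic and a $\widehat{\phi}$-geodesic with standard parametrization, with $\gamma$ having no focal points to the geodesic submanifold given by $\exp_{\gamma(0)}(\dot\gamma(0)^{\perp})$ (near $\gamma(0)$). Suppose that $$R^{\nabla^{\phi}}(V,\dot{\gamma},\dot{\gamma},V)\ \ge\ R^{\widehat{\nabla}^{\widehat{\phi}}}(\widehat{V},\dot{\widehat{\gamma}},\dot{\widehat{\gamma}},\widehat{V})$$ for every $s\in[0,S]$ and all unit vectors $V\in T_{\gamma(s)}M$, $\widehat{V}\in T_{\widehat{\gamma}(s)}\widehat{M}$ perpendicular to $\dot\gamma(s)$ and $\dot{\widehat\gamma}(s)$ respectively. Let $J$ and $\widehat{J}$ be Jacobi fields along $\gamma,\widehat{\gamma}$ respectively, parametrized in terms of $s$, with $$J'(0)=0,\quad \widehat{J}'(0)=0,\quad |J(0)|=|\widehat{J}(0)|,\quad J(0)\perp\dot\gamma(0),\quad \widehat{J}(0)\perp\dot{\widehat{\gamma}}(0).$$ Then, for every $s\in[0,S]$ such that $\widehat J$ does not vanish on $[0,s]$, $$e^{\phi(\gamma(0))-\phi(\gamma(s))}|J(s)|\ \le\ e^{\widehat\phi(\widehat{\gamma}(0))-\widehat\phi(\widehat{\gamma}(s))}\,|\widehat{J}(s)|\;e^{\left(d\widehat{\phi}(\dot{\widehat{\gamma}}(0))-d\phi(\dot\gamma(0))\right)\tau(s)},$$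 where $$\tau(s)=\int_0^s\frac{|e^{-\widehat\phi}\widehat{J}|^2(0)}{|e^{-\widehat\phi}\widehat{J}|^2(\xi)}\,d\xi .$$
   Context: A manifold with density $(M^n,g,\phi)$ is an $n$-dimensional Riemannian manifold $(M,g)$ with a smooth function $\phi:M\to\mathbb{R}$. With $\nabla$ the Levi-Civita connection of $g$, the weighted connection is $\nabla^{\phi}_XY=\nabla_XY-d\phi(X)Y-d\phi(Y)X$, with curvature $$R^{\nabla^\phi}(X,Y)Z=\nabla^{\phi}_X\nabla^{\phi}_YZ-\nabla^{\phi}_Y\nabla^{\phi}_XZ-\nabla^{\phi}_{[X,Y]}Z,$$ and $R^{\nabla^\phi}(V,\dot\gamma,\dot\gamma,V)=g(R^{\nabla^\phi}(V,\dot\gamma)\dot\gamma,V)$. Hatted objects are the analogous ones on $\widehat M$. The geodesics of $\nabla^\phi$ ($\phi$-geodesics) are reparametrizations of $g$-geodesics. A $\phi$-geodesic $\gamma(s)$ with standard parametrization is the curve obtained from a unit speed $g$-geodesic $\sigma(t)$ by the change of parameter $s(t)=\int_0^t e^{-2\phi(\sigma(\tau))}d\tau$; a dot denotes the derivative in $s$, so $\dot\gamma=e^{2\phi}\sigma'$. Jacobi fields and focal points are those of the Riemannian metrics $g,\widehat g$ along the underlying $g$-, $\widehat g$-geodesics, regarded as functions of the parameter $s$; $J'$ is the covariant derivative along the geodesic. The notation $|e^{-\widehat\phi}\widehat J|(\xi)$ means $e^{-\widehat\phi(\widehat\gamma(\xi))}|\widehat J(\xi)|$. *)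

theory Defs
  imports "HOL-Analysis.Analysis" "HOL-Library.Function_Algebras"
begin

text \<open>
  Used for open \<open>S\<close> and for relatively open subsets \<open>S\<close> of nondegenerate real intervals
  (one-sided derivatives at the end points); in both cases the derivative within \<open>S\<close> is unique.
\<close>

primrec Ck_on :: "nat \<Rightarrow> 'a::real_normed_vector set \<Rightarrow> ('a \<Rightarrow> 'b::real_normed_vector) \<Rightarrow> bool" where
  "Ck_on 0 S f \<longleftrightarrow> continuous_on S f"
| "Ck_on (Suc k) S f \<longleftrightarrow>
     (\<forall>x\<in>S. f differentiable (at x within S)) \<and>
     (\<forall>v. Ck_on k S (\<lambda>x. frechet_derivative f (at x within S) v))"

definition smooth_on :: "'a::real_normed_vector set \<Rightarrow> ('a \<Rightarrow> 'b::real_normed_vector) \<Rightarrow> bool" where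
  "smooth_on S f \<longleftrightarrow> (\<forall>k. Ck_on k S f)"

type_synonym ('m, 'n) chart = "'m set \<times> ('m \<Rightarrow> real ^ 'n)"

abbreviation cdom :: "('m, 'n) chart \<Rightarrow> 'm set" where "cdom c \<equiv> fst c"
abbreviation cmap :: "('m, 'n) chart \<Rightarrow> 'm \<Rightarrow> real ^ 'n" where "cmap c \<equiv> snd c"
definition cinv :: "('m, 'n) chart \<Rightarrow> real ^ 'n \<Rightarrow> 'm" where
  "cinv c = inv_into (cdom c) (cmap c)"

definition points :: "('m, 'n) chart set \<Rightarrow> 'm set" where
  "points A = (\<Union>c\<in>A. cdom c)"

definition compatible_chart ::
  "('m::{t2_space,second_countable_topology}, 'n::finite) chart set \<Rightarrow> ('m, 'n) chart \<Rightarrow> bool" where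
  "compatible_chart A c \<longleftrightarrow>
     open (cdom c) \<and> cdom c \<subseteq> points A \<and> open (cmap c ` cdom c) \<and>
     homeomorphism (cdom c) (cmap c ` cdom c) (cmap c) (cinv c) \<and>
     (\<forall>d\<in>A. smooth_on (cmap c ` (cdom c \<inter> cdom d)) (cmap d \<circ> cinv c) \<and>
            smooth_on (cmap d ` (cdom c \<inter> cdom d)) (cmap c \<circ> cinv d))"

definition smooth_atlas :: "('m::{t2_space,second_countable_topology}, 'n::finite) chart set \<Rightarrow> bool" where
  "smooth_atlas A \<longleftrightarrow> (\<forall>c\<in>A. compatible_chart A c)"

definition smooth_fun_on ::
  "('m, 'n::finite) chart set \<Rightarrow> 'm set \<Rightarrow> ('m \<Rightarrow> real) \<Rightarrow> bool" where
  "smooth_fun_on A U f \<longleftrightarrow> (\<forall>c\<in>A. smooth_on (cmap c ` (U \<inter> cdom c)) (f \<circ> cinv c))"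

text \<open>
  A tangent vector at \<open>p\<close> is the family of its component vectors in all charts around \<open>p\<close>, related
  by the differentials of the transition maps. The entry for any other chart is 0, so that
  distinct families are distinct vectors. Sums and differences are those of the function space.
\<close>

type_synonym ('m, 'n) tvec = "('m, 'n) chart \<Rightarrow> real ^ 'n"
type_synonym ('m, 'n) field = "'m \<Rightarrow> ('m, 'n) tvec"

definition tangent_space :: "('m, 'n::finite) chart set \<Rightarrow> 'm \<Rightarrow> ('m, 'n) tvec set" where
  "tangent_space A p = {v.
     (\<forall>c. \<not> (c \<in> A \<and> p \<in> cdom c) \<longrightarrow> v c = 0) \<and>
     (\<forall>c\<in>A. \<forall>d\<in>A. p \<in> cdom c \<and> p \<in> cdom d \<longrightarrow>
        v d = frechet_derivative (cmap d \<circ> cinv c) (at (cmap c p)) (v c))}"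

definition tscale :: "real \<Rightarrow> ('m, 'n::finite) tvec \<Rightarrow> ('m, 'n) tvec" where
  "tscale a v = (\<lambda>c. a *\<^sub>R v c)"

text \<open>The vector field on \<open>cdom c\<close> with constant components \<open>x\<close> in the chart \<open>c\<close>.\<close>
definition coord_field :: "('m, 'n::finite) chart set \<Rightarrow> ('m, 'n) chart \<Rightarrow> real ^ 'n \<Rightarrow> ('m, 'n) field" where
  "coord_field A c x = (\<lambda>p d. if d \<in> A \<and> p \<in> cdom c \<and> p \<in> cdom d
     then frechet_derivative (cmap d \<circ> cinv c) (at (cmap c p)) x else 0)"

definition vector_field_on :: "('m, 'n::finite) chart set \<Rightarrow> 'm set \<Rightarrow> ('m, 'n) field \<Rightarrow> bool" where
  "vector_field_on A U X \<longleftrightarrow>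
     (\<forall>p\<in>U. X p \<in> tangent_space A p) \<and>
     (\<forall>c\<in>A. smooth_on (cmap c ` (U \<inter> cdom c)) (\<lambda>u. X (cinv c u) c))"

definition chart_at :: "('m, 'n) chart set \<Rightarrow> 'm \<Rightarrow> ('m, 'n) chart" where
  "chart_at A p = (SOME c. c \<in> A \<and> p \<in> cdom c)"

text \<open>\<open>dfun A f p v\<close> is \<open>df\<^sub>p(v)\<close>; the value does not depend on the chart.\<close>
definition dfun :: "('m, 'n::finite) chart set \<Rightarrow> ('m \<Rightarrow> real) \<Rightarrow> 'm \<Rightarrow> ('m, 'n) tvec \<Rightarrow> real" where
  "dfun A f p v = (let c = chart_at A p in
     frechet_derivative (f \<circ> cinv c) (at (cmap c p)) (v c))"

definition lie_bracket ::
  "('m, 'n::finite) chart set \<Rightarrow> ('m, 'n) field \<Rightarrow> ('m, 'n) field \<Rightarrow> ('m, 'n) field" where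
  "lie_bracket A X Y = (\<lambda>p c. if c \<in> A \<and> p \<in> cdom c
     then frechet_derivative (\<lambda>u. Y (cinv c u) c) (at (cmap c p)) (X p c)
        - frechet_derivative (\<lambda>u. X (cinv c u) c) (at (cmap c p)) (Y p c)
     else 0)"

type_synonym ('m, 'n) metric = "'m \<Rightarrow> ('m, 'n) tvec \<Rightarrow> ('m, 'n) tvec \<Rightarrow> real"
type_synonym ('m, 'n) connection = "('m, 'n) field \<Rightarrow> ('m, 'n) field \<Rightarrow> ('m, 'n) field"

definition riemannian_metric ::
  "('m::topological_space, 'n::finite) chart set \<Rightarrow> ('m, 'n) metric \<Rightarrow> bool" where
  "riemannian_metric A g \<longleftrightarrow>
     (\<forall>p\<in>points A. \<forall>u\<in>tangent_space A p. \<forall>v\<in>tangent_space A p.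
        g p u v = g p v u \<and> (u \<noteq> 0 \<longrightarrow> g p u u > 0) \<and>
        (\<forall>a. g p (tscale a u) v = a * g p u v) \<and>
        (\<forall>w\<in>tangent_space A p. g p (u + w) v = g p u v + g p w v)) \<and>
     (\<forall>U X Y. open U \<and> U \<subseteq> points A \<and> vector_field_on A U X \<and> vector_field_on A U Y \<longrightarrow>
        smooth_fun_on A U (\<lambda>p. g p (X p) (Y p)))"

definition gnorm :: "('m, 'n) metric \<Rightarrow> 'm \<Rightarrow> ('m, 'n) tvec \<Rightarrow> real" where
  "gnorm g p v = sqrt (g p v v)"

text \<open>
  A connection acts on the smooth vector fields over every open set \<open>U\<close>; the last clause is the
  locality that makes these operators compatible with restriction.
\<close>
definition affine_connection ::
  "('m::topological_space, 'n::finite) chart set \<Rightarrow> ('m, 'n) connection \<Rightarrow> bool" where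
  "affine_connection A D \<longleftrightarrow>
     (\<forall>U X Y. open U \<and> U \<subseteq> points A \<and> vector_field_on A U X \<and> vector_field_on A U Y \<longrightarrow>
        vector_field_on A U (D X Y) \<and>
        (\<forall>Z. vector_field_on A U Z \<longrightarrow> (\<forall>p\<in>U.
           D (X + Z) Y p = D X Y p + D Z Y p \<and> D X (Y + Z) p = D X Y p + D X Z p)) \<and>
        (\<forall>f. smooth_fun_on A U f \<longrightarrow> (\<forall>p\<in>U.
           D (\<lambda>q. tscale (f q) (X q)) Y p = tscale (f p) (D X Y p) \<and>
           D X (\<lambda>q. tscale (f q) (Y q)) p =
             tscale (dfun A f p (X p)) (Y p) + tscale (f p) (D X Y p))) \<and>
        (\<forall>X' Y'. (\<forall>p\<in>U. X' p = X p \<and> Y' p = Y p) \<longrightarrow> (\<forall>p\<in>U. D X' Y' p = D X Y p)))"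

text \<open>The torsion-free metric connection; its values on smooth fields are determined by \<open>g\<close>.\<close>
definition levi_civita ::
  "('m::topological_space, 'n::finite) chart set \<Rightarrow> ('m, 'n) metric \<Rightarrow> ('m, 'n) connection \<Rightarrow> bool" where
  "levi_civita A g D \<longleftrightarrow> affine_connection A D \<and>
     (\<forall>U X Y. open U \<and> U \<subseteq> points A \<and> vector_field_on A U X \<and> vector_field_on A U Y \<longrightarrow>
        (\<forall>p\<in>U. D X Y p - D Y X p = lie_bracket A X Y p) \<and>
        (\<forall>Z. vector_field_on A U Z \<longrightarrow> (\<forall>p\<in>U.
           dfun A (\<lambda>q. g q (Y q) (Z q)) p (X p) = g p (D X Y p) (Z p) + g p (Y p) (D X Z p))))"

definition curvature ::
  "('m, 'n::finite) chart set \<Rightarrow> ('m, 'n) connection \<Rightarrow>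
   ('m, 'n) field \<Rightarrow> ('m, 'n) field \<Rightarrow> ('m, 'n) field \<Rightarrow> ('m, 'n) field" where
  "curvature A D X Y Z = (\<lambda>p.
     D X (D Y Z) p - D Y (D X Z) p - D (lie_bracket A X Y) Z p)"

text \<open>
  The curvature on tangent vectors: since \<open>curvature\<close> is tensorial, the vectors may be extended
  to arbitrary local fields; here by constant components in a chart.
\<close>
definition curvature_at ::
  "('m, 'n::finite) chart set \<Rightarrow> ('m, 'n) connection \<Rightarrow> 'm \<Rightarrow>
   ('m, 'n) tvec \<Rightarrow> ('m, 'n) tvec \<Rightarrow> ('m, 'n) tvec \<Rightarrow> ('m, 'n) tvec" where
  "curvature_at A D p u v w = (let c = chart_at A p; E = (\<lambda>x. coord_field A c (x c)) in
     curvature A D (E u) (E v) (E w) p)"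

definition smooth_curve_on ::
  "('m::topological_space, 'n::finite) chart set \<Rightarrow> real set \<Rightarrow> (real \<Rightarrow> 'm) \<Rightarrow> bool" where
  "smooth_curve_on A I \<sigma> \<longleftrightarrow> continuous_on I \<sigma> \<and> \<sigma> ` I \<subseteq> points A \<and>
     (\<forall>c\<in>A. smooth_on {t\<in>I. \<sigma> t \<in> cdom c} (cmap c \<circ> \<sigma>))"

definition velocity ::
  "('m, 'n::finite) chart set \<Rightarrow> real set \<Rightarrow> (real \<Rightarrow> 'm) \<Rightarrow> real \<Rightarrow> ('m, 'n) tvec" where
  "velocity A I \<sigma> t = (\<lambda>c. if c \<in> A \<and> \<sigma> t \<in> cdom c
     then vector_derivative (cmap c \<circ> \<sigma>) (at t within I) else 0)"

definition field_along ::
  "('m, 'n::finite) chart set \<Rightarrow> real set \<Rightarrow> (real \<Rightarrow> 'm) \<Rightarrow> (real \<Rightarrow> ('m, 'n) tvec) \<Rightarrow> bool" where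
  "field_along A I \<sigma> J \<longleftrightarrow> (\<forall>t\<in>I. J t \<in> tangent_space A (\<sigma> t)) \<and>
     (\<forall>c\<in>A. smooth_on {t\<in>I. \<sigma> t \<in> cdom c} (\<lambda>t. J t c))"

text \<open>\<open>\<Sum>\<^sub>i\<^sub>j \<Gamma>\<^sup>k\<^sub>i\<^sub>j(p) x\<^sub>i y\<^sub>j\<close> as a vector indexed by \<open>k\<close>, in the chart \<open>c\<close>.\<close>
definition christoffel ::
  "('m, 'n::finite) chart set \<Rightarrow> ('m, 'n) connection \<Rightarrow> ('m, 'n) chart \<Rightarrow> 'm \<Rightarrow>
   real ^ 'n \<Rightarrow> real ^ 'n \<Rightarrow> real ^ 'n" where
  "christoffel A D c p x y = D (coord_field A c x) (coord_field A c y) p c"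

definition cov_deriv ::
  "('m, 'n::finite) chart set \<Rightarrow> ('m, 'n) connection \<Rightarrow> real set \<Rightarrow> (real \<Rightarrow> 'm) \<Rightarrow>
   (real \<Rightarrow> ('m, 'n) tvec) \<Rightarrow> real \<Rightarrow> ('m, 'n) tvec" where
  "cov_deriv A D I \<sigma> J t = (\<lambda>c. if c \<in> A \<and> \<sigma> t \<in> cdom c
     then vector_derivative (\<lambda>r. J r c) (at t within I)
        + christoffel A D c (\<sigma> t) (velocity A I \<sigma> t c) (J t c)
     else 0)"

definition geodesic ::
  "('m::topological_space, 'n::finite) chart set \<Rightarrow> ('m, 'n) connection \<Rightarrow> real set \<Rightarrow> (real \<Rightarrow> 'm) \<Rightarrow> bool" where
  "geodesic A D I \<sigma> \<longleftrightarrow> smooth_curve_on A I \<sigma> \<and>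
     (\<forall>t\<in>I. cov_deriv A D I \<sigma> (velocity A I \<sigma>) t = 0)"

definition jacobi_field ::
  "('m, 'n::finite) chart set \<Rightarrow> ('m, 'n) connection \<Rightarrow> real set \<Rightarrow> (real \<Rightarrow> 'm) \<Rightarrow>
   (real \<Rightarrow> ('m, 'n) tvec) \<Rightarrow> bool" where
  "jacobi_field A D I \<sigma> J \<longleftrightarrow> field_along A I \<sigma> J \<and>
     (\<forall>t\<in>I. cov_deriv A D I \<sigma> (cov_deriv A D I \<sigma> J) t
        + curvature_at A D (\<sigma> t) (J t) (velocity A I \<sigma> t) (velocity A I \<sigma> t) = 0)"

definition geodesic_from ::
  "('m::topological_space, 'n::finite) chart set \<Rightarrow> ('m, 'n) connection \<Rightarrow> 'm \<Rightarrow> ('m, 'n) tvec \<Rightarrow>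
   (real \<Rightarrow> 'm) \<Rightarrow> bool" where
  "geodesic_from A D p v \<beta> \<longleftrightarrow>
     geodesic A D {0..1} \<beta> \<and> \<beta> 0 = p \<and> velocity A {0..1} \<beta> 0 = v"

definition exp_map ::
  "('m::topological_space, 'n::finite) chart set \<Rightarrow> ('m, 'n) connection \<Rightarrow> 'm \<Rightarrow> ('m, 'n) tvec \<Rightarrow> 'm" where
  "exp_map A D p v = (THE q. \<exists>\<beta>. geodesic_from A D p v \<beta> \<and> \<beta> 1 = q)"

text \<open>
  \<open>exp\<^sub>p\<close> is defined on the ball of radius \<open>\<epsilon>\<close> of \<open>T\<^sub>pM\<close> and maps it diffeomorphically onto an open
  set, i.e. its inverse is a chart (normal coordinates). This holds for all small \<open>\<epsilon>\<close>. Here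
  \<open>T\<^sub>pM\<close> is identified with the coordinate space by means of a chart \<open>c\<close> around \<open>p\<close>.
\<close>
definition normal_ball ::
  "('m::{t2_space,second_countable_topology}, 'n::finite) chart set \<Rightarrow> ('m, 'n) metric \<Rightarrow>
   ('m, 'n) connection \<Rightarrow> 'm \<Rightarrow> real \<Rightarrow> bool" where
  "normal_ball A g D p \<epsilon> \<longleftrightarrow> 0 < \<epsilon> \<and>
     (\<forall>v\<in>tangent_space A p. gnorm g p v < \<epsilon> \<longrightarrow> (\<exists>\<beta>. geodesic_from A D p v \<beta>)) \<and>
     (\<forall>c\<in>A. p \<in> cdom c \<longrightarrow>
        (let B = {x. gnorm g p (coord_field A c x p) < \<epsilon>};
             E = (\<lambda>x. exp_map A D p (coord_field A c x p))
         in inj_on E B \<and> compatible_chart A (E ` B, inv_into B E)))"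

text \<open>\<open>exp\<^sub>p(n\<^sup>\<bottom>)\<close> near \<open>p\<close>.\<close>
definition geodesic_submanifold ::
  "('m::topological_space, 'n::finite) chart set \<Rightarrow> ('m, 'n) metric \<Rightarrow> ('m, 'n) connection \<Rightarrow>
   'm \<Rightarrow> ('m, 'n) tvec \<Rightarrow> real \<Rightarrow> 'm set" where
  "geodesic_submanifold A g D p n \<epsilon> =
     exp_map A D p ` {v \<in> tangent_space A p. g p v n = 0 \<and> gnorm g p v < \<epsilon>}"

definition tangent_space_of ::
  "('m::topological_space, 'n::finite) chart set \<Rightarrow> 'm set \<Rightarrow> 'm \<Rightarrow> ('m, 'n) tvec set" where
  "tangent_space_of A P q = {velocity A {-1<..<1} \<alpha> 0 | \<alpha>.
     smooth_curve_on A {-1<..<1} \<alpha> \<and> \<alpha> ` {-1<..<1} \<subseteq> P \<and> \<alpha> 0 = q}"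

text \<open>
  \<open>P\<close>-Jacobi fields along a geodesic \<open>\<sigma>\<close> that starts perpendicularly to the submanifold \<open>P\<close>:
  \<open>K(0)\<close> is tangent to \<open>P\<close>, and the component of \<open>K'(0)\<close> tangent to \<open>P\<close> is prescribed by the
  second fundamental form, namely it is the tangential component of \<open>D\<^bsub>K(0)\<^esub>\<zeta>\<close> for
  normal extensions \<open>\<zeta>\<close> of \<open>\<sigma>'(0)\<close> along curves in \<open>P\<close> with initial velocity \<open>K(0)\<close> (a quantity
  that does not depend on the extension).
\<close>
definition P_jacobi_field ::
  "('m::topological_space, 'n::finite) chart set \<Rightarrow> ('m, 'n) metric \<Rightarrow> ('m, 'n) connection \<Rightarrow>
   'm set \<Rightarrow> real set \<Rightarrow> (real \<Rightarrow> 'm) \<Rightarrow> (real \<Rightarrow> ('m, 'n) tvec) \<Rightarrow> bool" where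
  "P_jacobi_field A g D P I \<sigma> K \<longleftrightarrow> jacobi_field A D I \<sigma> K \<and>
     K 0 \<in> tangent_space_of A P (\<sigma> 0) \<and>
     (\<forall>\<alpha> \<zeta>. smooth_curve_on A {-1<..<1} \<alpha> \<and> \<alpha> ` {-1<..<1} \<subseteq> P \<and> \<alpha> 0 = \<sigma> 0 \<and>
        velocity A {-1<..<1} \<alpha> 0 = K 0 \<and>
        field_along A {-1<..<1} \<alpha> \<zeta> \<and> \<zeta> 0 = velocity A I \<sigma> 0 \<and>
        (\<forall>r\<in>{-1<..<1}. \<forall>w\<in>tangent_space_of A P (\<alpha> r). g (\<alpha> r) (\<zeta> r) w = 0) \<longrightarrow>
        (\<forall>w\<in>tangent_space_of A P (\<sigma> 0).
           g (\<sigma> 0) (cov_deriv A D I \<sigma> K 0) w = g (\<sigma> 0) (cov_deriv A D {-1<..<1} \<alpha> \<zeta> 0) w))"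

definition focal_point ::
  "('m::topological_space, 'n::finite) chart set \<Rightarrow> ('m, 'n) metric \<Rightarrow> ('m, 'n) connection \<Rightarrow>
   'm set \<Rightarrow> real set \<Rightarrow> (real \<Rightarrow> 'm) \<Rightarrow> real \<Rightarrow> bool" where
  "focal_point A g D P I \<sigma> t \<longleftrightarrow>
     (\<exists>K. P_jacobi_field A g D P I \<sigma> K \<and> (\<exists>r\<in>I. K r \<noteq> 0) \<and> K t = 0)"

definition density_manifold ::
  "('m::{t2_space,second_countable_topology}, 'n::finite) chart set \<Rightarrow> ('m, 'n) metric \<Rightarrow>
   ('m, 'n) connection \<Rightarrow> ('m \<Rightarrow> real) \<Rightarrow> bool" where
  "density_manifold A g D \<phi> \<longleftrightarrow> smooth_atlas A \<and> riemannian_metric A g \<and> levi_civita A g D \<and>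
     smooth_fun_on A (points A) \<phi>"

definition weighted_connection ::
  "('m, 'n::finite) chart set \<Rightarrow> ('m, 'n) connection \<Rightarrow> ('m \<Rightarrow> real) \<Rightarrow> ('m, 'n) connection" where
  "weighted_connection A D \<phi> X Y = (\<lambda>p.
     D X Y p - tscale (dfun A \<phi> p (X p)) (Y p) - tscale (dfun A \<phi> p (Y p)) (X p))"

definition std_parameter :: "('m \<Rightarrow> real) \<Rightarrow> (real \<Rightarrow> 'm) \<Rightarrow> real \<Rightarrow> real" where
  "std_parameter \<phi> \<sigma> t = integral {0..t} (\<lambda>r. exp (- 2 * \<phi> (\<sigma> r)))"

text \<open>
  \<open>\<gamma>\<close> on \<open>[0,S]\<close> is the \<open>\<phi>\<close>-geodesic with standard parametrization obtained from the unit speed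
  geodesic \<open>\<sigma>\<close> on \<open>[0,T]\<close>.
\<close>
definition phi_geodesic ::
  "('m::topological_space, 'n::finite) chart set \<Rightarrow> ('m, 'n) metric \<Rightarrow> ('m, 'n) connection \<Rightarrow>
   ('m \<Rightarrow> real) \<Rightarrow> real \<Rightarrow> (real \<Rightarrow> 'm) \<Rightarrow> real \<Rightarrow> (real \<Rightarrow> 'm) \<Rightarrow> bool" where
  "phi_geodesic A g D \<phi> T \<sigma> S \<gamma> \<longleftrightarrow> 0 < T \<and> geodesic A D {0..T} \<sigma> \<and>
     (\<forall>t\<in>{0..T}. gnorm g (\<sigma> t) (velocity A {0..T} \<sigma> t) = 1) \<and>
     S = std_parameter \<phi> \<sigma> T \<and>
     (\<forall>t\<in>{0..T}. \<gamma> (std_parameter \<phi> \<sigma> t) = \<sigma> t)"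

text \<open>
  For a field \<open>J\<close> given as a function of the parameter \<open>s\<close>, this is the same field as a function of
  the arc length \<open>t\<close> of the underlying geodesic.
\<close>
definition in_arc_length ::
  "('m \<Rightarrow> real) \<Rightarrow> (real \<Rightarrow> 'm) \<Rightarrow> (real \<Rightarrow> ('m, 'n) tvec) \<Rightarrow> real \<Rightarrow> ('m, 'n) tvec" where
  "in_arc_length \<phi> \<sigma> J = (\<lambda>t. J (std_parameter \<phi> \<sigma> t))"

text \<open>\<open>|e\<^bsup>-\<phi>\<^esup>J|(\<xi>)\<close>.\<close>
definition weighted_norm ::
  "('m, 'n) metric \<Rightarrow> ('m \<Rightarrow> real) \<Rightarrow> (real \<Rightarrow> 'm) \<Rightarrow> (real \<Rightarrow> ('m, 'n) tvec) \<Rightarrow> real \<Rightarrow> real" where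
  "weighted_norm g \<phi> \<gamma> J \<xi> = exp (- \<phi> (\<gamma> \<xi>)) * gnorm g (\<gamma> \<xi>) (J \<xi>)"

end

theory Submission imports Defs
begin

text \<open>
  Put \<open>Y = e\<^bsup>-\<phi>\<^esup> J\<close>, read it in a parallel frame of the geodesic and let \<open>s\<close> be the standard
  parameter, \<open>ds = e\<^bsup>-2\<phi>\<^esup> dt\<close>. The Jacobi equation turns into \<open>Y'' = - R\<^sub>s Y\<close>, where on the normal
  directions \<open>R\<^sub>s\<close> has the quadratic form \<open>R(V, \<gamma>', \<gamma>', V)\<close> of the weighted connection, and \<open>J'(0) = 0\<close> turns
  into \<open>Y'(0) = - \<lambda> Y(0)\<close> with \<open>\<lambda> = d\<phi>(\<gamma>'(0))\<close> (\<open>weighted_solution\<close>, \<open>weighted_curvature_frame\<close>).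
  What has to be compared is therefore the growth of solutions of two linear systems in \<open>\<real>\<^sup>n\<close>.

  On the hatted side Cauchy-Schwarz makes \<open>w = |Y|\<close> a supersolution: \<open>w'' \<ge> - \<kappa> w\<close> with
  \<open>\<kappa> = \<langle>R\<^sub>s Y, Y\<rangle> / |Y|\<^sup>2\<close>. Let \<open>\<tau>' = w(0)\<^sup>2 / w\<^sup>2\<close> and let \<open>\<delta>\<close> be the difference of the two values of
  \<open>\<lambda>\<close>. Since \<open>(w\<^sup>2 \<tau>')' = 0\<close>, the function \<open>h = w e\<^bsup>\<delta>\<tau>\<^esup>\<close> is again a supersolution, and its logarithmic
  derivative at \<open>0\<close> is that of the other side (\<open>norm_supersolution\<close>). The curvature hypothesis says that
  \<open>R\<^sub>s \<ge> \<kappa>\<close> on the normal vectors of the unhatted side.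

  On the unhatted side it has to be shown that \<open>|Y| / h\<close> does not increase. Let \<open>C\<close> be the matrix solution
  with the initial condition \<open>C'(0) = - \<lambda> C(0)\<close>. If \<open>C\<close> is invertible, then \<open>U = C' C\<^sup>-\<^sup>1 - h'/h\<close> is symmetric,
  because the Wronskians of its columns vanish, and it satisfies a Riccati equation that makes
  \<open>h\<^sup>2 \<langle>U v, v\<rangle>\<close> nonincreasing for each fixed normal \<open>v\<close>; it starts at \<open>0\<close>, so \<open>\<langle>U v, v\<rangle> \<le> 0\<close>
  (\<open>conormal_nonpositive\<close>).

  Invertibility of \<open>C\<close> is what the absence of focal points provides. In normal coordinates the submanifold
  \<open>exp(\<gamma>'(0)\<^sup>\<bottom>)\<close> is a linear slice, and the second derivative of \<open>exp\<close> at \<open>0\<close> cancels the Christoffel symbols;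
  hence its second fundamental form vanishes at the base point, every perpendicular Jacobi field with
  \<open>J'(0) = 0\<close> is a Jacobi field of the submanifold, and it has no zero unless it is trivial
  (\<open>normal_field_derivative\<close>, \<open>nonvanishing_without_focal_points\<close>).

  All geometric notions are evaluated in charts: the connection and its curvature by Christoffel symbols, and
  parallel frames by linear differential equations.
\<close>

section \<open>Smooth maps on open sets and on intervals\<close>

text \<open>
  Each point of \<open>S\<close> is a limit of points of \<open>S\<close> on every coordinate line through it. This holds for open sets
  and for nondegenerate intervals, and it is what makes derivatives within \<open>S\<close> unique; hence open sets of
  coordinate space and parameter intervals with end points share one calculus of smooth maps.
\<close>

definition fully_approachable :: "'a::euclidean_space set \<Rightarrow> bool" where
  "fully_approachable S \<longleftrightarrow>
     (\<forall>x\<in>S. \<forall>i\<in>Basis. \<forall>e>0. \<exists>d. 0 < \<bar>d\<bar> \<and> \<bar>d\<bar> < e \<and> x + d *\<^sub>R i \<in> S)"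

lemma fully_approachable_open: "open S \<Longrightarrow> fully_approachable S"
  unfolding fully_approachable_def
proof (intro ballI allI impI)
  fix x i :: 'a and e :: real
  assume "open S" "x \<in> S" "i \<in> Basis" "0 < e"
  then obtain r where r: "r > 0" "ball x r \<subseteq> S" using open_contains_ball by blast
  have "x + (min e r / 2) *\<^sub>R i \<in> ball x r"
    using r \<open>i \<in> Basis\<close> \<open>0 < e\<close> by (simp add: dist_norm)
  with r \<open>0 < e\<close> show "\<exists>d. 0 < \<bar>d\<bar> \<and> \<bar>d\<bar> < e \<and> x + d *\<^sub>R i \<in> S"
    by (intro exI[of _ "min e r / 2"]) auto
qed

lemma fully_approachable_Icc: "a < b \<Longrightarrow> fully_approachable {a..b::real}"
  unfolding fully_approachable_def
proof (intro ballI allI impI)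
  fix x i e :: real
  assume *: "a < b" "x \<in> {a..b}" "i \<in> Basis" "0 < e"
  then have "i = 1" by simp
  show "\<exists>d. 0 < \<bar>d\<bar> \<and> \<bar>d\<bar> < e \<and> x + d *\<^sub>R i \<in> {a..b}"
  proof (cases "x < b")
    case True
    then show ?thesis using * \<open>i = 1\<close>
      by (intro exI[of _ "min (e / 2) (b - x)"]) auto
  next
    case False
    then show ?thesis using * \<open>i = 1\<close>
      by (intro exI[of _ "- min (e / 2) (x - a)"]) auto
  qed
qed

lemma fully_approachable_openin:
  assumes U: "fully_approachable U" and S: "openin (top_of_set U) S"
  shows "fully_approachable S"
  unfolding fully_approachable_def
proof (intro ballI allI impI)
  fix x i :: 'a and e :: real
  assume *: "x \<in> S" "i \<in> Basis" "0 < e"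
  obtain r where r: "r > 0" "ball x r \<inter> U \<subseteq> S"
    using S * openin_contains_ball by metis
  have "x \<in> U" using S * openin_imp_subset by blast
  with U * r obtain d where "0 < \<bar>d\<bar>" "\<bar>d\<bar> < min e r" "x + d *\<^sub>R i \<in> U"
    unfolding fully_approachable_def by (metis min_less_iff_conj)
  with r * show "\<exists>d. 0 < \<bar>d\<bar> \<and> \<bar>d\<bar> < e \<and> x + d *\<^sub>R i \<in> S"
    by (intro exI[of _ d]) (auto simp: dist_norm subset_iff)
qed

lemma frechet_derivative_within_eq:
  fixes f :: "'a::euclidean_space \<Rightarrow> 'b::real_normed_vector"
  assumes "fully_approachable S" "x \<in> S" "(f has_derivative f') (at x within S)"
  shows "frechet_derivative f (at x within S) = f'"
proof -
  have "(f has_derivative frechet_derivative f (at x within S)) (at x within S)"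
    using assms(3) frechet_derivative_works differentiableI by blast
  then show ?thesis
    using assms frechet_derivative_unique_within[of f _ x S f']
    unfolding fully_approachable_def by blast
qed

lemma at_within_openin:
  assumes "openin (top_of_set U) S" "x \<in> S"
  shows "at x within S = at x within U"
proof -
  obtain V where "open V" "S = U \<inter> V" using assms(1) by (auto simp: openin_open)
  then show ?thesis using assms(2) by (intro at_within_nhd[of _ V]) auto
qed

lemma Ck_on_SucI:
  fixes f :: "'a::euclidean_space \<Rightarrow> 'b::real_normed_vector"
  assumes "fully_approachable S"
    and "\<And>x. x \<in> S \<Longrightarrow> (f has_derivative f' x) (at x within S)"
    and "\<And>v. Ck_on k S (\<lambda>x. f' x v)"
  shows "Ck_on (Suc k) S f"
proof -
  have cong: "Ck_on k S h" if "Ck_on k S g" "\<And>x. x \<in> S \<Longrightarrow> g x = h x"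
    for g h :: "'a \<Rightarrow> 'b" and k
    using that
  proof (induction k arbitrary: g h)
    case 0
    then show ?case by (auto intro: continuous_on_eq)
  next
    case (Suc k)
    have d: "(h has_derivative frechet_derivative g (at x within S)) (at x within S)" if "x \<in> S" for x
    proof (rule has_derivative_transform[OF that])
      show "(g has_derivative frechet_derivative g (at x within S)) (at x within S)"
        using Suc.prems(1) that by (auto simp: frechet_derivative_works[symmetric])
    qed (use Suc.prems(2) in auto)
    have "frechet_derivative h (at x within S) = frechet_derivative g (at x within S)" if "x \<in> S" for x
      using frechet_derivative_within_eq[OF assms(1) that d[OF that]] .
    then have "Ck_on k S (\<lambda>x. frechet_derivative h (at x within S) v)" for v
      by (intro Suc.IH[where h = "\<lambda>x. frechet_derivative h (at x within S) v" and g = "\<lambda>x. frechet_derivative g (at x within S) v"])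
        (use Suc.prems(1) in auto)
    with d show ?case by (auto simp: differentiable_def)
  qed
  have "Ck_on k S (\<lambda>x. frechet_derivative f (at x within S) v)" for v
    by (rule cong[OF assms(3)[of v]]) (simp add: frechet_derivative_within_eq[OF assms(1) _ assms(2)])
  then show ?thesis using assms(2) by (auto simp: differentiable_def)
qed

lemma Ck_on_SucD:
  assumes "Ck_on (Suc k) S f"
  shows "x \<in> S \<Longrightarrow> (f has_derivative frechet_derivative f (at x within S)) (at x within S)"
    and "Ck_on k S (\<lambda>x. frechet_derivative f (at x within S) v)"
  using assms by (auto simp: frechet_derivative_works[symmetric])

lemma Ck_on_cong:
  fixes f g :: "'a::euclidean_space \<Rightarrow> 'b::real_normed_vector"
  assumes "fully_approachable S" "Ck_on k S f" "\<And>x. x \<in> S \<Longrightarrow> f x = g x"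
  shows "Ck_on k S g"
proof (cases k)
  case 0
  then show ?thesis using assms by (auto intro: continuous_on_eq)
next
  case (Suc j)
  note f = Ck_on_SucD[OF assms(2)[unfolded Suc]]
  show ?thesis unfolding Suc
  proof (rule Ck_on_SucI[OF assms(1)])
    show "(g has_derivative frechet_derivative f (at x within S)) (at x within S)" if "x \<in> S" for x
      using has_derivative_transform[OF that _ f(1)[OF that]] assms(3) by simp
  qed (rule f(2))
qed

lemma Ck_on_continuous: "Ck_on k S f \<Longrightarrow> continuous_on S f"
  by (cases k) (auto simp: continuous_on_eq_continuous_within intro: differentiable_imp_continuous_within)

lemma Ck_on_Suc_le: "Ck_on (Suc k) S f \<Longrightarrow> Ck_on k S f"
proof (induction k arbitrary: f)
  case 0
  then show ?case using Ck_on_continuous by (metis Ck_on.simps(1))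
next
  case (Suc k)
  then show ?case by (metis Ck_on.simps(2))
qed

lemma Ck_on_subset:
  fixes f :: "'a::euclidean_space \<Rightarrow> 'b::real_normed_vector"
  assumes "fully_approachable S" "S \<subseteq> U" "Ck_on k U f"
  shows "Ck_on k S f"
  using assms(3)
proof (induction k arbitrary: f)
  case 0
  then show ?case using assms(2) by (auto intro: continuous_on_subset)
next
  case (Suc k)
  show ?case
  proof (rule Ck_on_SucI[OF assms(1)])
    show "(f has_derivative frechet_derivative f (at x within U)) (at x within S)" if "x \<in> S" for x
      using Ck_on_SucD(1)[OF Suc.prems] that assms(2) by (blast intro: has_derivative_subset)
  qed (rule Suc.IH[OF Ck_on_SucD(2)[OF Suc.prems]])
qed

text \<open>
  Derivatives within \<open>U\<close> are unchanged by passing to a relatively open part of \<open>U\<close>, so smoothness may be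
  checked near each point.
\<close>

lemma Ck_on_local:
  fixes f :: "'a::euclidean_space \<Rightarrow> 'b::real_normed_vector"
  assumes "fully_approachable U"
    and "\<And>x. x \<in> U \<Longrightarrow> \<exists>S. openin (top_of_set U) S \<and> x \<in> S \<and> Ck_on k S f"
  shows "Ck_on k U f"
  using assms(2)
proof (induction k arbitrary: f)
  case 0
  show ?case unfolding Ck_on.simps continuous_on_eq_continuous_within
  proof
    fix x assume x: "x \<in> U"
    obtain S where S: "openin (top_of_set U) S" "x \<in> S" "continuous_on S f" using 0[OF x] by auto
    then show "continuous (at x within U) f"
      using at_within_openin[OF S(1,2)] by (metis continuous_on_eq_continuous_within)
  qed
next
  case (Suc k)
  show ?case
  proof (rule Ck_on_SucI[OF assms(1)])
    show d: "(f has_derivative frechet_derivative f (at x within U)) (at x within U)" if x: "x \<in> U" for x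
    proof -
      obtain S where S: "openin (top_of_set U) S" "x \<in> S" "Ck_on (Suc k) S f" using Suc.prems[OF x] by blast
      from Ck_on_SucD(1)[OF S(3,2)] show ?thesis using at_within_openin[OF S(1,2)] by simp
    qed
    show "Ck_on k U (\<lambda>x. frechet_derivative f (at x within U) v)" for v
    proof (rule Suc.IH)
      fix x assume x: "x \<in> U"
      obtain S where S: "openin (top_of_set U) S" "x \<in> S" "Ck_on (Suc k) S f" using Suc.prems[OF x] by blast
      have "Ck_on k S (\<lambda>x. frechet_derivative f (at x within U) v)"
        by (rule Ck_on_cong[OF fully_approachable_openin[OF assms(1) S(1)] Ck_on_SucD(2)[OF S(3)]])
          (simp add: at_within_openin[OF S(1)])
      with S show "\<exists>S. openin (top_of_set U) S \<and> x \<in> S \<and> Ck_on k S (\<lambda>x. frechet_derivative f (at x within U) v)"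
        by blast
    qed
  qed
qed

lemma Ck_on_const: "fully_approachable S \<Longrightarrow> Ck_on k S (\<lambda>x. c)"
proof (induction k arbitrary: c)
  case (Suc k)
  then show ?case by (intro Ck_on_SucI[where f' = "\<lambda>x v. 0"]) auto
qed simp

lemma Ck_on_linear:
  assumes "fully_approachable S" "bounded_linear l"
  shows "Ck_on k S l"
proof (cases k)
  case 0
  then show ?thesis using linear_continuous_on[OF assms(2)] by simp
next
  case (Suc j)
  show ?thesis unfolding Suc
    by (rule Ck_on_SucI[OF assms(1), where f' = "\<lambda>x. l"])
      (use assms in \<open>auto intro: Ck_on_const bounded_linear_imp_has_derivative\<close>)
qed

lemma Ck_on_add:
  assumes "fully_approachable S" "Ck_on k S f" "Ck_on k S g"
  shows "Ck_on k S (\<lambda>x. f x + g x)"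
  using assms(2,3)
proof (induction k arbitrary: f g)
  case 0
  then show ?case by (auto intro: continuous_on_add)
next
  case (Suc k)
  show ?case
    by (rule Ck_on_SucI[OF assms(1) has_derivative_add
          [OF Ck_on_SucD(1)[OF Suc.prems(1)] Ck_on_SucD(1)[OF Suc.prems(2)]]])
      (auto intro!: Suc.IH Ck_on_SucD(2) Suc.prems)
qed

lemma (in bounded_bilinear) Ck_on:
  fixes f :: "'d::euclidean_space \<Rightarrow> 'a"
  assumes "fully_approachable S" "Ck_on k S f" "Ck_on k S g"
  shows "Ck_on k S (\<lambda>x. f x ** g x)"
  using assms(2,3)
proof (induction k arbitrary: f g)
  case 0
  then show ?case by (auto intro: continuous_on)
next
  case (Suc k)
  show ?case
    by (rule Ck_on_SucI[OF assms(1) FDERIV[OF Ck_on_SucD(1)[OF Suc.prems(1)] Ck_on_SucD(1)[OF Suc.prems(2)]]])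
      (use Suc.prems in \<open>auto intro!: Ck_on_add[OF assms(1)] Suc.IH Ck_on_SucD(2) intro: Ck_on_Suc_le\<close>)
qed

lemmas Ck_on_scaleR = bounded_bilinear.Ck_on[OF bounded_bilinear_scaleR]
lemmas Ck_on_mult = bounded_bilinear.Ck_on[OF bounded_bilinear_mult]

lemma Ck_on_sum:
  assumes "fully_approachable S" "\<And>i. i \<in> F \<Longrightarrow> Ck_on k S (f i)"
  shows "Ck_on k S (\<lambda>x. \<Sum>i\<in>F. f i x)"
  using assms(2)
  by (induction F rule: infinite_finite_induct) (auto intro: Ck_on_const Ck_on_add assms(1))

text \<open>
  The derivative \<open>Dg(f x)(Df(x) v)\<close> is linear in its inner argument. Expanded in a basis, it is a sum of
  products of maps to which the induction hypothesis and the product rule apply.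
\<close>

lemma Ck_on_compose:
  fixes f :: "'a::euclidean_space \<Rightarrow> 'b::euclidean_space" and g :: "'b \<Rightarrow> 'c::real_normed_vector"
  assumes S: "fully_approachable S" and "Ck_on k T g" "Ck_on k S f" "f ` S \<subseteq> T"
  shows "Ck_on k S (\<lambda>x. g (f x))"
  using assms(2-4)
proof (induction k arbitrary: f g)
  case 0
  then show ?case by (auto intro: continuous_on_compose2)
next
  case (Suc k)
  let ?f' = "\<lambda>x. frechet_derivative f (at x within S)"
  let ?g' = "\<lambda>y. frechet_derivative g (at y within T)"
  have d: "((\<lambda>x. g (f x)) has_derivative (\<lambda>v. ?g' (f x) (?f' x v))) (at x within S)" if x: "x \<in> S" for x
    by (rule has_derivative_in_compose2[where t = T])
      (use Suc.prems x Ck_on_SucD(1)[OF Suc.prems(1)] Ck_on_SucD(1)[OF Suc.prems(2)] in auto)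
  have eq: "?g' (f x) w = (\<Sum>i\<in>Basis. (w \<bullet> i) *\<^sub>R ?g' (f x) i)" if "x \<in> S" for x w
  proof -
    have "linear (?g' (f x))"
      using Ck_on_SucD(1)[OF Suc.prems(1), of "f x"] that Suc.prems(3) has_derivative_linear by blast
    then show ?thesis
      by (subst (1) euclidean_representation[symmetric, of w]) (simp add: linear_sum linear_scale)
  qed
  show ?case
  proof (rule Ck_on_SucI[OF S d])
    fix v
    have 1: "Ck_on k S (\<lambda>x. ?g' (f x) i)" for i
      by (rule Suc.IH[OF Ck_on_SucD(2)[OF Suc.prems(1)] _ Suc.prems(3)]) (rule Ck_on_Suc_le[OF Suc.prems(2)])
    have 2: "Ck_on k S (\<lambda>x. ?f' x v \<bullet> i)" for i
      by (rule bounded_bilinear.Ck_on[OF bounded_bilinear_inner S Ck_on_SucD(2)[OF Suc.prems(2)] Ck_on_const[OF S]])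
    show "Ck_on k S (\<lambda>x. ?g' (f x) (?f' x v))"
      by (rule Ck_on_cong[OF S, of _ "\<lambda>x. \<Sum>i\<in>Basis. (?f' x v \<bullet> i) *\<^sub>R ?g' (f x) i"])
        (auto intro!: Ck_on_sum[OF S] Ck_on_scaleR[OF S] 1 2 simp: eq[symmetric])
  qed
qed

lemma smooth_on_Ck: "smooth_on S f \<Longrightarrow> Ck_on k S f"
  by (simp add: smooth_on_def)

context
  fixes S :: "'a::euclidean_space set"
  assumes S: "fully_approachable S"
begin

lemma smooth_on_cong: "smooth_on S f \<Longrightarrow> (\<And>x. x \<in> S \<Longrightarrow> f x = g x) \<Longrightarrow> smooth_on S g"
  using Ck_on_cong[OF S, of _ f g] by (simp add: smooth_on_def)

lemma smooth_on_subset: "smooth_on U f \<Longrightarrow> S \<subseteq> U \<Longrightarrow> smooth_on S f"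
  using Ck_on_subset[OF S, of U _ f] by (simp add: smooth_on_def)

lemma smooth_on_local:
  assumes "\<And>x. x \<in> S \<Longrightarrow> \<exists>S'. openin (top_of_set S) S' \<and> x \<in> S' \<and> smooth_on S' f"
  shows "smooth_on S f"
  unfolding smooth_on_def
proof
  fix k
  show "Ck_on k S f"
  proof (rule Ck_on_local[OF S])
    fix x assume "x \<in> S"
    then obtain S' where "openin (top_of_set S) S'" "x \<in> S'" "smooth_on S' f" using assms by blast
    then show "\<exists>S'. openin (top_of_set S) S' \<and> x \<in> S' \<and> Ck_on k S' f"
      by (intro exI[of _ S'] conjI smooth_on_Ck)
  qed
qed

lemma smooth_on_const: "smooth_on S (\<lambda>x. c)"
  by (simp add: smooth_on_def Ck_on_const[OF S])

lemma smooth_on_linear: "bounded_linear l \<Longrightarrow> smooth_on S l"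
  by (simp add: smooth_on_def Ck_on_linear[OF S])

lemma smooth_on_add: "smooth_on S f \<Longrightarrow> smooth_on S g \<Longrightarrow> smooth_on S (\<lambda>x. f x + g x)"
  by (simp add: smooth_on_def Ck_on_add[OF S])

lemma smooth_on_sum: "(\<And>i. i \<in> F \<Longrightarrow> smooth_on S (f i)) \<Longrightarrow> smooth_on S (\<lambda>x. \<Sum>i\<in>F. f i x)"
  by (simp add: smooth_on_def Ck_on_sum[OF S])

lemma smooth_on_scaleR: "smooth_on S f \<Longrightarrow> smooth_on S g \<Longrightarrow> smooth_on S (\<lambda>x. f x *\<^sub>R g x)"
  by (simp add: smooth_on_def Ck_on_scaleR[OF S])

lemma smooth_on_mult:
  fixes f g :: "'a \<Rightarrow> real"
  shows "smooth_on S f \<Longrightarrow> smooth_on S g \<Longrightarrow> smooth_on S (\<lambda>x. f x * g x)"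
  by (simp add: smooth_on_def Ck_on_mult[OF S])

lemma smooth_on_compose:
  fixes f :: "'a \<Rightarrow> 'b::euclidean_space"
  shows "smooth_on T g \<Longrightarrow> smooth_on S f \<Longrightarrow> f ` S \<subseteq> T \<Longrightarrow> smooth_on S (\<lambda>x. g (f x))"
  using Ck_on_compose[OF S, of _ T g f] by (simp add: smooth_on_def)

lemma smooth_on_compose_linear:
  "bounded_linear l \<Longrightarrow> smooth_on S f \<Longrightarrow> smooth_on S (\<lambda>x. l (f x))"
  for f :: "'a \<Rightarrow> 'b::euclidean_space"
  by (rule smooth_on_compose[of UNIV l f])
    (auto simp: smooth_on_def intro: Ck_on_linear fully_approachable_open)

end

lemma smooth_on_has_derivative:
  "smooth_on S f \<Longrightarrow> x \<in> S \<Longrightarrow> (f has_derivative frechet_derivative f (at x within S)) (at x within S)"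
  using Ck_on_SucD(1)[OF smooth_on_Ck[of S f "Suc 0"]] by simp

lemma smooth_on_frechet_derivative:
  "smooth_on S f \<Longrightarrow> smooth_on S (\<lambda>x. frechet_derivative f (at x within S) v)"
  unfolding smooth_on_def using Ck_on_SucD(2)[of _ S f] by simp

lemma smooth_on_continuous: "smooth_on S f \<Longrightarrow> continuous_on S f"
  using smooth_on_Ck[of S f 0] by simp

lemma smooth_on_open_has_derivative:
  assumes "open S" "smooth_on S f" "x \<in> S"
  shows "(f has_derivative frechet_derivative f (at x)) (at x)"
  using smooth_on_has_derivative[OF assms(2,3)] at_within_open[OF assms(3,1)] by simp

lemma smooth_on_open_frechet_derivative:
  fixes f :: "'a::euclidean_space \<Rightarrow> 'b::real_normed_vector"
  assumes "open S" "smooth_on S f"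
  shows "smooth_on S (\<lambda>x. frechet_derivative f (at x) v)"
  by (rule smooth_on_cong[OF fully_approachable_open[OF assms(1)] smooth_on_frechet_derivative[OF assms(2)]])
    (simp add: at_within_open[OF _ assms(1)])

lemma vector_derivative_within_eq:
  fixes f :: "real \<Rightarrow> 'b::real_normed_vector"
  assumes "fully_approachable I" "t \<in> I" "(f has_vector_derivative f') (at t within I)"
  shows "vector_derivative f (at t within I) = f'"
proof (rule vector_derivative_within[OF _ assms(3)])
  have "t islimpt I" unfolding islimpt_approachable
  proof (intro allI impI)
    fix e :: real assume "0 < e"
    then obtain d where "0 < \<bar>d\<bar>" "\<bar>d\<bar> < e" "t + d *\<^sub>R 1 \<in> I"
      using assms(1,2) unfolding fully_approachable_def by auto
    then show "\<exists>x'\<in>I. x' \<noteq> t \<and> dist x' t < e"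
      by (intro bexI[of _ "t + d"]) (auto simp: dist_real_def)
  qed
  then show "at t within I \<noteq> bot" using trivial_limit_within by metis
qed

text \<open>
  For curves, \<open>S\<close> is the relatively open part of the parameter interval \<open>I\<close> that is mapped into a given chart;
  derivatives are nevertheless taken within \<open>I\<close>, so that they do not refer to the chart.
\<close>

lemma smooth_on_has_vector_derivative:
  fixes f :: "real \<Rightarrow> 'b::real_normed_vector"
  assumes I: "fully_approachable I" and S: "openin (top_of_set I) S" and "smooth_on S f" "t \<in> S"
  shows "(f has_vector_derivative vector_derivative f (at t within I)) (at t within I)"
proof -
  have "f differentiable at t within I"
    using smooth_on_has_derivative[OF assms(3,4)] at_within_openin[OF S assms(4)]
    by (auto simp: differentiable_def)
  then show ?thesis by (simp add: vector_derivative_works)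
qed

lemma smooth_on_vector_derivative:
  fixes f :: "real \<Rightarrow> 'b::real_normed_vector"
  assumes I: "fully_approachable I" and S: "openin (top_of_set I) S" and f: "smooth_on S f"
  shows "smooth_on S (\<lambda>t. vector_derivative f (at t within I))"
proof (rule smooth_on_cong[OF fully_approachable_openin[OF I S] smooth_on_frechet_derivative[OF f, of 1]])
  fix t assume t: "t \<in> S"
  have "(f has_derivative (\<lambda>h. h *\<^sub>R vector_derivative f (at t within I))) (at t within S)"
    using smooth_on_has_vector_derivative[OF assms t] at_within_openin[OF S t]
    by (simp add: has_vector_derivative_def)
  then show "frechet_derivative f (at t within S) 1 = vector_derivative f (at t within I)"
    using frechet_derivative_within_eq[OF fully_approachable_openin[OF I S] t] by fastforce
qed

lemma Ck_on_Suc_vector_derivative: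
  fixes f :: "real \<Rightarrow> 'b::real_normed_vector"
  assumes "fully_approachable S"
    and "\<And>x. x \<in> S \<Longrightarrow> (f has_vector_derivative f' x) (at x within S)" "Ck_on k S f'"
  shows "Ck_on (Suc k) S f"
proof (rule Ck_on_SucI[OF assms(1)])
  show "(f has_derivative (\<lambda>h. h *\<^sub>R f' x)) (at x within S)" if "x \<in> S" for x
    using assms(2)[OF that] by (simp add: has_vector_derivative_def)
qed (intro Ck_on_scaleR Ck_on_const assms)

section \<open>Charts and tangent vectors\<close>

text \<open>
  A tangent vector at \<open>p\<close> is the family of its components in all charts around \<open>p\<close>; the components in two
  charts differ by \<open>tdiff c d p\<close>, the differential of the change of coordinates.
\<close>

locale manifold =
  fixes A :: "('m::{t2_space,second_countable_topology}, 'n::finite) chart set"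
  assumes atlas: "smooth_atlas A"
begin

lemma compatible: "c \<in> A \<Longrightarrow> compatible_chart A c"
  using atlas unfolding smooth_atlas_def by blast

lemma chart_facts:
  assumes "compatible_chart A c"
  shows open_cdom: "open (cdom c)" and cdom_points: "cdom c \<subseteq> points A"
    and open_cmap_cdom: "open (cmap c ` cdom c)"
    and cinv_cmap: "p \<in> cdom c \<Longrightarrow> cinv c (cmap c p) = p"
    and cinv_in: "u \<in> cmap c ` cdom c \<Longrightarrow> cinv c u \<in> cdom c"
    and cmap_cinv: "u \<in> cmap c ` cdom c \<Longrightarrow> cmap c (cinv c u) = u"
    and cont_cmap: "continuous_on (cdom c) (cmap c)"
    and cont_cinv: "continuous_on (cmap c ` cdom c) (cinv c)"
  using assms unfolding compatible_chart_def homeomorphism_def by auto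

lemma open_cmap_image:
  assumes c: "compatible_chart A c" and U: "open U" "U \<subseteq> cdom c"
  shows "open (cmap c ` U)"
proof -
  have "homeomorphism (cdom c) (cmap c ` cdom c) (cmap c) (cinv c)"
    using c unfolding compatible_chart_def by blast
  moreover have "openin (top_of_set (cdom c)) U"
    using U by (metis openin_open inf.absorb2)
  ultimately have "openin (top_of_set (cmap c ` cdom c)) (cmap c ` U)"
    by (rule homeomorphism_imp_open_map)
  then show ?thesis using open_cmap_cdom[OF c] openin_open_eq by blast
qed

lemma smooth_transition:
  assumes "compatible_chart A c" "d \<in> A"
  shows "smooth_on (cmap c ` (cdom c \<inter> cdom d)) (cmap d \<circ> cinv c)"
    and "smooth_on (cmap d ` (cdom c \<inter> cdom d)) (cmap c \<circ> cinv d)"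
  using assms unfolding compatible_chart_def by blast+

lemma open_overlap:
  assumes "c \<in> A" "d \<in> A"
  shows "open (cdom c \<inter> cdom d)" "open (cmap c ` (cdom c \<inter> cdom d))" "open (cmap d ` (cdom c \<inter> cdom d))"
  using assms by (auto intro!: open_cmap_image compatible open_cdom)

definition tdiff :: "('m, 'n) chart \<Rightarrow> ('m, 'n) chart \<Rightarrow> 'm \<Rightarrow> real ^ 'n \<Rightarrow> real ^ 'n" where
  "tdiff c d p = frechet_derivative (cmap d \<circ> cinv c) (at (cmap c p))"

lemma tdiff_has_derivative:
  assumes "c \<in> A" "d \<in> A" "p \<in> cdom c" "p \<in> cdom d"
  shows "((cmap d \<circ> cinv c) has_derivative tdiff c d p) (at (cmap c p))"
  unfolding tdiff_def
  by (rule smooth_on_open_has_derivative[OF open_overlap(2) smooth_transition(1)])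
    (use assms compatible in auto)

lemma linear_tdiff:
  assumes "c \<in> A" "d \<in> A" "p \<in> cdom c" "p \<in> cdom d"
  shows "linear (tdiff c d p)"
  using tdiff_has_derivative[OF assms] has_derivative_linear by blast

lemma derivative_change_chart:
  assumes "c \<in> A" "d \<in> A" "p \<in> cdom c" "p \<in> cdom d"
    and F: "((F \<circ> cinv d) has_derivative F') (at (cmap d p))"
  shows "((F \<circ> cinv c) has_derivative (\<lambda>x. F' (tdiff c d p x))) (at (cmap c p))"
proof -
  note C = compatible[OF assms(1)] and D = compatible[OF assms(2)]
  have "((F \<circ> cinv d) \<circ> (cmap d \<circ> cinv c) has_derivative F' \<circ> tdiff c d p) (at (cmap c p))"
    by (rule diff_chain_at[OF tdiff_has_derivative[OF assms(1-4)]])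
      (use F cinv_cmap[OF C assms(3)] in simp)
  then have *: "((F \<circ> cinv d) \<circ> (cmap d \<circ> cinv c) has_derivative (\<lambda>x. F' (tdiff c d p x))) (at (cmap c p))"
    by (simp add: comp_def)
  show ?thesis
    by (rule has_derivative_transform_within_open[OF * open_overlap(2)[OF assms(1,2)]])
      (use assms cinv_cmap[OF C] cinv_cmap[OF D] in \<open>auto simp: o_def\<close>)
qed

lemma tdiff_chain:
  assumes "c \<in> A" "d \<in> A" "e \<in> A" "p \<in> cdom c" "p \<in> cdom d" "p \<in> cdom e"
  shows "tdiff d e p (tdiff c d p x) = tdiff c e p x"
  using has_derivative_unique[OF derivative_change_chart[OF assms(1,2,4,5)
        tdiff_has_derivative[OF assms(2,3,5,6)]] tdiff_has_derivative[OF assms(1,3,4,6)]]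
  by (rule fun_cong)

lemma tdiff_id:
  assumes "c \<in> A" "p \<in> cdom c"
  shows "tdiff c c p x = x"
proof -
  note C = compatible[OF assms(1)]
  have "((\<lambda>u. u) has_derivative tdiff c c p) (at (cmap c p))"
    by (rule has_derivative_transform_within_open[OF tdiff_has_derivative open_cmap_cdom[OF C]])
      (use assms cmap_cinv[OF C] in auto)
  from has_derivative_unique[OF this has_derivative_ident] show ?thesis by simp
qed

lemma coord_field_chart:
  assumes "d \<in> A" "p \<in> cdom c" "p \<in> cdom d"
  shows "coord_field A c x p d = tdiff c d p x"
  using assms by (simp add: coord_field_def tdiff_def)

lemma coord_field_same: "c \<in> A \<Longrightarrow> p \<in> cdom c \<Longrightarrow> coord_field A c x p c = x"
  by (simp add: coord_field_chart tdiff_id)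

lemma tangent_spaceI:
  assumes "\<And>c. \<not> (c \<in> A \<and> p \<in> cdom c) \<Longrightarrow> v c = 0"
    and "\<And>c d. c \<in> A \<Longrightarrow> d \<in> A \<Longrightarrow> p \<in> cdom c \<Longrightarrow> p \<in> cdom d \<Longrightarrow> v d = tdiff c d p (v c)"
  shows "v \<in> tangent_space A p"
  using assms unfolding tangent_space_def tdiff_def by blast

lemma coord_field_in_tangent_space:
  assumes "c \<in> A" "p \<in> cdom c"
  shows "coord_field A c x p \<in> tangent_space A p"
proof (rule tangent_spaceI)
  show "coord_field A c x p d = 0" if "\<not> (d \<in> A \<and> p \<in> cdom d)" for d
    using that by (auto simp: coord_field_def)
  show "coord_field A c x p e = tdiff d e p (coord_field A c x p d)"
    if "d \<in> A" "e \<in> A" "p \<in> cdom d" "p \<in> cdom e" for d e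
    using that assms by (simp add: coord_field_chart tdiff_chain)
qed

lemma tangent_chart:
  assumes "v \<in> tangent_space A p" "c \<in> A" "d \<in> A" "p \<in> cdom c" "p \<in> cdom d"
  shows "v d = tdiff c d p (v c)"
  using assms unfolding tangent_space_def tdiff_def by blast

lemma tangent_outside: "v \<in> tangent_space A p \<Longrightarrow> \<not> (c \<in> A \<and> p \<in> cdom c) \<Longrightarrow> v c = 0"
  unfolding tangent_space_def by blast

lemma tangent_eqI:
  assumes "v \<in> tangent_space A p" "w \<in> tangent_space A p" "c \<in> A" "p \<in> cdom c" "v c = w c"
  shows "v = w"
proof
  show "v d = w d" for d
    using tangent_chart[OF assms(1,3) _ assms(4), of d] tangent_chart[OF assms(2,3) _ assms(4), of d]
      tangent_outside[OF assms(1), of d] tangent_outside[OF assms(2), of d] assms(5)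
    by (cases "d \<in> A \<and> p \<in> cdom d") auto
qed

lemma tangent_coord_field:
  assumes "v \<in> tangent_space A p" "c \<in> A" "p \<in> cdom c"
  shows "coord_field A c (v c) p = v"
  by (rule tangent_eqI[OF coord_field_in_tangent_space[OF assms(2,3)] assms coord_field_same[OF assms(2,3)]])

lemma tangent_add:
  assumes "v \<in> tangent_space A p" "w \<in> tangent_space A p"
  shows "v + w \<in> tangent_space A p"
proof (rule tangent_spaceI)
  show "(v + w) c = 0" if "\<not> (c \<in> A \<and> p \<in> cdom c)" for c
    using tangent_outside[OF assms(1) that] tangent_outside[OF assms(2) that] by simp
  show "(v + w) d = tdiff c d p ((v + w) c)" if "c \<in> A" "d \<in> A" "p \<in> cdom c" "p \<in> cdom d" for c d
    using tangent_chart[OF assms(1) that] tangent_chart[OF assms(2) that] by (simp add: linear_add[OF linear_tdiff[OF that]])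
qed

lemma tangent_diff:
  assumes "v \<in> tangent_space A p" "w \<in> tangent_space A p"
  shows "v - w \<in> tangent_space A p"
proof (rule tangent_spaceI)
  show "(v - w) c = 0" if "\<not> (c \<in> A \<and> p \<in> cdom c)" for c
    using tangent_outside[OF assms(1) that] tangent_outside[OF assms(2) that] by simp
  show "(v - w) d = tdiff c d p ((v - w) c)" if "c \<in> A" "d \<in> A" "p \<in> cdom c" "p \<in> cdom d" for c d
    using tangent_chart[OF assms(1) that] tangent_chart[OF assms(2) that] by (simp add: linear_diff[OF linear_tdiff[OF that]])
qed

lemma tangent_scale:
  assumes "v \<in> tangent_space A p"
  shows "tscale a v \<in> tangent_space A p"
proof (rule tangent_spaceI)
  show "tscale a v c = 0" if "\<not> (c \<in> A \<and> p \<in> cdom c)" for c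
    using tangent_outside[OF assms that] by (simp add: tscale_def)
  show "tscale a v d = tdiff c d p (tscale a v c)" if "c \<in> A" "d \<in> A" "p \<in> cdom c" "p \<in> cdom d" for c d
    using tangent_chart[OF assms that] by (simp add: tscale_def linear_scale[OF linear_tdiff[OF that]])
qed

lemma tangent_0: "0 \<in> tangent_space A p"
  by (rule tangent_spaceI) (simp_all add: linear_0[OF linear_tdiff])

lemma tangent_sum:
  "(\<And>i. i \<in> F \<Longrightarrow> v i \<in> tangent_space A p) \<Longrightarrow> (\<Sum>i\<in>F. v i) \<in> tangent_space A p"
  by (induction F rule: infinite_finite_induct) (auto intro: tangent_add tangent_0)

lemma pointsE:
  assumes "p \<in> points A" obtains c where "c \<in> A" "p \<in> cdom c"
  using assms unfolding points_def by blast

lemma chart_at: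
  assumes "p \<in> points A"
  shows "chart_at A p \<in> A" "p \<in> cdom (chart_at A p)"
proof -
  obtain c where "c \<in> A \<and> p \<in> cdom c" using assms by (rule pointsE) blast
  then have "chart_at A p \<in> A \<and> p \<in> cdom (chart_at A p)"
    unfolding chart_at_def by (rule someI)
  then show "chart_at A p \<in> A" "p \<in> cdom (chart_at A p)" by auto
qed

lemma open_points: "open (points A)"
  unfolding points_def using compatible open_cdom by blast

text \<open>
  One and the same map is smooth in every chart once it is smooth in one, because the transition maps are.
\<close>

lemma smooth_change_chart:
  fixes F :: "'m \<Rightarrow> 'b::real_normed_vector"
  assumes c: "compatible_chart A c" and d: "d \<in> A" and U: "open U" "U \<subseteq> cdom d \<inter> cdom c"
    and F: "smooth_on (cmap d ` U) (\<lambda>u. F (cinv d u))"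
  shows "smooth_on (cmap c ` U) (\<lambda>u. F (cinv c u))"
proof -
  note C = c and D = compatible[OF d]
  have f: "fully_approachable (cmap c ` U)"
    using U by (intro fully_approachable_open open_cmap_image[OF C]) auto
  have sub: "cmap c ` U \<subseteq> cmap c ` (cdom c \<inter> cdom d)" using U by auto
  have "smooth_on (cmap c ` U) (\<lambda>u. F (cinv d ((cmap d \<circ> cinv c) u)))"
    by (rule smooth_on_compose[OF f F smooth_on_subset[OF f smooth_transition(1)[OF C d] sub]])
      (use U cinv_cmap[OF C] in auto)
  then show ?thesis
    by (rule smooth_on_cong[OF f]) (use U cinv_cmap[OF C] cinv_cmap[OF D] in \<open>auto simp: subset_iff\<close>)
qed

lemma smooth_fun_onI:
  assumes "c \<in> A" "open U" "U \<subseteq> cdom c" "smooth_on (cmap c ` U) (f \<circ> cinv c)"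
  shows "smooth_fun_on A U f"
  unfolding smooth_fun_on_def
proof
  fix d assume d: "d \<in> A"
  have o: "open (U \<inter> cdom d)" using assms open_cdom compatible d by blast
  have "smooth_on (cmap c ` (U \<inter> cdom d)) (\<lambda>u. f (cinv c u))"
    by (rule smooth_on_subset[OF fully_approachable_open[OF open_cmap_image[OF compatible[OF assms(1)] o]]
          assms(4)[unfolded o_def]]) (use assms in auto)
  from smooth_change_chart[OF compatible[OF d] assms(1) o _ this] assms(3)
  show "smooth_on (cmap d ` (U \<inter> cdom d)) (f \<circ> cinv d)" by (auto simp: o_def)
qed

lemma smooth_fun_on_chart:
  assumes "smooth_fun_on A U f" "c \<in> A" "open V" "V \<subseteq> U \<inter> cdom c"
  shows "smooth_on (cmap c ` V) (\<lambda>u. f (cinv c u))"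
  by (rule smooth_on_subset[OF fully_approachable_open[OF open_cmap_image[OF compatible[OF assms(2)]]]])
    (use assms in \<open>auto simp: smooth_fun_on_def o_def\<close>)

lemma vector_field_on_chart:
  assumes "vector_field_on A U X" "c \<in> A" "open V" "V \<subseteq> U \<inter> cdom c"
  shows "smooth_on (cmap c ` V) (\<lambda>u. X (cinv c u) c)"
  by (rule smooth_on_subset[OF fully_approachable_open[OF open_cmap_image[OF compatible[OF assms(2)]]]])
    (use assms in \<open>auto simp: vector_field_on_def\<close>)

lemma vector_field_on_tangent: "vector_field_on A U X \<Longrightarrow> p \<in> U \<Longrightarrow> X p \<in> tangent_space A p"
  unfolding vector_field_on_def by blast

lemma has_derivative_in_chart:
  fixes F :: "'m \<Rightarrow> 'b::real_normed_vector"
  assumes "c \<in> A" "open U" "U \<subseteq> cdom c" "p \<in> U" "smooth_on (cmap c ` U) (\<lambda>u. F (cinv c u))"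
  shows "((\<lambda>u. F (cinv c u)) has_derivative frechet_derivative (\<lambda>u. F (cinv c u)) (at (cmap c p))) (at (cmap c p))"
  by (rule smooth_on_open_has_derivative[OF open_cmap_image[OF compatible] assms(5)]) (use assms in auto)

lemma tdiff_expand:
  assumes "c \<in> A" "d \<in> A" "p \<in> cdom c" "p \<in> cdom d"
  shows "tdiff c d p x = (\<Sum>i\<in>Basis. (x \<bullet> i) *\<^sub>R tdiff c d p i)"
  by (subst (1) euclidean_representation[symmetric, of x])
    (simp add: linear_sum[OF linear_tdiff[OF assms]] linear_scale[OF linear_tdiff[OF assms]])

lemma smooth_tdiff:
  assumes "c \<in> A" "d \<in> A"
  shows "smooth_on (cmap c ` (cdom c \<inter> cdom d)) (\<lambda>u. tdiff c d (cinv c u) x)"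
proof (rule smooth_on_cong[OF fully_approachable_open[OF open_overlap(2)[OF assms]]
      smooth_on_open_frechet_derivative[OF open_overlap(2)[OF assms] smooth_transition(1)[OF compatible assms(2)]]])
  show "c \<in> A" by fact
  fix u assume "u \<in> cmap c ` (cdom c \<inter> cdom d)"
  then show "frechet_derivative (cmap d \<circ> cinv c) (at u) x = tdiff c d (cinv c u) x"
    using cmap_cinv[OF compatible[OF assms(1)], of u] by (auto simp: tdiff_def)
qed

text \<open>
  Smoothness of the components in one chart suffices: in another chart they are the image under \<open>tdiff\<close>,
  whose entries are smooth.
\<close>

lemma vector_field_onI:
  assumes c: "c \<in> A" and U: "open U" "U \<subseteq> cdom c"
    and X: "\<And>p. p \<in> U \<Longrightarrow> X p \<in> tangent_space A p"
    and sm: "smooth_on (cmap c ` U) (\<lambda>u. X (cinv c u) c)"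
  shows "vector_field_on A U X"
  unfolding vector_field_on_def
proof (intro conjI ballI X)
  fix d assume d: "d \<in> A"
  note C = compatible[OF c] and D = compatible[OF d]
  define V where "V = U \<inter> cdom d"
  have o: "open V" using U open_cdom[OF D] unfolding V_def by blast
  have f: "fully_approachable (cmap c ` V)"
    by (rule fully_approachable_open[OF open_cmap_image[OF C o]]) (use U V_def in auto)
  have f': "fully_approachable (cmap d ` V)"
    by (rule fully_approachable_open[OF open_cmap_image[OF D o]]) (use U V_def in auto)
  have 1: "smooth_on (cmap c ` V) (\<lambda>u. tdiff c d (cinv c u) i)" for i
    by (rule smooth_on_subset[OF f smooth_tdiff[OF c d]]) (use U V_def in auto)
  have 2: "smooth_on (cmap c ` V) (\<lambda>u. X (cinv c u) c)"
    by (rule smooth_on_subset[OF f sm]) (use U V_def in auto)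
  have "smooth_on (cmap c ` V) (\<lambda>u. \<Sum>i\<in>Basis. (X (cinv c u) c \<bullet> i) *\<^sub>R tdiff c d (cinv c u) i)"
    by (intro smooth_on_sum[OF f] smooth_on_scaleR[OF f] 1
        smooth_on_compose_linear[OF f bounded_linear_inner_left 2])
  then have "smooth_on (cmap c ` V) (\<lambda>u. X (cinv c u) d)"
  proof (rule smooth_on_cong[OF f])
    fix u assume "u \<in> cmap c ` V"
    then obtain p where p: "p \<in> V" "u = cmap c p" by blast
    then have *: "cinv c u = p" "p \<in> cdom c" "p \<in> cdom d" "p \<in> U" using cinv_cmap[OF C] U V_def by auto
    show "(\<Sum>i\<in>Basis. (X (cinv c u) c \<bullet> i) *\<^sub>R tdiff c d (cinv c u) i) = X (cinv c u) d"
      unfolding * using tangent_chart[OF X c d] tdiff_expand[OF c d] * by metis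
  qed
  from smooth_change_chart[OF D c o _ this] U
  show "smooth_on (cmap d ` (U \<inter> cdom d)) (\<lambda>u. X (cinv d u) d)" unfolding V_def by auto
qed

lemma vector_field_coord:
  assumes "c \<in> A" "open U" "U \<subseteq> cdom c"
  shows "vector_field_on A U (coord_field A c x)"
proof (rule vector_field_onI[OF assms coord_field_in_tangent_space[OF assms(1)]])
  show "p \<in> cdom c" if "p \<in> U" for p using that assms by auto
  have f: "fully_approachable (cmap c ` U)"
    by (rule fully_approachable_open[OF open_cmap_image[OF compatible[OF assms(1)] assms(2,3)]])
  show "smooth_on (cmap c ` U) (\<lambda>u. coord_field A c x (cinv c u) c)"
    by (rule smooth_on_cong[OF f smooth_on_const[OF f, of x]])
      (use assms cinv_cmap[OF compatible[OF assms(1)]] in \<open>auto simp: coord_field_same subset_iff\<close>)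
qed

lemma dfun_chart:
  assumes f: "smooth_fun_on A U f" and U: "open U" and p: "p \<in> U" "p \<in> cdom c" and c: "c \<in> A"
    and v: "v \<in> tangent_space A p"
  shows "dfun A f p v = frechet_derivative (f \<circ> cinv c) (at (cmap c p)) (v c)"
proof -
  let ?d = "chart_at A p"
  have pp: "p \<in> points A" using p c by (auto simp: points_def)
  note d = chart_at[OF pp] and C = compatible[OF c]
  have "((\<lambda>u. f (cinv c u)) has_derivative frechet_derivative (\<lambda>u. f (cinv c u)) (at (cmap c p))) (at (cmap c p))"
    by (rule has_derivative_in_chart[OF c _ _ _ smooth_fun_on_chart[OF f c], where U = "U \<inter> cdom c"])
      (use p U open_cdom[OF C] in auto)
  then have "((f \<circ> cinv c) has_derivative frechet_derivative (f \<circ> cinv c) (at (cmap c p))) (at (cmap c p))"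
    by (simp add: o_def)
  from derivative_change_chart[OF d(1) c d(2) p(2) this]
  have "frechet_derivative (f \<circ> cinv ?d) (at (cmap ?d p)) =
      (\<lambda>x. frechet_derivative (f \<circ> cinv c) (at (cmap c p)) (tdiff ?d c p x))"
    using frechet_derivative_at by metis
  then show ?thesis
    unfolding dfun_def Let_def using tangent_chart[OF v d(1) c d(2) p(2)] by simp
qed

end

section \<open>Bilinear fields and the symmetry of second derivatives\<close>

lemma bilinear_expand:
  fixes B :: "'a::euclidean_space \<Rightarrow> 'b::euclidean_space \<Rightarrow> 'c::real_vector"
  assumes "bilinear B"
  shows "B x y = (\<Sum>i\<in>Basis. \<Sum>j\<in>Basis. ((x \<bullet> i) * (y \<bullet> j)) *\<^sub>R B i j)"
proof -
  have "B x y = B (\<Sum>i\<in>Basis. (x \<bullet> i) *\<^sub>R i) (\<Sum>j\<in>Basis. (y \<bullet> j) *\<^sub>R j)"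
    by (simp add: euclidean_representation)
  also have "\<dots> = (\<Sum>i\<in>Basis. (x \<bullet> i) *\<^sub>R B i (\<Sum>j\<in>Basis. (y \<bullet> j) *\<^sub>R j))"
    using assms unfolding bilinear_def
    by (simp only: linear_sum[where f = "\<lambda>x. B x y" for y] linear_scale[where f = "\<lambda>x. B x y" for y])
  also have "\<dots> = (\<Sum>i\<in>Basis. \<Sum>j\<in>Basis. ((x \<bullet> i) * (y \<bullet> j)) *\<^sub>R B i j)"
    using assms unfolding bilinear_def by (simp add: linear_sum linear_scale scaleR_sum_right)
  finally show ?thesis .
qed

text \<open>
  The product rule for a bilinear map that itself depends on the point. Only the derivatives of its values on
  fixed vectors are assumed; expansion in bases reduces the claim to products of scalar functions.
\<close>

lemma bilinear_field_has_derivative: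
  fixes B :: "'d::euclidean_space \<Rightarrow> 'a::euclidean_space \<Rightarrow> 'b::euclidean_space \<Rightarrow> 'c::real_normed_vector"
  assumes S: "fully_approachable S" and bil: "\<And>p. p \<in> S \<Longrightarrow> bilinear (B p)" and x: "x \<in> S"
    and B': "\<And>a b. ((\<lambda>p. B p a b) has_derivative B' a b) (at x within S)"
    and f: "(f has_derivative f') (at x within S)" and g: "(g has_derivative g') (at x within S)"
  shows "((\<lambda>p. B p (f p) (g p)) has_derivative
    (\<lambda>v. B' (f x) (g x) v + B x (f' v) (g x) + B x (f x) (g' v))) (at x within S)"
proof -
  have rep: "B p a b = (\<Sum>i\<in>Basis. \<Sum>j\<in>Basis. ((a \<bullet> i) * (b \<bullet> j)) *\<^sub>R B p i j)" if "p \<in> S" for p a b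
    using bilinear_expand[OF bil[OF that]] .
  have B'rep: "B' a b v = (\<Sum>i\<in>Basis. \<Sum>j\<in>Basis. ((a \<bullet> i) * (b \<bullet> j)) *\<^sub>R B' i j v)" for a b v
  proof -
    have "((\<lambda>p. \<Sum>i\<in>Basis. \<Sum>j\<in>Basis. ((a \<bullet> i) * (b \<bullet> j)) *\<^sub>R B p i j) has_derivative
        (\<lambda>v. \<Sum>i\<in>Basis. \<Sum>j\<in>Basis. ((a \<bullet> i) * (b \<bullet> j)) *\<^sub>R B' i j v)) (at x within S)"
      by (intro has_derivative_sum has_derivative_scaleR_right B')
    from has_derivative_transform[OF x rep this]
    have "frechet_derivative (\<lambda>p. B p a b) (at x within S) =
        (\<lambda>v. \<Sum>i\<in>Basis. \<Sum>j\<in>Basis. ((a \<bullet> i) * (b \<bullet> j)) *\<^sub>R B' i j v)"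
      by (rule frechet_derivative_within_eq[OF S x])
    with frechet_derivative_within_eq[OF S x B', of a b] show ?thesis by metis
  qed
  have "((\<lambda>p. \<Sum>i\<in>Basis. \<Sum>j\<in>Basis. ((f p \<bullet> i) * (g p \<bullet> j)) *\<^sub>R B p i j) has_derivative
      (\<lambda>v. \<Sum>i\<in>Basis. \<Sum>j\<in>Basis. ((f x \<bullet> i) * (g x \<bullet> j)) *\<^sub>R B' i j v
          + ((f x \<bullet> i) * (g' v \<bullet> j) + (f' v \<bullet> i) * (g x \<bullet> j)) *\<^sub>R B x i j)) (at x within S)"
    by (intro has_derivative_sum has_derivative_scaleR B' has_derivative_mult has_derivative_inner_left f g)
  moreover have "(\<lambda>v. \<Sum>i\<in>Basis. \<Sum>j\<in>Basis. ((f x \<bullet> i) * (g x \<bullet> j)) *\<^sub>R B' i j v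
          + ((f x \<bullet> i) * (g' v \<bullet> j) + (f' v \<bullet> i) * (g x \<bullet> j)) *\<^sub>R B x i j)
     = (\<lambda>v. B' (f x) (g x) v + B x (f' v) (g x) + B x (f x) (g' v))"
    by (intro ext, subst B'rep, subst (2 3) rep[OF x])
      (simp add: sum.distrib algebra_simps)
  ultimately have "((\<lambda>p. \<Sum>i\<in>Basis. \<Sum>j\<in>Basis. ((f p \<bullet> i) * (g p \<bullet> j)) *\<^sub>R B p i j) has_derivative
      (\<lambda>v. B' (f x) (g x) v + B x (f' v) (g x) + B x (f x) (g' v))) (at x within S)" by simp
  from has_derivative_transform[OF x rep this] show ?thesis .
qed

lemma smooth_on_bilinear_field:
  fixes B :: "'d::euclidean_space \<Rightarrow> 'a::euclidean_space \<Rightarrow> 'b::euclidean_space \<Rightarrow> 'c::real_normed_vector"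
  assumes S: "fully_approachable S" and bil: "\<And>p. p \<in> S \<Longrightarrow> bilinear (B p)"
    and B: "\<And>a b. smooth_on S (\<lambda>p. B p a b)" and f: "smooth_on S f" and g: "smooth_on S g"
  shows "smooth_on S (\<lambda>p. B p (f p) (g p))"
proof (rule smooth_on_cong[OF S])
  show "smooth_on S (\<lambda>p. \<Sum>i\<in>Basis. \<Sum>j\<in>Basis. ((f p \<bullet> i) * (g p \<bullet> j)) *\<^sub>R B p i j)"
    by (intro smooth_on_sum[OF S] smooth_on_scaleR[OF S] smooth_on_mult[OF S] B
        smooth_on_compose_linear[OF S bounded_linear_inner_left f]
        smooth_on_compose_linear[OF S bounded_linear_inner_left g])
  show "(\<Sum>i\<in>Basis. \<Sum>j\<in>Basis. ((f p \<bullet> i) * (g p \<bullet> j)) *\<^sub>R B p i j) = B p (f p) (g p)" if "p \<in> S" for p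
    using bilinear_expand[OF bil[OF that]] by metis
qed

text \<open>
  The mean value theorem, applied first in the direction \<open>v\<close> and then in the direction \<open>w\<close>, expresses the
  mixed second difference by one of the two mixed derivatives.
\<close>

lemma second_difference_mean_value:
  fixes f :: "'a::real_normed_vector \<Rightarrow> real"
  assumes h: "h > 0" and f: "\<And>s t. s \<in> {0..h} \<Longrightarrow> t \<in> {0..h} \<Longrightarrow>
      (f has_derivative f' (x + s *\<^sub>R v + t *\<^sub>R w)) (at (x + s *\<^sub>R v + t *\<^sub>R w))"
    and f': "\<And>s t. s \<in> {0..h} \<Longrightarrow> t \<in> {0..h} \<Longrightarrow>
      ((\<lambda>u. f' u v) has_derivative D (x + s *\<^sub>R v + t *\<^sub>R w)) (at (x + s *\<^sub>R v + t *\<^sub>R w))"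
  obtains s t where "s \<in> {0..h}" "t \<in> {0..h}"
    "f (x + h *\<^sub>R v + h *\<^sub>R w) - f (x + h *\<^sub>R v) - f (x + h *\<^sub>R w) + f x = h * h * D (x + s *\<^sub>R v + t *\<^sub>R w) w"
proof -
  have lin: "linear (f' (x + s *\<^sub>R v + t *\<^sub>R w))" "linear (D (x + s *\<^sub>R v + t *\<^sub>R w))"
    if "s \<in> {0..h}" "t \<in> {0..h}" for s t
    using f[OF that] f'[OF that] has_derivative_linear by blast+
  define F where "F s = f (x + s *\<^sub>R v + h *\<^sub>R w) - f (x + s *\<^sub>R v + 0 *\<^sub>R w)" for s
  have 1: "((\<lambda>s. f (x + s *\<^sub>R v + t *\<^sub>R w)) has_real_derivative f' (x + s *\<^sub>R v + t *\<^sub>R w) v) (at s within {0..h})"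
    if "s \<in> {0..h}" "t \<in> {0..h}" for s t
  proof -
    have "((\<lambda>s. f (x + s *\<^sub>R v + t *\<^sub>R w)) has_derivative (\<lambda>r. f' (x + s *\<^sub>R v + t *\<^sub>R w) (r *\<^sub>R v))) (at s within {0..h})"
      by (rule has_derivative_compose[where f = "\<lambda>s. x + s *\<^sub>R v + t *\<^sub>R w" and g = f, OF _ f[OF that]]) (auto intro!: derivative_eq_intros)
    then show ?thesis
      by (simp add: has_field_derivative_def linear_scale[OF lin(1)[OF that]] mult_commute_abs)
  qed
  have 2: "((\<lambda>t. f' (x + s *\<^sub>R v + t *\<^sub>R w) v) has_real_derivative D (x + s *\<^sub>R v + t *\<^sub>R w) w) (at t within {0..h})"
    if "s \<in> {0..h}" "t \<in> {0..h}" for s t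
  proof -
    have "((\<lambda>t. f' (x + s *\<^sub>R v + t *\<^sub>R w) v) has_derivative (\<lambda>r. D (x + s *\<^sub>R v + t *\<^sub>R w) (r *\<^sub>R w))) (at t within {0..h})"
      by (rule has_derivative_compose[where f = "\<lambda>t. x + s *\<^sub>R v + t *\<^sub>R w" and g = "\<lambda>u. f' u v", OF _ f'[OF that]]) (auto intro!: derivative_eq_intros)
    then show ?thesis
      by (simp add: has_field_derivative_def linear_scale[OF lin(2)[OF that]] mult_commute_abs)
  qed
  have "(F has_derivative (*) (f' (x + s *\<^sub>R v + h *\<^sub>R w) v - f' (x + s *\<^sub>R v + 0 *\<^sub>R w) v)) (at s within {0..h})"
    if "0 \<le> s" "s \<le> h" for s
    unfolding F_def using DERIV_diff[OF 1[of s h] 1[of s 0]] h that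
    by (simp add: has_field_derivative_def)
  then have "\<exists>s\<in>{0<..<h}. F h - F 0 = (f' (x + s *\<^sub>R v + h *\<^sub>R w) v - f' (x + s *\<^sub>R v + 0 *\<^sub>R w) v) * (h - 0)"
    by (intro mvt_simple[OF h]) auto
  then obtain s where s0: "s \<in> {0<..<h}"
    and s2: "F h - F 0 = (f' (x + s *\<^sub>R v + h *\<^sub>R w) v - f' (x + s *\<^sub>R v + 0 *\<^sub>R w) v) * (h - 0)" by blast
  have s: "s \<in> {0..h}" using s0 by simp
  have "((\<lambda>t. f' (x + s *\<^sub>R v + t *\<^sub>R w) v) has_derivative (*) (D (x + s *\<^sub>R v + t *\<^sub>R w) w)) (at t within {0..h})"
    if "0 \<le> t" "t \<le> h" for t
    using 2[OF s(1), of t] that by (simp add: has_field_derivative_def)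
  then have "\<exists>t\<in>{0<..<h}. f' (x + s *\<^sub>R v + h *\<^sub>R w) v - f' (x + s *\<^sub>R v + 0 *\<^sub>R w) v
      = D (x + s *\<^sub>R v + t *\<^sub>R w) w * (h - 0)"
    by (intro mvt_simple[OF h]) auto
  then obtain t where t0: "t \<in> {0<..<h}"
    and t2: "f' (x + s *\<^sub>R v + h *\<^sub>R w) v - f' (x + s *\<^sub>R v + 0 *\<^sub>R w) v
      = D (x + s *\<^sub>R v + t *\<^sub>R w) w * (h - 0)" by blast
  have t: "t \<in> {0..h}" using t0 by simp
  show ?thesis
    by (rule that[OF s t]) (use s2[unfolded t2] in \<open>simp add: F_def algebra_simps\<close>)
qed

text \<open>
  Both mixed derivatives are limits of the same second difference, divided by \<open>h\<^sup>2\<close>.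
\<close>

lemma second_derivative_symmetric_real:
  fixes f :: "'a::real_normed_vector \<Rightarrow> real"
  assumes S: "open S" "x \<in> S" and f: "\<And>u. u \<in> S \<Longrightarrow> (f has_derivative f' u) (at u)"
    and Dv: "\<And>u. u \<in> S \<Longrightarrow> ((\<lambda>u. f' u v) has_derivative Dv u) (at u)"
    and Dw: "\<And>u. u \<in> S \<Longrightarrow> ((\<lambda>u. f' u w) has_derivative Dw u) (at u)"
    and cont: "isCont (\<lambda>u. Dv u w) x" "isCont (\<lambda>u. Dw u v) x"
  shows "Dv x w = Dw x v"
proof (rule ccontr)
  assume ne: "Dv x w \<noteq> Dw x v"
  define e where "e = \<bar>Dv x w - Dw x v\<bar> / 2"
  have e: "e > 0" using ne by (simp add: e_def)
  obtain d1 where d1: "d1 > 0" "\<And>u. dist u x < d1 \<Longrightarrow> dist (Dv u w) (Dv x w) < e"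
    using cont(1) e unfolding continuous_at_eps_delta by metis
  obtain d2 where d2: "d2 > 0" "\<And>u. dist u x < d2 \<Longrightarrow> dist (Dw u v) (Dw x v) < e"
    using cont(2) e unfolding continuous_at_eps_delta by metis
  obtain d3 where d3: "d3 > 0" "ball x d3 \<subseteq> S" using S open_contains_ball by blast
  define d where "d = min d1 (min d2 d3)"
  have d: "d > 0" using d1 d2 d3 by (simp add: d_def)
  \<comment> \<open>The parallelogram with sides \<open>h v\<close> and \<open>h w\<close> lies within distance \<open>d\<close> of \<open>x\<close>.\<close>
  define h where "h = d / (2 * (norm v + norm w + 1))"
  have pos: "norm v + norm w + 1 > 0" by (simp add: add_nonneg_pos)
  have h: "h > 0" using d pos by (simp add: h_def)
  have near: "dist (x + s *\<^sub>R v + t *\<^sub>R w) x < d" if "s \<in> {0..h}" "t \<in> {0..h}" for s t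
  proof -
    have "dist (x + s *\<^sub>R v + t *\<^sub>R w) x \<le> norm (s *\<^sub>R v) + norm (t *\<^sub>R w)"
      by (metis add_diff_cancel_left' dist_norm group_cancel.add1 norm_triangle_ineq)
    also have "\<dots> \<le> h * norm v + h * norm w"
      using that by (auto intro!: add_mono mult_right_mono)
    also have "\<dots> \<le> h * (norm v + norm w + 1)" using h by (simp add: algebra_simps)
    also have "\<dots> = d / 2" using pos unfolding h_def by (simp add: field_simps)
    also have "\<dots> < d" using d by simp
    finally show ?thesis .
  qed
  have inS: "x + s *\<^sub>R v + t *\<^sub>R w \<in> S" if "s \<in> {0..h}" "t \<in> {0..h}" for s t
    using near[OF that] d3 by (auto simp: d_def dist_commute)
  obtain s t where st: "s \<in> {0..h}" "t \<in> {0..h}"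
    "f (x + h *\<^sub>R v + h *\<^sub>R w) - f (x + h *\<^sub>R v) - f (x + h *\<^sub>R w) + f x = h * h * Dv (x + s *\<^sub>R v + t *\<^sub>R w) w"
    using second_difference_mean_value[OF h f[OF inS] Dv[OF inS]] by blast
  have inS': "x + s *\<^sub>R w + t *\<^sub>R v \<in> S" if "s \<in> {0..h}" "t \<in> {0..h}" for s t
    using inS[OF that(2,1)] by (simp add: algebra_simps)
  obtain t' s' where st': "t' \<in> {0..h}" "s' \<in> {0..h}"
    "f (x + h *\<^sub>R w + h *\<^sub>R v) - f (x + h *\<^sub>R w) - f (x + h *\<^sub>R v) + f x = h * h * Dw (x + t' *\<^sub>R w + s' *\<^sub>R v) v"
    using second_difference_mean_value[OF h f[OF inS'] Dw[OF inS']] by blast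
  have swap: "x + t' *\<^sub>R w + s' *\<^sub>R v = x + s' *\<^sub>R v + t' *\<^sub>R w" "x + h *\<^sub>R w + h *\<^sub>R v = x + h *\<^sub>R v + h *\<^sub>R w" by simp_all
  have "h * h * Dv (x + s *\<^sub>R v + t *\<^sub>R w) w = h * h * Dw (x + s' *\<^sub>R v + t' *\<^sub>R w) v"
    using st(3) st'(3) unfolding swap by linarith
  then have "Dv (x + s *\<^sub>R v + t *\<^sub>R w) w = Dw (x + s' *\<^sub>R v + t' *\<^sub>R w) v" using h by simp
  moreover have "dist (Dv (x + s *\<^sub>R v + t *\<^sub>R w) w) (Dv x w) < e"
    using near[OF st(1,2)] by (intro d1) (simp add: d_def)
  moreover have "dist (Dw (x + s' *\<^sub>R v + t' *\<^sub>R w) v) (Dw x v) < e"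
    using near[OF st'(2,1)] by (intro d2) (simp add: d_def)
  ultimately show False unfolding e_def dist_real_def by (smt (verit) field_sum_of_halves)
qed

lemma second_derivative_symmetric:
  fixes f :: "'a::euclidean_space \<Rightarrow> 'b::euclidean_space"
  assumes S: "open S" "x \<in> S" and f: "smooth_on S f"
  shows "frechet_derivative (\<lambda>u. frechet_derivative f (at u) v) (at x) w
       = frechet_derivative (\<lambda>u. frechet_derivative f (at u) w) (at x) v"
proof (rule euclidean_eqI)
  fix b :: 'b assume "b \<in> Basis"
  let ?D = "\<lambda>u. frechet_derivative f (at u)"
  note sm = smooth_on_open_frechet_derivative[OF S(1) f]
  note sm2 = smooth_on_open_frechet_derivative[OF S(1) sm]
  have c: "isCont (\<lambda>u. frechet_derivative (\<lambda>u. ?D u v) (at u) w \<bullet> b) x" for v w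
    using smooth_on_continuous[OF sm2[of v w]] S continuous_on_eq_continuous_at
    by (intro continuous_inner continuous_const) blast
  show "frechet_derivative (\<lambda>u. ?D u v) (at x) w \<bullet> b = frechet_derivative (\<lambda>u. ?D u w) (at x) v \<bullet> b"
    by (rule second_derivative_symmetric_real[OF S, where f = "\<lambda>u. f u \<bullet> b" and f' = "\<lambda>u v. ?D u v \<bullet> b"
          and Dv = "\<lambda>u w. frechet_derivative (\<lambda>u. ?D u v) (at u) w \<bullet> b"
          and Dw = "\<lambda>u v. frechet_derivative (\<lambda>u. ?D u w) (at u) v \<bullet> b"])
      (intro has_derivative_inner_left smooth_on_open_has_derivative[OF S(1) f]
        smooth_on_open_has_derivative[OF S(1) sm] c, assumption?)+
qed

section \<open>The Levi-Civita connection in a chart\<close>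

lemma sum_fun_apply: "(\<Sum>i\<in>F. h i) c = (\<Sum>i\<in>F. h i c)" for h :: "'i \<Rightarrow> 'c \<Rightarrow> 'd::comm_monoid_add"
  by (induction F rule: infinite_finite_induct) auto

context manifold begin

lemma vector_field_on_add:
  assumes "c \<in> A" "open U" "U \<subseteq> cdom c" "vector_field_on A U X" "vector_field_on A U Y"
  shows "vector_field_on A U (\<lambda>p. X p + Y p)"
proof (rule vector_field_onI[OF assms(1-3)])
  have f: "fully_approachable (cmap c ` U)"
    by (rule fully_approachable_open[OF open_cmap_image[OF compatible[OF assms(1)] assms(2,3)]])
  show "smooth_on (cmap c ` U) (\<lambda>u. (X (cinv c u) + Y (cinv c u)) c)"
    unfolding plus_fun_apply
    by (intro smooth_on_add[OF f] vector_field_on_chart[OF assms(4,1,2)] vector_field_on_chart[OF assms(5,1,2)])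
      (use assms in auto)
qed (use assms vector_field_on_tangent tangent_add in blast)

lemma vector_field_on_scale:
  assumes "c \<in> A" "open U" "U \<subseteq> cdom c" "smooth_fun_on A U f" "vector_field_on A U X"
  shows "vector_field_on A U (\<lambda>p. tscale (f p) (X p))"
proof (rule vector_field_onI[OF assms(1-3)])
  have f: "fully_approachable (cmap c ` U)"
    by (rule fully_approachable_open[OF open_cmap_image[OF compatible[OF assms(1)] assms(2,3)]])
  show "smooth_on (cmap c ` U) (\<lambda>u. tscale (f (cinv c u)) (X (cinv c u)) c)"
    unfolding tscale_def
    by (intro smooth_on_scaleR[OF f] smooth_fun_on_chart[OF assms(4,1,2)] vector_field_on_chart[OF assms(5,1,2)])
      (use assms in auto)
qed (use assms vector_field_on_tangent tangent_scale in blast)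

lemma vector_field_on_0:
  assumes "c \<in> A" "open U" "U \<subseteq> cdom c"
  shows "vector_field_on A U (\<lambda>p. 0)"
  by (rule vector_field_onI[OF assms tangent_0])
    (simp add: smooth_on_const fully_approachable_open open_cmap_image compatible assms)

lemma vector_field_on_sum:
  assumes "c \<in> A" "open U" "U \<subseteq> cdom c" "\<And>i. i \<in> F \<Longrightarrow> vector_field_on A U (Z i)"
  shows "vector_field_on A U (\<lambda>p. \<Sum>i\<in>F. Z i p)"
  using assms(4)
  by (induction F rule: infinite_finite_induct)
    (auto intro: vector_field_on_0[OF assms(1-3)] vector_field_on_add[OF assms(1-3)])

lemma smooth_fun_component:
  assumes "c \<in> A" "open U" "U \<subseteq> cdom c" "vector_field_on A U X"
  shows "smooth_fun_on A U (\<lambda>p. X p c \<bullet> i)"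
proof (rule smooth_fun_onI[OF assms(1-3)])
  have f: "fully_approachable (cmap c ` U)"
    by (rule fully_approachable_open[OF open_cmap_image[OF compatible[OF assms(1)] assms(2,3)]])
  have "smooth_on (cmap c ` U) (\<lambda>u. X (cinv c u) c)"
    by (rule vector_field_on_chart[OF assms(4,1,2)]) (use assms in auto)
  from smooth_on_compose_linear[OF f bounded_linear_inner_left this]
  show "smooth_on (cmap c ` U) ((\<lambda>p. X p c \<bullet> i) \<circ> cinv c)" by (simp add: o_def)
qed

text \<open>
  The coordinate fields of a chart form a frame; expanding in it reduces a connection to its Christoffel symbols.
\<close>

lemma tangent_basis_expansion:
  assumes "v \<in> tangent_space A p" "c \<in> A" "p \<in> cdom c"
  shows "v = (\<Sum>i\<in>Basis. tscale (v c \<bullet> i) (coord_field A c i p))"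
proof (rule tangent_eqI[OF assms(1) _ assms(2,3)])
  show "(\<Sum>i\<in>Basis. tscale (v c \<bullet> i) (coord_field A c i p)) \<in> tangent_space A p"
    by (intro tangent_sum tangent_scale coord_field_in_tangent_space assms)
  show "v c = (\<Sum>i\<in>Basis. tscale (v c \<bullet> i) (coord_field A c i p)) c"
    by (simp add: sum_fun_apply tscale_def coord_field_same assms euclidean_representation)
qed

end

locale riemannian = manifold A
  for A :: "('m::{t2_space,second_countable_topology}, 'n::finite) chart set" +
  fixes g :: "('m, 'n) metric" and D :: "('m, 'n) connection"
  assumes metric: "riemannian_metric A g" and lc: "levi_civita A g D"
begin

lemma affine: "affine_connection A D"
  using lc unfolding levi_civita_def by blast

lemma
  assumes "open U" "U \<subseteq> points A" "vector_field_on A U X" "vector_field_on A U Y"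
  shows conn_field: "vector_field_on A U (D X Y)"
    and conn_add_left: "vector_field_on A U Z \<Longrightarrow> p \<in> U \<Longrightarrow> D (\<lambda>q. X q + Z q) Y p = D X Y p + D Z Y p"
    and conn_add_right: "vector_field_on A U Z \<Longrightarrow> p \<in> U \<Longrightarrow> D X (\<lambda>q. Y q + Z q) p = D X Y p + D X Z p"
    and conn_scale_left: "smooth_fun_on A U f \<Longrightarrow> p \<in> U \<Longrightarrow> D (\<lambda>q. tscale (f q) (X q)) Y p = tscale (f p) (D X Y p)"
    and conn_leibniz: "smooth_fun_on A U f \<Longrightarrow> p \<in> U \<Longrightarrow>
      D X (\<lambda>q. tscale (f q) (Y q)) p = tscale (dfun A f p (X p)) (Y p) + tscale (f p) (D X Y p)"
    and conn_local: "(\<And>p. p \<in> U \<Longrightarrow> X' p = X p) \<Longrightarrow> (\<And>p. p \<in> U \<Longrightarrow> Y' p = Y p) \<Longrightarrow> p \<in> U \<Longrightarrow> D X' Y' p = D X Y p"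
    and torsion_free: "p \<in> U \<Longrightarrow> D X Y p - D Y X p = lie_bracket A X Y p"
    and metric_compatible: "vector_field_on A U Z \<Longrightarrow> p \<in> U \<Longrightarrow>
      dfun A (\<lambda>q. g q (Y q) (Z q)) p (X p) = g p (D X Y p) (Z p) + g p (Y p) (D X Z p)"
proof -
  note * = affine[unfolded affine_connection_def, rule_format, OF conjI[OF assms(1) conjI[OF assms(2) conjI[OF assms(3,4)]]]]
  show "vector_field_on A U (D X Y)" using * by blast
  show "vector_field_on A U Z \<Longrightarrow> p \<in> U \<Longrightarrow> D (\<lambda>q. X q + Z q) Y p = D X Y p + D Z Y p"
    "vector_field_on A U Z \<Longrightarrow> p \<in> U \<Longrightarrow> D X (\<lambda>q. Y q + Z q) p = D X Y p + D X Z p"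
    using * unfolding plus_fun_def[of X Z, symmetric] plus_fun_def[of Y Z, symmetric] by blast+
  show "smooth_fun_on A U f \<Longrightarrow> p \<in> U \<Longrightarrow> D (\<lambda>q. tscale (f q) (X q)) Y p = tscale (f p) (D X Y p)"
    "smooth_fun_on A U f \<Longrightarrow> p \<in> U \<Longrightarrow>
      D X (\<lambda>q. tscale (f q) (Y q)) p = tscale (dfun A f p (X p)) (Y p) + tscale (f p) (D X Y p)"
    using * by blast+
  show "(\<And>p. p \<in> U \<Longrightarrow> X' p = X p) \<Longrightarrow> (\<And>p. p \<in> U \<Longrightarrow> Y' p = Y p) \<Longrightarrow> p \<in> U \<Longrightarrow> D X' Y' p = D X Y p"
    using * by blast
  note * = conjunct2[OF lc[unfolded levi_civita_def], rule_format, OF conjI[OF assms(1) conjI[OF assms(2) conjI[OF assms(3,4)]]]]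
  show "p \<in> U \<Longrightarrow> D X Y p - D Y X p = lie_bracket A X Y p"
    "vector_field_on A U Z \<Longrightarrow> p \<in> U \<Longrightarrow>
      dfun A (\<lambda>q. g q (Y q) (Z q)) p (X p) = g p (D X Y p) (Z p) + g p (Y p) (D X Z p)"
    using * by blast+
qed

lemma
  assumes c: "c \<in> A" and U: "open U" "U \<subseteq> cdom c" and p: "p \<in> U" and X: "vector_field_on A U X"
    and Z: "finite F" "\<And>i. i \<in> F \<Longrightarrow> vector_field_on A U (Z i)"
  shows conn_sum_left: "D (\<lambda>q. \<Sum>i\<in>F. Z i q) X p = (\<Sum>i\<in>F. D (Z i) X p)"
    and conn_sum_right: "D X (\<lambda>q. \<Sum>i\<in>F. Z i q) p = (\<Sum>i\<in>F. D X (Z i) p)"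
proof -
  have UP: "U \<subseteq> points A" using U c by (auto simp: points_def)
  note 0 = vector_field_on_0[OF c U]
  have zero: "D (\<lambda>q. 0) X p = 0" "D X (\<lambda>q. 0) p = 0"
    using conn_add_left[OF U(1) UP 0 X 0 p] conn_add_right[OF U(1) UP X 0 0 p] by simp_all
  note ** = vector_field_on_sum[OF c U]
  have "D (\<lambda>q. \<Sum>i\<in>F. Z i q) X p = (\<Sum>i\<in>F. D (Z i) X p) \<and> D X (\<lambda>q. \<Sum>i\<in>F. Z i q) p = (\<Sum>i\<in>F. D X (Z i) p)"
    using Z
  proof (induction F rule: finite_induct)
    case (insert i F)
    have V: "vector_field_on A U (Z i)" "vector_field_on A U (\<lambda>q. \<Sum>i\<in>F. Z i q)"
      using insert.prems by (auto intro: **)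
    have "D (\<lambda>q. \<Sum>i\<in>F. Z i q) X p = (\<Sum>i\<in>F. D (Z i) X p)" "D X (\<lambda>q. \<Sum>i\<in>F. Z i q) p = (\<Sum>i\<in>F. D X (Z i) p)"
      using insert by auto
    then show ?case
      unfolding sum.insert[OF insert.hyps]
      using conn_add_left[OF U(1) UP V(1) X V(2) p] conn_add_right[OF U(1) UP X V p] by metis
  qed (simp add: zero)
  then show "D (\<lambda>q. \<Sum>i\<in>F. Z i q) X p = (\<Sum>i\<in>F. D (Z i) X p)"
    "D X (\<lambda>q. \<Sum>i\<in>F. Z i q) p = (\<Sum>i\<in>F. D X (Z i) p)" by auto
qed

abbreviation \<Gamma> :: "('m, 'n) chart \<Rightarrow> 'm \<Rightarrow> real ^ 'n \<Rightarrow> real ^ 'n \<Rightarrow> real ^ 'n" where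
  "\<Gamma> \<equiv> christoffel A D"

text \<open>
  The coordinate formula of a connection. Both fields are expanded in the coordinate frame; additivity,
  tensoriality in the first argument and the Leibniz rule in the second leave the values on coordinate fields.
\<close>

lemma connection_chart_expanded:
  assumes c: "c \<in> A" and U: "open U" "U \<subseteq> cdom c" and p: "p \<in> U"
    and X: "vector_field_on A U X" and Y: "vector_field_on A U Y"
  shows "D X Y p c = frechet_derivative (\<lambda>u. Y (cinv c u) c) (at (cmap c p)) (X p c)
    + (\<Sum>i\<in>Basis. \<Sum>j\<in>Basis. ((X p c \<bullet> i) * (Y p c \<bullet> j)) *\<^sub>R \<Gamma> c p i j)"
proof -
  note C = compatible[OF c]
  have UP: "U \<subseteq> points A" using U c by (auto simp: points_def)
  have pc: "p \<in> cdom c" using p U by auto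
  note E = vector_field_coord[OF c U]
  note fX = smooth_fun_component[OF c U X] and fY = smooth_fun_component[OF c U Y]
  note XE = vector_field_on_scale[OF c U fX E] and YE = vector_field_on_scale[OF c U fY E]
  let ?Y = "\<lambda>u. Y (cinv c u) c"
  have "D X Y p = D X (\<lambda>q. \<Sum>j\<in>Basis. tscale (Y q c \<bullet> j) (coord_field A c j q)) p"
  proof (rule conn_local[OF U(1) UP X _ _ _ p, symmetric])
    fix q assume q: "q \<in> U"
    show "(\<Sum>j\<in>Basis. tscale (Y q c \<bullet> j) (coord_field A c j q)) = Y q"
      by (rule tangent_basis_expansion[OF vector_field_on_tangent[OF Y q] c, symmetric]) (use q U in auto)
  qed (use Y in auto)
  also have "\<dots> = (\<Sum>j\<in>Basis. D X (\<lambda>q. tscale (Y q c \<bullet> j) (coord_field A c j q)) p)"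
    by (rule conn_sum_right[OF c U p X]) (auto intro: YE)
  also have "\<dots> = (\<Sum>j\<in>Basis. tscale (dfun A (\<lambda>q. Y q c \<bullet> j) p (X p)) (coord_field A c j p)
      + tscale (Y p c \<bullet> j) (D X (coord_field A c j) p))"
    by (intro sum.cong refl conn_leibniz[OF U(1) UP X E fY p])
  finally have 1: "D X Y p c = (\<Sum>j\<in>Basis. dfun A (\<lambda>q. Y q c \<bullet> j) p (X p) *\<^sub>R j)
      + (\<Sum>j\<in>Basis. (Y p c \<bullet> j) *\<^sub>R D X (coord_field A c j) p c)"
    by (simp add: sum_fun_apply tscale_def coord_field_same c pc sum.distrib)
  have 2: "D X (coord_field A c j) p c = (\<Sum>i\<in>Basis. (X p c \<bullet> i) *\<^sub>R \<Gamma> c p i j)" for j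
  proof -
    have "D X (coord_field A c j) p = D (\<lambda>q. \<Sum>i\<in>Basis. tscale (X q c \<bullet> i) (coord_field A c i q)) (coord_field A c j) p"
    proof (rule conn_local[OF U(1) UP X _ _ _ p, symmetric])
      fix q assume q: "q \<in> U"
      show "(\<Sum>i\<in>Basis. tscale (X q c \<bullet> i) (coord_field A c i q)) = X q"
        by (rule tangent_basis_expansion[OF vector_field_on_tangent[OF X q] c, symmetric]) (use q U in auto)
    qed (use E in auto)
    also have "\<dots> = (\<Sum>i\<in>Basis. D (\<lambda>q. tscale (X q c \<bullet> i) (coord_field A c i q)) (coord_field A c j) p)"
      by (rule conn_sum_left[OF c U p E]) (auto intro: XE)
    also have "\<dots> = (\<Sum>i\<in>Basis. tscale (X p c \<bullet> i) (D (coord_field A c i) (coord_field A c j) p))"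
      by (intro sum.cong refl conn_scale_left[OF U(1) UP E E fX p])
    finally show ?thesis by (simp add: sum_fun_apply tscale_def christoffel_def)
  qed
  have "(?Y has_derivative frechet_derivative ?Y (at (cmap c p))) (at (cmap c p))"
    by (rule has_derivative_in_chart[OF c U p vector_field_on_chart[OF Y c U(1)]]) (use U in auto)
  from frechet_derivative_at[OF has_derivative_inner_left[OF this]]
  have "dfun A (\<lambda>q. Y q c \<bullet> j) p (X p) = frechet_derivative ?Y (at (cmap c p)) (X p c) \<bullet> j" for j
    unfolding dfun_chart[OF fY U(1) p pc c vector_field_on_tangent[OF X p]] o_def by metis
  then have 3: "(\<Sum>j\<in>Basis. dfun A (\<lambda>q. Y q c \<bullet> j) p (X p) *\<^sub>R j) = frechet_derivative ?Y (at (cmap c p)) (X p c)"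
    by (simp add: euclidean_representation)
  have 4: "(\<Sum>j\<in>Basis. (Y p c \<bullet> j) *\<^sub>R D X (coord_field A c j) p c) =
      (\<Sum>i\<in>Basis. \<Sum>j\<in>Basis. ((X p c \<bullet> i) * (Y p c \<bullet> j)) *\<^sub>R \<Gamma> c p i j)"
    unfolding 2 scaleR_sum_right by (subst sum.swap) (simp add: mult.commute)
  show ?thesis unfolding 1 3 4 ..
qed

lemma christoffel_expand:
  assumes c: "c \<in> A" and p: "p \<in> cdom c"
  shows "\<Gamma> c p x y = (\<Sum>i\<in>Basis. \<Sum>j\<in>Basis. ((x \<bullet> i) * (y \<bullet> j)) *\<^sub>R \<Gamma> c p i j)"
proof -
  note C = compatible[OF c]
  note E = vector_field_coord[OF c open_cdom[OF C] order_refl]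
  have "((\<lambda>u. coord_field A c y (cinv c u) c) has_derivative (\<lambda>v. 0)) (at (cmap c p))"
    by (rule has_derivative_transform_within_open[OF has_derivative_const[of y] open_cmap_cdom[OF C]])
      (use p cinv_cmap[OF C] c in \<open>auto simp: coord_field_same\<close>)
  then have "frechet_derivative (\<lambda>u. coord_field A c y (cinv c u) c) (at (cmap c p)) = (\<lambda>v. 0)"
    using frechet_derivative_at by metis
  then show ?thesis
    using connection_chart_expanded[OF c open_cdom[OF C] order_refl p E E, of x y]
    by (simp add: christoffel_def coord_field_same c p)
qed

text \<open>
  Coordinate fields with constant components are combinations of the basis fields with constant coefficients,
  on which the connection acts linearly in both arguments.
\<close>

lemma bilinear_christoffel:
  assumes c: "c \<in> A" and p: "p \<in> cdom c"
  shows "bilinear (\<Gamma> c p)"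
  unfolding bilinear_def
proof safe
  show "linear (\<Gamma> c p x)" for x
  proof (rule linearI)
    fix a b and r :: real
    show "\<Gamma> c p x (a + b) = \<Gamma> c p x a + \<Gamma> c p x b"
      unfolding christoffel_expand[OF assms, of x "a + b"] christoffel_expand[OF assms, of x a] christoffel_expand[OF assms, of x b]
      by (simp add: algebra_simps sum.distrib)
    show "\<Gamma> c p x (r *\<^sub>R a) = r *\<^sub>R \<Gamma> c p x a"
      unfolding christoffel_expand[OF assms, of x "r *\<^sub>R a"] christoffel_expand[OF assms, of x a]
      by (simp add: algebra_simps scaleR_sum_right)
  qed
  show "linear (\<lambda>x. \<Gamma> c p x y)" for y
  proof (rule linearI)
    fix a b and r :: real
    show "\<Gamma> c p (a + b) y = \<Gamma> c p a y + \<Gamma> c p b y"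
      unfolding christoffel_expand[OF assms, of "a + b" y] christoffel_expand[OF assms, of a y] christoffel_expand[OF assms, of b y]
      by (simp add: algebra_simps sum.distrib)
    show "\<Gamma> c p (r *\<^sub>R a) y = r *\<^sub>R \<Gamma> c p a y"
      unfolding christoffel_expand[OF assms, of "r *\<^sub>R a" y] christoffel_expand[OF assms, of a y]
      by (simp add: algebra_simps scaleR_sum_right)
  qed
qed

lemma connection_chart:
  assumes "c \<in> A" and "open U" "U \<subseteq> cdom c" and "p \<in> U"
    and "vector_field_on A U X" and "vector_field_on A U Y"
  shows "D X Y p c = frechet_derivative (\<lambda>u. Y (cinv c u) c) (at (cmap c p)) (X p c) + \<Gamma> c p (X p c) (Y p c)"
  using connection_chart_expanded[OF assms] christoffel_expand[of c p "X p c" "Y p c"] assms by auto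

lemma smooth_christoffel:
  assumes c: "c \<in> A"
  shows "smooth_on (cmap c ` cdom c) (\<lambda>u. \<Gamma> c (cinv c u) x y)"
proof -
  note C = compatible[OF c]
  note E = vector_field_coord[OF c open_cdom[OF C] order_refl]
  from vector_field_on_chart[OF conn_field[OF open_cdom[OF C] cdom_points[OF C] E E] c open_cdom[OF C]]
  show ?thesis by (auto simp: christoffel_def)
qed

lemma lie_bracket_coord:
  assumes c: "c \<in> A" and p: "p \<in> cdom c"
  shows "lie_bracket A (coord_field A c x) (coord_field A c y) p c = 0"
proof -
  note C = compatible[OF c]
  have "frechet_derivative (\<lambda>u. coord_field A c y (cinv c u) c) (at (cmap c p)) = (\<lambda>v. 0)" for y
  proof -
    have "((\<lambda>u. coord_field A c y (cinv c u) c) has_derivative (\<lambda>v. 0)) (at (cmap c p))"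
      by (rule has_derivative_transform_within_open[OF has_derivative_const[of y] open_cmap_cdom[OF C]])
        (use p cinv_cmap[OF C] c in \<open>auto simp: coord_field_same\<close>)
    then show ?thesis using frechet_derivative_at by metis
  qed
  then show ?thesis using c p by (simp add: lie_bracket_def)
qed

text \<open>
  Absence of torsion, because coordinate fields commute.
\<close>

lemma christoffel_symmetric:
  assumes c: "c \<in> A" and p: "p \<in> cdom c"
  shows "\<Gamma> c p x y = \<Gamma> c p y x"
proof -
  note C = compatible[OF c]
  note E = vector_field_coord[OF c open_cdom[OF C] order_refl]
  have "(D (coord_field A c x) (coord_field A c y) p - D (coord_field A c y) (coord_field A c x) p) c = 0"
    unfolding torsion_free[OF open_cdom[OF C] cdom_points[OF C] E E p] by (rule lie_bracket_coord[OF c p])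
  then show ?thesis by (simp add: christoffel_def)
qed

end

section \<open>Curvature in a chart\<close>

text \<open>
  The classical expression \<open>\<partial>\<Gamma> - \<partial>\<Gamma> + \<Gamma>\<Gamma> - \<Gamma>\<Gamma>\<close> for \<open>R(x, y) z\<close> at the coordinate point \<open>u\<close>.
\<close>

definition local_curv :: "(real ^ 'n \<Rightarrow> real ^ 'n \<Rightarrow> real ^ 'n \<Rightarrow> real ^ 'n) \<Rightarrow> real ^ 'n
    \<Rightarrow> real ^ 'n \<Rightarrow> real ^ 'n \<Rightarrow> real ^ 'n \<Rightarrow> real ^ 'n" where
  "local_curv G u x y z = frechet_derivative (\<lambda>u. G u y z) (at u) x - frechet_derivative (\<lambda>u. G u x z) (at u) y
     + G u x (G u y z) - G u y (G u x z)"

lemma bilinear_field_has_derivative_at: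
  fixes B :: "'d::euclidean_space \<Rightarrow> 'a::euclidean_space \<Rightarrow> 'b::euclidean_space \<Rightarrow> 'c::real_normed_vector"
  assumes S: "open S" and bil: "\<And>p. p \<in> S \<Longrightarrow> bilinear (B p)" and x: "x \<in> S"
    and B: "\<And>a b. smooth_on S (\<lambda>p. B p a b)"
    and f: "(f has_derivative f') (at x)" and g: "(g has_derivative g') (at x)"
  shows "((\<lambda>p. B p (f p) (g p)) has_derivative
    (\<lambda>v. frechet_derivative (\<lambda>p. B p (f x) (g x)) (at x) v + B x (f' v) (g x) + B x (f x) (g' v))) (at x)"
proof -
  note * = bilinear_field_has_derivative[OF fully_approachable_open[OF S] bil x, where
      B' = "\<lambda>a b. frechet_derivative (\<lambda>p. B p a b) (at x)" and f = f and f' = f' and g = g and g' = g', unfolded at_within_open[OF x S]]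
  show ?thesis by (rule *[OF _ _ f g]) (use smooth_on_open_has_derivative[OF S B x] in auto)
qed

lemma smooth_on_linear_field:
  fixes L :: "'d::euclidean_space \<Rightarrow> 'a::euclidean_space \<Rightarrow> 'b::euclidean_space"
  assumes S: "fully_approachable S" and lin: "\<And>p. p \<in> S \<Longrightarrow> linear (L p)"
    and L: "\<And>a. smooth_on S (\<lambda>p. L p a)" and f: "smooth_on S f"
  shows "smooth_on S (\<lambda>p. L p (f p))"
proof -
  have "smooth_on S (\<lambda>p. (\<lambda>a b. b *\<^sub>R L p a) (f p) (1::real))"
  proof (rule smooth_on_bilinear_field[OF S, where B = "\<lambda>p a b. b *\<^sub>R L p a" and f = f and g = "\<lambda>p. 1"])
    show "bilinear (\<lambda>a (b::real). b *\<^sub>R L p a)" if "p \<in> S" for p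
      unfolding bilinear_def
    proof safe
      interpret linear "L p" by (rule lin[OF that])
      show "linear (\<lambda>b. b *\<^sub>R L p a)" for a by (rule linearI) (simp_all add: algebra_simps)
      show "linear (\<lambda>a. b *\<^sub>R L p a)" for b by (rule linearI) (simp_all add: add scale algebra_simps)
    qed
    show "smooth_on S (\<lambda>p. b *\<^sub>R L p a)" for a and b :: real
      by (rule smooth_on_scaleR[OF S smooth_on_const[OF S] L])
  qed (rule f smooth_on_const[OF S])+
  then show ?thesis by simp
qed

lemma linear_field_has_derivative_at:
  fixes L :: "'d::euclidean_space \<Rightarrow> 'a::euclidean_space \<Rightarrow> 'b::real_normed_vector"
  assumes S: "open S" and lin: "\<And>p. p \<in> S \<Longrightarrow> linear (L p)" and x: "x \<in> S"
    and L: "\<And>a. smooth_on S (\<lambda>p. L p a)" and f: "(f has_derivative f') (at x)"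
  shows "((\<lambda>p. L p (f p)) has_derivative
    (\<lambda>v. frechet_derivative (\<lambda>p. L p (f x)) (at x) v + L x (f' v))) (at x)"
proof -
  have "((\<lambda>p. (\<lambda>a b. b *\<^sub>R L p a) (f p) (1::real)) has_derivative
    (\<lambda>v. frechet_derivative (\<lambda>p. (\<lambda>a b. b *\<^sub>R L p a) (f x) (1::real)) (at x) v
       + (1::real) *\<^sub>R L x (f' v) + (0::real) *\<^sub>R L x (f x))) (at x)"
  proof (rule bilinear_field_has_derivative_at[OF S _ x _ f has_derivative_const])
    show "bilinear (\<lambda>a (b::real). b *\<^sub>R L p a)" if "p \<in> S" for p
      unfolding bilinear_def
    proof safe
      interpret linear "L p" by (rule lin[OF that])
      show "linear (\<lambda>b. b *\<^sub>R L p a)" for a by (rule linearI) (simp_all add: algebra_simps)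
      show "linear (\<lambda>a. b *\<^sub>R L p a)" for b by (rule linearI) (simp_all add: add scale algebra_simps)
    qed
    show "smooth_on S (\<lambda>p. b *\<^sub>R L p a)" for a and b :: real
      by (rule smooth_on_scaleR[OF fully_approachable_open[OF S] smooth_on_const[OF fully_approachable_open[OF S]] L])
  qed
  then show ?thesis by simp
qed

lemma frechet_derivative_eqI: "(f has_derivative f') (at x) \<Longrightarrow> frechet_derivative f (at x) v = f' v"
  using frechet_derivative_at by metis

context
  fixes \<Omega> :: "(real ^ 'n) set" and \<Gamma> :: "real ^ 'n \<Rightarrow> real ^ 'n \<Rightarrow> real ^ 'n \<Rightarrow> real ^ 'n"
  assumes \<Omega>: "open \<Omega>" and bil: "\<And>u. u \<in> \<Omega> \<Longrightarrow> bilinear (\<Gamma> u)"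
    and sm: "\<And>x y. smooth_on \<Omega> (\<lambda>u. \<Gamma> u x y)"
begin

text \<open>
  Tensoriality of the curvature. \<open>N\<close> is the covariant derivative in coordinates; in its commutator the first
  derivatives of \<open>Z\<close> cancel against the bracket term, and the second derivatives cancel by symmetry.
\<close>

lemma local_curv_commutator:
  assumes u: "u \<in> \<Omega>" and X: "smooth_on \<Omega> X" and Y: "smooth_on \<Omega> Y" and Z: "smooth_on \<Omega> Z"
  defines "N \<equiv> \<lambda>X Y u. frechet_derivative Y (at u) (X u) + \<Gamma> u (X u) (Y u)"
  shows "N X (N Y Z) u - N Y (N X Z) u
    - N (\<lambda>u. frechet_derivative Y (at u) (X u) - frechet_derivative X (at u) (Y u)) Z u
    = local_curv \<Gamma> u (X u) (Y u) (Z u)"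
proof -
  note hd = smooth_on_open_has_derivative[OF \<Omega> _ u]
  have lin: "linear (frechet_derivative Z (at p))" if "p \<in> \<Omega>" for p
    using smooth_on_open_has_derivative[OF \<Omega> Z that] has_derivative_linear by blast
  have *: "frechet_derivative (N V Z) (at u) w =
      frechet_derivative (\<lambda>p. frechet_derivative Z (at p) (V u)) (at u) w
      + frechet_derivative Z (at u) (frechet_derivative V (at u) w)
      + (frechet_derivative (\<lambda>p. \<Gamma> p (V u) (Z u)) (at u) w + \<Gamma> u (frechet_derivative V (at u) w) (Z u)
      + \<Gamma> u (V u) (frechet_derivative Z (at u) w))" if V: "smooth_on \<Omega> V" for V w
    unfolding N_def
    by (rule frechet_derivative_eqI, rule has_derivative_add
        [OF linear_field_has_derivative_at[OF \<Omega> lin u smooth_on_open_frechet_derivative[OF \<Omega> Z] hd[OF V]]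
          bilinear_field_has_derivative_at[OF \<Omega> bil u sm hd[OF V] hd[OF Z]]])
  interpret Z': linear "frechet_derivative Z (at u)" by (rule lin[OF u])
  note b = bil[OF u]
  have "N X (N Y Z) u = frechet_derivative (\<lambda>p. frechet_derivative Z (at p) (Y u)) (at u) (X u)
      + frechet_derivative Z (at u) (frechet_derivative Y (at u) (X u))
      + (frechet_derivative (\<lambda>p. \<Gamma> p (Y u) (Z u)) (at u) (X u) + \<Gamma> u (frechet_derivative Y (at u) (X u)) (Z u)
      + \<Gamma> u (Y u) (frechet_derivative Z (at u) (X u)))
      + \<Gamma> u (X u) (frechet_derivative Z (at u) (Y u) + \<Gamma> u (Y u) (Z u))"
    unfolding *[OF Y, symmetric] by (simp only: N_def)
  moreover have "N Y (N X Z) u = frechet_derivative (\<lambda>p. frechet_derivative Z (at p) (X u)) (at u) (Y u)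
      + frechet_derivative Z (at u) (frechet_derivative X (at u) (Y u))
      + (frechet_derivative (\<lambda>p. \<Gamma> p (X u) (Z u)) (at u) (Y u) + \<Gamma> u (frechet_derivative X (at u) (Y u)) (Z u)
      + \<Gamma> u (X u) (frechet_derivative Z (at u) (Y u)))
      + \<Gamma> u (Y u) (frechet_derivative Z (at u) (X u) + \<Gamma> u (X u) (Z u))"
    unfolding *[OF X, symmetric] by (simp only: N_def)
  ultimately show ?thesis
    unfolding local_curv_def second_derivative_symmetric[OF \<Omega> u Z, of "Y u" "X u"]
    by (simp add: N_def Z'.diff bilinear_radd[OF b] bilinear_lsub[OF b])
qed

text \<open>
  The change of the connection from \<open>\<nabla>\<close> to \<open>\<nabla>\<^sup>f\<close> changes the curvature by the tensor \<open>H = Hess f + df \<otimes> df\<close>: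
  the terms that involve the derivative of \<open>df\<close> in antisymmetric combination vanish because second derivatives
  commute.
\<close>

lemma local_curv_weighted:
  fixes f :: "real ^ 'n \<Rightarrow> real"
  assumes sym: "\<And>u x y. u \<in> \<Omega> \<Longrightarrow> \<Gamma> u x y = \<Gamma> u y x" and u: "u \<in> \<Omega>" and f: "smooth_on \<Omega> f"
  defines "a \<equiv> \<lambda>u. frechet_derivative f (at u)"
  defines "H \<equiv> \<lambda>y z. frechet_derivative (\<lambda>u. a u z) (at u) y - a u (\<Gamma> u y z) + a u y * a u z"
  shows "local_curv (\<lambda>u x y. \<Gamma> u x y - a u x *\<^sub>R y - a u y *\<^sub>R x) u x y z
    = local_curv \<Gamma> u x y z + H y z *\<^sub>R x - H x z *\<^sub>R y"
proof -
  have lin: "linear (a u)"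
    using smooth_on_open_has_derivative[OF \<Omega> f u] has_derivative_linear unfolding a_def by blast
  have sma: "smooth_on \<Omega> (\<lambda>u. a u v)" for v
    unfolding a_def by (rule smooth_on_open_frechet_derivative[OF \<Omega> f])
  note da = smooth_on_open_has_derivative[OF \<Omega> sma u]
  note d\<Gamma> = smooth_on_open_has_derivative[OF \<Omega> sm u]
  have d: "frechet_derivative (\<lambda>u. \<Gamma> u y z - a u y *\<^sub>R z - a u z *\<^sub>R y) (at u) x
      = frechet_derivative (\<lambda>u. \<Gamma> u y z) (at u) x - frechet_derivative (\<lambda>u. a u y) (at u) x *\<^sub>R z
        - frechet_derivative (\<lambda>u. a u z) (at u) x *\<^sub>R y" for x y z
    by (rule frechet_derivative_eqI) (intro has_derivative_diff has_derivative_scaleR_left d\<Gamma> da)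
  have s: "frechet_derivative (\<lambda>u. a u x) (at u) y = frechet_derivative (\<lambda>u. a u y) (at u) x" for x y
    unfolding a_def by (rule second_derivative_symmetric[OF \<Omega> u f])
  note b = bil[OF u]
  have g: "\<Gamma> u y x = \<Gamma> u x y" by (rule sym[OF u])
  show ?thesis
    unfolding local_curv_def d s[of x y] H_def
    by (simp add: bilinear_rsub[OF b] bilinear_radd[OF b] bilinear_rmul[OF b] g
        linear_diff[OF lin] linear_add[OF lin] linear_scale[OF lin] algebra_simps,
        simp add: vec_eq_iff algebra_simps)
qed

text \<open>
  The classical derivation of the pair symmetry of the Riemann tensor: antisymmetry in the last two arguments
  comes from differentiating twice the equation \<open>\<nabla>G = 0\<close>, and together with antisymmetry in the first two
  arguments and the first Bianchi identity it yields the symmetry under exchange of the pairs.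
\<close>

lemma jacobi_operator_symmetric_local:
  fixes G :: "real ^ 'n \<Rightarrow> real ^ 'n \<Rightarrow> real ^ 'n \<Rightarrow> real"
  assumes sym: "\<And>u x y. u \<in> \<Omega> \<Longrightarrow> \<Gamma> u x y = \<Gamma> u y x" and u: "u \<in> \<Omega>"
    and G: "\<And>u. u \<in> \<Omega> \<Longrightarrow> bilinear (G u)" "\<And>u x y. u \<in> \<Omega> \<Longrightarrow> G u x y = G u y x"
      "\<And>x y. smooth_on \<Omega> (\<lambda>u. G u x y)"
    and par: "\<And>u x y z. u \<in> \<Omega> \<Longrightarrow> frechet_derivative (\<lambda>u. G u x y) (at u) z = G u (\<Gamma> u z x) y + G u x (\<Gamma> u z y)"
  shows "G u (local_curv \<Gamma> u x w w) y = G u (local_curv \<Gamma> u y w w) x"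
proof -
  note b = bil[OF u] and Gb = G(1)[OF u]
  note d\<Gamma> = smooth_on_open_has_derivative[OF \<Omega> sm u]
  have dd: "frechet_derivative (\<lambda>u. frechet_derivative (\<lambda>u. G u z w) (at u) y) (at u) x =
      G u (\<Gamma> u x (\<Gamma> u y z)) w + G u (\<Gamma> u y z) (\<Gamma> u x w) + G u (frechet_derivative (\<lambda>u. \<Gamma> u y z) (at u) x) w
      + (G u (\<Gamma> u x z) (\<Gamma> u y w) + G u z (\<Gamma> u x (\<Gamma> u y w)) + G u z (frechet_derivative (\<lambda>u. \<Gamma> u y w) (at u) x))" for x y z w
  proof (rule frechet_derivative_eqI)
    have 1: "((\<lambda>u. G u (\<Gamma> u y z) w) has_derivative (\<lambda>v. frechet_derivative (\<lambda>p. G p (\<Gamma> u y z) w) (at u) v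
        + G u (frechet_derivative (\<lambda>u. \<Gamma> u y z) (at u) v) w + G u (\<Gamma> u y z) 0)) (at u)"
      by (rule bilinear_field_has_derivative_at[OF \<Omega> G(1) u G(3) d\<Gamma> has_derivative_const])
    have 2: "((\<lambda>u. G u z (\<Gamma> u y w)) has_derivative (\<lambda>v. frechet_derivative (\<lambda>p. G p z (\<Gamma> u y w)) (at u) v
        + G u 0 (\<Gamma> u y w) + G u z (frechet_derivative (\<lambda>u. \<Gamma> u y w) (at u) v))) (at u)"
      by (rule bilinear_field_has_derivative_at[OF \<Omega> G(1) u G(3) has_derivative_const d\<Gamma>])
    show "((\<lambda>u. frechet_derivative (\<lambda>u. G u z w) (at u) y) has_derivative (\<lambda>x. G u (\<Gamma> u x (\<Gamma> u y z)) w + G u (\<Gamma> u y z) (\<Gamma> u x w)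
      + G u (frechet_derivative (\<lambda>u. \<Gamma> u y z) (at u) x) w
      + (G u (\<Gamma> u x z) (\<Gamma> u y w) + G u z (\<Gamma> u x (\<Gamma> u y w)) + G u z (frechet_derivative (\<lambda>u. \<Gamma> u y w) (at u) x)))) (at u)"
      by (rule has_derivative_transform_within_open[OF _ \<Omega> u par[symmetric]])
        (use has_derivative_add[OF 1 2] in \<open>simp add: par[OF u] bilinear_rzero[OF Gb] bilinear_lzero[OF Gb]\<close>)
  qed
  define R where "R x y z w = G u (local_curv \<Gamma> u x y z) w" for x y z w
  have skew12: "R x y z w = - R y x z w" for x y z w
    unfolding R_def local_curv_def by (simp add: bilinear_lsub[OF Gb] bilinear_ladd[OF Gb])
  \<comment> \<open>The second derivative \<open>dd\<close> of \<open>G(z, w)\<close> is symmetric in the directions \<open>x\<close> and \<open>y\<close>.\<close>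
  have skew34: "R x y z w = - R x y w z" for x y z w
  proof -
    have "frechet_derivative (\<lambda>u. frechet_derivative (\<lambda>u. G u z w) (at u) y) (at u) x
        = frechet_derivative (\<lambda>u. frechet_derivative (\<lambda>u. G u z w) (at u) x) (at u) y"
      by (rule second_derivative_symmetric[OF \<Omega> u G(3)])
    then show ?thesis
      unfolding dd R_def local_curv_def G(2)[OF u, of _ z]
      by (simp add: bilinear_lsub[OF Gb] bilinear_ladd[OF Gb] bilinear_rsub[OF Gb] bilinear_radd[OF Gb])
  qed
  have ds: "frechet_derivative (\<lambda>u. \<Gamma> u y z) (at u) x = frechet_derivative (\<lambda>u. \<Gamma> u z y) (at u) x" for x y z
    by (rule frechet_derivative_eqI, rule has_derivative_transform_within_open[OF d\<Gamma> \<Omega> u])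
      (rule sym)
  have bianchi: "R x y z w + R y z x w + R z x y w = 0" for x y z w
    unfolding R_def local_curv_def
    by (simp add: bilinear_lsub[OF Gb] bilinear_ladd[OF Gb] sym[OF u, of y z] sym[OF u, of x z] sym[OF u, of x y]
        ds[of y z] ds[of x z] ds[of x y])
  show ?thesis
    using bianchi[of x w w y] bianchi[of w y x w] bianchi[of y w w x] bianchi[of x y w w]
      skew12 skew34 unfolding R_def[symmetric] by smt
qed

end

context riemannian begin

lemma bracket_field:
  assumes c: "c \<in> A" and U: "open U" "U \<subseteq> cdom c" and X: "vector_field_on A U X" and Y: "vector_field_on A U Y"
  shows "vector_field_on A U (lie_bracket A X Y)"
proof -
  note C = compatible[OF c]
  have UP: "U \<subseteq> points A" using U c by (auto simp: points_def)
  have eq: "lie_bracket A X Y p = D X Y p - D Y X p" if "p \<in> U" for p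
    using torsion_free[OF U(1) UP X Y that] by simp
  note XY = conn_field[OF U(1) UP X Y] and YX = conn_field[OF U(1) UP Y X]
  have f: "fully_approachable (cmap c ` U)"
    by (rule fully_approachable_open[OF open_cmap_image[OF C U]])
  show ?thesis
  proof (rule vector_field_onI[OF c U])
    show "lie_bracket A X Y p \<in> tangent_space A p" if "p \<in> U" for p
      unfolding eq[OF that] using vector_field_on_tangent[OF XY that] vector_field_on_tangent[OF YX that] by (rule tangent_diff)
    have s: "smooth_on (cmap c ` U) (\<lambda>u. D X Y (cinv c u) c)" "smooth_on (cmap c ` U) (\<lambda>u. D Y X (cinv c u) c)"
      by (rule vector_field_on_chart[OF XY c U(1)], use U in auto)
         (rule vector_field_on_chart[OF YX c U(1)], use U in auto)
    show "smooth_on (cmap c ` U) (\<lambda>u. lie_bracket A X Y (cinv c u) c)"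
      by (rule smooth_on_cong[OF f smooth_on_add[OF f s(1) smooth_on_scaleR[OF f smooth_on_const[OF f, of "-1"] s(2)]]])
        (use U cinv_cmap[OF C] in \<open>auto simp: eq subset_iff\<close>)
  qed
qed

end

text \<open>
  A connection given in charts by coefficients \<open>\<Theta>\<close>. The curvature formula is needed for two connections on the
  same manifold, the Levi-Civita connection and the weighted one, and only this description of them enters.
\<close>

locale chart_connection = riemannian A g D
  for A :: "('m::{t2_space,second_countable_topology}, 'n::finite) chart set" and g D +
  fixes C :: "('m, 'n) connection" and \<Theta> :: "('m, 'n) chart \<Rightarrow> 'm \<Rightarrow> real ^ 'n \<Rightarrow> real ^ 'n \<Rightarrow> real ^ 'n"
  assumes C_field: "c \<in> A \<Longrightarrow> open U \<Longrightarrow> U \<subseteq> cdom c \<Longrightarrow> vector_field_on A U X \<Longrightarrow> vector_field_on A U Y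
      \<Longrightarrow> vector_field_on A U (C X Y)"
    and C_chart: "c \<in> A \<Longrightarrow> open U \<Longrightarrow> U \<subseteq> cdom c \<Longrightarrow> p \<in> U \<Longrightarrow> vector_field_on A U X \<Longrightarrow> vector_field_on A U Y
      \<Longrightarrow> C X Y p c = frechet_derivative (\<lambda>u. Y (cinv c u) c) (at (cmap c p)) (X p c) + \<Theta> c p (X p c) (Y p c)"
    and \<Theta>_bilinear: "c \<in> A \<Longrightarrow> p \<in> cdom c \<Longrightarrow> bilinear (\<Theta> c p)"
    and \<Theta>_smooth: "c \<in> A \<Longrightarrow> smooth_on (cmap c ` cdom c) (\<lambda>u. \<Theta> c (cinv c u) x y)"
begin

lemma curvature_chart:
  assumes c: "c \<in> A" and U: "open U" "U \<subseteq> cdom c" and p: "p \<in> U"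
    and X: "vector_field_on A U X" and Y: "vector_field_on A U Y" and Z: "vector_field_on A U Z"
  shows "curvature A C X Y Z p c = local_curv (\<lambda>u. \<Theta> c (cinv c u)) (cmap c p) (X p c) (Y p c) (Z p c)"
proof -
  note K = compatible[OF c]
  let ?\<Omega> = "cmap c ` U" and ?X = "\<lambda>u. X (cinv c u) c" and ?Y = "\<lambda>u. Y (cinv c u) c" and ?Z = "\<lambda>u. Z (cinv c u) c"
  have \<Omega>: "open ?\<Omega>" by (rule open_cmap_image[OF K U])
  have pc: "p \<in> cdom c" using p U by auto
  note inv = cinv_cmap[OF K pc]
  have u: "cmap c p \<in> ?\<Omega>" using p by simp
  have inU: "cinv c u \<in> U" "cmap c (cinv c u) = u" if "u \<in> ?\<Omega>" for u
    using that U cinv_cmap[OF K] by auto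
  define N where "N X Y u = frechet_derivative Y (at u) (X u) + \<Theta> c (cinv c u) (X u) (Y u)"
    for X Y :: "real^'n \<Rightarrow> real^'n" and u
  have CN: "C V W (cinv c u) c = N (\<lambda>u. V (cinv c u) c) (\<lambda>u. W (cinv c u) c) u"
    if "vector_field_on A U V" "vector_field_on A U W" "u \<in> ?\<Omega>" for V W u
    using C_chart[OF c U inU(1)[OF that(3)] that(1,2)] inU(2)[OF that(3)] by (simp add: N_def)
  \<comment> \<open>Iterated covariant derivatives: \<open>N\<close> depends on its second argument only through the germ, so
    the coordinate expression may be substituted under the derivative.\<close>
  have NN: "N V W u = N V W' u" if "u \<in> ?\<Omega>" "\<And>u. u \<in> ?\<Omega> \<Longrightarrow> W u = W' u" "W differentiable at u" for V W W' u
  proof -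
    have "(W' has_derivative frechet_derivative W (at u)) (at u)"
      by (rule has_derivative_transform_within_open[OF _ \<Omega> that(1,2)])
        (use that(3) in \<open>simp add: frechet_derivative_works\<close>)
    then have "frechet_derivative W' (at u) = frechet_derivative W (at u)"
      using frechet_derivative_at by metis
    then show ?thesis using that by (simp add: N_def)
  qed
  have sm: "smooth_on ?\<Omega> (\<lambda>u. V (cinv c u) c)" if "vector_field_on A U V" for V
    by (rule vector_field_on_chart[OF that c U(1)]) (use U in auto)
  have diff: "(\<lambda>u. V (cinv c u) c) differentiable at (cmap c p)" if "vector_field_on A U V" for V
    using smooth_on_open_has_derivative[OF \<Omega> sm[OF that] u] by (auto simp: differentiable_def)
  have CC: "C V (C W Z) p c = N (\<lambda>u. V (cinv c u) c) (N (\<lambda>u. W (cinv c u) c) ?Z) (cmap c p)"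
    if V: "vector_field_on A U V" and W: "vector_field_on A U W" for V W
  proof -
    note WZ = C_field[OF c U W Z]
    show ?thesis
      using CN[OF V WZ u] NN[OF u CN[OF W Z] diff[OF WZ], of "\<lambda>u. V (cinv c u) c"] by (simp add: inv)
  qed
  have lb: "(\<lambda>u. lie_bracket A X Y (cinv c u) c) u = frechet_derivative ?Y (at u) (?X u) - frechet_derivative ?X (at u) (?Y u)"
    if "u \<in> ?\<Omega>" for u
    using inU[OF that] c U by (auto simp: lie_bracket_def)
  have 3: "C (lie_bracket A X Y) Z p c = N (\<lambda>u. frechet_derivative ?Y (at u) (?X u) - frechet_derivative ?X (at u) (?Y u)) ?Z (cmap c p)"
    using CN[OF bracket_field[OF c U X Y] Z u] lb[OF u] by (simp add: N_def inv)
  have f: "fully_approachable ?\<Omega>" by (rule fully_approachable_open[OF \<Omega>])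
  have "smooth_on ?\<Omega> (\<lambda>u. \<Theta> c (cinv c u) x y)" for x y
    by (rule smooth_on_subset[OF f \<Theta>_smooth[OF c]]) (use U in auto)
  moreover have "bilinear (\<Theta> c (cinv c u))" if "u \<in> ?\<Omega>" for u
    by (rule \<Theta>_bilinear[OF c]) (use inU(1)[OF that] U in auto)
  ultimately show ?thesis
    using local_curv_commutator[OF \<Omega> _ _ u sm[OF X] sm[OF Y] sm[OF Z], of "\<lambda>u. \<Theta> c (cinv c u)"]
    unfolding curvature_def minus_apply CC[OF X Y] CC[OF Y X] 3 N_def by (simp add: inv)
qed

lemma
  assumes c: "c \<in> A" and p: "p \<in> cdom c"
    and t: "x \<in> tangent_space A p" "y \<in> tangent_space A p" "z \<in> tangent_space A p"
  shows curvature_at_chart: "curvature_at A C p x y z c = local_curv (\<lambda>u. \<Theta> c (cinv c u)) (cmap c p) (x c) (y c) (z c)"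
    and curvature_at_tangent: "curvature_at A C p x y z \<in> tangent_space A p"
proof -
  have pp: "p \<in> points A" using p c by (auto simp: points_def)
  let ?d = "chart_at A p"
  note d = chart_at[OF pp] and oc = open_cdom[OF compatible]
  define E where "E v = coord_field A ?d (v ?d)" for v :: "('m,'n) tvec"
  have EU: "vector_field_on A U (E v)" if "open U" "U \<subseteq> cdom ?d" for v U
    unfolding E_def by (rule vector_field_coord[OF d(1) that])
  have Ep: "E v p = v" if "v \<in> tangent_space A p" for v
    unfolding E_def by (rule tangent_coord_field[OF that d])
  have eq: "curvature_at A C p x y z = curvature A C (E x) (E y) (E z) p"
    by (simp add: curvature_at_def E_def Let_def)
  have o: "open (cdom c \<inter> cdom ?d)" by (rule open_overlap(1)[OF c d(1)])
  show "curvature_at A C p x y z c = local_curv (\<lambda>u. \<Theta> c (cinv c u)) (cmap c p) (x c) (y c) (z c)"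
    unfolding eq using curvature_chart[OF c o _ _ EU[OF o] EU[OF o] EU[OF o], of p x y z] p d(2) t by (simp add: Ep)
  note o' = oc[OF d(1)]
  note F = EU[OF o' order_refl] and CF = C_field[OF d(1) o' order_refl]
  show "curvature_at A C p x y z \<in> tangent_space A p"
    unfolding eq curvature_def
    by (intro tangent_diff vector_field_on_tangent[OF CF d(2)] F CF bracket_field[OF d(1) o' order_refl])
qed

end

context riemannian begin

sublocale levi: chart_connection A g D D \<Gamma>
proof
  fix c U X Y and p :: 'm assume *: "c \<in> A" "open U" "U \<subseteq> cdom c" "vector_field_on A U X" "vector_field_on A U Y"
  then have "U \<subseteq> points A" by (auto simp: points_def)
  with * show "vector_field_on A U (D X Y)" by (intro conn_field)
  show "p \<in> U \<Longrightarrow> D X Y p c = frechet_derivative (\<lambda>u. Y (cinv c u) c) (at (cmap c p)) (X p c) + \<Gamma> c p (X p c) (Y p c)"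
    using connection_chart[OF *(1-3) _ *(4,5)] .
qed (simp_all add: bilinear_christoffel smooth_christoffel)

end

section \<open>The metric in a chart\<close>

context riemannian begin

lemma
  assumes p: "p \<in> points A" and t: "u \<in> tangent_space A p" "v \<in> tangent_space A p"
  shows g_sym: "g p u v = g p v u"
    and g_pos: "u \<noteq> 0 \<Longrightarrow> g p u u > 0"
    and g_scale_left: "g p (tscale a u) v = a * g p u v"
    and g_add_left: "w \<in> tangent_space A p \<Longrightarrow> g p (u + w) v = g p u v + g p w v"
    and g_scale_right: "g p u (tscale a v) = a * g p u v"
    and g_add_right: "w \<in> tangent_space A p \<Longrightarrow> g p u (v + w) = g p u v + g p u w"
proof -
  have *: "g p u v = g p v u \<and> (u \<noteq> 0 \<longrightarrow> g p u u > 0) \<and> (\<forall>a. g p (tscale a u) v = a * g p u v) \<and>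
        (\<forall>w\<in>tangent_space A p. g p (u + w) v = g p u v + g p w v)"
    if "u \<in> tangent_space A p" "v \<in> tangent_space A p" for u v
    using metric that p unfolding riemannian_metric_def by blast
  show "g p u v = g p v u" "u \<noteq> 0 \<Longrightarrow> g p u u > 0" "g p (tscale a u) v = a * g p u v"
    "w \<in> tangent_space A p \<Longrightarrow> g p (u + w) v = g p u v + g p w v"
    using *[OF t] by auto
  show "g p u (tscale a v) = a * g p u v"
    using *[OF t(2,1)] *[OF t(1) tangent_scale[OF t(2)]] by auto
  show "g p u (v + w) = g p u v + g p u w" if w: "w \<in> tangent_space A p"
    using *[OF t(2,1)] *[OF t(1) tangent_add[OF t(2) w]] *[OF t(1) w] w by auto
qed

lemma metric_smooth:
  assumes "open U" "U \<subseteq> points A" "vector_field_on A U X" "vector_field_on A U Y"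
  shows "smooth_fun_on A U (\<lambda>p. g p (X p) (Y p))"
  using conjunct2[OF metric[unfolded riemannian_metric_def]] assms by blast

text \<open>
  The matrix of the metric in the chart \<open>c\<close>, as a bilinear form.
\<close>

definition gc :: "('m, 'n) chart \<Rightarrow> 'm \<Rightarrow> real ^ 'n \<Rightarrow> real ^ 'n \<Rightarrow> real" where
  "gc c p x y = g p (coord_field A c x p) (coord_field A c y p)"

context
  fixes c and p assumes c: "c \<in> A" and p: "p \<in> cdom c"
begin

private lemma pp: "p \<in> points A" using c p by (auto simp: points_def)
private lemmas E = coord_field_in_tangent_space[OF c p]

lemma coord_field_add: "coord_field A c (x + y) p = coord_field A c x p + coord_field A c y p"
  by (rule tangent_eqI[OF E tangent_add[OF E E] c p]) (simp add: coord_field_same[OF c p])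

lemma coord_field_scale: "coord_field A c (r *\<^sub>R x) p = tscale r (coord_field A c x p)"
  by (rule tangent_eqI[OF E tangent_scale[OF E] c p]) (simp add: coord_field_same[OF c p] tscale_def)

lemma gc_sym: "gc c p x y = gc c p y x"
  unfolding gc_def by (rule g_sym[OF pp E E])

lemma bilinear_gc: "bilinear (gc c p)"
  unfolding bilinear_def
proof safe
  show "linear (gc c p x)" for x
    by (rule linearI)
      (simp_all add: gc_def coord_field_add coord_field_scale g_add_right[OF pp E E E] g_scale_right[OF pp E E])
  show "linear (\<lambda>x. gc c p x y)" for y
    by (rule linearI)
      (simp_all add: gc_def coord_field_add coord_field_scale g_add_left[OF pp E E E] g_scale_left[OF pp E E])
qed

lemma gc_pos: "x \<noteq> 0 \<Longrightarrow> gc c p x x > 0"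
  unfolding gc_def using coord_field_same[OF c p, of x] by (intro g_pos[OF pp E E]) auto

lemma g_chart:
  assumes u: "u \<in> tangent_space A p" and v: "v \<in> tangent_space A p"
  shows "g p u v = gc c p (u c) (v c)"
proof -
  have "coord_field A c (u c) p = u" by (rule tangent_coord_field[OF u c p])
  moreover have "coord_field A c (v c) p = v" by (rule tangent_coord_field[OF v c p])
  ultimately show ?thesis by (simp only: gc_def)
qed

end

lemma smooth_gc:
  assumes c: "c \<in> A"
  shows "smooth_on (cmap c ` cdom c) (\<lambda>u. gc c (cinv c u) x y)"
proof -
  note C = compatible[OF c]
  note E = vector_field_coord[OF c open_cdom[OF C] order_refl]
  have "smooth_fun_on A (cdom c) (\<lambda>p. gc c p x y)"
    unfolding gc_def by (rule metric_smooth[OF open_cdom[OF C] cdom_points[OF C] E E])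
  from smooth_fun_on_chart[OF this c open_cdom[OF C]] show ?thesis by simp
qed

text \<open>
  Compatibility of the connection with the metric, for coordinate fields: in coordinates the metric is parallel.
\<close>

lemma gc_derivative:
  assumes c: "c \<in> A" and p: "p \<in> cdom c"
  shows "frechet_derivative (\<lambda>u. gc c (cinv c u) x y) (at (cmap c p)) z = gc c p (\<Gamma> c p z x) y + gc c p x (\<Gamma> c p z y)"
proof -
  note C = compatible[OF c]
  note o = open_cdom[OF C] and UP = cdom_points[OF C]
  note E = vector_field_coord[OF c o order_refl]
  note T = coord_field_in_tangent_space[OF c p]
  have s: "smooth_fun_on A (cdom c) (\<lambda>q. g q (coord_field A c x q) (coord_field A c y q))"
    by (rule metric_smooth[OF o UP E E])
  have DT: "D (coord_field A c z) (coord_field A c x) p \<in> tangent_space A p" for x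
    by (rule vector_field_on_tangent[OF conn_field[OF o UP E E] p])
  have "frechet_derivative (\<lambda>u. gc c (cinv c u) x y) (at (cmap c p)) z
      = dfun A (\<lambda>q. g q (coord_field A c x q) (coord_field A c y q)) p (coord_field A c z p)"
    unfolding dfun_chart[OF s o p p c T] by (simp add: gc_def o_def coord_field_same[OF c p])
  also have "\<dots> = g p (D (coord_field A c z) (coord_field A c x) p) (coord_field A c y p)
     + g p (coord_field A c x p) (D (coord_field A c z) (coord_field A c y) p)"
    by (rule metric_compatible[OF o UP E E E p])
  also have "\<dots> = gc c p (\<Gamma> c p z x) y + gc c p x (\<Gamma> c p z y)"
    unfolding g_chart[OF c p DT T] g_chart[OF c p T DT] by (simp add: christoffel_def coord_field_same[OF c p])
  finally show ?thesis .
qed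

text \<open>
  This makes the coefficient matrix of the Jacobi equation symmetric, which is why Wronskians of Jacobi fields
  are constant.
\<close>

lemma jacobi_operator_symmetric:
  assumes p: "p \<in> points A" and t: "x \<in> tangent_space A p" "y \<in> tangent_space A p" "w \<in> tangent_space A p"
  shows "g p (curvature_at A D p x w w) y = g p (curvature_at A D p y w w) x"
proof -
  obtain c where c: "c \<in> A" and pc: "p \<in> cdom c" using p by (rule pointsE)
  note C = compatible[OF c]
  have inv: "cinv c u \<in> cdom c" "cmap c (cinv c u) = u" if "u \<in> cmap c ` cdom c" for u
    using that cinv_in[OF C] cmap_cinv[OF C] by auto
  have der: "frechet_derivative (\<lambda>u. gc c (cinv c u) x y) (at u) z
      = gc c (cinv c u) (\<Gamma> c (cinv c u) z x) y + gc c (cinv c u) x (\<Gamma> c (cinv c u) z y)"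
    if "u \<in> cmap c ` cdom c" for u x y z
    using gc_derivative[OF c inv(1)[OF that], of x y z] inv(2)[OF that] by simp
  have u: "cmap c p \<in> cmap c ` cdom c" using pc by simp
  note * = jacobi_operator_symmetric_local[where \<Gamma> = "\<lambda>u. \<Gamma> c (cinv c u)" and G = "\<lambda>u. gc c (cinv c u)",
      OF open_cmap_cdom[OF C] bilinear_christoffel[OF c inv(1)] smooth_christoffel[OF c]
      christoffel_symmetric[OF c inv(1)] u bilinear_gc[OF c inv(1)] gc_sym[OF c inv(1)] smooth_gc[OF c] der]
  show ?thesis
    unfolding g_chart[OF c pc levi.curvature_at_tangent[OF c pc t(1,3,3)] t(2)]
      g_chart[OF c pc levi.curvature_at_tangent[OF c pc t(2,3,3)] t(1)]
      levi.curvature_at_chart[OF c pc t(1,3,3)] levi.curvature_at_chart[OF c pc t(2,3,3)]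
    using * cinv_cmap[OF C pc] by simp
qed

end

section \<open>The weighted connection\<close>

lemma frechet_derivative_cong_open:
  assumes "open S" "x \<in> S" "\<And>u. u \<in> S \<Longrightarrow> F u = G u" "smooth_on S F"
  shows "frechet_derivative F (at x) = frechet_derivative G (at x)"
proof -
  have "(G has_derivative frechet_derivative F (at x)) (at x)"
    by (rule has_derivative_transform_within_open[OF smooth_on_open_has_derivative[OF assms(1,4,2)] assms(1-3)])
  then show ?thesis using frechet_derivative_at by metis
qed

locale density = riemannian A g D
  for A :: "('m::{t2_space,second_countable_topology}, 'n::finite) chart set" and g D +
  fixes \<phi> :: "'m \<Rightarrow> real"
  assumes \<phi>_smooth: "smooth_fun_on A (points A) \<phi>"
begin

definition d\<phi> :: "('m, 'n) chart \<Rightarrow> 'm \<Rightarrow> real ^ 'n \<Rightarrow> real" where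
  "d\<phi> c p = frechet_derivative (\<lambda>u. \<phi> (cinv c u)) (at (cmap c p))"

lemma \<phi>_chart:
  assumes c: "c \<in> A"
  shows "smooth_on (cmap c ` cdom c) (\<lambda>u. \<phi> (cinv c u))"
  by (rule smooth_fun_on_chart[OF \<phi>_smooth c open_cdom[OF compatible[OF c]]])
    (use cdom_points[OF compatible[OF c]] in auto)

lemma \<phi>_has_derivative:
  assumes "c \<in> A" "p \<in> cdom c"
  shows "((\<lambda>u. \<phi> (cinv c u)) has_derivative d\<phi> c p) (at (cmap c p))"
  unfolding d\<phi>_def
  by (rule smooth_on_open_has_derivative[OF open_cmap_cdom[OF compatible[OF assms(1)]] \<phi>_chart[OF assms(1)]])
    (use assms in auto)

lemma linear_d\<phi>: "c \<in> A \<Longrightarrow> p \<in> cdom c \<Longrightarrow> linear (d\<phi> c p)"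
  using \<phi>_has_derivative has_derivative_linear by blast

lemma dfun_\<phi>:
  assumes "c \<in> A" "p \<in> cdom c" "v \<in> tangent_space A p"
  shows "dfun A \<phi> p v = d\<phi> c p (v c)"
  using dfun_chart[OF \<phi>_smooth open_points _ assms(2,1,3)] assms(1,2)
  by (auto simp: d\<phi>_def o_def points_def)

lemma smooth_d\<phi>:
  assumes c: "c \<in> A"
  shows "smooth_on (cmap c ` cdom c) (\<lambda>u. d\<phi> c (cinv c u) x)"
proof (rule smooth_on_cong[OF fully_approachable_open])
  note C = compatible[OF c]
  show "open (cmap c ` cdom c)" by (rule open_cmap_cdom[OF C])
  show "smooth_on (cmap c ` cdom c) (\<lambda>u. frechet_derivative (\<lambda>u. \<phi> (cinv c u)) (at u) x)"
    by (rule smooth_on_open_frechet_derivative[OF open_cmap_cdom[OF C] \<phi>_chart[OF c]])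
qed (use cmap_cinv[OF compatible[OF c]] in \<open>auto simp: d\<phi>_def\<close>)

abbreviation \<Gamma>\<phi> where "\<Gamma>\<phi> c p x y \<equiv> \<Gamma> c p x y - d\<phi> c p x *\<^sub>R y - d\<phi> c p y *\<^sub>R x"

sublocale weighted: chart_connection A g D "weighted_connection A D \<phi>" \<Gamma>\<phi>
proof
  fix c U X Y assume c: "c \<in> A" and U: "open U" "U \<subseteq> cdom c"
    and X: "vector_field_on A U X" and Y: "vector_field_on A U Y"
  note C = compatible[OF c]
  have UP: "U \<subseteq> points A" using U c by (auto simp: points_def)
  note DXY = conn_field[OF U(1) UP X Y]
  have f: "fully_approachable (cmap c ` U)" by (rule fully_approachable_open[OF open_cmap_image[OF C U]])
  have s\<phi>: "smooth_on (cmap c ` U) (\<lambda>u. d\<phi> c (cinv c u) (V (cinv c u) c))" if V: "vector_field_on A U V" for V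
  proof (rule smooth_on_linear_field[OF f, where L = "\<lambda>u. d\<phi> c (cinv c u)" and f = "\<lambda>u. V (cinv c u) c"])
    show "linear (d\<phi> c (cinv c u))" if "u \<in> cmap c ` U" for u
      using that U cinv_cmap[OF C] by (auto intro!: linear_d\<phi> c)
    show "smooth_on (cmap c ` U) (\<lambda>u. d\<phi> c (cinv c u) a)" for a
      by (rule smooth_on_subset[OF f smooth_d\<phi>[OF c]]) (use U in auto)
    show "smooth_on (cmap c ` U) (\<lambda>u. V (cinv c u) c)"
      by (rule vector_field_on_chart[OF V c U(1)]) (use U in auto)
  qed
  have eq: "weighted_connection A D \<phi> X Y p c = D X Y p c - d\<phi> c p (X p c) *\<^sub>R Y p c - d\<phi> c p (Y p c) *\<^sub>R X p c"
    if "p \<in> U" for p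
    using dfun_\<phi>[OF c _ vector_field_on_tangent[OF X that]] dfun_\<phi>[OF c _ vector_field_on_tangent[OF Y that]] U that
    by (auto simp: weighted_connection_def tscale_def)
  show "vector_field_on A U (weighted_connection A D \<phi> X Y)"
  proof (rule vector_field_onI[OF c U])
    show "weighted_connection A D \<phi> X Y p \<in> tangent_space A p" if "p \<in> U" for p
      unfolding weighted_connection_def
      by (intro tangent_diff tangent_scale vector_field_on_tangent[OF DXY that] vector_field_on_tangent[OF X that]
          vector_field_on_tangent[OF Y that])
    have sub: "U \<subseteq> U \<inter> cdom c" using U by auto
    show "smooth_on (cmap c ` U) (\<lambda>u. weighted_connection A D \<phi> X Y (cinv c u) c)"
    proof (rule smooth_on_cong[OF f])
      show "smooth_on (cmap c ` U) (\<lambda>u. (D X Y (cinv c u) c + (- 1) *\<^sub>R (d\<phi> c (cinv c u) (X (cinv c u) c) *\<^sub>R Y (cinv c u) c))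
          + (- 1) *\<^sub>R (d\<phi> c (cinv c u) (Y (cinv c u) c) *\<^sub>R X (cinv c u) c))"
        by (intro smooth_on_add[OF f] smooth_on_scaleR[OF f] smooth_on_const[OF f] s\<phi> X Y
            vector_field_on_chart[OF DXY c U(1) sub] vector_field_on_chart[OF X c U(1) sub] vector_field_on_chart[OF Y c U(1) sub])
      show "D X Y (cinv c u) c + (- 1) *\<^sub>R (d\<phi> c (cinv c u) (X (cinv c u) c) *\<^sub>R Y (cinv c u) c)
          + (- 1) *\<^sub>R (d\<phi> c (cinv c u) (Y (cinv c u) c) *\<^sub>R X (cinv c u) c) = weighted_connection A D \<phi> X Y (cinv c u) c"
        if "u \<in> cmap c ` U" for u
        using that U cinv_cmap[OF C] by (auto simp: eq subset_iff)
    qed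
  qed
  show "weighted_connection A D \<phi> X Y p c = frechet_derivative (\<lambda>u. Y (cinv c u) c) (at (cmap c p)) (X p c)
      + \<Gamma>\<phi> c p (X p c) (Y p c)" if "p \<in> U" for p
    unfolding eq[OF that] connection_chart[OF c U that X Y] by simp
next
  fix c and p :: 'm assume c: "c \<in> A" and p: "p \<in> cdom c"
  note b = bilinear_christoffel[OF c p] and l = linear_d\<phi>[OF c p]
  show "bilinear (\<Gamma>\<phi> c p)"
    unfolding bilinear_def
    by safe (rule linearI; simp add: bilinear_radd[OF b] bilinear_ladd[OF b] bilinear_rmul[OF b] bilinear_lmul[OF b]
        linear_add[OF l] linear_scale[OF l] algebra_simps)+
next
  fix c and x y :: "real^'n" assume c: "c \<in> A"
  have f: "fully_approachable (cmap c ` cdom c)" by (rule fully_approachable_open[OF open_cmap_cdom[OF compatible[OF c]]])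
  have "smooth_on (cmap c ` cdom c) (\<lambda>u. (\<Gamma> c (cinv c u) x y + (- 1) *\<^sub>R (d\<phi> c (cinv c u) x *\<^sub>R y)) + (-1) *\<^sub>R (d\<phi> c (cinv c u) y *\<^sub>R x))"
    by (intro smooth_on_add[OF f] smooth_on_scaleR[OF f] smooth_on_const[OF f] smooth_christoffel smooth_d\<phi> c)
  then show "smooth_on (cmap c ` cdom c) (\<lambda>u. \<Gamma>\<phi> c (cinv c u) x y)" by simp
qed

text \<open>
  The Hessian of \<open>\<phi>\<close> in the chart \<open>c\<close>: the second derivative corrected by the Christoffel symbols.
\<close>

definition hess\<phi> :: "('m, 'n) chart \<Rightarrow> 'm \<Rightarrow> real ^ 'n \<Rightarrow> real ^ 'n \<Rightarrow> real" where
  "hess\<phi> c p y z = frechet_derivative (\<lambda>u. d\<phi> c (cinv c u) z) (at (cmap c p)) y - d\<phi> c p (\<Gamma> c p y z)"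

text \<open>
  Of the two correction terms in the weighted curvature, the multiple of \<open>W\<close> is orthogonal to \<open>V\<close>.
\<close>

lemma weighted_curvature:
  assumes c: "c \<in> A" and p: "p \<in> cdom c"
    and V: "V \<in> tangent_space A p" and W: "W \<in> tangent_space A p" and perp: "g p V W = 0"
  shows "g p (curvature_at A (weighted_connection A D \<phi>) p V W W) V
    = g p (curvature_at A D p V W W) V + (hess\<phi> c p (W c) (W c) + (d\<phi> c p (W c))\<^sup>2) * g p V V"
proof -
  note C = compatible[OF c]
  let ?\<Omega> = "cmap c ` cdom c" and ?f = "\<lambda>u. \<phi> (cinv c u)"
  have \<Omega>: "open ?\<Omega>" by (rule open_cmap_cdom[OF C])
  have u: "cmap c p \<in> ?\<Omega>" using p by simp
  have inv: "cinv c u \<in> cdom c" "cmap c (cinv c u) = u" if "u \<in> ?\<Omega>" for u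
    using that cinv_in[OF C] cmap_cinv[OF C] by auto
  have d: "d\<phi> c (cinv c u) = frechet_derivative ?f (at u)" if "u \<in> ?\<Omega>" for u
    using inv(2)[OF that] by (simp add: d\<phi>_def)
  note cong = frechet_derivative_cong_open[OF \<Omega> u]
  define H where "H y z = frechet_derivative (\<lambda>u. frechet_derivative ?f (at u) z) (at (cmap c p)) y
    - frechet_derivative ?f (at (cmap c p)) (\<Gamma> c p y z)
    + frechet_derivative ?f (at (cmap c p)) y * frechet_derivative ?f (at (cmap c p)) z" for y z
  have H: "H y z = hess\<phi> c p y z + d\<phi> c p y * d\<phi> c p z" for y z
    using cong[OF fun_cong[OF d] smooth_d\<phi>[OF c]] d[OF u] by (simp add: H_def hess\<phi>_def cinv_cmap[OF C p])
  have K: "local_curv (\<lambda>u. \<Gamma>\<phi> c (cinv c u)) (cmap c p) x y z =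
      local_curv (\<lambda>u x y. \<Gamma> c (cinv c u) x y - frechet_derivative ?f (at u) x *\<^sub>R y - frechet_derivative ?f (at u) y *\<^sub>R x) (cmap c p) x y z" for x y z
    unfolding local_curv_def
    using d[OF u] cong[OF _ weighted.\<Theta>_smooth[OF c], where G = "\<lambda>u. \<Gamma> c (cinv c u) y z - frechet_derivative ?f (at u) y *\<^sub>R z - frechet_derivative ?f (at u) z *\<^sub>R y", of y z]
      cong[OF _ weighted.\<Theta>_smooth[OF c], where G = "\<lambda>u. \<Gamma> c (cinv c u) x z - frechet_derivative ?f (at u) x *\<^sub>R z - frechet_derivative ?f (at u) z *\<^sub>R x", of x z]
    by (simp add: d)
  have main: "local_curv (\<lambda>u. \<Gamma>\<phi> c (cinv c u)) (cmap c p) (V c) (W c) (W c)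
      = local_curv (\<lambda>u. \<Gamma> c (cinv c u)) (cmap c p) (V c) (W c) (W c) + H (W c) (W c) *\<^sub>R V c - H (V c) (W c) *\<^sub>R W c"
    unfolding K H_def
    using local_curv_weighted[OF \<Omega> bilinear_christoffel[OF c inv(1)] smooth_christoffel[OF c]
        christoffel_symmetric[OF c inv(1)] u \<phi>_chart[OF c], of "V c" "W c" "W c"] cinv_cmap[OF C p] by simp
  note b = bilinear_gc[OF c p]
  have "gc c p (W c) (V c) = 0" using perp unfolding g_chart[OF c p V W] gc_sym[OF c p, of "V c"] .
  then show ?thesis
    unfolding g_chart[OF c p weighted.curvature_at_tangent[OF c p V W W] V]
      g_chart[OF c p levi.curvature_at_tangent[OF c p V W W] V] g_chart[OF c p V V]
      weighted.curvature_at_chart[OF c p V W W] levi.curvature_at_chart[OF c p V W W] main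
    by (simp add: bilinear_lsub[OF b] bilinear_ladd[OF b] bilinear_lmul[OF b] H power2_eq_square)
qed

end

section \<open>Covariant derivatives along curves\<close>

lemma has_derivative_compose_vector:
  fixes f :: "real \<Rightarrow> 'a::real_normed_vector"
  assumes "(f has_vector_derivative f') (at t within I)" "(F has_derivative F') (at (f t))"
  shows "((\<lambda>r. F (f r)) has_vector_derivative F' f') (at t within I)"
proof -
  have "((\<lambda>r. F (f r)) has_derivative (\<lambda>h. F' (h *\<^sub>R f'))) (at t within I)"
    by (rule has_derivative_compose[OF assms(1)[unfolded has_vector_derivative_def] assms(2)])
  then show ?thesis
    using linear_scale[OF has_derivative_linear[OF assms(2)]] by (simp add: has_vector_derivative_def)
qed

lemma bilinear_field_has_vector_derivative:
  fixes B :: "real \<Rightarrow> 'a::euclidean_space \<Rightarrow> 'b::euclidean_space \<Rightarrow> 'c::real_normed_vector"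
  assumes S: "fully_approachable S" and bil: "\<And>p. p \<in> S \<Longrightarrow> bilinear (B p)" and x: "x \<in> S"
    and B': "\<And>a b. ((\<lambda>p. B p a b) has_vector_derivative B' a b) (at x within S)"
    and f: "(f has_vector_derivative f') (at x within S)" and g: "(g has_vector_derivative g') (at x within S)"
  shows "((\<lambda>p. B p (f p) (g p)) has_vector_derivative
    B' (f x) (g x) + B x f' (g x) + B x (f x) g') (at x within S)"
proof -
  have "((\<lambda>p. B p (f p) (g p)) has_derivative (\<lambda>h. h *\<^sub>R B' (f x) (g x) + B x (h *\<^sub>R f') (g x) + B x (f x) (h *\<^sub>R g')))
      (at x within S)"
    by (rule bilinear_field_has_derivative[OF S bil x])
      (use B' f g in \<open>auto simp: has_vector_derivative_def\<close>)
  then show ?thesis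
    by (simp add: has_vector_derivative_def bilinear_lmul[OF bil[OF x]] bilinear_rmul[OF bil[OF x]] scaleR_add_right)
qed

context riemannian begin

text \<open>
  The inhomogeneous transformation law of the Christoffel symbols. It is obtained by expressing the derivative
  of a coordinate field of \<open>c\<close> in the chart \<open>d\<close>, and it makes covariant derivatives along curves independent of the chart.
\<close>

lemma christoffel_transform:
  assumes c: "c \<in> A" and d: "d \<in> A" and p: "p \<in> cdom c" "p \<in> cdom d"
  shows "frechet_derivative (\<lambda>u. tdiff c d (cinv c u) y) (at (cmap c p)) x
    + \<Gamma> d p (tdiff c d p x) (tdiff c d p y) = tdiff c d p (\<Gamma> c p x y)"
proof -
  note C = compatible[OF c] and K = compatible[OF d]
  define U where "U = cdom c \<inter> cdom d"
  have U: "open U" "U \<subseteq> cdom c" "U \<subseteq> cdom d" and pU: "p \<in> U" using open_overlap(1)[OF c d] p by (auto simp: U_def)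
  have UP: "U \<subseteq> points A" using U c by (auto simp: points_def)
  note E = vector_field_coord[OF c U(1,2)]
  have T: "D (coord_field A c x) (coord_field A c y) p \<in> tangent_space A p"
    by (rule vector_field_on_tangent[OF conn_field[OF U(1) UP E E] pU])
  define F where "F q = coord_field A c y q d" for q
  have "((\<lambda>u. F (cinv d u)) has_derivative frechet_derivative (\<lambda>u. F (cinv d u)) (at (cmap d p))) (at (cmap d p))"
    unfolding F_def
    by (rule has_derivative_in_chart[OF d U(1,3) pU vector_field_on_chart[OF E d U(1)]]) (use U in auto)
  then have "((F \<circ> cinv d) has_derivative frechet_derivative (\<lambda>u. F (cinv d u)) (at (cmap d p))) (at (cmap d p))"
    by (simp add: o_def)
  from derivative_change_chart[OF c d p this]
  have "((\<lambda>u. tdiff c d (cinv c u) y) has_derivative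
      (\<lambda>x. frechet_derivative (\<lambda>u. F (cinv d u)) (at (cmap d p)) (tdiff c d p x))) (at (cmap c p))"
    by (rule has_derivative_transform_within_open[OF _ open_overlap(2)[OF c d]])
      (use p in \<open>auto simp: F_def cinv_cmap[OF C] coord_field_chart[OF d]\<close>)
  from frechet_derivative_eqI[OF this]
  have "frechet_derivative (\<lambda>u. tdiff c d (cinv c u) y) (at (cmap c p)) x
      = frechet_derivative (\<lambda>u. F (cinv d u)) (at (cmap d p)) (tdiff c d p x)" .
  with connection_chart[OF d U(1,3) pU E E, of x y] tangent_chart[OF T c d p]
  show ?thesis by (simp add: F_def christoffel_def coord_field_chart[OF d p])
qed

end

text \<open>
  The parameter set \<open>I\<close> may be an open or a closed interval: geodesic segments have end points, whereas the curves that
  define tangent vectors of a submanifold are open.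
\<close>

locale curve = riemannian A g D
  for A :: "('m::{t2_space,second_countable_topology}, 'n::finite) chart set" and g D +
  fixes I :: "real set" and \<sigma> :: "real \<Rightarrow> 'm"
  assumes I: "fully_approachable I" and \<sigma>: "smooth_curve_on A I \<sigma>"
begin

definition piece :: "('m, 'n) chart \<Rightarrow> real set" where
  "piece c = {t \<in> I. \<sigma> t \<in> cdom c}"

abbreviation vel :: "real \<Rightarrow> ('m, 'n) tvec" where "vel \<equiv> velocity A I \<sigma>"
abbreviation cov :: "(real \<Rightarrow> ('m, 'n) tvec) \<Rightarrow> real \<Rightarrow> ('m, 'n) tvec" where "cov \<equiv> cov_deriv A D I \<sigma>"

lemma pieceD: "t \<in> piece c \<Longrightarrow> t \<in> I" "t \<in> piece c \<Longrightarrow> \<sigma> t \<in> cdom c"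
  by (auto simp: piece_def)

lemma openin_piece: "c \<in> A \<Longrightarrow> openin (top_of_set I) (piece c)"
proof -
  assume c: "c \<in> A"
  have "continuous_on I \<sigma>" using \<sigma> by (simp add: smooth_curve_on_def)
  from continuous_openin_preimage_gen[OF this open_cdom[OF compatible[OF c]]]
  moreover have "piece c = I \<inter> \<sigma> -` cdom c" by (auto simp: piece_def)
  ultimately show ?thesis by simp
qed

lemma \<sigma>_points: "t \<in> I \<Longrightarrow> \<sigma> t \<in> points A"
  using \<sigma> by (auto simp: smooth_curve_on_def)

lemma \<sigma>_chartE: assumes "t \<in> I" obtains c where "c \<in> A" "t \<in> piece c"
  using \<sigma>_points[OF assms] assms unfolding points_def piece_def by blast

lemma appr_piece: "openin (top_of_set I) S \<Longrightarrow> fully_approachable S"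
  by (rule fully_approachable_openin[OF I])

lemma smooth_\<sigma>: "c \<in> A \<Longrightarrow> smooth_on (piece c) (\<lambda>r. cmap c (\<sigma> r))"
  using \<sigma> by (simp add: smooth_curve_on_def piece_def o_def)

lemma vel_chart: "c \<in> A \<Longrightarrow> t \<in> piece c \<Longrightarrow> vel t c = vector_derivative (\<lambda>r. cmap c (\<sigma> r)) (at t within I)"
  by (simp add: velocity_def piece_def o_def)

lemma vel_derivative:
  assumes "c \<in> A" "t \<in> piece c"
  shows "((\<lambda>r. cmap c (\<sigma> r)) has_vector_derivative vel t c) (at t within I)"
  unfolding vel_chart[OF assms]
  by (rule smooth_on_has_vector_derivative[OF I openin_piece[OF assms(1)] smooth_\<sigma>[OF assms(1)] assms(2)])

lemma eventually_piece:
  assumes "c \<in> A" "t \<in> piece c"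
  shows "at t within I = at t within piece c"
  using at_within_openin[OF openin_piece[OF assms(1)] assms(2)] by simp

lemma along_derivative:
  assumes c: "c \<in> A" and t: "t \<in> piece c"
    and F: "((\<lambda>u. F (cinv c u)) has_derivative F') (at (cmap c (\<sigma> t)))"
  shows "((\<lambda>r. F (\<sigma> r)) has_vector_derivative F' (vel t c)) (at t within I)"
  unfolding eventually_piece[OF c t]
proof (rule has_vector_derivative_transform[OF t])
  show "((\<lambda>r. F (cinv c (cmap c (\<sigma> r)))) has_vector_derivative F' (vel t c)) (at t within piece c)"
    using has_derivative_compose_vector[OF vel_derivative[OF c t] F] eventually_piece[OF c t] by simp
qed (simp add: cinv_cmap[OF compatible[OF c]] pieceD)

lemma smooth_along:
  fixes F :: "'m \<Rightarrow> 'b::real_normed_vector"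
  assumes c: "c \<in> A" and S: "openin (top_of_set I) S" "S \<subseteq> piece c" "\<And>r. r \<in> S \<Longrightarrow> \<sigma> r \<in> U"
    and F: "smooth_on (cmap c ` (cdom c \<inter> U)) (\<lambda>u. F (cinv c u))"
  shows "smooth_on S (\<lambda>r. F (\<sigma> r))"
proof -
  have f: "fully_approachable S" by (rule appr_piece[OF S(1)])
  have "smooth_on S (\<lambda>r. F (cinv c (cmap c (\<sigma> r))))"
    by (rule smooth_on_compose[OF f F smooth_on_subset[OF f smooth_\<sigma>[OF c] S(2)]])
      (use S in \<open>auto simp: piece_def subset_iff\<close>)
  then show ?thesis
    by (rule smooth_on_cong[OF f]) (use S(2) in \<open>simp add: cinv_cmap[OF compatible[OF c]] subset_iff pieceD(2)\<close>)
qed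

definition tangent_along :: "(real \<Rightarrow> ('m, 'n) tvec) \<Rightarrow> bool" where
  "tangent_along J \<longleftrightarrow> (\<forall>t\<in>I. J t \<in> tangent_space A (\<sigma> t))"

lemma tangent_alongD: "tangent_along J \<Longrightarrow> t \<in> I \<Longrightarrow> J t \<in> tangent_space A (\<sigma> t)"
  by (simp add: tangent_along_def)

lemma field_along_tangent: "field_along A I \<sigma> J \<Longrightarrow> tangent_along J"
  by (simp add: field_along_def tangent_along_def)

lemma field_along_smooth: "field_along A I \<sigma> J \<Longrightarrow> c \<in> A \<Longrightarrow> smooth_on (piece c) (\<lambda>r. J r c)"
  by (simp add: field_along_def piece_def)

lemma field_along_derivative:
  assumes "field_along A I \<sigma> J" "c \<in> A" "t \<in> piece c"
  shows "((\<lambda>r. J r c) has_vector_derivative vector_derivative (\<lambda>r. J r c) (at t within I)) (at t within I)"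
  by (rule smooth_on_has_vector_derivative[OF I openin_piece[OF assms(2)] field_along_smooth[OF assms(1,2)] assms(3)])

lemma vel_tangent: "tangent_along vel"
  unfolding tangent_along_def
proof
  fix t assume t: "t \<in> I"
  show "vel t \<in> tangent_space A (\<sigma> t)"
  proof (rule tangent_spaceI)
    fix c d assume *: "c \<in> A" "d \<in> A" "\<sigma> t \<in> cdom c" "\<sigma> t \<in> cdom d"
    then have pc: "t \<in> piece c" and pd: "t \<in> piece d" using t by (auto simp: piece_def)
    have "((\<lambda>r. cmap d (\<sigma> r)) has_vector_derivative tdiff c d (\<sigma> t) (vel t c)) (at t within I)"
      by (rule along_derivative[OF *(1) pc]) (use tdiff_has_derivative[OF *] in \<open>simp add: o_def\<close>)
    then show "vel t d = tdiff c d (\<sigma> t) (vel t c)"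
      unfolding vel_chart[OF *(2) pd] by (rule vector_derivative_within_eq[OF I t])
  qed (auto simp: velocity_def)
qed

lemma field_along_vel: "field_along A I \<sigma> vel"
  unfolding field_along_def
proof (intro conjI ballI)
  fix c assume c: "c \<in> A"
  have "smooth_on (piece c) (\<lambda>t. vel t c)"
    by (rule smooth_on_cong[OF appr_piece[OF openin_piece[OF c]] smooth_on_vector_derivative[OF I openin_piece[OF c] smooth_\<sigma>[OF c]]])
      (simp add: vel_chart[OF c])
  then show "smooth_on {t \<in> I. \<sigma> t \<in> cdom c} (\<lambda>t. vel t c)" by (simp add: piece_def)
qed (use vel_tangent tangent_alongD in blast)

lemma smooth_tdiff_along:
  assumes c: "c \<in> A" and d: "d \<in> A" and S: "openin (top_of_set I) S" "S \<subseteq> piece c" "S \<subseteq> piece d"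
  shows "smooth_on S (\<lambda>r. tdiff c d (\<sigma> r) x)"
  by (rule smooth_along[OF c S(1,2) _ smooth_tdiff[OF c d]]) (use S in \<open>auto simp: piece_def subset_iff\<close>)

lemma field_alongI:
  assumes T: "tangent_along J"
    and loc: "\<And>t. t \<in> I \<Longrightarrow> \<exists>c\<in>A. \<exists>S. openin (top_of_set I) S \<and> t \<in> S \<and> S \<subseteq> piece c \<and> smooth_on S (\<lambda>r. J r c)"
  shows "field_along A I \<sigma> J"
  unfolding field_along_def piece_def[symmetric]
proof (intro conjI ballI tangent_alongD[OF T])
  fix d assume d: "d \<in> A"
  show "smooth_on (piece d) (\<lambda>r. J r d)"
  proof (rule smooth_on_local[OF appr_piece[OF openin_piece[OF d]]])
    fix t assume t: "t \<in> piece d"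
    from loc[OF pieceD(1)[OF t]] obtain c S where c: "c \<in> A" and S: "openin (top_of_set I) S" "t \<in> S" "S \<subseteq> piece c"
      and sm: "smooth_on S (\<lambda>r. J r c)" by blast
    define S' where "S' = S \<inter> piece d"
    have o: "openin (top_of_set I) S'" unfolding S'_def by (rule openin_Int[OF S(1) openin_piece[OF d]])
    note f = appr_piece[OF o]
    have "smooth_on S' (\<lambda>r. tdiff c d (\<sigma> r) (J r c))"
      by (rule smooth_on_linear_field[OF f _ smooth_tdiff_along[OF c d o] smooth_on_subset[OF f sm]])
        (use S c d in \<open>auto simp: S'_def piece_def subset_iff intro!: linear_tdiff\<close>)
    then have "smooth_on S' (\<lambda>r. J r d)"
    proof (rule smooth_on_cong[OF f])
      fix r assume "r \<in> S'"
      then have "r \<in> piece c" "r \<in> piece d" using S by (auto simp: S'_def)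
      then show "tdiff c d (\<sigma> r) (J r c) = J r d"
        using tangent_chart[OF tangent_alongD[OF T] c d, of r] pieceD by metis
    qed
    moreover have "openin (top_of_set (piece d)) S'"
      using o unfolding S'_def by (metis S(1) inf_le2 openin_piece[OF d] openin_subset_trans openin_imp_subset)
    ultimately show "\<exists>S'. openin (top_of_set (piece d)) S' \<and> t \<in> S' \<and> smooth_on S' (\<lambda>r. J r d)"
      using S t by (intro exI[of _ S']) (auto simp: S'_def)
  qed
qed

text \<open>
  The second derivative of the coordinate change, which appears when the components of \<open>J\<close> are differentiated
  in \<open>d\<close>, is absorbed by \<open>christoffel_transform\<close>.
\<close>

lemma covariant_change_chart:
  assumes T: "tangent_along J" and c: "c \<in> A" and d: "d \<in> A" and tc: "t \<in> piece c" and td: "t \<in> piece d"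
    and x: "((\<lambda>r. J r c) has_vector_derivative x) (at t within I)"
  shows "((\<lambda>r. J r d) has_vector_derivative
      tdiff c d (\<sigma> t) (x + \<Gamma> c (\<sigma> t) (vel t c) (J t c)) - \<Gamma> d (\<sigma> t) (vel t d) (J t d)) (at t within I)"
proof -
  define S where "S = piece c \<inter> piece d"
  have o: "openin (top_of_set I) S" unfolding S_def by (rule openin_Int[OF openin_piece[OF c] openin_piece[OF d]])
  note f = appr_piece[OF o]
  have t: "t \<in> S" using tc td by (simp add: S_def)
  note w = at_within_openin[OF o t]
  note p = pieceD(2)[OF tc] pieceD(2)[OF td]
  note tI = pieceD(1)[OF tc]
  have lin: "linear (tdiff c d (\<sigma> t))" by (rule linear_tdiff[OF c d p])
  have bil: "bilinear (\<lambda>a (b::real). b *\<^sub>R tdiff c d (\<sigma> r) a)" if "r \<in> S" for r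
    unfolding bilinear_def
  proof safe
    interpret linear "tdiff c d (\<sigma> r)"
      by (rule linear_tdiff[OF c d]) (use that in \<open>auto simp: S_def piece_def\<close>)
    show "linear (\<lambda>b. b *\<^sub>R tdiff c d (\<sigma> r) a)" for a by (rule linearI) (simp_all add: algebra_simps)
    show "linear (\<lambda>a. b *\<^sub>R tdiff c d (\<sigma> r) a)" for b by (rule linearI) (simp_all add: add scale algebra_simps)
  qed
  let ?D2 = "\<lambda>a. frechet_derivative (\<lambda>u. tdiff c d (cinv c u) a) (at (cmap c (\<sigma> t))) (vel t c)"
  have "((\<lambda>r. tdiff c d (\<sigma> r) a) has_vector_derivative ?D2 a) (at t within I)" for a
    by (rule along_derivative[OF c tc smooth_on_open_has_derivative[OF open_overlap(2)[OF c d] smooth_tdiff[OF c d]]])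
      (use p in auto)
  then have B': "((\<lambda>r. b *\<^sub>R tdiff c d (\<sigma> r) a) has_vector_derivative b *\<^sub>R ?D2 a) (at t within S)" for a and b :: real
    unfolding w[symmetric] by (auto intro!: derivative_eq_intros)
  have "((\<lambda>r. (1::real) *\<^sub>R tdiff c d (\<sigma> r) (J r c)) has_vector_derivative
      (1::real) *\<^sub>R ?D2 (J t c) + (1::real) *\<^sub>R tdiff c d (\<sigma> t) x + (0::real) *\<^sub>R tdiff c d (\<sigma> t) (J t c)) (at t within S)"
    by (rule bilinear_field_has_vector_derivative[OF f bil t B', where f = "\<lambda>r. J r c" and g = "\<lambda>r. 1::real"])
      (use x w in auto)
  then have "((\<lambda>r. tdiff c d (\<sigma> r) (J r c)) has_vector_derivative ?D2 (J t c) + tdiff c d (\<sigma> t) x) (at t within S)"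
    by simp
  then have "((\<lambda>r. J r d) has_vector_derivative ?D2 (J t c) + tdiff c d (\<sigma> t) x) (at t within S)"
  proof (rule has_vector_derivative_transform[OF t, rotated])
    fix r assume "r \<in> S"
    then have "r \<in> piece c" "r \<in> piece d" by (auto simp: S_def)
    then show "J r d = tdiff c d (\<sigma> r) (J r c)"
      using tangent_chart[OF tangent_alongD[OF T] c d, of r] pieceD by metis
  qed
  moreover have "?D2 (J t c) + tdiff c d (\<sigma> t) x
      = tdiff c d (\<sigma> t) (x + \<Gamma> c (\<sigma> t) (vel t c) (J t c)) - \<Gamma> d (\<sigma> t) (vel t d) (J t d)"
    using christoffel_transform[OF c d p, of "J t c" "vel t c"]
    unfolding tangent_chart[OF tangent_alongD[OF T tI] c d p] tangent_chart[OF tangent_alongD[OF vel_tangent tI] c d p]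
    by (simp add: linear_add[OF lin] algebra_simps)
  ultimately show ?thesis using w by simp
qed

lemma cov_chart:
  assumes "c \<in> A" "t \<in> piece c" "((\<lambda>r. J r c) has_vector_derivative x) (at t within I)"
  shows "cov J t c = x + \<Gamma> c (\<sigma> t) (vel t c) (J t c)"
  using assms vector_derivative_within_eq[OF I pieceD(1)[OF assms(2)] assms(3)]
  by (auto simp: cov_deriv_def piece_def)

lemma cov_tangent:
  assumes J: "tangent_along J" and t: "t \<in> I"
    and x: "c \<in> A" "t \<in> piece c" "((\<lambda>r. J r c) has_vector_derivative x) (at t within I)"
  shows "cov J t \<in> tangent_space A (\<sigma> t)"
proof (rule tangent_spaceI)
  fix d e assume *: "d \<in> A" "e \<in> A" "\<sigma> t \<in> cdom d" "\<sigma> t \<in> cdom e"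
  then have d: "t \<in> piece d" and e: "t \<in> piece e" using t by (auto simp: piece_def)
  note xd = covariant_change_chart[OF J x(1) *(1) x(2) d x(3)]
  show "cov J t e = tdiff d e (\<sigma> t) (cov J t d)"
    unfolding cov_chart[where J = J, OF *(2) e covariant_change_chart[OF J *(1,2) d e xd]]
      cov_chart[where J = J, OF *(1) d xd] by simp
qed (auto simp: cov_deriv_def)

lemma smooth_christoffel_along:
  assumes c: "c \<in> A" and S: "openin (top_of_set I) S" "S \<subseteq> piece c" and x: "smooth_on S x" and y: "smooth_on S y"
  shows "smooth_on S (\<lambda>r. \<Gamma> c (\<sigma> r) (x r) (y r))"
proof (rule smooth_on_bilinear_field[OF appr_piece[OF S(1)] _ _ x y])
  show "bilinear (\<Gamma> c (\<sigma> r))" if "r \<in> S" for r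
    by (rule bilinear_christoffel[OF c]) (use that S in \<open>auto simp: piece_def subset_iff\<close>)
  show "smooth_on S (\<lambda>r. \<Gamma> c (\<sigma> r) a b)" for a b
    by (rule smooth_along[OF c S, where U = UNIV]) (use smooth_christoffel[OF c] in auto)
qed

lemma field_along_cov:
  assumes J: "field_along A I \<sigma> J"
  shows "field_along A I \<sigma> (cov J)"
proof (rule field_alongI)
  note T = field_along_tangent[OF J]
  show "tangent_along (cov J)"
    unfolding tangent_along_def
  proof
    fix t assume t: "t \<in> I"
    from t obtain c where c: "c \<in> A" "t \<in> piece c" by (rule \<sigma>_chartE)
    show "cov J t \<in> tangent_space A (\<sigma> t)" by (rule cov_tangent[OF T t c field_along_derivative[OF J c]])
  qed
  fix t assume "t \<in> I"
  then obtain c where c: "c \<in> A" "t \<in> piece c" by (rule \<sigma>_chartE)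
  note o = openin_piece[OF c(1)] and f = appr_piece[OF openin_piece[OF c(1)]]
  have "smooth_on (piece c) (\<lambda>r. vector_derivative (\<lambda>r. J r c) (at r within I) + \<Gamma> c (\<sigma> r) (vel r c) (J r c))"
    by (intro smooth_on_add[OF f] smooth_on_vector_derivative[OF I o] smooth_christoffel_along[OF c(1) o order_refl]
        field_along_smooth[OF J c(1)] field_along_smooth[OF field_along_vel c(1)])
  then have "smooth_on (piece c) (\<lambda>r. cov J r c)"
    by (rule smooth_on_cong[OF f]) (simp add: cov_chart[where J = J, OF c(1) _ field_along_derivative[OF J c(1)]])
  with c o show "\<exists>c\<in>A. \<exists>S. openin (top_of_set I) S \<and> t \<in> S \<and> S \<subseteq> piece c \<and> smooth_on S (\<lambda>r. cov J r c)"
    by blast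
qed

text \<open>
  The product rule is needed also for fields that are differentiable at the single parameter \<open>t\<close>.
\<close>

lemma metric_derivative_weak:
  assumes J: "tangent_along J" and K: "tangent_along K" and c: "c \<in> A" and t: "t \<in> piece c"
    and x: "((\<lambda>r. J r c) has_vector_derivative x) (at t within I)"
    and y: "((\<lambda>r. K r c) has_vector_derivative y) (at t within I)"
  shows "((\<lambda>r. g (\<sigma> r) (J r) (K r)) has_vector_derivative
    g (\<sigma> t) (cov J t) (K t) + g (\<sigma> t) (J t) (cov K t)) (at t within I)"
proof -
  note o = openin_piece[OF c] and w = eventually_piece[OF c t] and p = pieceD(2)[OF t] and tI = pieceD(1)[OF t]
  note C = compatible[OF c]
  let ?G' = "\<lambda>a b. frechet_derivative (\<lambda>u. gc c (cinv c u) a b) (at (cmap c (\<sigma> t))) (vel t c)"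
  have "((\<lambda>r. gc c (\<sigma> r) a b) has_vector_derivative ?G' a b) (at t within I)" for a b
    by (rule along_derivative[OF c t smooth_on_open_has_derivative[OF open_cmap_cdom[OF C] smooth_gc[OF c]]])
      (use p in auto)
  then have "((\<lambda>r. gc c (\<sigma> r) (J r c) (K r c)) has_vector_derivative
      ?G' (J t c) (K t c) + gc c (\<sigma> t) x (K t c) + gc c (\<sigma> t) (J t c) y) (at t within piece c)"
    by (intro bilinear_field_has_vector_derivative[OF appr_piece[OF o] _ t]) (use x y w bilinear_gc[OF c] in \<open>auto simp: piece_def\<close>)
  then have *: "((\<lambda>r. g (\<sigma> r) (J r) (K r)) has_vector_derivative
      ?G' (J t c) (K t c) + gc c (\<sigma> t) x (K t c) + gc c (\<sigma> t) (J t c) y) (at t within piece c)"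
    by (rule has_vector_derivative_transform[OF t, rotated])
      (simp add: g_chart[OF c pieceD(2) tangent_alongD[OF J pieceD(1)] tangent_alongD[OF K pieceD(1)]])
  note b = bilinear_gc[OF c p]
  have "?G' (J t c) (K t c) + gc c (\<sigma> t) x (K t c) + gc c (\<sigma> t) (J t c) y =
      g (\<sigma> t) (cov J t) (K t) + g (\<sigma> t) (J t) (cov K t)"
    unfolding g_chart[OF c p cov_tangent[OF J tI c t x] tangent_alongD[OF K tI]]
      g_chart[OF c p tangent_alongD[OF J tI] cov_tangent[OF K tI c t y]]
      cov_chart[where J = J, OF c t x] cov_chart[where J = K, OF c t y] gc_derivative[OF c p]
    by (simp add: bilinear_radd[OF b] bilinear_ladd[OF b])
  with * w show ?thesis by simp
qed

lemma metric_derivative: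
  assumes J: "field_along A I \<sigma> J" and K: "field_along A I \<sigma> K" and t: "t \<in> I"
  shows "((\<lambda>r. g (\<sigma> r) (J r) (K r)) has_vector_derivative
    g (\<sigma> t) (cov J t) (K t) + g (\<sigma> t) (J t) (cov K t)) (at t within I)"
proof -
  from t obtain c where c: "c \<in> A" "t \<in> piece c" by (rule \<sigma>_chartE)
  show ?thesis
    by (rule metric_derivative_weak[OF field_along_tangent[OF J] field_along_tangent[OF K] c
          field_along_derivative[OF J c] field_along_derivative[OF K c]])
qed

lemma smooth_metric_along:
  assumes J: "field_along A I \<sigma> J" and K: "field_along A I \<sigma> K"
  shows "smooth_on I (\<lambda>r. g (\<sigma> r) (J r) (K r))"
proof (rule smooth_on_local[OF I])
  fix t assume "t \<in> I"
  then obtain c where c: "c \<in> A" "t \<in> piece c" by (rule \<sigma>_chartE)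
  note o = openin_piece[OF c(1)] and f = appr_piece[OF openin_piece[OF c(1)]]
  have "smooth_on (piece c) (\<lambda>r. gc c (\<sigma> r) (J r c) (K r c))"
  proof (rule smooth_on_bilinear_field[OF f _ _ field_along_smooth[OF J c(1)] field_along_smooth[OF K c(1)]])
    show "bilinear (gc c (\<sigma> r))" if "r \<in> piece c" for r
      by (rule bilinear_gc[OF c(1) pieceD(2)[OF that]])
    show "smooth_on (piece c) (\<lambda>r. gc c (\<sigma> r) a b)" for a b
      by (rule smooth_along[OF c(1) o order_refl, where U = UNIV]) (use smooth_gc[OF c(1)] in auto)
  qed
  then have "smooth_on (piece c) (\<lambda>r. g (\<sigma> r) (J r) (K r))"
    by (rule smooth_on_cong[OF f])
      (simp add: g_chart[OF c(1) pieceD(2) tangent_alongD[OF field_along_tangent[OF J] pieceD(1)]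
          tangent_alongD[OF field_along_tangent[OF K] pieceD(1)]])
  with c o show "\<exists>S'. openin (top_of_set I) S' \<and> t \<in> S' \<and> smooth_on S' (\<lambda>r. g (\<sigma> r) (J r) (K r))" by blast
qed

end

section \<open>Linear differential equations\<close>

lemma nonincreasing_within:
  fixes f :: "real \<Rightarrow> real"
  assumes f: "\<And>t. t \<in> {a..b} \<Longrightarrow> (f has_real_derivative f' t) (at t within {a..b})"
    and le: "\<And>t. t \<in> {a..b} \<Longrightarrow> f' t \<le> 0" and xy: "a \<le> x" "x \<le> y" "y \<le> b"
  shows "f y \<le> f x"
proof (cases "x < y")
  case True
  have "(f has_derivative (*) (f' t)) (at t within {x..y})" if "x \<le> t" "t \<le> y" for t
    using has_field_derivative_subset[OF f, of t "{x..y}"] that xy by (auto simp: has_field_derivative_def)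
  then have "\<exists>t\<in>{x<..<y}. f y - f x = f' t * (y - x)" by (intro mvt_simple[OF True]) auto
  then obtain t where t: "t \<in> {x<..<y}" "f y - f x = f' t * (y - x)" by blast
  have "f' t * (y - x) \<le> 0" using le[of t] t(1) xy by (intro mult_nonpos_nonneg) auto
  then show ?thesis using t(2) by simp
next
  case False
  then show ?thesis using xy by simp
qed

lemma constant_within:
  fixes f :: "real \<Rightarrow> real"
  assumes f: "\<And>t. t \<in> {a..b} \<Longrightarrow> (f has_real_derivative 0) (at t within {a..b})" and t: "t \<in> {a..b}"
  shows "f t = f a"
  using nonincreasing_within[OF f, of a t] t
    nonincreasing_within[of a b "\<lambda>t. - f t" "\<lambda>t. 0" a t] DERIV_minus[OF f] by force

text \<open>
  Gronwall's inequality in the form in which it gives uniqueness for differential equations: \<open>E e\<^bsup>-Ct\<^esup>\<close> is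
  nonincreasing, nonnegative and starts at \<open>0\<close>.
\<close>

lemma gronwall_zero:
  fixes E :: "real \<Rightarrow> real"
  assumes E: "\<And>t. t \<in> {a..b} \<Longrightarrow> (E has_real_derivative E' t) (at t within {a..b})"
    and le: "\<And>t. t \<in> {a..b} \<Longrightarrow> E' t \<le> C * E t" and pos: "\<And>t. t \<in> {a..b} \<Longrightarrow> 0 \<le> E t"
    and E0: "E a = 0" and t: "t \<in> {a..b}"
  shows "E t = 0"
proof -
  have "exp (- C * t) * E t \<le> exp (- C * a) * E a"
  proof (rule nonincreasing_within[where f = "\<lambda>t. exp (- C * t) * E t" and
        f' = "\<lambda>t. exp (- C * t) * (E' t - C * E t)" and a = a and b = b])
    show "((\<lambda>t. exp (- C * t) * E t) has_real_derivative exp (- C * t) * (E' t - C * E t)) (at t within {a..b})"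
      if "t \<in> {a..b}" for t
      by (rule derivative_eq_intros E[OF that] refl)+ (simp add: algebra_simps)
    show "exp (- C * t) * (E' t - C * E t) \<le> 0" if "t \<in> {a..b}" for t
      using le[OF that] by (simp add: mult_le_0_iff)
  qed (use t in auto)
  then show ?thesis using E0 pos[OF t] by (simp add: mult_le_0_iff)
qed

lemma linear_expand:
  fixes L :: "'a::euclidean_space \<Rightarrow> 'b::real_vector"
  assumes "linear L"
  shows "L x = (\<Sum>i\<in>Basis. (x \<bullet> i) *\<^sub>R L i)"
  by (subst (1) euclidean_representation[symmetric, of x]) (simp add: linear_sum[OF assms] linear_scale[OF assms])

text \<open>
  Picard iteration: the solution is the sum of the iterated integrals \<open>u\<^sub>0 = x\<^sub>0\<close>,
  \<open>u\<^sub>k\<^sub>+\<^sub>1(t) = \<integral> L(s) u\<^sub>k(s) ds\<close>. They are dominated by the terms of an exponential series, so that the series may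
  be differentiated term by term. For a linear equation this yields a solution on the whole interval.
\<close>

lemma linear_ode_exists:
  fixes L :: "real \<Rightarrow> 'a::euclidean_space \<Rightarrow> 'a"
  assumes lin: "\<And>t. t \<in> {a..b} \<Longrightarrow> linear (L t)" and cont: "\<And>x. continuous_on {a..b} (\<lambda>t. L t x)" and ab: "a \<le> b"
  obtains x where "x a = x0" "\<And>t. t \<in> {a..b} \<Longrightarrow> (x has_vector_derivative L t (x t)) (at t within {a..b})"
proof -
  have contL: "continuous_on {a..b} (\<lambda>t. L t (y t))" if "continuous_on {a..b} y" for y
  proof (rule continuous_on_eq)
    show "continuous_on {a..b} (\<lambda>t. \<Sum>i\<in>Basis. (y t \<bullet> i) *\<^sub>R L t i)"
      by (intro continuous_intros that cont)
  qed (simp add: linear_expand[OF lin, symmetric])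
  obtain M where M: "M \<ge> 0" "\<And>t y. t \<in> {a..b} \<Longrightarrow> norm (L t y) \<le> M * norm y"
  proof -
    have "\<exists>B. \<forall>t\<in>{a..b}. norm (L t i) \<le> B" for i
      using compact_imp_bounded[OF compact_continuous_image[OF cont[of i] compact_Icc]]
      unfolding bounded_iff by simp
    then obtain B where B: "\<And>i t. t \<in> {a..b} \<Longrightarrow> norm (L t i) \<le> B i" by metis
    have "norm (L t y) \<le> (\<Sum>i\<in>Basis. B i) * norm y" if "t \<in> {a..b}" for t y
    proof -
      have "norm (L t y) \<le> (\<Sum>i\<in>Basis. norm ((y \<bullet> i) *\<^sub>R L t i))"
        unfolding linear_expand[OF lin[OF that], of y] by (rule norm_sum)
      also have "\<dots> \<le> (\<Sum>i\<in>Basis. norm y * B i)"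
        unfolding norm_scaleR by (intro sum_mono mult_mono B that) (auto simp: Basis_le_norm)
      finally show ?thesis by (simp add: sum_distrib_left mult.commute)
    qed
    moreover have "0 \<le> (\<Sum>i\<in>Basis. B i)"
      using ab by (intro sum_nonneg order_trans[OF norm_ge_zero B[of a]]) simp
    ultimately show ?thesis using that by blast
  qed
  define u where "u = rec_nat (\<lambda>t. x0) (\<lambda>k v t. integral {a..t} (\<lambda>s. L s (v s)))"
  have u0: "u 0 = (\<lambda>t. x0)" and uS: "u (Suc k) = (\<lambda>t. integral {a..t} (\<lambda>s. L s (u k s)))" for k
    by (simp_all add: u_def)
  \<comment> \<open>The derivative of the \<open>k\<close>-th iterated integral.\<close>
  define d where "d k t = (case k of 0 \<Rightarrow> 0 | Suc j \<Rightarrow> L t (u j t))" for k t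
  have der: "(u k has_vector_derivative d k t) (at t within {a..b}) \<and> continuous_on {a..b} (u k)" if "t \<in> {a..b}" for k t
    using that
  proof (induction k arbitrary: t)
    case 0
    then show ?case by (simp add: u0 d_def)
  next
    case (Suc k)
    have c: "continuous_on {a..b} (\<lambda>s. L s (u k s))" using Suc by (intro contL) auto
    have *: "(u (Suc k) has_vector_derivative L t (u k t)) (at t within {a..b})" if "t \<in> {a..b}" for t
      unfolding uS by (rule integral_has_vector_derivative[OF c that])
    then have "continuous_on {a..b} (u (Suc k))"
      unfolding continuous_on_eq_continuous_within by (blast intro: has_vector_derivative_continuous)
    with * Suc.prems show ?case by (simp add: d_def)
  qed
  have bound: "norm (u k t) \<le> norm x0 * (M * (t - a)) ^ k / fact k" if "t \<in> {a..b}" for k t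
    using that
  proof (induction k arbitrary: t)
    case 0
    then show ?case by (simp add: u0)
  next
    case (Suc k)
    have c: "continuous_on {a..t} (\<lambda>s. L s (u k s))"
      by (rule continuous_on_subset[OF contL[OF conjunct2[OF der[OF Suc.prems]]]]) (use Suc.prems in auto)
    have "norm (u (Suc k) t) \<le> integral {a..t} (\<lambda>s. M * (norm x0 * (M * (s - a)) ^ k / fact k))"
      unfolding uS
    proof (rule integral_norm_bound_integral[OF integrable_continuous_real[OF c]])
      show "(\<lambda>s. M * (norm x0 * (M * (s - a)) ^ k / fact k)) integrable_on {a..t}"
        by (intro integrable_continuous_real continuous_intros) simp
      fix s assume s: "s \<in> {a..t}"
      then have "norm (L s (u k s)) \<le> M * norm (u k s)" using Suc.prems by (intro M(2)) auto
      also have "\<dots> \<le> M * (norm x0 * (M * (s - a)) ^ k / fact k)"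
        using s Suc.prems by (intro mult_left_mono Suc.IH M(1)) auto
      finally show "norm (L s (u k s)) \<le> M * (norm x0 * (M * (s - a)) ^ k / fact k)" .
    qed
    also have "\<dots> = norm x0 * (M * (t - a)) ^ Suc k / fact (Suc k) - norm x0 * (M * (a - a)) ^ Suc k / fact (Suc k)"
    proof (rule integral_unique[OF fundamental_theorem_of_calculus])
      show "a \<le> t" using Suc.prems by simp
      show "((\<lambda>s. norm x0 * (M * (s - a)) ^ Suc k / fact (Suc k)) has_vector_derivative
          M * (norm x0 * (M * (s - a)) ^ k / fact k)) (at s within {a..t})" for s
      proof -
        have "((\<lambda>s. norm x0 / fact (Suc k) * (M * (s - a)) ^ Suc k) has_real_derivative
            norm x0 / fact (Suc k) * (real (Suc k) * (M * (s - a)) ^ k * M)) (at s within {a..t})"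
        proof (rule DERIV_cmult)
          have "((\<lambda>s. M * (s - a)) has_real_derivative M) (at s within {a..t})"
            by (auto intro!: derivative_eq_intros)
          from DERIV_power_Suc[OF this, of k]
          show "((\<lambda>s. (M * (s - a)) ^ Suc k) has_real_derivative real (Suc k) * (M * (s - a)) ^ k * M) (at s within {a..t})"
            by (simp add: algebra_simps)
        qed
        moreover have "norm x0 / fact (Suc k) * (real (Suc k) * (M * (s - a)) ^ k * M)
            = M * (norm x0 * (M * (s - a)) ^ k / fact k)"
          by (simp add: divide_simps del: of_nat_Suc)
        ultimately show ?thesis
          by (simp add: has_real_derivative_iff_has_vector_derivative[symmetric] ac_simps)
      qed
    qed
    finally show ?case by simp
  qed
  define m where "m k = norm x0 * (inverse (fact k) * (M * (b - a)) ^ k)" for k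
  have m: "summable m" unfolding m_def by (intro summable_mult summable_exp)
  have bound': "norm (u k t) \<le> m k" if "t \<in> {a..b}" for k t
  proof -
    have "(M * (t - a)) ^ k \<le> (M * (b - a)) ^ k"
      using that M(1) by (intro power_mono mult_left_mono) auto
    then have "norm x0 * (M * (t - a)) ^ k / fact k \<le> m k"
      unfolding m_def by (simp add: field_simps mult_left_mono divide_right_mono)
    with bound[OF that, of k] show ?thesis by linarith
  qed
  define x where "x t = (\<Sum>k. u k t)" for t
  have sums: "(\<lambda>k. u k t) sums x t" if "t \<in> {a..b}" for t
    unfolding x_def by (intro summable_sums summable_comparison_test[OF _ m]) (use bound'[OF that] in auto)
  have ul: "uniform_limit {a..b} (\<lambda>n t. \<Sum>k<n. u k t) x sequentially"
    unfolding x_def by (rule Weierstrass_m_test[OF bound' m])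
  have "\<exists>g. \<forall>t\<in>{a..b}. (\<lambda>n. u n t) sums g t \<and> (g has_derivative (\<lambda>h. h *\<^sub>R L t (x t))) (at t within {a..b})"
  proof (rule has_derivative_series[where f' = "\<lambda>k t h. h *\<^sub>R d k t" and x = a and l = "x a"])
    show "(u n has_derivative (\<lambda>h. h *\<^sub>R d n t)) (at t within {a..b})" if "t \<in> {a..b}" for n t
      using der[OF that, of n] by (simp add: has_vector_derivative_def)
    fix e :: real assume e: "e > 0"
    have "\<forall>\<^sub>F n in sequentially. \<forall>t\<in>{a..b}. dist (\<Sum>k<n. u k t) (x t) < e / (M + 1)"
      using uniform_limitD[OF ul, of "e / (M + 1)"] e M(1) by simp
    then have "\<forall>\<^sub>F n in sequentially. \<forall>t\<in>{a..b}. norm ((\<Sum>k<Suc n. d k t) - L t (x t)) \<le> e"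
    proof eventually_elim
      case (elim n)
      show ?case
      proof
        fix t assume t: "t \<in> {a..b}"
        \<comment> \<open>The differentiated series is shifted by one against the series itself.\<close>
        have "(\<Sum>k<Suc n. d k t) = L t (\<Sum>k<n. u k t)"
          unfolding sum.lessThan_Suc_shift linear_sum[OF lin[OF t]] by (simp add: d_def)
        then have "norm ((\<Sum>k<Suc n. d k t) - L t (x t)) = norm (L t ((\<Sum>k<n. u k t) - x t))"
          by (simp add: linear_diff[OF lin[OF t]])
        also have "\<dots> \<le> M * (e / (M + 1))"
        proof (rule order_trans[OF M(2)[OF t] mult_left_mono[OF _ M(1)]])
          show "norm ((\<Sum>k<n. u k t) - x t) \<le> e / (M + 1)"
            using elim t unfolding dist_norm by (blast intro: less_imp_le)
        qed
        also have "\<dots> \<le> e" using e M(1) by (simp add: field_simps)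
        finally show "norm ((\<Sum>k<Suc n. d k t) - L t (x t)) \<le> e" .
      qed
    qed
    then have ev: "\<forall>\<^sub>F n in sequentially. \<forall>t\<in>{a..b}. norm ((\<Sum>k<n. d k t) - L t (x t)) \<le> e"
      using eventually_sequentially_Suc[of "\<lambda>n. \<forall>t\<in>{a..b}. norm ((\<Sum>k<n. d k t) - L t (x t)) \<le> e"] by blast
    then show "\<forall>\<^sub>F n in sequentially. \<forall>t\<in>{a..b}. \<forall>h. norm ((\<Sum>k<n. h *\<^sub>R d k t) - h *\<^sub>R L t (x t)) \<le> e * norm h"
    proof eventually_elim
      case (elim n)
      show ?case
      proof (intro ballI allI)
        fix t h assume "t \<in> {a..b}"
        have "norm ((\<Sum>k<n. h *\<^sub>R d k t) - h *\<^sub>R L t (x t)) = \<bar>h\<bar> * norm ((\<Sum>k<n. d k t) - L t (x t))"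
          by (metis norm_scaleR scaleR_diff_right scaleR_sum_right)
        also have "\<dots> \<le> e * norm h"
          unfolding mult.commute[of e] real_norm_def
          by (rule mult_left_mono[OF bspec[OF elim \<open>t \<in> {a..b}\<close>]]) simp
        finally show "norm ((\<Sum>k<n. h *\<^sub>R d k t) - h *\<^sub>R L t (x t)) \<le> e * norm h" .
      qed
    qed
  qed (use ab sums in auto)
  then obtain g where g: "\<And>t. t \<in> {a..b} \<Longrightarrow> (\<lambda>n. u n t) sums g t"
    "\<And>t. t \<in> {a..b} \<Longrightarrow> (g has_derivative (\<lambda>h. h *\<^sub>R L t (x t))) (at t within {a..b})" by blast
  have gx: "g t = x t" if "t \<in> {a..b}" for t using g(1)[OF that] sums[OF that] sums_unique2 by blast
  show ?thesis
  proof
    show "(x has_vector_derivative L t (x t)) (at t within {a..b})" if "t \<in> {a..b}" for t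
      unfolding has_vector_derivative_def
      by (rule has_derivative_transform[OF that gx[symmetric] g(2)[OF that]])
    have "u k a = (if k = 0 then x0 else 0)" for k
      by (cases k) (simp_all add: u0 uS)
    then have "(\<lambda>k. u k a) sums x0" using sums_single[of 0 "\<lambda>k. x0"] by simp
    then show "x a = x0" using sums[of a] ab sums_unique2 by fastforce
  qed
qed

text \<open>
  The equation expresses the derivative of \<open>x\<close> by \<open>x\<close>, so each order of differentiability yields the next one.
\<close>

lemma linear_ode_smooth:
  fixes L :: "real \<Rightarrow> 'a::euclidean_space \<Rightarrow> 'a"
  assumes S: "fully_approachable S" and lin: "\<And>t. t \<in> S \<Longrightarrow> linear (L t)" and L: "\<And>v. smooth_on S (\<lambda>t. L t v)"
    and x: "\<And>t. t \<in> S \<Longrightarrow> (x has_vector_derivative L t (x t)) (at t within S)"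
  shows "smooth_on S x"
  unfolding smooth_on_def
proof
  show "Ck_on k S x" for k
  proof (induction k)
    case 0
    show ?case
      unfolding Ck_on.simps continuous_on_eq_continuous_within
      using x has_vector_derivative_continuous by blast
  next
    case (Suc k)
    have c: "Ck_on k S (\<lambda>t. x t \<bullet> i)" for i
      by (rule bounded_bilinear.Ck_on[OF bounded_bilinear_inner S Suc Ck_on_const[OF S]])
    have "Ck_on k S (\<lambda>t. \<Sum>i\<in>Basis. (x t \<bullet> i) *\<^sub>R L t i)"
      by (intro Ck_on_sum[OF S] Ck_on_scaleR[OF S] c smooth_on_Ck L)
    then have "Ck_on k S (\<lambda>t. L t (x t))"
      by (rule Ck_on_cong[OF S]) (simp add: linear_expand[OF lin, symmetric])
    from Ck_on_Suc_vector_derivative[OF S x this] show ?case .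
  qed
qed

section \<open>Parallel transport\<close>

lemma has_vector_derivative_within_union:
  assumes "(f has_vector_derivative d) (at x within S)" "(f has_vector_derivative d) (at x within T)"
  shows "(f has_vector_derivative d) (at x within (S \<union> T))"
proof -
  have "at x within (S \<union> T) = sup (at x within S) (at x within T)" by (rule at_within_union)
  then show ?thesis
    using assms unfolding has_vector_derivative_def has_derivative_within by (auto intro: filterlim_sup)
qed

context curve begin

text \<open>
  Parallelism is stated by derivatives of the components that are required to exist; a vanishing value of
  \<open>cov_deriv\<close> alone says nothing about differentiability.
\<close>

definition parallel_along :: "(real \<Rightarrow> ('m, 'n) tvec) \<Rightarrow> bool" where
  "parallel_along X \<longleftrightarrow> tangent_along X \<and> (\<forall>c\<in>A. \<forall>t\<in>piece c.
     ((\<lambda>r. X r c) has_vector_derivative - \<Gamma> c (\<sigma> t) (vel t c) (X t c)) (at t within I))"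

lemma smooth_transport_coefficients:
  "c \<in> A \<Longrightarrow> smooth_on (piece c) (\<lambda>t. - \<Gamma> c (\<sigma> t) (vel t c) x)"
proof -
  assume c: "c \<in> A"
  note o = openin_piece[OF c] and f = appr_piece[OF openin_piece[OF c]]
  have "smooth_on (piece c) (\<lambda>t. (-1) *\<^sub>R \<Gamma> c (\<sigma> t) (vel t c) x)"
    by (intro smooth_on_scaleR[OF f] smooth_on_const[OF f] smooth_christoffel_along[OF c o order_refl]
        field_along_smooth[OF field_along_vel c])
  then show ?thesis by simp
qed

lemma linear_transport:
  "c \<in> A \<Longrightarrow> t \<in> piece c \<Longrightarrow> linear (\<lambda>x. - \<Gamma> c (\<sigma> t) (vel t c) x)"
  using bilinear_christoffel[OF _ pieceD(2)] unfolding bilinear_def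
  by (intro linear_compose_neg) auto

lemma parallel_field:
  assumes "parallel_along X"
  shows "field_along A I \<sigma> X" "t \<in> I \<Longrightarrow> cov X t = 0"
proof -
  have T: "tangent_along X" and d: "\<And>c t. c \<in> A \<Longrightarrow> t \<in> piece c \<Longrightarrow>
      ((\<lambda>r. X r c) has_vector_derivative - \<Gamma> c (\<sigma> t) (vel t c) (X t c)) (at t within I)"
    using assms by (auto simp: parallel_along_def)
  show "field_along A I \<sigma> X"
    unfolding field_along_def piece_def[symmetric]
  proof (intro conjI ballI tangent_alongD[OF T])
    fix c assume c: "c \<in> A"
    show "smooth_on (piece c) (\<lambda>t. X t c)"
      by (rule linear_ode_smooth[OF appr_piece[OF openin_piece[OF c]], where L = "\<lambda>t x. - \<Gamma> c (\<sigma> t) (vel t c) x"])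
        (use d[OF c] eventually_piece[OF c] in \<open>auto intro: linear_transport[OF c] smooth_transport_coefficients[OF c]\<close>)
  qed
  show "cov X t = 0" if "t \<in> I"
  proof
    show "cov X t c = 0 c" for c
    proof (cases "c \<in> A \<and> \<sigma> t \<in> cdom c")
      case True
      then have "c \<in> A" "t \<in> piece c" using that by (auto simp: piece_def)
      from cov_chart[where J = X, OF this d[OF this]] show ?thesis by simp
    qed (auto simp: cov_deriv_def)
  qed
qed

text \<open>
  In one chart parallel transport is a linear differential equation for the components.
\<close>

lemma parallel_exists_in_chart:
  assumes ab: "I = {a..b}" "a < b" and c: "c \<in> A" and sub: "\<sigma> ` I \<subseteq> cdom c" and v: "v \<in> tangent_space A (\<sigma> a)"
  obtains X where "parallel_along X" "X a = v"
proof -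
  have pc: "piece c = I" using sub by (auto simp: piece_def)
  have ct: "continuous_on {a..b} (\<lambda>t. - \<Gamma> c (\<sigma> t) (vel t c) x)" for x
    using smooth_on_continuous[OF smooth_transport_coefficients[OF c]] pc ab by metis
  obtain x where x: "x a = v c" "\<And>t. t \<in> {a..b} \<Longrightarrow> (x has_vector_derivative - \<Gamma> c (\<sigma> t) (vel t c) (x t)) (at t within {a..b})"
    by (rule linear_ode_exists[of a b "\<lambda>t x. - \<Gamma> c (\<sigma> t) (vel t c) x" "v c"])
      (use linear_transport[OF c] ct ab pc in auto)
  define X where "X t = coord_field A c (x t) (\<sigma> t)" for t
  have T: "tangent_along X"
    unfolding tangent_along_def X_def using coord_field_in_tangent_space[OF c] sub by auto
  have Xc: "X t c = x t" if "t \<in> I" for t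
    unfolding X_def by (rule coord_field_same[OF c]) (use that sub in auto)
  have d: "((\<lambda>r. X r c) has_vector_derivative - \<Gamma> c (\<sigma> t) (vel t c) (X t c)) (at t within I)" if "t \<in> I" for t
    unfolding Xc[OF that]
    by (rule has_vector_derivative_transform[OF that Xc]) (use x(2) that ab in auto)
  have "((\<lambda>r. X r e) has_vector_derivative - \<Gamma> e (\<sigma> t) (vel t e) (X t e)) (at t within I)"
    if e: "e \<in> A" "t \<in> piece e" for e t
  proof -
    have t: "t \<in> I" and tc: "t \<in> piece c" using pieceD(1)[OF e(2)] pc by auto
    show ?thesis
      using covariant_change_chart[OF T c e(1) tc e(2) d[OF t]]
        linear_0[OF linear_tdiff[OF c e(1) pieceD(2)[OF tc] pieceD(2)[OF e(2)]]] by simp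
  qed
  then have "parallel_along X" using T by (auto simp: parallel_along_def)
  moreover have "X a = v"
    unfolding X_def x(1) by (rule tangent_coord_field[OF v c]) (use sub ab in auto)
  ultimately show ?thesis by (rule that)
qed

end

context riemannian begin

lemma smooth_curve_subinterval:
  assumes \<sigma>: "smooth_curve_on A I \<sigma>" and I': "fully_approachable I'" "I' \<subseteq> I" and I: "fully_approachable I"
  shows "curve A g D I' \<sigma>"
proof
  show "smooth_curve_on A I' \<sigma>"
    unfolding smooth_curve_on_def
  proof (intro conjI ballI)
    interpret curve A g D I \<sigma> by unfold_locales fact+
    show "continuous_on I' \<sigma>" "\<sigma> ` I' \<subseteq> points A"
      using \<sigma> I' by (auto simp: smooth_curve_on_def intro: continuous_on_subset)
    fix c assume c: "c \<in> A"
    have "openin (top_of_set I') (I' \<inter> \<sigma> -` cdom c)"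
      by (rule continuous_openin_preimage_gen[OF _ open_cdom[OF compatible[OF c]]]) fact
    then have "openin (top_of_set I') {t \<in> I'. \<sigma> t \<in> cdom c}" by (simp add: vimage_def Int_def)
    then have "fully_approachable {t \<in> I'. \<sigma> t \<in> cdom c}" by (rule fully_approachable_openin[OF I'(1)])
    then show "smooth_on {t \<in> I'. \<sigma> t \<in> cdom c} (cmap c \<circ> \<sigma>)"
      by (rule smooth_on_subset[of _ "piece c"])
        (use smooth_\<sigma>[OF c] I' in \<open>auto simp: piece_def o_def\<close>)
  qed
qed fact

lemma velocity_subinterval:
  assumes "curve A g D I \<sigma>" "curve A g D I' \<sigma>" "I' \<subseteq> I" "t \<in> I'"
  shows "velocity A I' \<sigma> t = velocity A I \<sigma> t"
proof
  interpret B: curve A g D I \<sigma> by fact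
  interpret S: curve A g D I' \<sigma> by fact
  fix c
  show "velocity A I' \<sigma> t c = velocity A I \<sigma> t c"
  proof (cases "c \<in> A \<and> \<sigma> t \<in> cdom c")
    case True
    then have c: "c \<in> A" and t: "t \<in> B.piece c" "t \<in> S.piece c" using assms by (auto simp: B.piece_def S.piece_def)
    show ?thesis
      unfolding S.vel_chart[OF c t(2)]
      by (rule vector_derivative_within_eq[OF S.I assms(4)
            has_vector_derivative_within_subset[OF B.vel_derivative[OF c t(1)] assms(3)]])
  qed (auto simp: velocity_def)
qed

text \<open>
  At the joint both one-sided derivatives are prescribed by the equation and agree, since the values agree.
\<close>

lemma glue_parallel:
  assumes s: "0 < s" "s < s'" "s' \<le> T" and \<sigma>: "smooth_curve_on A {0..T} \<sigma>"
    and X: "curve.parallel_along A D {0..s} \<sigma> X" and Y: "curve.parallel_along A D {s..s'} \<sigma> Y" and eq: "Y s = X s"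
  obtains Z where "curve.parallel_along A D {0..s'} \<sigma> Z" "Z 0 = X 0"
proof -
  have I: "fully_approachable {0..T}" using s by (intro fully_approachable_Icc) simp
  have a: "fully_approachable {0..s}" "fully_approachable {s..s'}" "fully_approachable {0..s'}"
    using s by (auto intro: fully_approachable_Icc)
  have l: "{0..s} \<subseteq> {0..T}" "{s..s'} \<subseteq> {0..T}" "{0..s'} \<subseteq> {0..T}" using s by auto
  interpret L: curve A g D "{0..s}" \<sigma> by (rule smooth_curve_subinterval[OF \<sigma> a(1) l(1) I])
  interpret R: curve A g D "{s..s'}" \<sigma> by (rule smooth_curve_subinterval[OF \<sigma> a(2) l(2) I])
  interpret B: curve A g D "{0..s'}" \<sigma> by (rule smooth_curve_subinterval[OF \<sigma> a(3) l(3) I])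
  have XT: "L.tangent_along X" and YT: "R.tangent_along Y" using X Y by (auto simp: L.parallel_along_def R.parallel_along_def)
  define Z where "Z r = (if r \<in> {0..s} then X r else Y r)" for r
  have Z1: "Z r = X r" if "r \<in> {0..s}" for r using that by (simp add: Z_def)
  have Z2: "Z r = Y r" if "r \<in> {s..s'}" for r using that s eq by (auto simp: Z_def)
  have "B.tangent_along Z"
    unfolding B.tangent_along_def
  proof
    fix r assume "r \<in> {0..s'}"
    then show "Z r \<in> tangent_space A (\<sigma> r)"
      using L.tangent_alongD[OF XT, of r] R.tangent_alongD[OF YT, of r] by (auto simp: Z_def)
  qed
  moreover have "((\<lambda>r. Z r c) has_vector_derivative - \<Gamma> c (\<sigma> t) (B.vel t c) (Z t c)) (at t within {0..s'})"
    if c: "c \<in> A" and t: "t \<in> B.piece c" for c t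
  proof -
    have un: "{0..s'} = {0..s} \<union> {s..s'}" using s by auto
    let ?d = "- \<Gamma> c (\<sigma> t) (B.vel t c) (Z t c)"
    have left: "((\<lambda>r. Z r c) has_vector_derivative ?d) (at t within {0..s})" if "t \<in> {0..s}"
    proof (rule has_vector_derivative_transform[OF that])
      have "t \<in> L.piece c" using t that by (auto simp: B.piece_def L.piece_def)
      then have "((\<lambda>r. X r c) has_vector_derivative - \<Gamma> c (\<sigma> t) (L.vel t c) (X t c)) (at t within {0..s})"
        using X c by (auto simp: L.parallel_along_def)
      then show "((\<lambda>r. X r c) has_vector_derivative ?d) (at t within {0..s})"
        using velocity_subinterval[OF B.curve_axioms L.curve_axioms _ that] s Z1[OF that] by auto
    qed (simp add: Z1)
    have right: "((\<lambda>r. Z r c) has_vector_derivative ?d) (at t within {s..s'})" if "t \<in> {s..s'}"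
    proof (rule has_vector_derivative_transform[OF that])
      have "t \<in> R.piece c" using t that by (auto simp: B.piece_def R.piece_def)
      then have "((\<lambda>r. Y r c) has_vector_derivative - \<Gamma> c (\<sigma> t) (R.vel t c) (Y t c)) (at t within {s..s'})"
        using Y c by (auto simp: R.parallel_along_def)
      then show "((\<lambda>r. Y r c) has_vector_derivative ?d) (at t within {s..s'})"
        using velocity_subinterval[OF B.curve_axioms R.curve_axioms _ that] s Z2[OF that] by auto
    qed (simp add: Z2)
    consider "t < s" | "t > s" | "t = s" by linarith
    then show ?thesis
    proof cases
      case 1
      have "at t within {0..s'} = at t within {0..s}"
        by (rule at_within_nhd[of _ "{..<s}"]) (use 1 s in auto)
      with left show ?thesis using t 1 by (auto simp: B.piece_def)
    next
      case 2
      have "at t within {0..s'} = at t within {s..s'}"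
        by (rule at_within_nhd[of _ "{s<..}"]) (use 2 s in auto)
      with right show ?thesis using t 2 by (auto simp: B.piece_def)
    next
      case 3
      then show ?thesis
        using has_vector_derivative_within_union[of "\<lambda>r. Z r c" ?d t "{0..s}" "{s..s'}"] left right s
        unfolding un by auto
    qed
  qed
  ultimately have "B.parallel_along Z" by (auto simp: B.parallel_along_def)
  moreover have "Z 0 = X 0" using s by (simp add: Z_def)
  ultimately show ?thesis by (rule that)
qed

text \<open>
  By Lebesgue's number lemma all subintervals of some length \<open>h\<close> are mapped into single charts; the field is
  continued from one such subinterval to the next.
\<close>

lemma parallel_exists:
  assumes T: "0 < T" and \<sigma>: "smooth_curve_on A {0..T} \<sigma>" and v: "v \<in> tangent_space A (\<sigma> 0)"
  obtains X where "curve.parallel_along A D {0..T} \<sigma> X" "X 0 = v"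
proof -
  have I: "fully_approachable {0..T}" using T by (rule fully_approachable_Icc)
  interpret curve A g D "{0..T}" \<sigma> by unfold_locales fact+
  have cont: "continuous_on {0..T} \<sigma>" using \<sigma> by (simp add: smooth_curve_on_def)
  have "\<exists>V. open V \<and> piece c = {0..T} \<inter> V" if "c \<in> A" for c
    using openin_piece[OF that] by (auto simp: openin_open)
  then obtain V where V: "\<And>c. c \<in> A \<Longrightarrow> open (V c)" "\<And>c. c \<in> A \<Longrightarrow> piece c = {0..T} \<inter> V c" by metis
  have cov: "{0..T} \<subseteq> \<Union> (V ` A)"
  proof
    fix t assume t: "t \<in> {0..T}"
    then obtain c where "c \<in> A" "t \<in> piece c" by (rule \<sigma>_chartE)
    then show "t \<in> \<Union> (V ` A)" using V(2) by blast
  qed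
  have ne: "V ` A \<noteq> {}" using cov T by fastforce
  obtain \<delta> where \<delta>: "0 < \<delta>" "\<And>X. X \<subseteq> {0..T} \<Longrightarrow> diameter X < \<delta> \<Longrightarrow> \<exists>B\<in>V ` A. X \<subseteq> B"
    using Lebesgue_number_lemma[OF compact_Icc ne cov] V(1) by (metis imageE)
  define h where "h = \<delta> / 2"
  have h: "h > 0" using \<delta> by (simp add: h_def)
  have loc: "\<exists>X. curve.parallel_along A D {a..b} \<sigma> X \<and> X a = w"
    if ab: "0 \<le> a" "a < b" "b \<le> T" "b \<le> a + h" and w: "w \<in> tangent_space A (\<sigma> a)" for a b w
  proof -
    have "diameter {a..b} < \<delta>" using ab h by (simp add: h_def)
    then obtain c where c: "c \<in> A" "{a..b} \<subseteq> V c" using \<delta>(2)[of "{a..b}"] ab by auto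
    have l: "{a..b} \<subseteq> {0..T}" using ab by auto
    interpret S: curve A g D "{a..b}" \<sigma>
      by (rule smooth_curve_subinterval[OF \<sigma> fully_approachable_Icc[OF ab(2)] l I])
    have "\<sigma> ` {a..b} \<subseteq> cdom c" using c V(2)[OF c(1)] l by (auto simp: piece_def)
    from S.parallel_exists_in_chart[OF refl ab(2) c(1) this w] show ?thesis by metis
  qed
  have "\<forall>s. 0 < s \<and> s \<le> T \<and> s \<le> real (Suc k) * h \<longrightarrow> (\<exists>X. curve.parallel_along A D {0..s} \<sigma> X \<and> X 0 = v)" for k
  proof (induction k)
    case 0
    then show ?case using loc[of 0 _ v] v by auto
  next
    case (Suc k)
    show ?case
    proof (intro allI impI)
      fix s' assume s': "0 < s' \<and> s' \<le> T \<and> s' \<le> real (Suc (Suc k)) * h"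
      show "\<exists>X. curve.parallel_along A D {0..s'} \<sigma> X \<and> X 0 = v"
      proof (cases "s' \<le> real (Suc k) * h")
        case True
        then show ?thesis using Suc s' by blast
      next
        case False
        define s where "s = real (Suc k) * h"
        have "0 < s" unfolding s_def using h by (intro mult_pos_pos) simp_all
        then have s: "0 < s" "s < s'" "s' \<le> T" "s' \<le> s + h" using False s' by (auto simp: s_def algebra_simps)
        obtain X where X: "curve.parallel_along A D {0..s} \<sigma> X" "X 0 = v"
        proof -
          have "0 < s \<and> s \<le> T \<and> s \<le> real (Suc k) * h" using s by (simp add: s_def)
          with Suc that show ?thesis by blast
        qed
        have l: "{0..s} \<subseteq> {0..T}" using s by auto
        interpret L: curve A g D "{0..s}" \<sigma>
          by (rule smooth_curve_subinterval[OF \<sigma> fully_approachable_Icc[OF s(1)] l I])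
        have "X s \<in> tangent_space A (\<sigma> s)"
          using X(1) s unfolding L.parallel_along_def L.tangent_along_def by auto
        then obtain Y where Y: "curve.parallel_along A D {s..s'} \<sigma> Y" "Y s = X s"
          using loc[of s s' "X s"] s by auto
        obtain Z where "curve.parallel_along A D {0..s'} \<sigma> Z" "Z 0 = X 0"
          by (rule glue_parallel[OF s(1-3) \<sigma> X(1) Y])
        with X(2) show ?thesis by auto
      qed
    qed
  qed
  moreover obtain k where "T / h \<le> real k" using real_arch_simple by blast
  then have "T \<le> real (Suc k) * h" using h by (simp add: field_simps)
  ultimately obtain X where "curve.parallel_along A D {0..T} \<sigma> X" "X 0 = v" using T by blast
  then show ?thesis by (rule that)
qed

end

section \<open>Parallel frames and Jacobi fields along a geodesic\<close>

context curve begin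

lemma smooth_local_curv_along:
  assumes c: "c \<in> A" and x: "smooth_on (piece c) x" and y: "smooth_on (piece c) y" and z: "smooth_on (piece c) z"
  shows "smooth_on (piece c) (\<lambda>r. local_curv (\<lambda>u. \<Gamma> c (cinv c u)) (cmap c (\<sigma> r)) (x r) (y r) (z r))"
proof -
  note C = compatible[OF c] and o = openin_piece[OF c] and f = appr_piece[OF openin_piece[OF c]]
  have \<Omega>: "open (cmap c ` cdom c)" by (rule open_cmap_cdom[OF C])
  let ?G = "\<lambda>u. \<Gamma> c (cinv c u)"
  have sm: "smooth_on (cmap c ` cdom c) (\<lambda>u. ?G u a b)" for a b by (rule smooth_christoffel[OF c])
  have hd: "((\<lambda>u. ?G u a b) has_derivative frechet_derivative (\<lambda>u. ?G u a b) (at u)) (at u)" if "u \<in> cmap c ` cdom c" for a b u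
    by (rule smooth_on_open_has_derivative[OF \<Omega> sm that])
  have D: "smooth_on (piece c) (\<lambda>r. frechet_derivative (\<lambda>u. ?G u (y r) (z r)) (at (cmap c (\<sigma> r))) (x r))"
    if x: "smooth_on (piece c) x" and y: "smooth_on (piece c) y" and z: "smooth_on (piece c) z" for x y z
  proof (rule smooth_on_linear_field[OF f, where f = x])
    show "linear (\<lambda>v. frechet_derivative (\<lambda>u. ?G u (y r) (z r)) (at (cmap c (\<sigma> r))) v)" if "r \<in> piece c" for r
      using has_derivative_linear[OF hd] pieceD(2)[OF that] by blast
    fix i
    show "smooth_on (piece c) (\<lambda>r. frechet_derivative (\<lambda>u. ?G u (y r) (z r)) (at (cmap c (\<sigma> r))) i)"
    proof (rule smooth_on_bilinear_field[OF f _ _ y z])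
      show "smooth_on (piece c) (\<lambda>r. frechet_derivative (\<lambda>u. ?G u a b) (at (cmap c (\<sigma> r))) i)" for a b
        by (rule smooth_on_compose[OF f smooth_on_open_frechet_derivative[OF \<Omega> sm] smooth_\<sigma>[OF c]])
          (auto simp: piece_def)
      fix r assume r: "r \<in> piece c"
      let ?u = "cmap c (\<sigma> r)"
      have u: "?u \<in> cmap c ` cdom c" using pieceD(2)[OF r] by simp
      have bil: "bilinear (?G u)" if "u \<in> cmap c ` cdom c" for u
        by (rule bilinear_christoffel[OF c cinv_in[OF C that]])
      have 1: "frechet_derivative (\<lambda>u. ?G u (a + a') b) (at ?u) i
          = frechet_derivative (\<lambda>u. ?G u a b) (at ?u) i + frechet_derivative (\<lambda>u. ?G u a' b) (at ?u) i" for a a' b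
        by (rule frechet_derivative_eqI, rule has_derivative_transform_within_open
            [OF has_derivative_add[OF hd[OF u] hd[OF u]] \<Omega> u])
          (simp add: bilinear_ladd[OF bil])
      have 2: "frechet_derivative (\<lambda>u. ?G u a (b + b')) (at ?u) i
          = frechet_derivative (\<lambda>u. ?G u a b) (at ?u) i + frechet_derivative (\<lambda>u. ?G u a b') (at ?u) i" for a b b'
        by (rule frechet_derivative_eqI, rule has_derivative_transform_within_open
            [OF has_derivative_add[OF hd[OF u] hd[OF u]] \<Omega> u])
          (simp add: bilinear_radd[OF bil])
      have 3: "frechet_derivative (\<lambda>u. ?G u (s *\<^sub>R a) b) (at ?u) i = s *\<^sub>R frechet_derivative (\<lambda>u. ?G u a b) (at ?u) i"
        for a b and s :: real
        by (rule frechet_derivative_eqI, rule has_derivative_transform_within_open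
            [OF has_derivative_scaleR_right[OF hd[OF u]] \<Omega> u])
          (simp add: bilinear_lmul[OF bil])
      have 4: "frechet_derivative (\<lambda>u. ?G u a (s *\<^sub>R b)) (at ?u) i = s *\<^sub>R frechet_derivative (\<lambda>u. ?G u a b) (at ?u) i"
        for a b and s :: real
        by (rule frechet_derivative_eqI, rule has_derivative_transform_within_open
            [OF has_derivative_scaleR_right[OF hd[OF u]] \<Omega> u])
          (simp add: bilinear_rmul[OF bil])
      show "bilinear (\<lambda>a b. frechet_derivative (\<lambda>u. ?G u a b) (at ?u) i)"
        unfolding bilinear_def by safe (rule linearI; simp only: 1 2 3 4)+
    qed
  qed (rule x)
  have G: "smooth_on (piece c) (\<lambda>r. ?G (cmap c (\<sigma> r)) (x r) (y r))"
    if x: "smooth_on (piece c) x" and y: "smooth_on (piece c) y" for x y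
    by (rule smooth_on_cong[OF f smooth_christoffel_along[OF c o order_refl x y]])
      (simp add: cinv_cmap[OF C pieceD(2)])
  have "smooth_on (piece c) (\<lambda>r. frechet_derivative (\<lambda>u. ?G u (y r) (z r)) (at (cmap c (\<sigma> r))) (x r)
      + (-1) *\<^sub>R frechet_derivative (\<lambda>u. ?G u (x r) (z r)) (at (cmap c (\<sigma> r))) (y r)
      + ?G (cmap c (\<sigma> r)) (x r) (?G (cmap c (\<sigma> r)) (y r) (z r))
      + (-1) *\<^sub>R ?G (cmap c (\<sigma> r)) (y r) (?G (cmap c (\<sigma> r)) (x r) (z r)))"
    by (intro smooth_on_add[OF f] smooth_on_scaleR[OF f] smooth_on_const[OF f] D G x y z)
  then show ?thesis by (simp add: local_curv_def)
qed

text \<open>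
  Smoothness of the curvature term is what bootstraps the solutions of the Jacobi equation to smooth fields.
\<close>

lemma field_along_curvature:
  assumes X: "field_along A I \<sigma> X" and Y: "field_along A I \<sigma> Y" and Z: "field_along A I \<sigma> Z"
  shows "field_along A I \<sigma> (\<lambda>t. curvature_at A D (\<sigma> t) (X t) (Y t) (Z t))"
  unfolding field_along_def piece_def[symmetric]
proof (intro conjI ballI)
  note T = field_along_tangent[OF X, THEN tangent_alongD] field_along_tangent[OF Y, THEN tangent_alongD]
    field_along_tangent[OF Z, THEN tangent_alongD]
  show "curvature_at A D (\<sigma> t) (X t) (Y t) (Z t) \<in> tangent_space A (\<sigma> t)" if "t \<in> I" for t
  proof -
    note t = that
    obtain c where c: "c \<in> A" "t \<in> piece c" using t by (rule \<sigma>_chartE)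
    show ?thesis by (rule levi.curvature_at_tangent[OF c(1) pieceD(2)[OF c(2)] T[OF t]])
  qed
  fix c assume c: "c \<in> A"
  show "smooth_on (piece c) (\<lambda>t. curvature_at A D (\<sigma> t) (X t) (Y t) (Z t) c)"
    by (rule smooth_on_cong[OF appr_piece[OF openin_piece[OF c]] smooth_local_curv_along[OF c
            field_along_smooth[OF X c] field_along_smooth[OF Y c] field_along_smooth[OF Z c]]])
      (use levi.curvature_at_chart[OF c pieceD(2) T] pieceD(1) in metis)
qed

end

context riemannian begin

lemma
  assumes p: "p \<in> points A" and t: "x \<in> tangent_space A p" "x' \<in> tangent_space A p" "w \<in> tangent_space A p"
  shows curvature_at_add: "curvature_at A D p (x + x') w w = curvature_at A D p x w w + curvature_at A D p x' w w"
    and curvature_at_scale: "curvature_at A D p (tscale r x) w w = tscale r (curvature_at A D p x w w)"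
    and curvature_at_scale_right: "curvature_at A D p x (tscale r w) (tscale r w) = tscale (r\<^sup>2) (curvature_at A D p x w w)"
proof -
  obtain c where c: "c \<in> A" and pc: "p \<in> cdom c" using p by (rule pointsE)
  note C = compatible[OF c]
  let ?G = "\<lambda>u. \<Gamma> c (cinv c u)" and ?u = "cmap c p"
  have \<Omega>: "open (cmap c ` cdom c)" by (rule open_cmap_cdom[OF C])
  have u: "?u \<in> cmap c ` cdom c" using pc by simp
  have hd: "((\<lambda>u. ?G u a b) has_derivative frechet_derivative (\<lambda>u. ?G u a b) (at ?u)) (at ?u)" for a b
    by (rule smooth_on_open_has_derivative[OF \<Omega> smooth_christoffel[OF c] u])
  have bil: "bilinear (?G u)" if "u \<in> cmap c ` cdom c" for u
    by (rule bilinear_christoffel[OF c cinv_in[OF C that]])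
  have 1: "frechet_derivative (\<lambda>u. ?G u (a + a') b) (at ?u) i
      = frechet_derivative (\<lambda>u. ?G u a b) (at ?u) i + frechet_derivative (\<lambda>u. ?G u a' b) (at ?u) i" for a a' b i
    by (rule frechet_derivative_eqI, rule has_derivative_transform_within_open
        [OF has_derivative_add[OF hd hd] \<Omega> u]) (simp add: bilinear_ladd[OF bil])
  have 3: "frechet_derivative (\<lambda>u. ?G u (s *\<^sub>R a) b) (at ?u) i = s *\<^sub>R frechet_derivative (\<lambda>u. ?G u a b) (at ?u) i"
    for a b i and s :: real
    by (rule frechet_derivative_eqI, rule has_derivative_transform_within_open
        [OF has_derivative_scaleR_right[OF hd] \<Omega> u]) (simp add: bilinear_lmul[OF bil])
  have 4: "frechet_derivative (\<lambda>u. ?G u a (s *\<^sub>R b)) (at ?u) i = s *\<^sub>R frechet_derivative (\<lambda>u. ?G u a b) (at ?u) i"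
    for a b i and s :: real
    by (rule frechet_derivative_eqI, rule has_derivative_transform_within_open
        [OF has_derivative_scaleR_right[OF hd] \<Omega> u]) (simp add: bilinear_rmul[OF bil])
  note lin = has_derivative_linear[OF hd]
  note b = bil[OF u]
  note simps = local_curv_def 1 3 4 linear_add[OF lin] linear_scale[OF lin] bilinear_ladd[OF b] bilinear_radd[OF b]
    bilinear_lmul[OF b] bilinear_rmul[OF b]
  note T = levi.curvature_at_tangent[OF c pc] and K = levi.curvature_at_chart[OF c pc]
  note xx = tangent_add[OF t(1,2)] and rx = tangent_scale[OF t(1), of r] and rw = tangent_scale[OF t(3), of r]
  show "curvature_at A D p (x + x') w w = curvature_at A D p x w w + curvature_at A D p x' w w"
    by (rule tangent_eqI[OF T[OF xx t(3,3)] tangent_add[OF T[OF t(1,3,3)] T[OF t(2,3,3)]] c pc])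
      (simp add: K[OF xx t(3,3)] K[OF t(1,3,3)] K[OF t(2,3,3)] simps algebra_simps)
  show "curvature_at A D p (tscale r x) w w = tscale r (curvature_at A D p x w w)"
    by (rule tangent_eqI[OF T[OF rx t(3,3)] tangent_scale[OF T[OF t(1,3,3)]] c pc])
      (simp add: K[OF rx t(3,3), unfolded tscale_def] K[OF t(1,3,3)] tscale_def simps algebra_simps)
  show "curvature_at A D p x (tscale r w) (tscale r w) = tscale (r\<^sup>2) (curvature_at A D p x w w)"
    by (rule tangent_eqI[OF T[OF t(1) rw rw] tangent_scale[OF T[OF t(1,3,3)]] c pc])
      (simp add: K[OF t(1) rw rw, unfolded tscale_def] K[OF t(1,3,3)] tscale_def simps algebra_simps power2_eq_square)
qed

end

text \<open>
  A parallel frame \<open>E\<close> along the geodesic, starting from the coordinate frame of a chart \<open>c0\<close> around the initial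
  point, identifies the tangent spaces with \<open>\<real>\<^sup>n\<close> such that \<open>cov\<close> becomes the ordinary derivative. The frame
  is not orthonormal: the metric becomes the constant inner product \<open>b\<close>.
\<close>

locale geodesic_segment = density A g D \<phi>
  for A :: "('m::{t2_space,second_countable_topology}, 'n::finite) chart set" and g D \<phi> +
  fixes T :: real and \<sigma> :: "real \<Rightarrow> 'm"
  assumes T: "0 < T" and geo: "geodesic A D {0..T} \<sigma>"
    and unit: "\<And>t. t \<in> {0..T} \<Longrightarrow> gnorm g (\<sigma> t) (velocity A {0..T} \<sigma> t) = 1"
begin

sublocale curve A g D "{0..T}" \<sigma>
  by unfold_locales (use T geo in \<open>auto simp: geodesic_def fully_approachable_Icc\<close>)

lemma zero_in: "0 \<in> {0..T}" using T by simp

definition c0 :: "('m, 'n) chart" where "c0 = (SOME c. c \<in> A \<and> \<sigma> 0 \<in> cdom c)"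

lemma c0: "c0 \<in> A" "\<sigma> 0 \<in> cdom c0"
proof -
  obtain c where "c \<in> A \<and> \<sigma> 0 \<in> cdom c" using \<sigma>_points[OF zero_in] by (rule pointsE) blast
  then have "c0 \<in> A \<and> \<sigma> 0 \<in> cdom c0" unfolding c0_def by (rule someI)
  then show "c0 \<in> A" "\<sigma> 0 \<in> cdom c0" by auto
qed

definition E :: "real ^ 'n \<Rightarrow> real \<Rightarrow> ('m, 'n) tvec" where
  "E i = (SOME X. parallel_along X \<and> X 0 = coord_field A c0 i (\<sigma> 0))"

lemma E: "parallel_along (E i)" "E i 0 = coord_field A c0 i (\<sigma> 0)"
proof -
  have "\<exists>X. parallel_along X \<and> X 0 = coord_field A c0 i (\<sigma> 0)"
    using parallel_exists[OF T \<sigma> coord_field_in_tangent_space[OF c0]] by metis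
  then have "parallel_along (E i) \<and> E i 0 = coord_field A c0 i (\<sigma> 0)" unfolding E_def by (rule someI_ex)
  then show "parallel_along (E i)" "E i 0 = coord_field A c0 i (\<sigma> 0)" by auto
qed

lemmas E_field = parallel_field(1)[OF E(1)] and E_cov = parallel_field(2)[OF E(1)]
lemmas E_tangent = tangent_alongD[OF field_along_tangent[OF E_field]]

definition frame :: "real \<Rightarrow> real ^ 'n \<Rightarrow> ('m, 'n) tvec" where
  "frame t x = (\<Sum>i\<in>Basis. tscale (x \<bullet> i) (E i t))"

definition b :: "real ^ 'n \<Rightarrow> real ^ 'n \<Rightarrow> real" where "b = gc c0 (\<sigma> 0)"

lemma bilinear_b: "bilinear b" and b_sym: "b x y = b y x" and b_pos: "x \<noteq> 0 \<Longrightarrow> b x x > 0"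
  unfolding b_def using bilinear_gc[OF c0] gc_sym[OF c0] gc_pos[OF c0] by auto

lemma frame_chart: "frame t x c = (\<Sum>i\<in>Basis. (x \<bullet> i) *\<^sub>R E i t c)"
  by (simp add: frame_def sum_fun_apply tscale_def)

lemma frame_tangent: "t \<in> {0..T} \<Longrightarrow> frame t x \<in> tangent_space A (\<sigma> t)"
  unfolding frame_def by (intro tangent_sum tangent_scale E_tangent)

lemma frame_add: "frame t (x + y) = frame t x + frame t y"
  and frame_scale: "frame t (r *\<^sub>R x) = tscale r (frame t x)"
  by (rule ext; simp add: frame_chart tscale_def algebra_simps sum.distrib scaleR_sum_right)+

lemma frame_0: "frame 0 x = coord_field A c0 x (\<sigma> 0)"
  by (rule tangent_eqI[OF frame_tangent[OF zero_in] coord_field_in_tangent_space[OF c0] c0])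
    (simp add: frame_chart E(2) coord_field_same[OF c0] euclidean_representation)

lemma
  assumes k: "\<And>t. t \<in> {0..T} \<Longrightarrow> (k has_vector_derivative k' t) (at t within {0..T})"
  shows frame_derivative: "c \<in> A \<Longrightarrow> t \<in> piece c \<Longrightarrow> ((\<lambda>r. frame r (k r) c) has_vector_derivative
      frame t (k' t) c - \<Gamma> c (\<sigma> t) (vel t c) (frame t (k t) c)) (at t within {0..T})"
    and frame_cov: "t \<in> {0..T} \<Longrightarrow> cov (\<lambda>t. frame t (k t)) t = frame t (k' t)"
proof -
  show *: "((\<lambda>r. frame r (k r) c) has_vector_derivative
      frame t (k' t) c - \<Gamma> c (\<sigma> t) (vel t c) (frame t (k t) c)) (at t within {0..T})"
    if c: "c \<in> A" "t \<in> piece c" for c t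
  proof -
    have d: "((\<lambda>r. E i r c) has_vector_derivative - \<Gamma> c (\<sigma> t) (vel t c) (E i t c)) (at t within {0..T})" for i
      using E(1) c by (auto simp: parallel_along_def)
    have "((\<lambda>r. k r \<bullet> i) has_vector_derivative k' t \<bullet> i) (at t within {0..T})" for i
      by (rule bounded_linear.has_vector_derivative[OF bounded_linear_inner_left k[OF pieceD(1)[OF c(2)]]])
    then have "((\<lambda>r. \<Sum>i\<in>Basis. (k r \<bullet> i) *\<^sub>R E i r c) has_vector_derivative
        (\<Sum>i\<in>Basis. (k t \<bullet> i) *\<^sub>R (- \<Gamma> c (\<sigma> t) (vel t c) (E i t c)) + (k' t \<bullet> i) *\<^sub>R E i t c)) (at t within {0..T})"
      by (intro has_vector_derivative_sum has_vector_derivative_scaleR d)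
        (simp add: has_real_derivative_iff_has_vector_derivative)
    moreover have "linear (\<Gamma> c (\<sigma> t) (vel t c))"
      using bilinear_christoffel[OF c(1) pieceD(2)[OF c(2)]] by (auto simp: bilinear_def)
    then have "(\<Sum>i\<in>Basis. (k t \<bullet> i) *\<^sub>R (- \<Gamma> c (\<sigma> t) (vel t c) (E i t c)) + (k' t \<bullet> i) *\<^sub>R E i t c)
        = frame t (k' t) c - \<Gamma> c (\<sigma> t) (vel t c) (frame t (k t) c)"
      unfolding frame_chart by (simp add: linear_sum linear_scale sum.distrib sum_negf sum_subtractf)
    ultimately show ?thesis unfolding frame_chart by metis
  qed
  have ta: "tangent_along (\<lambda>t. frame t (k t))" by (simp add: tangent_along_def frame_tangent)
  show "cov (\<lambda>t. frame t (k t)) t = frame t (k' t)" if t: "t \<in> {0..T}"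
  proof -
    obtain c where c: "c \<in> A" "t \<in> piece c" using t by (rule \<sigma>_chartE)
    show ?thesis
      by (rule tangent_eqI[OF cov_tangent[OF ta t c *[OF c]] frame_tangent[OF t] c(1) pieceD(2)[OF c(2)]])
        (simp add: cov_chart[where J = "\<lambda>t. frame t (k t)", OF c *[OF c]])
  qed
qed

lemma field_along_frame:
  assumes "smooth_on {0..T} k"
  shows "field_along A {0..T} \<sigma> (\<lambda>t. frame t (k t))"
  unfolding field_along_def piece_def[symmetric]
proof (intro conjI ballI frame_tangent)
  fix c assume c: "c \<in> A"
  note f = appr_piece[OF openin_piece[OF c]]
  have "smooth_on (piece c) k"
    by (rule smooth_on_subset[OF f assms]) (auto simp: piece_def)
  then show "smooth_on (piece c) (\<lambda>t. frame t (k t) c)"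
    unfolding frame_chart
    by (intro smooth_on_sum[OF f] smooth_on_scaleR[OF f] field_along_smooth[OF E_field c]
        smooth_on_compose_linear[OF f bounded_linear_inner_left])
qed

text \<open>
  Parallel transport preserves the metric, so its matrix in the frame keeps its initial value.
\<close>

lemma frame_metric:
  assumes t: "t \<in> {0..T}"
  shows "g (\<sigma> t) (frame t x) (frame t y) = b x y"
proof -
  have fa: "field_along A {0..T} \<sigma> (\<lambda>t. frame t x)" for x
    by (rule field_along_frame[OF smooth_on_const[OF I]])
  have z: "frame t 0 = 0" for t by (rule ext) (simp add: frame_chart)
  have cv: "cov (\<lambda>t. frame t x) t = 0" if "t \<in> {0..T}" for t x
    using frame_cov[of "\<lambda>t. x" "\<lambda>t. 0", OF _ that] z by simp
  have g0: "g (\<sigma> t) 0 v = 0" "g (\<sigma> t) v 0 = 0" if "t \<in> {0..T}" "v \<in> tangent_space A (\<sigma> t)" for t v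
    using g_add_left[OF \<sigma>_points[OF that(1)] tangent_0 that(2) tangent_0]
      g_add_right[OF \<sigma>_points[OF that(1)] that(2) tangent_0 tangent_0] by auto
  have "g (\<sigma> t) (frame t x) (frame t y) = g (\<sigma> 0) (frame 0 x) (frame 0 y)"
  proof (rule constant_within[OF _ t])
    fix r assume r: "r \<in> {0..T}"
    show "((\<lambda>r. g (\<sigma> r) (frame r x) (frame r y)) has_real_derivative 0) (at r within {0..T})"
      using metric_derivative[OF fa fa r, of x y] g0[OF r frame_tangent[OF r]]
      by (simp add: cv[OF r] has_real_derivative_iff_has_vector_derivative)
  qed
  also have "\<dots> = b x y" by (simp add: frame_0 gc_def b_def)
  finally show ?thesis .
qed

end

context riemannian begin

lemma g_zero_left: "p \<in> points A \<Longrightarrow> v \<in> tangent_space A p \<Longrightarrow> g p 0 v = 0"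
  using g_add_left[OF _ tangent_0 _ tangent_0, of p v] by auto

lemma g_zero_right: "p \<in> points A \<Longrightarrow> v \<in> tangent_space A p \<Longrightarrow> g p v 0 = 0"
  using g_add_right[OF _ _ tangent_0 tangent_0, of p v] by auto

lemma curvature_at_same:
  assumes p: "p \<in> points A" and w: "w \<in> tangent_space A p"
  shows "curvature_at A D p w w w = 0"
proof -
  obtain c where c: "c \<in> A" and pc: "p \<in> cdom c" using p by (rule pointsE)
  show ?thesis
    by (rule tangent_eqI[OF levi.curvature_at_tangent[OF c pc w w w] tangent_0 c pc])
      (simp add: levi.curvature_at_chart[OF c pc w w w] local_curv_def)
qed

end

context geodesic_segment begin

lemma frame_E: "i \<in> Basis \<Longrightarrow> frame t i = E i t"
  by (rule ext) (simp add: frame_chart inner_Basis if_distrib[of "\<lambda>r. r *\<^sub>R _"] cong: if_cong)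

lemma frame_eq_0:
  assumes t: "t \<in> {0..T}" and "frame t x = 0"
  shows "x = 0"
proof (rule ccontr)
  assume "x \<noteq> 0"
  then have "0 < b x x" by (rule b_pos)
  also have "b x x = g (\<sigma> t) 0 0" using frame_metric[OF t, of x x] assms by simp
  also have "\<dots> = 0" by (rule g_zero_left[OF \<sigma>_points[OF t] tangent_0])
  finally show False by simp
qed

text \<open>
  The frame at \<open>t\<close> is linearly independent, because \<open>b\<close> is nondegenerate, and hence spans the tangent space.
\<close>

lemma frame_surj:
  assumes t: "t \<in> {0..T}" and w: "w \<in> tangent_space A (\<sigma> t)"
  obtains x where "frame t x = w"
proof -
  obtain c where c: "c \<in> A" "t \<in> piece c" using t by (rule \<sigma>_chartE)
  note p = pieceD(2)[OF c(2)]
  have lin: "linear (\<lambda>x. frame t x c)"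
    by (rule linearI) (simp_all add: frame_add frame_scale tscale_def)
  moreover have "inj (\<lambda>x. frame t x c)"
    unfolding linear_injective_0[OF lin]
  proof (intro allI impI)
    fix x assume "frame t x c = 0"
    then have "frame t x = 0" by (intro tangent_eqI[OF frame_tangent[OF t] tangent_0 c(1) p]) simp
    then show "x = 0" by (rule frame_eq_0[OF t])
  qed
  ultimately have "surj (\<lambda>x. frame t x c)" by (rule linear_injective_imp_surjective) simp
  then obtain x where "w c = frame t x c" by (auto simp: surj_def)
  then have "frame t x = w" by (intro tangent_eqI[OF frame_tangent[OF t] w c(1) p]) simp
  then show ?thesis by (rule that)
qed

text \<open>
  The lowering of the index by \<open>b\<close> in the standard basis, and its inverse. They express the coefficients of a
  vector in the frame by its inner products with the frame.
\<close>

definition flat :: "real ^ 'n \<Rightarrow> real ^ 'n" where "flat x = (\<Sum>i\<in>Basis. b x i *\<^sub>R i)"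
definition sharp :: "real ^ 'n \<Rightarrow> real ^ 'n" where "sharp = (SOME h. linear h \<and> h \<circ> flat = id)"

lemma sharp: "linear sharp" "sharp (flat x) = x"
proof -
  have lin: "linear flat"
    unfolding flat_def
    by (rule linearI) (simp_all add: bilinear_ladd[OF bilinear_b] bilinear_lmul[OF bilinear_b] algebra_simps
        sum.distrib scaleR_sum_right)
  moreover have "inj flat"
    unfolding linear_injective_0[OF lin]
  proof (intro allI impI, rule ccontr)
    fix x assume "flat x = 0" "x \<noteq> 0"
    then have "b x i = 0" if "i \<in> Basis" for i
    proof -
      have "flat x \<bullet> i = b x i" unfolding flat_def using that by (simp add: inner_sum_left inner_Basis if_distrib cong: if_cong)
      then show ?thesis using \<open>flat x = 0\<close> by simp
    qed
    moreover have "linear (b x)" using bilinear_b by (simp add: bilinear_def)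
    ultimately have "b x x = 0" by (subst linear_expand[of "b x" x]) simp_all
    then show False using b_pos[OF \<open>x \<noteq> 0\<close>] by simp
  qed
  ultimately have "\<exists>h. linear h \<and> h \<circ> flat = id" by (rule linear_injective_left_inverse)
  then have "linear sharp \<and> sharp \<circ> flat = id" unfolding sharp_def by (rule someI_ex)
  then show "linear sharp" "sharp (flat x) = x" by (auto simp: fun_eq_iff)
qed

text \<open>
  The coordinates of a tangent vector in the frame. By this formula they are visibly smooth along smooth fields,
  which the inverse of \<open>frame t\<close> would not show.
\<close>

definition co :: "real \<Rightarrow> ('m, 'n) tvec \<Rightarrow> real ^ 'n" where
  "co t w = sharp (\<Sum>i\<in>Basis. g (\<sigma> t) w (E i t) *\<^sub>R i)"

lemma co_frame:
  assumes t: "t \<in> {0..T}"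
  shows "co t (frame t x) = x"
proof -
  have "(\<Sum>i\<in>Basis. g (\<sigma> t) (frame t x) (E i t) *\<^sub>R i) = flat x"
    unfolding flat_def using frame_metric[OF t, of x] frame_E by (intro sum.cong) metis+
  then show ?thesis by (simp add: co_def sharp)
qed

lemma frame_co: "t \<in> {0..T} \<Longrightarrow> w \<in> tangent_space A (\<sigma> t) \<Longrightarrow> frame t (co t w) = w"
  using frame_surj co_frame by metis

lemma co_derivative:
  assumes J: "field_along A {0..T} \<sigma> J" and t: "t \<in> {0..T}"
  shows "((\<lambda>t. co t (J t)) has_vector_derivative co t (cov J t)) (at t within {0..T})"
  unfolding co_def
proof (rule bounded_linear.has_vector_derivative[OF linear_conv_bounded_linear[THEN iffD1, OF sharp(1)]])
  have "((\<lambda>t. g (\<sigma> t) (J t) (E i t)) has_vector_derivative g (\<sigma> t) (cov J t) (E i t)) (at t within {0..T})" for i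
    using metric_derivative[OF J E_field t, of i] E_cov[OF t]
      g_zero_right[OF \<sigma>_points[OF t] tangent_alongD[OF field_along_tangent[OF J] t]] by simp
  from has_vector_derivative_scaleR[OF this[folded has_real_derivative_iff_has_vector_derivative] has_vector_derivative_const]
  show "((\<lambda>t. \<Sum>i\<in>Basis. g (\<sigma> t) (J t) (E i t) *\<^sub>R i) has_vector_derivative
      (\<Sum>i\<in>Basis. g (\<sigma> t) (cov J t) (E i t) *\<^sub>R i)) (at t within {0..T})"
    by (intro has_vector_derivative_sum) simp
qed

lemma smooth_co:
  assumes J: "field_along A {0..T} \<sigma> J"
  shows "smooth_on {0..T} (\<lambda>t. co t (J t))"
  unfolding co_def
  by (rule smooth_on_compose_linear[OF I linear_conv_bounded_linear[THEN iffD1, OF sharp(1)]])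
    (intro smooth_on_sum[OF I] smooth_on_scaleR[OF I] smooth_on_const[OF I] smooth_metric_along[OF J E_field])

text \<open>
  The velocity of a geodesic is parallel, so it has constant coordinates \<open>e\<close> in the frame.
\<close>

definition e :: "real ^ 'n" where "e = co 0 (vel 0)"

lemma cov_vel: "t \<in> {0..T} \<Longrightarrow> cov vel t = 0"
  using geo by (simp add: geodesic_def)

lemma vel_T: "t \<in> {0..T} \<Longrightarrow> vel t \<in> tangent_space A (\<sigma> t)"
  by (rule tangent_alongD[OF vel_tangent])

lemma co_zero: "t \<in> {0..T} \<Longrightarrow> co t 0 = 0"
proof -
  assume t: "t \<in> {0..T}"
  have "frame t 0 = 0" by (rule ext) (simp add: frame_chart)
  with co_frame[OF t, of 0] show ?thesis by simp
qed

lemma co_vel: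
  assumes t: "t \<in> {0..T}" shows "co t (vel t) = e"
proof -
  have "((\<lambda>t. co t (vel t)) has_vector_derivative 0) (at r within {0..T})" if "r \<in> {0..T}" for r
    using co_derivative[OF field_along_vel that] unfolding cov_vel[OF that] co_zero[OF that] .
  then obtain c where "\<And>r. r \<in> {0..T} \<Longrightarrow> co r (vel r) = c"
    using has_vector_derivative_zero_constant[of "{0..T}" "\<lambda>t. co t (vel t)"] by auto
  then show ?thesis using t zero_in unfolding e_def by metis
qed

lemma vel_frame: "t \<in> {0..T} \<Longrightarrow> vel t = frame t e"
  using frame_co[OF _ vel_T] co_vel by metis

text \<open>
  The Jacobi operator \<open>V \<mapsto> R(V, \<sigma>')\<sigma>'\<close> in the frame.
\<close>

definition Rop :: "real \<Rightarrow> real ^ 'n \<Rightarrow> real ^ 'n" where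
  "Rop t x = co t (curvature_at A D (\<sigma> t) (frame t x) (vel t) (vel t))"

lemma curvature_T:
  assumes t: "t \<in> {0..T}" and x: "x \<in> tangent_space A (\<sigma> t)"
  shows "curvature_at A D (\<sigma> t) x (vel t) (vel t) \<in> tangent_space A (\<sigma> t)"
proof -
  obtain c where c: "c \<in> A" "t \<in> piece c" using t by (rule \<sigma>_chartE)
  show ?thesis by (rule levi.curvature_at_tangent[OF c(1) pieceD(2)[OF c(2)] x vel_T[OF t] vel_T[OF t]])
qed

lemma frame_Rop:
  assumes t: "t \<in> {0..T}"
  shows "frame t (Rop t x) = curvature_at A D (\<sigma> t) (frame t x) (vel t) (vel t)"
  unfolding Rop_def by (rule frame_co[OF t curvature_T[OF t frame_tangent[OF t]]])

lemma b_Rop: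
  assumes t: "t \<in> {0..T}"
  shows "b (Rop t x) y = g (\<sigma> t) (curvature_at A D (\<sigma> t) (frame t x) (vel t) (vel t)) (frame t y)"
  using frame_metric[OF t, of "Rop t x" y] frame_Rop[OF t, of x] by simp

lemma Rop_sym: "t \<in> {0..T} \<Longrightarrow> b (Rop t x) y = b (Rop t y) x"
  unfolding b_Rop by (rule jacobi_operator_symmetric[OF \<sigma>_points frame_tangent frame_tangent vel_T])

lemma Rop_e: "t \<in> {0..T} \<Longrightarrow> Rop t e = 0"
  unfolding Rop_def vel_frame[symmetric] curvature_at_same[OF \<sigma>_points vel_T] by (rule co_zero)

lemma Rop_perp: "t \<in> {0..T} \<Longrightarrow> b (Rop t x) e = 0"
  using Rop_sym[of t x e] Rop_e[of t] bilinear_lzero[OF bilinear_b] by simp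

lemma linear_Rop:
  assumes t: "t \<in> {0..T}" shows "linear (Rop t)"
proof (rule linearI)
  note inj = co_frame[OF t]
  fix x y and r :: real
  have "frame t (Rop t (x + y)) = frame t (Rop t x + Rop t y)"
    unfolding frame_add frame_Rop[OF t]
    by (rule curvature_at_add[OF \<sigma>_points[OF t] frame_tangent[OF t] frame_tangent[OF t] vel_T[OF t]])
  then show "Rop t (x + y) = Rop t x + Rop t y" using inj by metis
  have "frame t (Rop t (r *\<^sub>R x)) = frame t (r *\<^sub>R Rop t x)"
    unfolding frame_scale frame_Rop[OF t]
    by (rule curvature_at_scale[OF \<sigma>_points[OF t] frame_tangent[OF t] frame_tangent[OF t] vel_T[OF t]])
  then show "Rop t (r *\<^sub>R x) = r *\<^sub>R Rop t x" using inj by metis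
qed

lemma smooth_Rop: "smooth_on {0..T} (\<lambda>t. Rop t x)"
  unfolding Rop_def
  by (intro smooth_co field_along_curvature field_along_frame[OF smooth_on_const[OF I]] field_along_vel)

text \<open>
  In the frame the Jacobi equation is the linear system \<open>k'' = - R k\<close>.
\<close>

lemma jacobi_co:
  assumes J: "jacobi_field A D {0..T} \<sigma> J" and t: "t \<in> {0..T}"
  shows "((\<lambda>t. co t (J t)) has_vector_derivative co t (cov J t)) (at t within {0..T})"
    and "((\<lambda>t. co t (cov J t)) has_vector_derivative - Rop t (co t (J t))) (at t within {0..T})"
proof -
  have fJ: "field_along A {0..T} \<sigma> J" using J by (simp add: jacobi_field_def)
  show "((\<lambda>t. co t (J t)) has_vector_derivative co t (cov J t)) (at t within {0..T})"
    by (rule co_derivative[OF fJ t])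
  note JT = tangent_alongD[OF field_along_tangent[OF fJ] t]
  have "cov (cov J) t + curvature_at A D (\<sigma> t) (J t) (vel t) (vel t) = 0"
    using J t unfolding jacobi_field_def by blast
  also have "curvature_at A D (\<sigma> t) (J t) (vel t) (vel t) = frame t (Rop t (co t (J t)))"
    unfolding frame_Rop[OF t] frame_co[OF t JT] ..
  finally have "cov (cov J) t = tscale (-1) (frame t (Rop t (co t (J t))))"
    by (auto simp: fun_eq_iff tscale_def add_eq_0_iff2)
  also have "\<dots> = frame t (- Rop t (co t (J t)))" unfolding frame_scale[symmetric] by simp
  finally have "co t (cov (cov J) t) = - Rop t (co t (J t))" using co_frame[OF t] by simp
  with co_derivative[OF field_along_cov[OF fJ] t]
  show "((\<lambda>t. co t (cov J t)) has_vector_derivative - Rop t (co t (J t))) (at t within {0..T})" by simp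
qed

context
  fixes k k' :: "real \<Rightarrow> real ^ 'n"
  assumes k: "\<And>t. t \<in> {0..T} \<Longrightarrow> (k has_vector_derivative k' t) (at t within {0..T})"
    and k': "\<And>t. t \<in> {0..T} \<Longrightarrow> (k' has_vector_derivative - Rop t (k t)) (at t within {0..T})"
begin

lemma jacobi_solution_smooth: "smooth_on {0..T} k" "smooth_on {0..T} k'"
proof -
  define L where "L t = (\<lambda>z :: (real ^ 'n) \<times> (real ^ 'n). (snd z, - Rop t (fst z)))" for t
  have lin: "linear (L t)" if "t \<in> {0..T}" for t
    unfolding L_def
    by (rule linearI) (simp_all add: linear_add[OF linear_Rop[OF that]] linear_scale[OF linear_Rop[OF that]])
  have sm: "smooth_on {0..T} (\<lambda>t. L t z)" for z
  proof -
    have "smooth_on {0..T} (\<lambda>t. (snd z, 0) + (-1) *\<^sub>R (0, Rop t (fst z)))"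
      by (intro smooth_on_add[OF I] smooth_on_scaleR[OF I] smooth_on_const[OF I]
          smooth_on_compose_linear[OF I _ smooth_Rop, of "\<lambda>x. (0, x)"])
        (simp add: linear_conv_bounded_linear[symmetric] linear_iff)
    then show ?thesis by (simp add: L_def)
  qed
  have "((\<lambda>t. (k t, k' t)) has_vector_derivative L t (k t, k' t)) (at t within {0..T})" if "t \<in> {0..T}" for t
    unfolding L_def using has_vector_derivative_Pair[OF k[OF that] k'[OF that]] by simp
  from linear_ode_smooth[OF I lin sm this] have z: "smooth_on {0..T} (\<lambda>t. (k t, k' t))" .
  show "smooth_on {0..T} k" "smooth_on {0..T} k'"
    using smooth_on_compose_linear[OF I bounded_linear_fst z] smooth_on_compose_linear[OF I bounded_linear_snd z] by simp_all
qed

text \<open>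
  The converse: solutions of the system are coordinates of Jacobi fields. Smoothness, which is a part of the
  definition of a field along a curve, follows from the equation.
\<close>

lemma jacobi_of_solution:
  shows "jacobi_field A D {0..T} \<sigma> (\<lambda>t. frame t (k t))"
    and "t \<in> {0..T} \<Longrightarrow> cov (\<lambda>t. frame t (k t)) t = frame t (k' t)"
proof -
  note f = field_along_frame[OF jacobi_solution_smooth(1)] and f' = field_along_frame[OF jacobi_solution_smooth(2)]
  show c1: "cov (\<lambda>t. frame t (k t)) t = frame t (k' t)" if "t \<in> {0..T}" for t
    by (rule frame_cov[OF k that])
  have cong: "cov X t = cov Y t" if "t \<in> {0..T}" "\<And>r. r \<in> {0..T} \<Longrightarrow> X r = Y r" "field_along A {0..T} \<sigma> Y" for X Y t
  proof
    fix c
    show "cov X t c = cov Y t c"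
    proof (cases "c \<in> A \<and> \<sigma> t \<in> cdom c")
      case True
      then have c: "c \<in> A" "t \<in> piece c" using that by (auto simp: piece_def)
      note d = field_along_derivative[OF that(3) c]
      have "((\<lambda>r. X r c) has_vector_derivative vector_derivative (\<lambda>r. Y r c) (at t within {0..T})) (at t within {0..T})"
        by (rule has_vector_derivative_transform[OF that(1) _ d]) (simp add: that(2))
      from cov_chart[where J = X, OF c this] cov_chart[where J = Y, OF c d] that(1,2) show ?thesis by simp
    qed (auto simp: cov_deriv_def)
  qed
  have c2: "cov (cov (\<lambda>t. frame t (k t))) t = frame t (- Rop t (k t))" if "t \<in> {0..T}" for t
    using cong[OF that c1 f'] frame_cov[OF k' that] by simp
  show "jacobi_field A D {0..T} \<sigma> (\<lambda>t. frame t (k t))"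
    unfolding jacobi_field_def
  proof (intro conjI f ballI)
    fix t assume t: "t \<in> {0..T}"
    show "cov (cov (\<lambda>t. frame t (k t))) t + curvature_at A D (\<sigma> t) (frame t (k t)) (vel t) (vel t) = 0"
      unfolding c2[OF t] frame_Rop[OF t, symmetric] frame_add[symmetric] by (rule ext) (simp add: frame_chart)
  qed
qed

end

lemma jacobi_solution_exists:
  obtains k k' where "k 0 = v" "k' 0 = 0"
    "\<And>t. t \<in> {0..T} \<Longrightarrow> (k has_vector_derivative k' t) (at t within {0..T})"
    "\<And>t. t \<in> {0..T} \<Longrightarrow> (k' has_vector_derivative - Rop t (k t)) (at t within {0..T})"
proof -
  define L where "L t = (\<lambda>z :: (real ^ 'n) \<times> (real ^ 'n). (snd z, - Rop t (fst z)))" for t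
  have lin: "linear (L t)" if "t \<in> {0..T}" for t
    unfolding L_def
    by (rule linearI) (simp_all add: linear_add[OF linear_Rop[OF that]] linear_scale[OF linear_Rop[OF that]])
  have "continuous_on {0..T} (\<lambda>t. L t z)" for z
    unfolding L_def by (intro continuous_intros smooth_on_continuous[OF smooth_Rop])
  then obtain z where z: "z 0 = (v, 0)" "\<And>t. t \<in> {0..T} \<Longrightarrow> (z has_vector_derivative L t (z t)) (at t within {0..T})"
    by (rule linear_ode_exists[of 0 T L "(v, 0)", rotated]) (use lin T in auto)
  show ?thesis
  proof (rule that[of "\<lambda>t. fst (z t)" "\<lambda>t. snd (z t)"])
    fix t assume "t \<in> {0..T}"
    from bounded_linear.has_vector_derivative[OF bounded_linear_fst z(2)[OF this]]
      bounded_linear.has_vector_derivative[OF bounded_linear_snd z(2)[OF this]]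
    show "((\<lambda>t. fst (z t)) has_vector_derivative snd (z t)) (at t within {0..T})"
      "((\<lambda>t. snd (z t)) has_vector_derivative - Rop t (fst (z t))) (at t within {0..T})"
      by (simp_all add: L_def)
  qed (simp_all add: z)
qed

lemma b_derivative:
  assumes "(k has_vector_derivative k') (at t within S)"
  shows "((\<lambda>t. b (k t) x) has_real_derivative b k' x) (at t within S)"
proof -
  have "bounded_linear (\<lambda>y. b y x)"
    using bilinear_b by (simp add: bilinear_def linear_conv_bounded_linear)
  from bounded_linear.has_vector_derivative[OF this assms] show ?thesis
    by (simp add: has_real_derivative_iff_has_vector_derivative)
qed

text \<open>
  The values of the Jacobi operator are orthogonal to \<open>e\<close>, so \<open>b(k, e)\<close> has vanishing second derivative.
\<close>

lemma jacobi_tangential_component: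
  assumes k: "\<And>t. t \<in> {0..T} \<Longrightarrow> (k has_vector_derivative k' t) (at t within {0..T})"
    and k': "\<And>t. t \<in> {0..T} \<Longrightarrow> (k' has_vector_derivative - Rop t (k t)) (at t within {0..T})"
    and 0: "k' 0 = 0" and t: "t \<in> {0..T}"
  shows "b (k t) e = b (k 0) e"
proof -
  have "b (k' r) e = 0" if r: "r \<in> {0..T}" for r
  proof -
    have "b (k' r) e = b (k' 0) e"
    proof (rule constant_within[OF _ r])
      fix s assume s: "s \<in> {0..T}"
      have "b (- Rop s (k s)) e = 0" using Rop_perp[OF s] by (simp add: bilinear_lneg[OF bilinear_b])
      then show "((\<lambda>t. b (k' t) e) has_real_derivative 0) (at s within {0..T})"
        using b_derivative[OF k'[OF s], of e] by simp
    qed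
    then show ?thesis by (simp add: 0 bilinear_lzero[OF bilinear_b])
  qed
  note k'_e = this
  show ?thesis
  proof (rule constant_within[OF _ t])
    fix s assume s: "s \<in> {0..T}"
    show "((\<lambda>t. b (k t) e) has_real_derivative 0) (at s within {0..T})"
      using b_derivative[OF k[OF s], of e] k'_e[OF s] by simp
  qed
qed

end

section \<open>Uniqueness of geodesics and the exponential map\<close>

lemma smooth_locally_lipschitz:
  fixes f :: "'a::euclidean_space \<Rightarrow> 'b::real_normed_vector"
  assumes S: "open S" and f: "smooth_on S f" and z: "z \<in> S"
  obtains r C where "r > 0" "C \<ge> 0" "cball z r \<subseteq> S"
    "\<And>x y. x \<in> cball z r \<Longrightarrow> y \<in> cball z r \<Longrightarrow> norm (f x - f y) \<le> C * norm (x - y)"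
proof -
  obtain r where r: "r > 0" "cball z r \<subseteq> S" using S z open_contains_cball by blast
  let ?f' = "\<lambda>x. frechet_derivative f (at x)"
  have "\<exists>M. \<forall>x\<in>cball z r. norm (?f' x i) \<le> M" for i
  proof -
    have "continuous_on (cball z r) (\<lambda>x. ?f' x i)"
      using smooth_on_continuous[OF smooth_on_open_frechet_derivative[OF S f]] r(2) by (rule continuous_on_subset)
    from compact_imp_bounded[OF compact_continuous_image[OF this compact_cball]]
    show ?thesis unfolding bounded_iff by simp
  qed
  then obtain M where M: "\<And>i x. x \<in> cball z r \<Longrightarrow> norm (?f' x i) \<le> M i" by metis
  define C where "C = (\<Sum>i\<in>Basis. M i)"
  have C: "C \<ge> 0" unfolding C_def using r by (intro sum_nonneg order_trans[OF norm_ge_zero M[of z]]) simp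
  have "norm (f x - f y) \<le> C * norm (x - y)" if "x \<in> cball z r" "y \<in> cball z r" for x y
  proof (rule differentiable_bound[OF convex_cball _ _ that])
    show "(f has_derivative ?f' x) (at x within cball z r)" if "x \<in> cball z r" for x
      using smooth_on_open_has_derivative[OF S f] that r(2) has_derivative_at_withinI by blast
    show "onorm (?f' x) \<le> C" if x: "x \<in> cball z r" for x
    proof (rule onorm_le)
      have lin: "linear (?f' x)"
        using smooth_on_open_has_derivative[OF S f] x r(2) has_derivative_linear by blast
      fix v
      have "norm (?f' x v) \<le> (\<Sum>i\<in>Basis. norm ((v \<bullet> i) *\<^sub>R ?f' x i))"
        unfolding linear_expand[OF lin, of v] by (rule norm_sum)
      also have "\<dots> \<le> (\<Sum>i\<in>Basis. norm v * M i)"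
        unfolding norm_scaleR by (intro sum_mono mult_mono M x) (auto simp: Basis_le_norm)
      finally show "norm (?f' x v) \<le> C * norm v" by (simp add: C_def sum_distrib_left mult.commute)
    qed
  qed
  with r C show ?thesis by (intro that)
qed

context riemannian begin

lemma smooth_geodesic_spray:
  assumes c: "c \<in> A"
  shows "open (cmap c ` cdom c \<times> (UNIV :: (real ^ 'n) set))"
    and "smooth_on (cmap c ` cdom c \<times> UNIV) (\<lambda>z. \<Gamma> c (cinv c (fst z)) (snd z) (snd z))"
proof -
  note C = compatible[OF c]
  show o: "open (cmap c ` cdom c \<times> (UNIV :: (real ^ 'n) set))" by (intro open_Times open_cmap_cdom[OF C] open_UNIV)
  note f = fully_approachable_open[OF o]
  show "smooth_on (cmap c ` cdom c \<times> UNIV) (\<lambda>z. \<Gamma> c (cinv c (fst z)) (snd z) (snd z))"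
  proof (rule smooth_on_bilinear_field[OF f, where B = "\<lambda>z. \<Gamma> c (cinv c (fst z))" and f = snd and g = snd])
    show "bilinear (\<Gamma> c (cinv c (fst z)))" if "z \<in> cmap c ` cdom c \<times> UNIV" for z :: "(real^'n) \<times> (real^'n)"
      by (rule bilinear_christoffel[OF c cinv_in[OF C]]) (use that in auto)
    show "smooth_on (cmap c ` cdom c \<times> UNIV) (\<lambda>z :: (real ^ 'n) \<times> (real ^ 'n). \<Gamma> c (cinv c (fst z)) x y)" for x y
      by (rule smooth_on_compose[where f = fst and g = "\<lambda>u. \<Gamma> c (cinv c u) x y", OF f smooth_christoffel[OF c]
            smooth_on_linear[OF f bounded_linear_fst]]) auto
  qed (rule smooth_on_linear[OF f bounded_linear_snd])+
qed

end

context curve begin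

lemma vel_coordinate_derivative:
  assumes geo: "\<And>t. t \<in> I \<Longrightarrow> cov vel t = 0" and c: "c \<in> A" and t: "t \<in> piece c"
  shows "((\<lambda>r. vel r c) has_vector_derivative - \<Gamma> c (\<sigma> t) (vel t c) (vel t c)) (at t within I)"
proof -
  note d = field_along_derivative[OF field_along_vel c t]
  from cov_chart[where J = vel, OF c t d] geo[OF pieceD(1)[OF t]]
  have "vector_derivative (\<lambda>r. vel r c) (at t within I) = - \<Gamma> c (\<sigma> t) (vel t c) (vel t c)"
    by (simp add: add_eq_0_iff2)
  with d show ?thesis by simp
qed

end

context riemannian begin

text \<open>
  Local uniqueness for the geodesic equation, as a first-order system for position and velocity in a chart:
  Gronwall's inequality for the squared distance of two solutions.
\<close>

lemma geodesics_agree_locally: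
  assumes \<beta>1: "geodesic A D {0..1} \<beta>1" and \<beta>2: "geodesic A D {0..1} \<beta>2"
    and s: "0 \<le> s" "s < 1" and eq: "\<beta>1 s = \<beta>2 s" "velocity A {0..1} \<beta>1 s = velocity A {0..1} \<beta>2 s"
  obtains \<delta> where "\<delta> > 0" "s + \<delta> \<le> 1"
    "\<And>t. t \<in> {s..s + \<delta>} \<Longrightarrow> \<beta>1 t = \<beta>2 t \<and> velocity A {0..1} \<beta>1 t = velocity A {0..1} \<beta>2 t"
proof -
  have I: "fully_approachable {0..1::real}" by (rule fully_approachable_Icc) simp
  interpret B1: curve A g D "{0..1}" \<beta>1 by unfold_locales (use I \<beta>1 in \<open>auto simp: geodesic_def\<close>)
  interpret B2: curve A g D "{0..1}" \<beta>2 by unfold_locales (use I \<beta>2 in \<open>auto simp: geodesic_def\<close>)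
  have sI: "s \<in> {0..1}" using s by simp
  obtain c where c: "c \<in> A" "s \<in> B1.piece c" using sI by (rule B1.\<sigma>_chartE)
  have c2: "s \<in> B2.piece c" using c(2) eq by (simp add: B1.piece_def B2.piece_def)
  let ?\<Omega> = "cmap c ` cdom c \<times> (UNIV :: (real^'n) set)" and ?f = "\<lambda>z. \<Gamma> c (cinv c (fst z)) (snd z) (snd z)"
  define z1 where "z1 t = (cmap c (\<beta>1 t), B1.vel t c)" for t
  define z2 where "z2 t = (cmap c (\<beta>2 t), B2.vel t c)" for t
  have "z1 s \<in> ?\<Omega>" using B1.pieceD(2)[OF c(2)] by (simp add: z1_def)
  from smooth_locally_lipschitz[OF smooth_geodesic_spray[OF c(1)] this] obtain r C where
    r: "r > 0" "C \<ge> 0" and lip: "\<And>x y. x \<in> cball (z1 s) r \<Longrightarrow> y \<in> cball (z1 s) r \<Longrightarrow> norm (?f x - ?f y) \<le> C * norm (x - y)"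
    by metis
  have zs: "z2 s = z1 s" by (simp add: z1_def z2_def eq)
  have near: "\<exists>d>0. \<forall>t\<in>{0..1}. dist t s < d \<longrightarrow> t \<in> P \<and> z t \<in> cball (z1 s) r"
    if o: "openin (top_of_set {0..1}) P" "s \<in> P" and z: "continuous_on P z" "z s = z1 s" for P and z :: "real \<Rightarrow> (real^'n) \<times> (real^'n)"
  proof -
    obtain d1 where d1: "d1 > 0" "ball s d1 \<inter> {0..1} \<subseteq> P" using o openin_contains_ball by metis
    obtain d2 where d2: "d2 > 0" "\<forall>t\<in>P. dist t s < d2 \<longrightarrow> dist (z t) (z s) < r"
      using z(1) o(2) r(1) unfolding continuous_on_iff by blast
    have "t \<in> P \<and> z t \<in> cball (z1 s) r" if "t \<in> {0..1}" "dist t s < min d1 d2" for t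
    proof -
      have tP: "t \<in> P" using d1(2) that by (auto simp: dist_commute subset_iff)
      moreover have "dist (z t) (z s) < r" using d2(2) tP that(2) by simp
      ultimately show ?thesis using z(2) by (simp add: dist_commute)
    qed
    then show ?thesis using d1(1) d2(1) by (intro exI[of _ "min d1 d2"]) simp
  qed
  have cont: "continuous_on (B1.piece c) z1" "continuous_on (B2.piece c) z2"
    unfolding z1_def[abs_def] z2_def[abs_def]
    by (intro continuous_on_Pair smooth_on_continuous B1.smooth_\<sigma>[OF c(1)] B2.smooth_\<sigma>[OF c(1)]
        B1.field_along_smooth[OF B1.field_along_vel c(1)] B2.field_along_smooth[OF B2.field_along_vel c(1)])+
  obtain d1 where d1: "d1 > 0" "\<And>t. t \<in> {0..1} \<Longrightarrow> dist t s < d1 \<Longrightarrow> t \<in> B1.piece c \<and> z1 t \<in> cball (z1 s) r"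
    using near[OF B1.openin_piece[OF c(1)] c(2) cont(1) refl] by blast
  obtain d2 where d2: "d2 > 0" "\<And>t. t \<in> {0..1} \<Longrightarrow> dist t s < d2 \<Longrightarrow> t \<in> B2.piece c \<and> z2 t \<in> cball (z1 s) r"
    using near[OF B2.openin_piece[OF c(1)] c2 cont(2) zs] by blast
  define \<delta> where "\<delta> = min (min d1 d2 / 2) (1 - s)"
  have \<delta>: "\<delta> > 0" "s + \<delta> \<le> 1" "\<delta> < d1" "\<delta> < d2" using d1(1) d2(1) s by (auto simp: \<delta>_def)
  have sub: "{s..s + \<delta>} \<subseteq> {0..1}" using s \<delta> by auto
  have loc: "t \<in> B1.piece c" "z1 t \<in> cball (z1 s) r" "t \<in> B2.piece c" "z2 t \<in> cball (z1 s) r"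
    if t: "t \<in> {s..s + \<delta>}" for t
  proof -
    have "t \<in> {0..1}" "dist t s < d1" "dist t s < d2" using t \<delta> sub by (auto simp: dist_real_def)
    then show "t \<in> B1.piece c" "z1 t \<in> cball (z1 s) r" "t \<in> B2.piece c" "z2 t \<in> cball (z1 s) r"
      using d1(2)[of t] d2(2)[of t] by auto
  qed
  have inv: "cinv c (cmap c (\<beta>1 t)) = \<beta>1 t" "cinv c (cmap c (\<beta>2 t)) = \<beta>2 t" if "t \<in> {s..s + \<delta>}" for t
    using cinv_cmap[OF compatible[OF c(1)]] B1.pieceD(2)[OF loc(1)[OF that]] B2.pieceD(2)[OF loc(3)[OF that]] by auto
  define x where "x t = cmap c (\<beta>1 t) - cmap c (\<beta>2 t)" for t
  define v where "v t = B1.vel t c - B2.vel t c" for t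
  define w where "w t = ?f (z1 t) - ?f (z2 t)" for t
  have dx: "(x has_vector_derivative v t) (at t within {s..s + \<delta>})" if t: "t \<in> {s..s + \<delta>}" for t
    unfolding x_def[abs_def] v_def
    by (intro has_vector_derivative_diff has_vector_derivative_within_subset[OF _ sub]
        B1.vel_derivative[OF c(1) loc(1)[OF t]] B2.vel_derivative[OF c(1) loc(3)[OF t]])
  have g1: "B1.cov B1.vel t = 0" "B2.cov B2.vel t = 0" if "t \<in> {0..1}" for t
    using \<beta>1 \<beta>2 that by (auto simp: geodesic_def)
  have dv: "(v has_vector_derivative - w t) (at t within {s..s + \<delta>})" if t: "t \<in> {s..s + \<delta>}" for t
  proof -
    have "(v has_vector_derivative - \<Gamma> c (\<beta>1 t) (B1.vel t c) (B1.vel t c) - - \<Gamma> c (\<beta>2 t) (B2.vel t c) (B2.vel t c))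
        (at t within {s..s + \<delta>})"
      unfolding v_def[abs_def]
      by (intro has_vector_derivative_diff has_vector_derivative_within_subset[OF _ sub]
          B1.vel_coordinate_derivative[OF g1(1) c(1) loc(1)[OF t]] B2.vel_coordinate_derivative[OF g1(2) c(1) loc(3)[OF t]])
    then show ?thesis by (simp add: w_def z1_def z2_def inv[OF t])
  qed
  \<comment> \<open>The squared distance of the two solutions; its derivative is at most a multiple of it, since
    the geodesic equation is locally Lipschitz.\<close>
  define E where "E t = x t \<bullet> x t + v t \<bullet> v t" for t
  have dE: "(E has_real_derivative 2 * (x t \<bullet> v t) - 2 * (v t \<bullet> w t)) (at t within {s..s + \<delta>})"
    if t: "t \<in> {s..s + \<delta>}" for t
  proof -
    have "(E has_derivative (\<lambda>h. (x t \<bullet> (h *\<^sub>R v t) + (h *\<^sub>R v t) \<bullet> x t) + (v t \<bullet> (h *\<^sub>R - w t) + (h *\<^sub>R - w t) \<bullet> v t)))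
        (at t within {s..s + \<delta>})"
      unfolding E_def[abs_def]
      by (intro has_derivative_add has_derivative_inner dx[OF t, unfolded has_vector_derivative_def]
          dv[OF t, unfolded has_vector_derivative_def])
    then show ?thesis
      unfolding has_field_derivative_def
      by (rule has_derivative_eq_rhs) (simp add: fun_eq_iff inner_commute algebra_simps)
  qed
  have bound: "2 * (x t \<bullet> v t) - 2 * (v t \<bullet> w t) \<le> (1 + 3 * C) * E t" if t: "t \<in> {s..s + \<delta>}" for t
  proof -
    let ?a = "norm (x t)" and ?b = "norm (v t)"
    have "norm (w t) \<le> C * norm (z1 t - z2 t)" unfolding w_def by (rule lip[OF loc(2,4)[OF t]])
    also have "norm (z1 t - z2 t) = norm (x t, v t)" by (simp add: z1_def z2_def x_def v_def)
    also have "\<dots> \<le> ?a + ?b" by (rule norm_Pair_le)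
    finally have w: "norm (w t) \<le> C * (?a + ?b)" using r(2) by (simp add: mult_left_mono)
    have "x t \<bullet> v t \<le> ?a * ?b" by (rule norm_cauchy_schwarz)
    moreover have "- (v t \<bullet> w t) \<le> ?b * (C * (?a + ?b))"
      using Cauchy_Schwarz_ineq2[of "v t" "w t"] mult_left_mono[OF w, of ?b] by simp
    moreover have "2 * (?a * ?b) \<le> ?a\<^sup>2 + ?b\<^sup>2" using sum_squares_bound[of ?a ?b] by simp
    moreover have "2 * (?b * (?a + ?b)) \<le> 3 * (?a\<^sup>2 + ?b\<^sup>2)"
    proof -
      have "2 * (?b * (?a + ?b)) = 2 * (?a * ?b) + 2 * ?b\<^sup>2" by (simp add: algebra_simps power2_eq_square)
      also have "\<dots> \<le> (?a\<^sup>2 + ?b\<^sup>2) + 2 * ?b\<^sup>2" by (rule add_right_mono) fact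
      also have "\<dots> \<le> 3 * (?a\<^sup>2 + ?b\<^sup>2)" by simp
      finally show ?thesis .
    qed
    moreover have "E t = ?a\<^sup>2 + ?b\<^sup>2" by (simp add: E_def power2_norm_eq_inner)
    moreover have "C * (2 * (?b * (?a + ?b))) \<le> C * (3 * (?a\<^sup>2 + ?b\<^sup>2))"
      by (rule mult_left_mono[OF _ r(2)]) fact
    ultimately show ?thesis by (simp add: algebra_simps)
  qed
  have "E t = 0" if t: "t \<in> {s..s + \<delta>}" for t
  proof (rule gronwall_zero[OF dE bound _ _ t])
    show "E s = 0" using zs by (simp add: E_def x_def v_def z1_def z2_def)
  qed (simp_all add: E_def)
  then have "x t \<bullet> x t = 0 \<and> v t \<bullet> v t = 0" if "t \<in> {s..s + \<delta>}" for t
    using that unfolding E_def add_nonneg_eq_0_iff[OF inner_ge_zero inner_ge_zero] by blast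
  then have E0: "x t = 0" "v t = 0" if "t \<in> {s..s + \<delta>}" for t
    using that by simp_all
  show ?thesis
  proof (rule that[OF \<delta>(1,2)])
    fix t assume t: "t \<in> {s..s + \<delta>}"
    have \<beta>: "\<beta>1 t = \<beta>2 t" using inv[OF t] E0(1)[OF t] unfolding x_def by (metis eq_iff_diff_eq_0)
    have tI: "t \<in> {0..1}" using t sub by blast
    have "B1.vel t = B2.vel t"
      by (rule tangent_eqI[OF B1.tangent_alongD[OF B1.vel_tangent tI]
            B2.tangent_alongD[OF B2.vel_tangent tI, folded \<beta>] c(1) B1.pieceD(2)[OF loc(1)[OF t]]])
        (use E0(2)[OF t] in \<open>simp add: v_def\<close>)
    with \<beta> show "\<beta>1 t = \<beta>2 t \<and> B1.vel t = B2.vel t" by blast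
  qed
qed

text \<open>
  At the infimum of the parameters at which two geodesics differ, positions and velocities still agree, by continuity;
  local uniqueness then carries the agreement further.
\<close>

lemma geodesic_unique:
  assumes \<beta>1: "geodesic A D {0..1} \<beta>1" and \<beta>2: "geodesic A D {0..1} \<beta>2"
    and eq: "\<beta>1 0 = \<beta>2 0" "velocity A {0..1} \<beta>1 0 = velocity A {0..1} \<beta>2 0" and t: "t \<in> {0..1}"
  shows "\<beta>1 t = \<beta>2 t"
proof (rule ccontr)
  assume ne: "\<beta>1 t \<noteq> \<beta>2 t"
  have I: "fully_approachable {0..1::real}" by (rule fully_approachable_Icc) simp
  interpret B1: curve A g D "{0..1}" \<beta>1 by unfold_locales (use I \<beta>1 in \<open>auto simp: geodesic_def\<close>)
  interpret B2: curve A g D "{0..1}" \<beta>2 by unfold_locales (use I \<beta>2 in \<open>auto simp: geodesic_def\<close>)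
  define Z where "Z r \<longleftrightarrow> \<beta>1 r = \<beta>2 r \<and> B1.vel r = B2.vel r" for r
  define bad where "bad = {r\<in>{0..1}. \<not> Z r}"
  have tb: "t \<in> bad" using ne t by (simp add: bad_def Z_def)
  define s where "s = Inf bad"
  have bdd: "bdd_below bad" by (auto simp: bad_def bdd_below_def)
  have s0: "0 \<le> s" unfolding s_def using tb by (intro cInf_greatest) (auto simp: bad_def)
  have st: "s \<le> t" unfolding s_def by (rule cInf_lower[OF tb bdd])
  have good: "Z r" if "0 \<le> r" "r < s" for r
  proof (rule ccontr)
    assume "\<not> Z r"
    then have "r \<in> bad" using that st t by (auto simp: bad_def)
    from cInf_lower[OF this bdd] that show False by (simp add: s_def)
  qed
  have sI: "s \<in> {0..1}" using s0 st t by simp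
  have Zs: "Z s"
  proof (cases "s = 0")
    case True
    then show ?thesis using eq by (simp add: Z_def)
  next
    case False
    then have s: "0 < s" using s0 by simp
    let ?F = "at s within {0..<s}"
    have nb: "?F \<noteq> bot" unfolding trivial_limit_within using s by simp
    have le: "?F \<le> at s within {0..1}" by (rule at_le) (use sI in auto)
    have ev: "\<forall>\<^sub>F r in ?F. Z r" unfolding eventually_at_filter by (rule always_eventually) (use good in auto)
    have tb1: "(\<beta>1 \<longlongrightarrow> \<beta>1 s) ?F" and tb2: "(\<beta>2 \<longlongrightarrow> \<beta>2 s) ?F"
    proof -
      have "(\<beta>1 \<longlongrightarrow> \<beta>1 s) (at s within {0..1})" "(\<beta>2 \<longlongrightarrow> \<beta>2 s) (at s within {0..1})"
        using B1.\<sigma> B2.\<sigma> sI unfolding smooth_curve_on_def continuous_on_def by blast+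
      from this[THEN tendsto_mono[OF le]] show "(\<beta>1 \<longlongrightarrow> \<beta>1 s) ?F" "(\<beta>2 \<longlongrightarrow> \<beta>2 s) ?F" .
    qed
    have "(\<beta>2 \<longlongrightarrow> \<beta>1 s) ?F"
      by (rule Lim_transform_eventually[OF tb1]) (use ev in \<open>auto elim: eventually_mono simp: Z_def\<close>)
    from tendsto_unique[OF nb this tb2] have eqs: "\<beta>1 s = \<beta>2 s" .
    obtain c where c: "c \<in> A" "s \<in> B1.piece c" using sI by (rule B1.\<sigma>_chartE)
    have c2: "s \<in> B2.piece c" using c(2) eqs by (simp add: B1.piece_def B2.piece_def)
    have lim: "((\<lambda>r. B1.vel r c) \<longlongrightarrow> B1.vel s c) ?F" "((\<lambda>r. B2.vel r c) \<longlongrightarrow> B2.vel s c) ?F"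
      using has_vector_derivative_continuous[OF B1.field_along_derivative[OF B1.field_along_vel c], unfolded continuous_within,
          THEN tendsto_mono[OF le]]
        has_vector_derivative_continuous[OF B2.field_along_derivative[OF B2.field_along_vel c(1) c2], unfolded continuous_within,
          THEN tendsto_mono[OF le]] .
    have "((\<lambda>r. B2.vel r c) \<longlongrightarrow> B1.vel s c) ?F"
      by (rule Lim_transform_eventually[OF lim(1)]) (use ev in \<open>auto elim: eventually_mono simp: Z_def\<close>)
    from tendsto_unique[OF nb this lim(2)] have "B1.vel s c = B2.vel s c" .
    then have "B1.vel s = B2.vel s"
      by (rule tangent_eqI[OF B1.tangent_alongD[OF B1.vel_tangent sI]
            B2.tangent_alongD[OF B2.vel_tangent sI, folded eqs] c(1) B1.pieceD(2)[OF c(2)]])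
    with eqs show ?thesis by (simp add: Z_def)
  qed
  have "s \<noteq> t" using Zs tb by (auto simp: bad_def)
  then have s1: "s < 1" using st t by simp
  from Zs obtain \<delta> where \<delta>: "\<delta> > 0" "\<And>r. r \<in> {s..s + \<delta>} \<Longrightarrow> Z r"
    using geodesics_agree_locally[OF \<beta>1 \<beta>2 s0 s1] unfolding Z_def by metis
  have "s + \<delta> \<le> Inf bad"
  proof (rule cInf_greatest)
    show "s + \<delta> \<le> r" if r: "r \<in> bad" for r
    proof (rule ccontr)
      assume "\<not> s + \<delta> \<le> r"
      moreover have "s \<le> r" unfolding s_def by (rule cInf_lower[OF r bdd])
      ultimately have "Z r" by (intro \<delta>(2)) simp
      with r show False by (simp add: bad_def)
    qed
  qed (use tb in blast)
  then have "s + \<delta> \<le> s" by (simp add: s_def)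
  with \<delta>(1) show False by simp
qed

lemma geodesic_rescale:
  assumes \<beta>: "geodesic A D {0..1} \<beta>" and r: "r \<in> {0..1}"
  shows "geodesic A D {0..1} (\<lambda>t. \<beta> (r * t))"
    and "t \<in> {0..1} \<Longrightarrow> velocity A {0..1} (\<lambda>t. \<beta> (r * t)) t = tscale r (velocity A {0..1} \<beta> (r * t))"
proof -
  have I: "fully_approachable {0..1::real}" by (rule fully_approachable_Icc) simp
  interpret B: curve A g D "{0..1}" \<beta> by unfold_locales (use I \<beta> in \<open>auto simp: geodesic_def\<close>)
  have rt: "r * t \<in> {0..1}" if "t \<in> {0..1}" for t using r that by (simp add: mult_le_one)
  have sc: "smooth_curve_on A {0..1} (\<lambda>t. \<beta> (r * t))"
    unfolding smooth_curve_on_def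
  proof (intro conjI ballI)
    show cont: "continuous_on {0..1} (\<lambda>t. \<beta> (r * t))"
    proof (rule continuous_on_compose2[of "{0..1}" \<beta>])
      show "continuous_on {0..1} \<beta>" using B.\<sigma> by (simp add: smooth_curve_on_def)
      show "continuous_on {0..1} ((*) r)" by (intro continuous_intros)
      show "(*) r ` {0..1} \<subseteq> {0..1}" by (rule image_subsetI) (rule rt)
    qed
    show "(\<lambda>t. \<beta> (r * t)) ` {0..1} \<subseteq> points A" by (intro image_subsetI B.\<sigma>_points rt)
    fix c assume c: "c \<in> A"
    have "openin (top_of_set {0..1}) ({0..1} \<inter> (\<lambda>t. \<beta> (r * t)) -` cdom c)"
      by (rule continuous_openin_preimage_gen[OF cont open_cdom[OF compatible[OF c]]])
    then have o: "openin (top_of_set {0..1}) {t \<in> {0..1}. \<beta> (r * t) \<in> cdom c}" by (simp add: vimage_def Int_def)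
    note f = fully_approachable_openin[OF I o]
    have "smooth_on {t \<in> {0..1}. \<beta> (r * t) \<in> cdom c} (\<lambda>t. cmap c (\<beta> (r * t)))"
      by (rule smooth_on_compose[OF f B.smooth_\<sigma>[OF c] smooth_on_linear[OF f bounded_linear_mult_right]])
        (use rt in \<open>simp add: B.piece_def image_subset_iff\<close>)
    then show "smooth_on {t \<in> {0..1}. \<beta> (r * t) \<in> cdom c} (cmap c \<circ> (\<lambda>t. \<beta> (r * t)))" by (simp add: o_def)
  qed
  interpret R: curve A g D "{0..1}" "\<lambda>t. \<beta> (r * t)" by unfold_locales (use I sc in auto)
  have chain: "((\<lambda>t. f (r * t)) has_vector_derivative r *\<^sub>R f') (at t within {0..1})"
    if "(f has_vector_derivative f') (at (r * t) within {0..1})" for f :: "real \<Rightarrow> real^'n" and f' t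
  proof -
    have "(*) r ` {0..1} \<subseteq> {0..1}" by (rule image_subsetI) (rule rt)
    then have "(f has_vector_derivative f') (at (r * t) within (*) r ` {0..1})"
      using that by (rule has_vector_derivative_within_subset[rotated])
    then have "((f \<circ> (*) r) has_vector_derivative r *\<^sub>R f') (at t within {0..1})"
      by (intro vector_diff_chain_within) (auto intro!: derivative_eq_intros)
    then show ?thesis by (simp add: o_def)
  qed
  show vel: "velocity A {0..1} (\<lambda>t. \<beta> (r * t)) t = tscale r (velocity A {0..1} \<beta> (r * t))" if t: "t \<in> {0..1}" for t
  proof -
    obtain c where c: "c \<in> A" "t \<in> R.piece c" using t by (rule R.\<sigma>_chartE)
    have c': "r * t \<in> B.piece c" using R.pieceD(2)[OF c(2)] rt[OF t] by (simp add: B.piece_def)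
    show ?thesis
    proof (rule tangent_eqI[OF R.tangent_alongD[OF R.vel_tangent t]
          tangent_scale[OF B.tangent_alongD[OF B.vel_tangent rt[OF t]]] c(1) R.pieceD(2)[OF c(2)]])
      show "R.vel t c = tscale r (B.vel (r * t)) c"
        unfolding R.vel_chart[OF c] tscale_def
        by (rule vector_derivative_within_eq[OF I t chain[OF B.vel_derivative[OF c(1) c']]])
    qed
  qed
  show "geodesic A D {0..1} (\<lambda>t. \<beta> (r * t))"
    unfolding geodesic_def
  proof (intro conjI sc ballI)
    fix t :: real assume t: "t \<in> {0..1}"
    obtain c where c: "c \<in> A" "t \<in> R.piece c" using t by (rule R.\<sigma>_chartE)
    have c': "r * t \<in> B.piece c" using R.pieceD(2)[OF c(2)] rt[OF t] by (simp add: B.piece_def)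
    have g0: "B.cov B.vel t = 0" if "t \<in> {0..1}" for t using \<beta> that by (auto simp: geodesic_def)
    have "((\<lambda>t. r *\<^sub>R B.vel (r * t) c) has_vector_derivative
        r *\<^sub>R (r *\<^sub>R (- \<Gamma> c (\<beta> (r * t)) (B.vel (r * t) c) (B.vel (r * t) c)))) (at t within {0..1})"
      by (intro bounded_linear.has_vector_derivative[OF bounded_linear_scaleR_right]
          chain B.vel_coordinate_derivative[OF g0 c(1) c'])
    then have d: "((\<lambda>t. R.vel t c) has_vector_derivative
        r *\<^sub>R (r *\<^sub>R (- \<Gamma> c (\<beta> (r * t)) (B.vel (r * t) c) (B.vel (r * t) c)))) (at t within {0..1})"
      by (rule has_vector_derivative_transform[OF t, rotated]) (simp add: vel tscale_def)
    show "R.cov R.vel t = 0"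
    proof (rule tangent_eqI[OF R.cov_tangent[OF R.vel_tangent t c d] tangent_0 c(1) R.pieceD(2)[OF c(2)]])
      note b = bilinear_christoffel[OF c(1) R.pieceD(2)[OF c(2)]]
      show "R.cov R.vel t c = 0 c"
        unfolding R.cov_chart[where J = R.vel, OF c d] vel[OF t]
        by (simp add: tscale_def bilinear_lmul[OF b] bilinear_rmul[OF b])
    qed
  qed
qed

text \<open>
  \<open>exp\<close> is defined by a definite description; uniqueness of geodesics gives it its value, and rescaling the
  parameter turns rays into geodesics.
\<close>

lemma exp_map_geodesic:
  assumes "geodesic_from A D p v \<beta>" and r: "r \<in> {0..1}"
  shows "exp_map A D p (tscale r v) = \<beta> r"
proof -
  have \<beta>: "geodesic A D {0..1} \<beta>" "\<beta> 0 = p" "velocity A {0..1} \<beta> 0 = v" using assms by (auto simp: geodesic_from_def)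
  have gf: "geodesic_from A D p (tscale r v) (\<lambda>t. \<beta> (r * t))"
    unfolding geodesic_from_def using geodesic_rescale[OF \<beta>(1) r] \<beta> by simp
  show ?thesis
    unfolding exp_map_def
  proof (rule the_equality)
    show "\<exists>\<beta>'. geodesic_from A D p (tscale r v) \<beta>' \<and> \<beta>' 1 = \<beta> r" using gf by (intro exI[of _ "\<lambda>t. \<beta> (r * t)"]) simp
    fix q assume "\<exists>\<beta>'. geodesic_from A D p (tscale r v) \<beta>' \<and> \<beta>' 1 = q"
    then obtain \<beta>' where "geodesic_from A D p (tscale r v) \<beta>'" "\<beta>' 1 = q" by blast
    then show "q = \<beta> r" using geodesic_unique[of \<beta>' "\<lambda>t. \<beta> (r * t)" 1] gf by (simp add: geodesic_from_def)
  qed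
qed

end

section \<open>The geodesic submanifold and its focal points\<close>

text \<open>
  \<open>expc\<close> is the exponential map at \<open>p\<close> read in the components of tangent vectors in the chart \<open>c0\<close>, and \<open>N\<close> the
  chart of normal coordinates. \<open>\<psi>\<close> is the transition map from \<open>N\<close> to \<open>c0\<close>; its first two derivatives at \<open>0\<close> carry
  the information about \<open>exp\<close> that is used.
\<close>

locale normal_ball_segment = geodesic_segment A g D \<phi> T \<sigma>
  for A :: "('m::{t2_space,second_countable_topology}, 'n::finite) chart set" and g D \<phi> T \<sigma> +
  fixes \<epsilon> :: real
  assumes ball: "normal_ball A g D (\<sigma> 0) \<epsilon>"
begin

abbreviation p :: 'm where "p \<equiv> \<sigma> 0"

definition B :: "(real ^ 'n) set" where "B = {x. gnorm g p (coord_field A c0 x p) < \<epsilon>}"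
definition expc :: "real ^ 'n \<Rightarrow> 'm" where "expc x = exp_map A D p (coord_field A c0 x p)"
definition N :: "('m, 'n) chart" where "N = (expc ` B, inv_into B expc)"

lemma \<epsilon>: "0 < \<epsilon>" using ball by (simp add: normal_ball_def)

lemma inj_expc: "inj_on expc B" and N: "compatible_chart A N"
proof -
  note * = ball[unfolded normal_ball_def Let_def, THEN conjunct2, THEN conjunct2, rule_format, OF c0]
  show "inj_on expc B" "compatible_chart A N"
    using * unfolding N_def B_def expc_def[abs_def] by auto
qed

lemma B_iff: "x \<in> B \<longleftrightarrow> sqrt (b x x) < \<epsilon>"
  by (simp add: B_def gnorm_def b_def gc_def)

lemma B_scale: "x \<in> B \<Longrightarrow> \<bar>r\<bar> \<le> 1 \<Longrightarrow> r *\<^sub>R x \<in> B"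
proof -
  assume x: "x \<in> B" and r: "\<bar>r\<bar> \<le> 1"
  have nn: "0 \<le> sqrt (b x x)" using b_pos[of x] bilinear_lzero[OF bilinear_b] by (cases "x = 0") auto
  have "sqrt (b (r *\<^sub>R x) (r *\<^sub>R x)) = \<bar>r\<bar> * sqrt (b x x)"
    by (simp add: bilinear_lmul[OF bilinear_b] bilinear_rmul[OF bilinear_b] real_sqrt_mult mult.assoc[symmetric])
  also have "\<dots> \<le> 1 * sqrt (b x x)" by (rule mult_right_mono[OF r nn])
  also have "\<dots> < \<epsilon>" using x by (simp add: B_iff)
  finally show ?thesis unfolding B_iff .
qed

lemma B_0: "0 \<in> B" using \<epsilon> by (simp add: B_iff bilinear_lzero[OF bilinear_b])

lemma cmap_N: "x \<in> B \<Longrightarrow> cmap N (expc x) = x"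
  by (simp add: N_def inj_expc)

lemma cdom_N: "cdom N = expc ` B" by (simp add: N_def)

lemma cmap_N_cdom: "cmap N ` cdom N = B"
  unfolding cdom_N by (force simp: cmap_N)

lemma cinv_N: "x \<in> B \<Longrightarrow> cinv N x = expc x"
  using cinv_cmap[OF N, of "expc x"] cmap_N by (simp add: cdom_N)

lemma open_B: "open B" using open_cmap_cdom[OF N] by (simp add: cmap_N_cdom)

lemma small_multiple: obtains s where "s > 0" "s *\<^sub>R x \<in> B"
proof -
  obtain r where r: "r > 0" "ball 0 r \<subseteq> B" using open_B B_0 open_contains_ball by blast
  have pos: "norm x + 1 > 0" by (simp add: add_nonneg_pos)
  have "(r / (norm x + 1)) *\<^sub>R x \<in> ball 0 r"
    using r(1) pos by (simp add: divide_less_eq algebra_simps)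
  moreover have "r / (norm x + 1) > 0" using r(1) pos by simp
  ultimately show ?thesis using r(2) that by blast
qed

lemma expc_geodesic:
  assumes x: "x \<in> B"
  obtains \<beta> where "geodesic_from A D p (coord_field A c0 x p) \<beta>" "\<And>r. r \<in> {0..1} \<Longrightarrow> expc (r *\<^sub>R x) = \<beta> r"
proof -
  have "coord_field A c0 x p \<in> tangent_space A p" by (rule coord_field_in_tangent_space[OF c0])
  moreover have "gnorm g p (coord_field A c0 x p) < \<epsilon>" using x by (simp add: B_def)
  ultimately obtain \<beta> where \<beta>: "geodesic_from A D p (coord_field A c0 x p) \<beta>"
    using ball unfolding normal_ball_def by blast
  show ?thesis
  proof (rule that[OF \<beta>])
    show "expc (r *\<^sub>R x) = \<beta> r" if "r \<in> {0..1}" for r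
      using exp_map_geodesic[OF \<beta> that] by (simp add: expc_def coord_field_scale[OF c0])
  qed
qed

lemma expc_0: "expc 0 = p"
proof -
  obtain \<beta> where "geodesic_from A D p (coord_field A c0 0 p) \<beta>" "\<And>r. r \<in> {0..1} \<Longrightarrow> expc (r *\<^sub>R 0) = \<beta> r"
    using expc_geodesic[OF B_0] by blast
  from this(1) this(2)[of 0] show ?thesis by (simp add: geodesic_from_def)
qed

definition W :: "(real ^ 'n) set" where "W = {x \<in> B. expc x \<in> cdom c0}"
definition \<psi> :: "real ^ 'n \<Rightarrow> real ^ 'n" where "\<psi> x = cmap c0 (expc x)"

lemma W_eq: "cmap N ` (cdom N \<inter> cdom c0) = W"
  unfolding cdom_N W_def by (force simp: cmap_N)

lemma open_W: "open W"
  unfolding W_eq[symmetric] by (rule open_cmap_image[OF N]) (auto intro: open_cdom N compatible c0)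

lemma W_0: "0 \<in> W" using B_0 c0 by (simp add: W_def expc_0)

lemma smooth_\<psi>: "smooth_on W \<psi>"
proof (rule smooth_on_cong[OF fully_approachable_open[OF open_W]])
  show "smooth_on W (cmap c0 \<circ> cinv N)" using smooth_transition(1)[OF N c0(1)] by (simp add: W_eq)
qed (simp add: W_def \<psi>_def cinv_N)

text \<open>
  Both identities are read off from the geodesic \<open>r \<mapsto> exp(r x)\<close>: its initial velocity is \<open>x\<close>, and its second
  derivative in the chart is given by the geodesic equation.
\<close>

lemma exp_differentials_diagonal:
  assumes x: "x \<in> B"
  shows "frechet_derivative \<psi> (at 0) x = x"
    and "frechet_derivative (\<lambda>u. frechet_derivative \<psi> (at u) x) (at 0) x = - \<Gamma> c0 p x x"
proof -
  obtain \<beta> where \<beta>: "geodesic_from A D p (coord_field A c0 x p) \<beta>" and expc: "\<And>r. r \<in> {0..1} \<Longrightarrow> expc (r *\<^sub>R x) = \<beta> r"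
    using expc_geodesic[OF x] by blast
  have g: "geodesic A D {0..1} \<beta>" "\<beta> 0 = p" "velocity A {0..1} \<beta> 0 = coord_field A c0 x p"
    using \<beta> by (auto simp: geodesic_from_def)
  have I1: "fully_approachable {0..1::real}" by (rule fully_approachable_Icc) simp
  interpret C: curve A g D "{0..1}" \<beta> by unfold_locales (use I1 g in \<open>auto simp: geodesic_def\<close>)
  have W: "r *\<^sub>R x \<in> W" if "r \<in> C.piece c0" for r
    using B_scale[OF x, of r] expc[of r] C.pieceD[OF that] by (auto simp: W_def)
  have lin: "((\<lambda>r. r *\<^sub>R x) has_vector_derivative x) (at r within {0..1})" for r
    unfolding has_vector_derivative_def by (auto intro!: derivative_eq_intros)
  have vel: "C.vel r c0 = frechet_derivative \<psi> (at (r *\<^sub>R x)) x" if r: "r \<in> C.piece c0" for r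
  proof -
    have "((\<lambda>r. \<psi> (r *\<^sub>R x)) has_vector_derivative frechet_derivative \<psi> (at (r *\<^sub>R x)) x) (at r within {0..1})"
      by (rule has_derivative_compose_vector[OF lin smooth_on_open_has_derivative[OF open_W smooth_\<psi> W[OF r]]])
    then have "((\<lambda>r. cmap c0 (\<beta> r)) has_vector_derivative frechet_derivative \<psi> (at (r *\<^sub>R x)) x) (at r within {0..1})"
      by (rule has_vector_derivative_transform[OF C.pieceD(1)[OF r], rotated]) (simp add: \<psi>_def expc)
    then show ?thesis
      unfolding C.vel_chart[OF c0(1) r] by (rule vector_derivative_within_eq[OF I1 C.pieceD(1)[OF r]])
  qed
  have 0: "0 \<in> C.piece c0" using c0 g(2) by (simp add: C.piece_def)
  have v0: "C.vel 0 c0 = x" using g(3) by (simp add: coord_field_same[OF c0])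
  show "frechet_derivative \<psi> (at 0) x = x" using vel[OF 0] v0 by simp
  have cov0: "C.cov C.vel t = 0" if "t \<in> {0..1}" for t using g(1) that by (auto simp: geodesic_def)
  have w: "at 0 within {0..1} = at 0 within C.piece c0" by (rule C.eventually_piece[OF c0(1) 0])
  have "((\<lambda>r. C.vel r c0) has_vector_derivative - \<Gamma> c0 p x x) (at 0 within {0..1})"
    using C.vel_coordinate_derivative[OF cov0 c0(1) 0] v0 g(2) by simp
  then have 1: "((\<lambda>r. frechet_derivative \<psi> (at (r *\<^sub>R x)) x) has_vector_derivative - \<Gamma> c0 p x x) (at 0 within C.piece c0)"
    unfolding w by (rule has_vector_derivative_transform[OF 0, rotated]) (simp add: vel)
  have "((\<lambda>r. frechet_derivative \<psi> (at (r *\<^sub>R x)) x) has_vector_derivative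
      frechet_derivative (\<lambda>u. frechet_derivative \<psi> (at u) x) (at 0) x) (at 0 within {0..1})"
    using has_derivative_compose_vector[OF lin, of "\<lambda>u. frechet_derivative \<psi> (at u) x" _ 0]
      smooth_on_open_has_derivative[OF open_W smooth_on_open_frechet_derivative[OF open_W smooth_\<psi>] W_0] by simp
  then show "frechet_derivative (\<lambda>u. frechet_derivative \<psi> (at u) x) (at 0) x = - \<Gamma> c0 p x x"
    using 1 unfolding w
    using vector_derivative_within_eq[OF C.appr_piece[OF C.openin_piece[OF c0(1)]] 0] by metis
qed

lemma exp_differential: "frechet_derivative \<psi> (at 0) x = x"
proof -
  obtain s where s: "s > 0" "s *\<^sub>R x \<in> B" by (rule small_multiple)
  have "linear (frechet_derivative \<psi> (at 0))"
    using smooth_on_open_has_derivative[OF open_W smooth_\<psi> W_0] has_derivative_linear by blast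
  from linear_scale[OF this, of s x] exp_differentials_diagonal(1)[OF s(2)] s(1) show ?thesis by simp
qed

text \<open>
  Polarization of the preceding identity: a symmetric bilinear map that vanishes on the diagonal of a
  neighbourhood of \<open>0\<close> is zero.
\<close>

lemma exp_second_differential:
  "frechet_derivative (\<lambda>u. frechet_derivative \<psi> (at u) y) (at 0) x = - \<Gamma> c0 p x y"
proof -
  \<comment> \<open>\<open>Q\<close> is symmetric and bilinear and vanishes on the diagonal, first near \<open>0\<close> and then everywhere.\<close>
  define Q where "Q x y = frechet_derivative (\<lambda>u. frechet_derivative \<psi> (at u) y) (at 0) x + \<Gamma> c0 p x y" for x y
  note bil = bilinear_christoffel[OF c0]
  have Qsym: "Q x y = Q y x" for x y
    using second_derivative_symmetric[OF open_W W_0 smooth_\<psi>, of y x] christoffel_symmetric[OF c0, of x y]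
    by (simp add: Q_def)
  have lin: "linear (\<lambda>x. frechet_derivative (\<lambda>u. frechet_derivative \<psi> (at u) y) (at 0) x)" for y
    using smooth_on_open_has_derivative[OF open_W smooth_on_open_frechet_derivative[OF open_W smooth_\<psi>] W_0]
      has_derivative_linear by blast
  have Qadd: "Q (x + x') y = Q x y + Q x' y" and Qscale: "Q (r *\<^sub>R x) y = r *\<^sub>R Q x y" for x x' y r
    unfolding Q_def using linear_add[OF lin] linear_scale[OF lin]
    by (simp_all add: bilinear_ladd[OF bil] bilinear_lmul[OF bil] algebra_simps)
  have diag: "Q x x = 0" for x
  proof -
    obtain s where s: "s > 0" "s *\<^sub>R x \<in> B" by (rule small_multiple)
    have "Q (s *\<^sub>R x) (s *\<^sub>R x) = 0" using exp_differentials_diagonal(2)[OF s(2)] by (simp add: Q_def)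
    then have "s *\<^sub>R s *\<^sub>R Q x x = 0" using Qscale[of s x "s *\<^sub>R x"] Qscale[of s x x] Qsym[of x "s *\<^sub>R x"] by simp
    with s(1) show ?thesis by simp
  qed
  have "Q (x + y) (x + y) = Q x x + Q y x + (Q x y + Q y y)"
    using Qadd[of x y "x + y"] Qsym[of x "x + y"] Qsym[of y "x + y"] Qadd[of x y x] Qadd[of x y y] by simp
  then have "2 *\<^sub>R Q x y = 0" using diag Qsym[of x y] by (simp add: scaleR_2)
  then have "Q x y = 0" by simp
  then show ?thesis by (simp add: Q_def add_eq_0_iff2)
qed

lemma curve_exp:
  assumes x: "smooth_on {-1<..<1} x" and xB: "x ` {-1<..<1::real} \<subseteq> B"
  shows "curve A g D {-1<..<1} (\<lambda>r. expc (x r))"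
    and "r \<in> {-1<..<1} \<Longrightarrow> x r \<in> W \<Longrightarrow> (x has_vector_derivative x') (at r within {-1<..<1}) \<Longrightarrow>
      velocity A {-1<..<1} (\<lambda>r. expc (x r)) r c0 = frechet_derivative \<psi> (at (x r)) x'"
proof -
  have J: "fully_approachable {-1<..<1::real}" by (rule fully_approachable_open) simp
  have expc: "expc (x r) = cinv N (x r)" if "r \<in> {-1<..<1}" for r using cinv_N[OF subsetD[OF xB imageI[OF that]]] by simp
  have "smooth_curve_on A {-1<..<1} (\<lambda>r. expc (x r))"
    unfolding smooth_curve_on_def
  proof (intro conjI ballI)
    show cont: "continuous_on {-1<..<1} (\<lambda>r. expc (x r))"
    proof (rule continuous_on_eq)
      show "continuous_on {-1<..<1} (\<lambda>r. cinv N (x r))"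
        by (rule continuous_on_compose2[OF cont_cinv[OF N] smooth_on_continuous[OF x]]) (use xB cmap_N_cdom in auto)
    qed (simp add: expc)
    show "(\<lambda>r. expc (x r)) ` {-1<..<1} \<subseteq> points A"
      using xB cdom_points[OF N] unfolding cdom_N by blast
    fix d assume d: "d \<in> A"
    have "openin (top_of_set {-1<..<1}) ({-1<..<1} \<inter> (\<lambda>r. expc (x r)) -` cdom d)"
      by (rule continuous_openin_preimage_gen[OF cont open_cdom[OF compatible[OF d]]])
    then have o: "openin (top_of_set {-1<..<1}) {r \<in> {-1<..<1}. expc (x r) \<in> cdom d}" by (simp add: vimage_def Int_def)
    note f = fully_approachable_openin[OF J o]
    have "smooth_on {r \<in> {-1<..<1}. expc (x r) \<in> cdom d} (\<lambda>r. (cmap d \<circ> cinv N) (x r))"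
    proof (rule smooth_on_compose[OF f smooth_transition(1)[OF N d] smooth_on_subset[OF f x]])
      show "x ` {r \<in> {-1<..<1}. expc (x r) \<in> cdom d} \<subseteq> cmap N ` (cdom N \<inter> cdom d)"
      proof (rule image_subsetI)
        fix r assume r: "r \<in> {r \<in> {-1<..<1}. expc (x r) \<in> cdom d}"
        then have xr: "x r \<in> B" using xB by auto
        then have "x r = cmap N (expc (x r))" "expc (x r) \<in> cdom N \<inter> cdom d" using r by (auto simp: cmap_N cdom_N)
        then show "x r \<in> cmap N ` (cdom N \<inter> cdom d)" by (rule image_eqI)
      qed
    qed auto
    then show "smooth_on {r \<in> {-1<..<1}. expc (x r) \<in> cdom d} (cmap d \<circ> (\<lambda>r. expc (x r)))"
      by (rule smooth_on_cong[OF f]) (simp add: expc)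
  qed
  then show c: "curve A g D {-1<..<1} (\<lambda>r. expc (x r))"
    by unfold_locales (rule J)
  then interpret C: curve A g D "{-1<..<1}" "\<lambda>r. expc (x r)" .
  show "velocity A {-1<..<1} (\<lambda>r. expc (x r)) r c0 = frechet_derivative \<psi> (at (x r)) x'"
    if r: "r \<in> {-1<..<1}" "x r \<in> W" and x': "(x has_vector_derivative x') (at r within {-1<..<1})"
  proof -
    have "r \<in> C.piece c0" using r by (simp add: C.piece_def W_def)
    from C.vel_chart[OF c0(1) this] show ?thesis
      using vector_derivative_within_eq[OF J r(1)
          has_derivative_compose_vector[OF x' smooth_on_open_has_derivative[OF open_W smooth_\<psi> r(2)]]]
      by (simp add: \<psi>_def)
  qed
qed

text \<open>
  \<open>P\<close> is the geodesic submanifold perpendicular to \<open>\<sigma>'(0)\<close>. The normal \<open>n\<close> may be any vector with the same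
  orthogonal complement, such as the velocity of \<open>\<sigma>\<close> in another parametrization.
\<close>

context
  fixes n :: "('m, 'n) tvec" and P :: "'m set"
  assumes n: "\<And>v. v \<in> tangent_space A p \<Longrightarrow> g p v n = 0 \<longleftrightarrow> g p v (vel 0) = 0"
  defines "P \<equiv> geodesic_submanifold A g D p n \<epsilon>"
begin

lemma P_eq: "P = expc ` {x \<in> B. b x e = 0}"
proof -
  have *: "{v \<in> tangent_space A p. g p v n = 0 \<and> gnorm g p v < \<epsilon>} = (\<lambda>x. coord_field A c0 x p) ` {x \<in> B. b x e = 0}"
  proof -
    have be: "b x e = g p (coord_field A c0 x p) (vel 0)" for x
      using frame_metric[OF zero_in, of x e] vel_frame[OF zero_in] by (simp add: frame_0)
    have "v = coord_field A c0 (v c0) p" if "v \<in> tangent_space A p" for v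
      using tangent_coord_field[OF that c0] by simp
    then show ?thesis
      using n coord_field_in_tangent_space[OF c0] unfolding B_def be by (auto simp: image_iff) metis
  qed
  show ?thesis unfolding P_def geodesic_submanifold_def * image_image expc_def ..
qed

lemma P_coords:
  assumes "q \<in> P"
  shows "cmap N q \<in> B" "b (cmap N q) e = 0" "expc (cmap N q) = q" "q \<in> cdom N"
  using assms unfolding P_eq by (auto simp: cmap_N cdom_N)

text \<open>
  In normal coordinates \<open>P\<close> is the linear slice \<open>e\<^sup>\<bottom>\<close>, and a curve in \<open>P\<close> through \<open>p\<close> has the same velocity at
  \<open>p\<close> in both charts because the differential of \<open>\<psi>\<close> at \<open>0\<close> is the identity.
\<close>

lemma curve_in_P:
  assumes \<alpha>: "smooth_curve_on A {-1<..<1} \<alpha>" "\<alpha> ` {-1<..<1} \<subseteq> P" "\<alpha> 0 = p"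
  defines "a \<equiv> velocity A {-1<..<1} \<alpha> 0 c0"
  shows "((\<lambda>r. cmap N (\<alpha> r)) has_vector_derivative a) (at 0 within {-1<..<1})" and "b a e = 0"
proof -
  have J: "fully_approachable {-1<..<1::real}" by (rule fully_approachable_open) simp
  interpret C: curve A g D "{-1<..<1}" \<alpha> by unfold_locales fact+
  have 0: "0 \<in> C.piece c0" using \<alpha>(3) c0 by (simp add: C.piece_def)
  let ?F = "frechet_derivative (\<lambda>u. cmap N (cinv c0 u)) (at (cmap c0 p))"
  have o: "open (cmap c0 ` (cdom N \<inter> cdom c0))"
    by (rule open_cmap_image[OF compatible[OF c0(1)]]) (auto intro: open_cdom N compatible c0)
  have pN: "p \<in> cdom N" unfolding cdom_N using B_0 expc_0 by (metis imageI)
  have "((\<lambda>u. cmap N (cinv c0 u)) has_derivative ?F) (at (cmap c0 p))"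
    by (rule smooth_on_open_has_derivative[OF o])
      (use smooth_transition(2)[OF N c0(1)] pN c0 in \<open>auto simp: o_def\<close>)
  then have d: "((\<lambda>r. cmap N (\<alpha> r)) has_vector_derivative ?F a) (at 0 within {-1<..<1})"
    using C.along_derivative[OF c0(1) 0, of "cmap N" ?F] \<alpha>(3) by (simp add: a_def)
  have N0: "cmap N (\<alpha> 0) = 0" using cmap_N[OF B_0] by (simp add: \<alpha>(3) expc_0)
  have "((\<lambda>r. \<psi> (cmap N (\<alpha> r))) has_vector_derivative frechet_derivative \<psi> (at 0) (?F a)) (at 0 within {-1<..<1})"
    using has_derivative_compose_vector[OF d] smooth_on_open_has_derivative[OF open_W smooth_\<psi> W_0] N0 by simp
  then have "((\<lambda>r. cmap c0 (\<alpha> r)) has_vector_derivative ?F a) (at 0 within {-1<..<1})"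
    unfolding exp_differential
    by (rule has_vector_derivative_transform[rotated 2]) (simp_all add: \<psi>_def P_coords(3)[OF subsetD[OF \<alpha>(2) imageI]])
  then have "a = ?F a"
    unfolding a_def C.vel_chart[OF c0(1) 0] by (rule vector_derivative_within_eq[OF J, rotated]) simp
  with d show da: "((\<lambda>r. cmap N (\<alpha> r)) has_vector_derivative a) (at 0 within {-1<..<1})" by simp
  have "((\<lambda>r. b (cmap N (\<alpha> r)) e) has_vector_derivative b a e) (at 0 within {-1<..<1})"
    using b_derivative[OF da, of e] by (simp add: has_real_derivative_iff_has_vector_derivative)
  moreover have "((\<lambda>r. b (cmap N (\<alpha> r)) e) has_vector_derivative 0) (at 0 within {-1<..<1})"
    by (rule has_vector_derivative_transform[where f = "\<lambda>r. 0"]) (simp_all add: P_coords(2)[OF subsetD[OF \<alpha>(2) imageI]])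
  ultimately show "b a e = 0"
    using vector_derivative_within_eq[OF J, of 0 "\<lambda>r. b (cmap N (\<alpha> r)) e" "b a e"]
      vector_derivative_within_eq[OF J, of 0 "\<lambda>r. b (cmap N (\<alpha> r)) e" 0] by simp
qed

lemma tangent_P:
  assumes "w \<in> tangent_space_of A P p"
  shows "b (w c0) e = 0" "w \<in> tangent_space A p"
proof -
  obtain \<alpha> where \<alpha>: "w = velocity A {-1<..<1} \<alpha> 0" "smooth_curve_on A {-1<..<1} \<alpha>" "\<alpha> ` {-1<..<1} \<subseteq> P" "\<alpha> 0 = p"
    using assms unfolding tangent_space_of_def by blast
  show "b (w c0) e = 0" unfolding \<alpha>(1) by (rule curve_in_P(2)[OF \<alpha>(2-4)])
  have J: "fully_approachable {-1<..<1::real}" by (rule fully_approachable_open) simp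
  interpret C: curve A g D "{-1<..<1}" \<alpha> by unfold_locales fact+
  show "w \<in> tangent_space A p" using C.tangent_alongD[OF C.vel_tangent, of 0] \<alpha> by simp
qed

text \<open>
  Straight segments of the slice are mapped to curves in \<open>P\<close>. Only a positive multiple of the vector is
  obtained, because the segment has to stay in the ball during the parameter interval \<open>(-1, 1)\<close>.
\<close>

lemma segment_tangent:
  assumes y: "y \<in> W" "b y e = 0" and w: "b w e = 0"
  obtains s where "s > 0"
    "tscale s (coord_field A c0 (frechet_derivative \<psi> (at y) w) (expc y)) \<in> tangent_space_of A P (expc y)"
proof -
  have yB: "y \<in> B" and yc: "expc y \<in> cdom c0" using y by (auto simp: W_def)
  obtain r where r: "r > 0" "ball y r \<subseteq> B" using open_B yB open_contains_ball by blast
  define s where "s = r / (norm w + 1)"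
  have nw: "norm w + 1 > 0" using norm_ge_zero[of w] by linarith
  have s: "s > 0" using r nw by (simp add: s_def)
  define x where "x u = y + u *\<^sub>R (s *\<^sub>R w)" for u :: real
  have J: "fully_approachable {-1<..<1::real}" by (rule fully_approachable_open) simp
  have xB: "x u \<in> B" if "u \<in> {-1<..<1}" for u
  proof -
    have "dist y (x u) = \<bar>u\<bar> * (s * norm w)" using s by (simp add: x_def dist_norm abs_mult)
    also have "\<dots> \<le> 1 * (s * norm w)" using that s by (intro mult_right_mono) auto
    also have "\<dots> < s * (norm w + 1)" using s by (simp add: algebra_simps)
    also have "\<dots> = r" using nw by (simp add: s_def)
    finally show ?thesis using r(2) by auto
  qed
  have xe: "b (x u) e = 0" for u
    by (simp add: x_def bilinear_ladd[OF bilinear_b] bilinear_lmul[OF bilinear_b] y w)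
  have sm: "smooth_on {-1<..<1} x"
    unfolding x_def[abs_def]
    by (intro smooth_on_add[OF J] smooth_on_const[OF J] smooth_on_scaleR[OF J] smooth_on_linear[OF J bounded_linear_ident])
  have dx: "(x has_vector_derivative s *\<^sub>R w) (at 0 within {-1<..<1})"
    unfolding x_def[abs_def] has_vector_derivative_def by (auto intro!: derivative_eq_intros)
  interpret C: curve A g D "{-1<..<1}" "\<lambda>r. expc (x r)" by (rule curve_exp(1)[OF sm]) (use xB in auto)
  have x0: "x 0 = y" by (simp add: x_def)
  have v: "C.vel 0 c0 = s *\<^sub>R frechet_derivative \<psi> (at y) w"
    using curve_exp(2)[OF sm _ _ _ dx] xB y x0
      linear_scale[OF has_derivative_linear[OF smooth_on_open_has_derivative[OF open_W smooth_\<psi> y(1)]]]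
    by (auto simp: image_subset_iff)
  have vT: "C.vel 0 \<in> tangent_space A (expc y)" using C.tangent_alongD[OF C.vel_tangent, of 0] x0 by simp
  have "C.vel 0 = tscale s (coord_field A c0 (frechet_derivative \<psi> (at y) w) (expc y))"
    by (rule tangent_eqI[OF vT tangent_scale[OF coord_field_in_tangent_space[OF c0(1) yc]] c0(1) yc])
      (simp add: v tscale_def coord_field_same[OF c0(1) yc])
  moreover have "C.vel 0 \<in> tangent_space_of A P (expc y)"
    unfolding tangent_space_of_def
    using C.\<sigma> xB xe x0 unfolding P_eq by (auto intro!: exI[of _ "\<lambda>r. expc (x r)"])
  ultimately show ?thesis using s by (intro that[of s]) simp_all
qed

text \<open>
  The second fundamental form of \<open>P\<close> vanishes at \<open>p\<close>. A vector \<open>w\<close> tangent to \<open>P\<close> is extended along \<open>\<alpha>\<close> by the field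
  \<open>X\<close> of vectors \<open>D\<psi>(y) w\<close>, which are tangent to \<open>P\<close>. The derivative of \<open>D\<psi>\<close> at \<open>0\<close> is \<open>- \<Gamma>\<close>, so the covariant
  derivative of \<open>X\<close> vanishes at \<open>0\<close>, and differentiating \<open>g(\<zeta>, X) = 0\<close> gives the claim.
\<close>

lemma normal_field_derivative:
  assumes \<alpha>: "smooth_curve_on A {-1<..<1} \<alpha>" "\<alpha> ` {-1<..<1} \<subseteq> P" "\<alpha> 0 = p"
    and \<zeta>: "field_along A {-1<..<1} \<alpha> \<zeta>"
    and normal: "\<And>r w. r \<in> {-1<..<1} \<Longrightarrow> w \<in> tangent_space_of A P (\<alpha> r) \<Longrightarrow> g (\<alpha> r) (\<zeta> r) w = 0"
    and w: "w \<in> tangent_space_of A P p"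
  shows "g p (cov_deriv A D {-1<..<1} \<alpha> \<zeta> 0) w = 0"
proof -
  have J: "fully_approachable {-1<..<1::real}" by (rule fully_approachable_open) simp
  interpret C: curve A g D "{-1<..<1}" \<alpha> by unfold_locales fact+
  have I0: "0 \<in> {-1<..<1::real}" by simp
  have 0: "0 \<in> C.piece c0" using \<alpha>(3) c0 by (simp add: C.piece_def)
  define y where "y r = cmap N (\<alpha> r)" for r
  define a where "a = C.vel 0 c0"
  define w0 where "w0 = w c0"
  note wT = tangent_P(2)[OF w]
  have w0: "b w0 e = 0" unfolding w0_def by (rule tangent_P(1)[OF w])
  have dy: "(y has_vector_derivative a) (at 0 within {-1<..<1})"
    unfolding y_def[abs_def] a_def by (rule curve_in_P(1)[OF \<alpha>])
  have y0: "y 0 = 0" using cmap_N[OF B_0] by (simp add: y_def \<alpha>(3) expc_0)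
  have y: "expc (y r) = \<alpha> r" "y r \<in> B" "b (y r) e = 0" if "r \<in> {-1<..<1}" for r
    using P_coords[OF subsetD[OF \<alpha>(2) imageI[OF that]]] by (simp_all add: y_def)
  have yW: "y r \<in> W" if "r \<in> C.piece c0" for r
    using y[OF C.pieceD(1)[OF that]] C.pieceD(2)[OF that] by (simp add: W_def)
  \<comment> \<open>The extension lives in the chart \<open>c0\<close>; elsewhere it has the default value \<open>0\<close>.\<close>
  define X where "X r = (if r \<in> C.piece c0 then coord_field A c0 (frechet_derivative \<psi> (at (y r)) w0) (\<alpha> r) else 0)" for r
  have XT: "C.tangent_along X"
    unfolding C.tangent_along_def
  proof
    fix r
    show "X r \<in> tangent_space A (\<alpha> r)"
      by (cases "r \<in> C.piece c0")
        (simp_all add: X_def tangent_0 coord_field_in_tangent_space[OF c0(1) C.pieceD(2)])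
  qed
  have "((\<lambda>r. frechet_derivative \<psi> (at (y r)) w0) has_vector_derivative
      frechet_derivative (\<lambda>u. frechet_derivative \<psi> (at u) w0) (at 0) a) (at 0 within {-1<..<1})"
    using has_derivative_compose_vector[OF dy, of "\<lambda>u. frechet_derivative \<psi> (at u) w0"]
      smooth_on_open_has_derivative[OF open_W smooth_on_open_frechet_derivative[OF open_W smooth_\<psi>] W_0] y0 by simp
  then have dX: "((\<lambda>r. X r c0) has_vector_derivative - \<Gamma> c0 p a w0) (at 0 within {-1<..<1})"
    unfolding exp_second_differential C.eventually_piece[OF c0(1) 0]
    by (rule has_vector_derivative_transform[OF 0, rotated]) (simp add: X_def coord_field_same[OF c0(1)] C.pieceD(2))
  have X0: "X 0 = w"
    unfolding X_def if_P[OF 0] y0 exp_differential w0_def \<alpha>(3) by (rule tangent_coord_field[OF wT c0])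
  have covX: "C.cov X 0 = 0"
  proof (rule tangent_eqI[OF C.cov_tangent[OF XT I0 c0(1) 0 dX] tangent_0 c0(1) C.pieceD(2)[OF 0]])
    show "C.cov X 0 c0 = 0 c0"
      unfolding C.cov_chart[where J = X, OF c0(1) 0 dX] by (simp add: X0 a_def w0_def \<alpha>(3))
  qed
  have \<zeta>T: "C.tangent_along \<zeta>" by (rule C.field_along_tangent[OF \<zeta>])
  have "((\<lambda>r. g (\<alpha> r) (\<zeta> r) (X r)) has_vector_derivative
      g (\<alpha> 0) (C.cov \<zeta> 0) (X 0) + g (\<alpha> 0) (\<zeta> 0) (C.cov X 0)) (at 0 within {-1<..<1})"
    by (rule C.metric_derivative_weak[OF \<zeta>T XT c0(1) 0 C.field_along_derivative[OF \<zeta> c0(1) 0] dX])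
  then have d: "((\<lambda>r. g (\<alpha> r) (\<zeta> r) (X r)) has_vector_derivative g p (C.cov \<zeta> 0) w) (at 0 within {-1<..<1})"
    using g_zero_right[OF C.\<sigma>_points[OF I0] C.tangent_alongD[OF \<zeta>T I0]] by (simp add: covX X0 \<alpha>(3))
  have z: "g (\<alpha> r) (\<zeta> r) (X r) = 0" if r: "r \<in> C.piece c0" for r
  proof -
    note rI = C.pieceD(1)[OF r]
    obtain s where s: "s > 0"
      "tscale s (coord_field A c0 (frechet_derivative \<psi> (at (y r)) w0) (expc (y r))) \<in> tangent_space_of A P (expc (y r))"
      by (rule segment_tangent[OF yW[OF r] y(3)[OF rI] w0])
    have "tscale s (X r) \<in> tangent_space_of A P (\<alpha> r)"
      using s(2) unfolding X_def if_P[OF r] y(1)[OF rI] .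
    from normal[OF rI this] have "s * g (\<alpha> r) (\<zeta> r) (X r) = 0"
      using g_scale_right[OF C.\<sigma>_points[OF rI] C.tangent_alongD[OF \<zeta>T rI] C.tangent_alongD[OF XT rI]] by simp
    then show ?thesis using s(1) by simp
  qed
  have d0: "((\<lambda>r. g (\<alpha> r) (\<zeta> r) (X r)) has_vector_derivative 0) (at 0 within {-1<..<1})"
    unfolding C.eventually_piece[OF c0(1) 0]
    by (rule has_vector_derivative_transform[OF 0, where f = "\<lambda>r. 0"]) (simp_all add: z)
  show ?thesis
    using vector_derivative_within_eq[OF J I0 d] vector_derivative_within_eq[OF J I0 d0] by (rule trans[OF sym])
qed

text \<open>
  Since the second fundamental form vanishes at \<open>p\<close>, a perpendicular Jacobi field with derivative \<open>0\<close> at \<open>0\<close>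
  is a \<open>P\<close>-Jacobi field, so a zero of it would be a focal point.
\<close>

lemma nonvanishing_without_focal_points:
  assumes no_focal: "\<And>t. t \<in> {0<..T} \<Longrightarrow> \<not> focal_point A g D P {0..T} \<sigma> t"
    and k: "\<And>t. t \<in> {0..T} \<Longrightarrow> (k has_vector_derivative k' t) (at t within {0..T})"
    and k': "\<And>t. t \<in> {0..T} \<Longrightarrow> (k' has_vector_derivative - Rop t (k t)) (at t within {0..T})"
    and k0: "k' 0 = 0" "k 0 \<noteq> 0" "b (k 0) e = 0" and t: "t \<in> {0..T}"
  shows "k t \<noteq> 0"
proof
  assume kt: "k t = 0"
  then have "t \<noteq> 0" using k0(2) by metis
  then have t': "t \<in> {0<..T}" using t by auto
  \<comment> \<open>The field is scaled so that its initial value lies in the normal ball.\<close>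
  obtain s where s: "s > 0" "s *\<^sub>R k 0 \<in> B" by (rule small_multiple)
  define K where "K r = frame r (s *\<^sub>R k r)" for r
  have dk: "((\<lambda>t. s *\<^sub>R k t) has_vector_derivative s *\<^sub>R k' t) (at t within {0..T})" if "t \<in> {0..T}" for t
    by (rule bounded_linear.has_vector_derivative[OF bounded_linear_scaleR_right k[OF that]])
  have dk': "((\<lambda>t. s *\<^sub>R k' t) has_vector_derivative - Rop t (s *\<^sub>R k t)) (at t within {0..T})" if "t \<in> {0..T}" for t
    using bounded_linear.has_vector_derivative[OF bounded_linear_scaleR_right k'[OF that], of s]
      linear_scale[OF linear_Rop[OF that]] by simp
  have jac: "jacobi_field A D {0..T} \<sigma> K"
    unfolding K_def[abs_def] by (rule jacobi_of_solution(1)[OF dk dk'])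
  have cov0: "cov K 0 = frame 0 (s *\<^sub>R k' 0)"
    unfolding K_def[abs_def] by (rule jacobi_of_solution(2)[OF dk dk' zero_in])
  have "cov K 0 = 0" unfolding cov0 k0(1) by (rule ext) (simp add: frame_chart)
  have se: "b (s *\<^sub>R k 0) e = 0" by (simp add: bilinear_lmul[OF bilinear_b] k0(3))
  have K0: "K 0 = coord_field A c0 (s *\<^sub>R k 0) p" by (simp add: K_def frame_0)
  have K0T: "K 0 \<in> tangent_space_of A P p"
  proof -
    have J: "fully_approachable {-1<..<1::real}" by (rule fully_approachable_open) simp
    define x where "x u = u *\<^sub>R (s *\<^sub>R k 0)" for u :: real
    have xB: "x u \<in> B" if "u \<in> {-1<..<1}" for u
      unfolding x_def by (rule B_scale[OF s(2)]) (use that in auto)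
    have sm: "smooth_on {-1<..<1} x"
      unfolding x_def[abs_def]
      by (intro smooth_on_const[OF J] smooth_on_scaleR[OF J] smooth_on_linear[OF J bounded_linear_ident])
    have dx: "(x has_vector_derivative s *\<^sub>R k 0) (at 0 within {-1<..<1})"
      unfolding x_def[abs_def] has_vector_derivative_def by (auto intro!: derivative_eq_intros)
    interpret C: curve A g D "{-1<..<1}" "\<lambda>r. expc (x r)" by (rule curve_exp(1)[OF sm]) (use xB in auto)
    have x0: "x 0 = 0" by (simp add: x_def)
    have v: "C.vel 0 c0 = s *\<^sub>R k 0"
    proof -
      have "x ` {-1<..<1} \<subseteq> B" using xB by blast
      moreover have "x 0 \<in> W" by (simp add: x0 W_0)
      ultimately show ?thesis using curve_exp(2)[OF sm _ _ _ dx] by (simp add: x0 exp_differential)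
    qed
    have vT: "C.vel 0 \<in> tangent_space A p" using C.tangent_alongD[OF C.vel_tangent, of 0] x0 expc_0 by simp
    have "C.vel 0 = K 0"
      unfolding K0
      by (rule tangent_eqI[OF vT coord_field_in_tangent_space[OF c0] c0]) (simp add: v coord_field_same[OF c0])
    moreover have "C.vel 0 \<in> tangent_space_of A P p"
      unfolding tangent_space_of_def
    proof (intro CollectI exI[of _ "\<lambda>r. expc (x r)"] conjI refl)
      show "smooth_curve_on A {-1<..<1} (\<lambda>r. expc (x r))" by (rule C.\<sigma>)
      show "expc (x 0) = p" by (simp add: x0 expc_0)
      have "b (x u) e = 0" for u by (simp add: x_def bilinear_lmul[OF bilinear_b] k0(3))
      then show "(\<lambda>r. expc (x r)) ` {-1<..<1} \<subseteq> P"
        unfolding P_eq using xB by (intro image_subsetI imageI) simp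
    qed
    ultimately show ?thesis by simp
  qed
  have "P_jacobi_field A g D P {0..T} \<sigma> K"
    unfolding P_jacobi_field_def
  proof (intro conjI jac K0T allI impI ballI)
    fix \<alpha> \<zeta> w
    assume *: "smooth_curve_on A {-1<..<1} \<alpha> \<and> \<alpha> ` {-1<..<1} \<subseteq> P \<and> \<alpha> 0 = p \<and>
        velocity A {-1<..<1} \<alpha> 0 = K 0 \<and> field_along A {-1<..<1} \<alpha> \<zeta> \<and> \<zeta> 0 = vel 0 \<and>
        (\<forall>r\<in>{-1<..<1}. \<forall>w\<in>tangent_space_of A P (\<alpha> r). g (\<alpha> r) (\<zeta> r) w = 0)"
      and w: "w \<in> tangent_space_of A P p"
    have "g p (cov_deriv A D {-1<..<1} \<alpha> \<zeta> 0) w = 0"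
      by (rule normal_field_derivative[OF conjunct1[OF *] conjunct1[OF conjunct2[OF *]]
            conjunct1[OF conjunct2[OF conjunct2[OF *]]]
            conjunct1[OF conjunct2[OF conjunct2[OF conjunct2[OF conjunct2[OF *]]]]] _ w])
        (rule *[THEN conjunct2, THEN conjunct2, THEN conjunct2, THEN conjunct2, THEN conjunct2, THEN conjunct2, rule_format])
    moreover have "g p (cov K 0) w = 0"
      unfolding \<open>cov K 0 = 0\<close> by (rule g_zero_left[OF \<sigma>_points[OF zero_in] tangent_P(2)[OF w]])
    ultimately show "g p (cov K 0) w = g p (cov_deriv A D {-1<..<1} \<alpha> \<zeta> 0) w" by simp
  qed
  moreover have "K 0 \<noteq> 0"
  proof
    assume "K 0 = 0"
    then have "s *\<^sub>R k 0 = 0" unfolding K_def by (rule frame_eq_0[OF zero_in])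
    with s(1) k0(2) show False by simp
  qed
  moreover have "K t = 0" unfolding K_def kt by (rule ext) (simp add: frame_chart)
  ultimately have "focal_point A g D P {0..T} \<sigma> t" unfolding focal_point_def
    using zero_in by (intro exI[of _ K] conjI bexI[of _ 0])
  with no_focal[OF t'] show False by simp
qed

end

end

section \<open>A comparison theorem for second-order systems\<close>

lemma bilinear_has_vector_derivative:
  fixes B :: "'a::euclidean_space \<Rightarrow> 'b::euclidean_space \<Rightarrow> real"
  assumes "bilinear B" "(f has_vector_derivative f') (at x within S)" "(g has_vector_derivative g') (at x within S)"
  shows "((\<lambda>t. B (f t) (g t)) has_real_derivative B f' (g x) + B (f x) g') (at x within S)"
proof -
  have "((\<lambda>t. B (f t) (g t)) has_vector_derivative B (f x) g' + B f' (g x)) (at x within S)"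
    by (rule bounded_bilinear.has_vector_derivative[OF bilinear_conv_bounded_bilinear[THEN iffD1, OF assms(1)] assms(2,3)])
  then show ?thesis by (simp add: has_real_derivative_iff_has_vector_derivative add.commute)
qed

text \<open>
  With Cramer's rule this shows that the solution of a linear system depends differentiably on its matrix.
\<close>

lemma det_differentiable:
  fixes M :: "real \<Rightarrow> real ^ 'n ^ 'n"
  assumes "\<And>i j. (\<lambda>s. M s $ i $ j) differentiable (at x within S)"
  shows "(\<lambda>s. det (M s)) differentiable (at x within S)"
proof -
  define d where "d i j = frechet_derivative (\<lambda>s. M s $ i $ j) (at x within S)" for i j
  have d: "((\<lambda>s. M s $ i $ j) has_derivative d i j) (at x within S)" for i j
    unfolding d_def using assms by (simp add: frechet_derivative_works)
  have "(\<lambda>s. of_int (sign p) * (\<Prod>i\<in>UNIV. M s $ i $ p i)) differentiable (at x within S)" for p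
    unfolding differentiable_def
    by (rule exI) (rule has_derivative_mult[OF has_derivative_const has_derivative_prod[OF d]])
  then show ?thesis unfolding det_def by (intro differentiable_sum) auto
qed

lemma linear_system_solution_differentiable:
  fixes M :: "real \<Rightarrow> real ^ 'n ^ 'n"
  assumes M: "\<And>i j s. s \<in> S \<Longrightarrow> (\<lambda>s. M s $ i $ j) differentiable (at s within S)"
    and det: "\<And>s. s \<in> S \<Longrightarrow> det (M s) \<noteq> 0"
  obtains x where "\<And>s. s \<in> S \<Longrightarrow> M s *v x s = v" "\<And>s. s \<in> S \<Longrightarrow> x differentiable (at s within S)"
proof -
  define x where "x s = (\<chi> k. det (\<chi> i j. if j = k then v $ i else M s $ i $ j) / det (M s))" for s
  have "M s *v x s = v" if "s \<in> S" for s
    by (rule cramer[OF det[OF that], THEN iffD2]) (simp only: x_def)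
  moreover have "x differentiable (at s within S)" if s: "s \<in> S" for s
  proof -
    have "(\<lambda>s. det (\<chi> i j. if j = k then v $ i else M s $ i $ j) / det (M s)) differentiable (at s within S)" for k
    proof (rule differentiable_divide[OF det_differentiable det_differentiable[OF M[OF s]] det[OF s]])
      show "(\<lambda>s. (\<chi> i j. if j = k then v $ i else M s $ i $ j) $ i $ j) differentiable at s within S" for i j
        using M[OF s, of i j] by (cases "j = k") simp_all
    qed
    then have xk: "(\<lambda>s. x s $ k) differentiable (at s within S)" for k by (simp add: x_def)
    define d where "d k = frechet_derivative (\<lambda>s. x s $ k) (at s within S)" for k
    have d: "((\<lambda>s. x s $ k) has_derivative d k) (at s within S)" for k
      unfolding d_def using xk by (simp add: frechet_derivative_works)
    have "(x has_derivative (\<lambda>h. \<chi> k. d k h)) (at s within S)"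
      unfolding has_derivative_componentwise_within[of x]
    proof
      fix i :: "real ^ 'n" assume "i \<in> Basis"
      then obtain k where i: "i = axis k 1" unfolding Basis_vec_def by auto
      show "((\<lambda>s. x s \<bullet> i) has_derivative (\<lambda>h. (\<chi> k. d k h) \<bullet> i)) (at s within S)"
        using d[of k] by (simp add: i inner_axis)
    qed
    then show ?thesis by (auto simp: differentiable_def)
  qed
  ultimately show ?thesis by (rule that)
qed

text \<open>
  Solutions of \<open>y'' = - R y\<close> whose logarithmic derivative at \<open>0\<close> is that of the positive function \<open>h\<close>. The
  quantity \<open>h y' - h' y\<close> vanishes at \<open>0\<close> and measures the growth of \<open>y\<close> relative to \<open>h\<close>. The derivatives
  are separate functions \<open>y'\<close>, \<open>h'\<close>, \<open>h''\<close>, because they are one-sided at the end points.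
\<close>

locale sturm_comparison =
  fixes b :: "real ^ 'n \<Rightarrow> real ^ 'n \<Rightarrow> real" and R :: "real \<Rightarrow> real ^ 'n \<Rightarrow> real ^ 'n"
    and h h' h'' :: "real \<Rightarrow> real" and a :: real
  assumes a: "0 < a" and bil: "bilinear b" and b_sym: "b x y = b y x" and pos: "x \<noteq> 0 \<Longrightarrow> b x x > 0"
    and R_sym: "s \<in> {0..a} \<Longrightarrow> b (R s x) y = b (R s y) x" and R_lin: "s \<in> {0..a} \<Longrightarrow> linear (R s)"
    and h_pos: "s \<in> {0..a} \<Longrightarrow> h s > 0"
    and h_deriv: "s \<in> {0..a} \<Longrightarrow> (h has_real_derivative h' s) (at s within {0..a})"
    and h'_deriv: "s \<in> {0..a} \<Longrightarrow> (h' has_real_derivative h'' s) (at s within {0..a})"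
begin

definition solution :: "(real \<Rightarrow> real ^ 'n) \<Rightarrow> (real \<Rightarrow> real ^ 'n) \<Rightarrow> bool" where
  "solution y y' \<longleftrightarrow> (\<forall>s\<in>{0..a}. (y has_vector_derivative y' s) (at s within {0..a}) \<and>
      (y' has_vector_derivative - R s (y s)) (at s within {0..a})) \<and> h 0 *\<^sub>R y' 0 = h' 0 *\<^sub>R y 0"

definition conormal :: "(real \<Rightarrow> real ^ 'n) \<Rightarrow> (real \<Rightarrow> real ^ 'n) \<Rightarrow> real \<Rightarrow> real ^ 'n" where
  "conormal y y' s = h s *\<^sub>R y' s - h' s *\<^sub>R y s"

lemma conormal_derivative:
  assumes "solution y y'" "s \<in> {0..a}"
  shows "(conormal y y' has_vector_derivative - (h s *\<^sub>R R s (y s)) - h'' s *\<^sub>R y s) (at s within {0..a})"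
proof -
  have d: "(y has_vector_derivative y' s) (at s within {0..a})" "(y' has_vector_derivative - R s (y s)) (at s within {0..a})"
    using assms by (auto simp: solution_def)
  have "(conormal y y' has_vector_derivative (h s *\<^sub>R (- R s (y s)) + h' s *\<^sub>R y' s) - (h' s *\<^sub>R y' s + h'' s *\<^sub>R y s)) (at s within {0..a})"
    unfolding conormal_def[abs_def]
    by (intro has_vector_derivative_diff has_vector_derivative_scaleR h_deriv h'_deriv d assms)
  then show ?thesis by simp
qed

text \<open>
  The Wronskian \<open>b(y', z) - b(y, z')\<close> is constant because \<open>R\<close> is symmetric, and it vanishes at \<open>0\<close> because both
  solutions satisfy the same initial condition.
\<close>

lemma wronskian_vanishes:
  assumes y: "solution y y'" and z: "solution z z'" and s: "s \<in> {0..a}"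
  shows "b (conormal y y' s) (z s) = b (y s) (conormal z z' s)"
proof -
  have a0: "0 \<in> {0..a}" using s by simp
  have "b (conormal y y' s) (z s) - b (y s) (conormal z z' s) = h s * (b (y' s) (z s) - b (y s) (z' s))"
    by (simp add: conormal_def bilinear_lsub[OF bil] bilinear_rsub[OF bil] bilinear_lmul[OF bil] bilinear_rmul[OF bil] algebra_simps)
  also have "b (y' s) (z s) - b (y s) (z' s) = b (y' 0) (z 0) - b (y 0) (z' 0)"
  proof (rule constant_within[OF _ s])
    fix r assume r: "r \<in> {0..a}"
    have d: "(y has_vector_derivative y' r) (at r within {0..a})" "(y' has_vector_derivative - R r (y r)) (at r within {0..a})"
      "(z has_vector_derivative z' r) (at r within {0..a})" "(z' has_vector_derivative - R r (z r)) (at r within {0..a})"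
      using y z r by (auto simp: solution_def)
    have eq: "b (- R r (y r)) (z r) + b (y' r) (z' r) - (b (y' r) (z' r) + b (y r) (- R r (z r))) = 0"
      using R_sym[OF r, of "y r" "z r"] b_sym[of "y r" "R r (z r)"]
      by (simp add: bilinear_lneg[OF bil] bilinear_rneg[OF bil])
    have "((\<lambda>s. b (y' s) (z s) - b (y s) (z' s)) has_real_derivative
        b (- R r (y r)) (z r) + b (y' r) (z' r) - (b (y' r) (z' r) + b (y r) (- R r (z r)))) (at r within {0..a})"
      by (intro DERIV_diff bilinear_has_vector_derivative[OF bil] d)
    then show "((\<lambda>s. b (y' s) (z s) - b (y s) (z' s)) has_real_derivative 0) (at r within {0..a})"
      unfolding eq .
  qed
  also have "\<dots> = 0"
  proof -
    have e: "h 0 *\<^sub>R y' 0 = h' 0 *\<^sub>R y 0" "h 0 *\<^sub>R z' 0 = h' 0 *\<^sub>R z 0"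
      using y z by (simp_all add: solution_def)
    have "h 0 * (b (y' 0) (z 0) - b (y 0) (z' 0)) = b (h 0 *\<^sub>R y' 0) (z 0) - b (y 0) (h 0 *\<^sub>R z' 0)"
      by (simp add: bilinear_lmul[OF bil] bilinear_rmul[OF bil] algebra_simps)
    also have "\<dots> = 0" unfolding e by (simp add: bilinear_lmul[OF bil] bilinear_rmul[OF bil])
    finally show ?thesis using h_pos[OF a0] by simp
  qed
  finally show ?thesis by simp
qed

text \<open>
  The vectors \<open>y j s\<close> are the columns of an invertible matrix \<open>M(s)\<close>. Let \<open>U = M' M\<^sup>-\<^sup>1 - h'/h\<close>, which
  is symmetric by the Wronskian identity, and fix the normal vector \<open>v = z(s)\<close>. Then \<open>q = h\<^sup>2 b(U v, v)\<close>
  satisfies \<open>q' = - h (h b(R v, v) + h'' b(v, v)) - |h U v|\<^sup>2 \<le> 0\<close> and \<open>q(0) = 0\<close>, while \<open>q(s) \<le> 0\<close> is the claim at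
  \<open>s\<close>. With \<open>x = M\<^sup>-\<^sup>1 v\<close> and \<open>C c = \<Sum> c\<^sub>j (h y\<^sub>j' - h' y\<^sub>j)\<close> one has \<open>h U v = C x\<close>, so that it suffices to
  differentiate \<open>x\<close>. Since \<open>v\<close> is kept fixed, the inequality on \<open>R\<close> is applied to this one element of \<open>V\<close> at all
  parameters.
\<close>

lemma conormal_nonpositive:
  fixes y y' :: "'n \<Rightarrow> real \<Rightarrow> real ^ 'n"
  assumes y: "\<And>j. solution (y j) (y' j)"
    and inj: "\<And>s c. s \<in> {0..a} \<Longrightarrow> (\<Sum>j\<in>UNIV. c $ j *\<^sub>R y j s) = 0 \<Longrightarrow> c = (0 :: real ^ 'n)"
    and z: "solution z z'" and z_V: "\<And>s. s \<in> {0..a} \<Longrightarrow> z s \<in> V"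
    and super: "\<And>s v. s \<in> {0..a} \<Longrightarrow> v \<in> V \<Longrightarrow> 0 \<le> h s * b (R s v) v + h'' s * b v v"
    and s: "s \<in> {0..a}"
  shows "b (conormal z z' s) (z s) \<le> 0"
proof -
  define M where "M s = (\<chi> i j. y j s $ i)" for s
  have Mv: "M s *v c = (\<Sum>j\<in>UNIV. c $ j *\<^sub>R y j s)" for s c
    by (simp add: M_def vec_eq_iff matrix_vector_mult_def mult.commute)
  have dy: "(y j has_vector_derivative y' j r) (at r within {0..a})" if "r \<in> {0..a}" for j r
    using y[of j] that by (simp add: solution_def)
  have det: "det (M r) \<noteq> 0" if "r \<in> {0..a}" for r
  proof -
    have "\<forall>c. M r *v c = 0 \<longrightarrow> c = 0" unfolding Mv using inj[OF that] by blast
    then have "invertible (M r)"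
      unfolding invertible_left_inverse matrix_left_invertible_ker .
    then show ?thesis by (simp add: invertible_det_nz)
  qed
  have diff: "(\<lambda>s. M s $ i $ j) differentiable (at r within {0..a})" if "r \<in> {0..a}" for i j r
  proof -
    have "((\<lambda>s. y j s $ i) has_vector_derivative y' j r $ i) (at r within {0..a})"
      by (rule bounded_linear.has_vector_derivative[OF bounded_linear_vec_nth dy[OF that]])
    then show ?thesis by (auto simp: M_def intro: differentiableI_vector)
  qed
  define v where "v = z s"
  have vV: "v \<in> V" unfolding v_def by (rule z_V[OF s])
  obtain x where x: "\<And>r. r \<in> {0..a} \<Longrightarrow> M r *v x r = v" "\<And>r. r \<in> {0..a} \<Longrightarrow> x differentiable (at r within {0..a})"
    using linear_system_solution_differentiable[of "{0..a}" M v, OF diff det] by blast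
  define x' where "x' r = vector_derivative x (at r within {0..a})" for r
  have dx: "(x has_vector_derivative x' r) (at r within {0..a})" if "r \<in> {0..a}" for r
    unfolding x'_def using x(2)[OF that] by (simp add: vector_derivative_works)
  have dxj: "((\<lambda>r. x r $ j) has_real_derivative x' r $ j) (at r within {0..a})" if "r \<in> {0..a}" for r j
    unfolding has_real_derivative_iff_has_vector_derivative
    by (rule bounded_linear.has_vector_derivative[OF bounded_linear_vec_nth dx[OF that]])
  define C where "C r c = (\<Sum>j\<in>UNIV. c $ j *\<^sub>R conormal (y j) (y' j) r)" for r and c :: "real ^ 'n"
  \<comment> \<open>Symmetry of \<open>U\<close>.\<close>
  have CM: "b (C r c) (M r *v d) = b (M r *v c) (C r d)" if "r \<in> {0..a}" for r c d
    unfolding C_def Mv bilinear_sum[OF bil]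
    by (intro sum.cong refl) (simp add: bilinear_lmul[OF bil] bilinear_rmul[OF bil] wronskian_vanishes[OF y y that] split: prod.splits)
  define q where "q r = h r * b (C r (x r)) v" for r
  let ?q' = "\<lambda>r. - (h r * (h r * b (R r v) v + h'' r * b v v)) - b (C r (x r)) (C r (x r))"
  have dq: "(q has_real_derivative ?q' r) (at r within {0..a})" if r: "r \<in> {0..a}" for r
  proof -
    interpret Rl: linear "R r" by (rule R_lin[OF r])
    have Mx: "(\<Sum>j\<in>UNIV. x r $ j *\<^sub>R y j r) = v" using x(1)[OF r] by (simp add: Mv)
    have "((\<lambda>r. C r (x r)) has_vector_derivative
        (\<Sum>j\<in>UNIV. x r $ j *\<^sub>R (- (h r *\<^sub>R R r (y j r)) - h'' r *\<^sub>R y j r) + x' r $ j *\<^sub>R conormal (y j) (y' j) r)) (at r within {0..a})"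
      unfolding C_def
      by (intro has_vector_derivative_sum has_vector_derivative_scaleR dxj r conormal_derivative[OF y r])
    also have "(\<Sum>j\<in>UNIV. x r $ j *\<^sub>R (- (h r *\<^sub>R R r (y j r)) - h'' r *\<^sub>R y j r) + x' r $ j *\<^sub>R conormal (y j) (y' j) r)
        = - (h r *\<^sub>R R r v) - h'' r *\<^sub>R v + C r (x' r)"
      unfolding Mx[symmetric]
      by (simp add: C_def Rl.sum Rl.scale scaleR_sum_right sum.distrib sum_subtractf sum_negf algebra_simps)
    finally have dC: "((\<lambda>r. C r (x r)) has_vector_derivative - (h r *\<^sub>R R r v) - h'' r *\<^sub>R v + C r (x' r)) (at r within {0..a})" .
    have "((\<lambda>r. \<Sum>j\<in>UNIV. x r $ j *\<^sub>R y j r) has_vector_derivative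
        (\<Sum>j\<in>UNIV. x r $ j *\<^sub>R y' j r + x' r $ j *\<^sub>R y j r)) (at r within {0..a})"
      by (intro has_vector_derivative_sum has_vector_derivative_scaleR dxj r dy)
    moreover have "((\<lambda>r. \<Sum>j\<in>UNIV. x r $ j *\<^sub>R y j r) has_vector_derivative 0) (at r within {0..a})"
      by (rule has_vector_derivative_transform[OF r, where f = "\<lambda>r. v"]) (use x(1) Mv in auto)
    moreover have "at r within {0..a} \<noteq> bot" using r a by (simp add: trivial_limit_within)
    ultimately have M'x: "(\<Sum>j\<in>UNIV. x r $ j *\<^sub>R y' j r) + M r *v x' r = 0"
      unfolding Mv sum.distrib[symmetric] by (intro vector_derivative_unique_within)
    \<comment> \<open>This is the quadratic term of the Riccati equation: \<open>M x\<close> is the constant \<open>v\<close>, so \<open>M x' = - M' x\<close>.\<close>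
    have key: "h r * b (C r (x' r)) v + h' r * b (C r (x r)) v = - b (C r (x r)) (C r (x r))"
    proof -
      have "b (C r (x' r)) v = b (M r *v x' r) (C r (x r))"
        using CM[OF r, of "x' r" "x r"] x(1)[OF r] by simp
      moreover have "h r *\<^sub>R (M r *v x' r) = - C r (x r) - h' r *\<^sub>R v"
      proof -
        have "M r *v x' r = - (\<Sum>j\<in>UNIV. x r $ j *\<^sub>R y' j r)" using M'x by (simp add: add_eq_0_iff)
        then show ?thesis
          by (simp add: C_def conormal_def Mx[symmetric] scaleR_sum_right sum_subtractf algebra_simps)
      qed
      moreover have "h r * b (M r *v x' r) (C r (x r)) = b (h r *\<^sub>R (M r *v x' r)) (C r (x r))"
        by (simp add: bilinear_lmul[OF bil])
      ultimately have "h r * b (C r (x' r)) v = b (- C r (x r) - h' r *\<^sub>R v) (C r (x r))"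
        by (simp only:)
      then show ?thesis
        using b_sym[of v "C r (x r)"] by (simp add: bilinear_lsub[OF bil] bilinear_lneg[OF bil] bilinear_lmul[OF bil])
    qed
    have eq: "h r * (b (- (h r *\<^sub>R R r v) - h'' r *\<^sub>R v + C r (x' r)) v + b (C r (x r)) 0) + h' r * b (C r (x r)) v
        = ?q' r"
      using key
      by (simp add: bilinear_ladd[OF bil] bilinear_lsub[OF bil] bilinear_lneg[OF bil]
          bilinear_lmul[OF bil] bilinear_rzero[OF bil] algebra_simps)
    have "(q has_real_derivative h' r * b (C r (x r)) v
        + (b (- (h r *\<^sub>R R r v) - h'' r *\<^sub>R v + C r (x' r)) v + b (C r (x r)) 0) * h r) (at r within {0..a})"
      unfolding q_def[abs_def]
      by (rule DERIV_mult[OF h_deriv[OF r] bilinear_has_vector_derivative[OF bil dC has_vector_derivative_const[of v]]])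
    then show ?thesis unfolding eq[symmetric] by (simp only: add.commute mult.commute)
  qed
  have nn: "0 \<le> b w w" for w using pos[of w] bilinear_lzero[OF bil] by (cases "w = 0") auto
  have a0: "0 \<in> {0..a}" using s by simp
  have "q s \<le> q 0"
  proof (rule nonincreasing_within[OF dq])
    show "?q' r \<le> 0" if r: "r \<in> {0..a}" for r
      using mult_nonneg_nonneg[OF less_imp_le[OF h_pos[OF r]] super[OF r vV]] nn[of "C r (x r)"] by linarith
  qed (use s in auto)
  also have "q 0 = 0"
  proof -
    have "conormal (y j) (y' j) 0 = 0" for j using y[of j] by (simp add: conormal_def solution_def)
    then show ?thesis by (simp add: q_def C_def bilinear_lzero[OF bil])
  qed
  finally have "h s * b (C s (x s)) v \<le> 0" by (simp add: q_def)
  then have "b (C s (x s)) v \<le> 0" using h_pos[OF s] by (simp add: mult_le_0_iff)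
  moreover have "b (conormal z z' s) (z s) = b (C s (x s)) v"
  proof -
    have "b (conormal z z' s) (M s *v x s) = b (z s) (C s (x s))"
    proof -
      have lb: "linear (b w)" for w using bil by (simp add: bilinear_def)
      show ?thesis unfolding Mv C_def by (simp add: linear_sum[OF lb] linear_scale[OF lb] wronskian_vanishes[OF z y s])
    qed
    then show ?thesis using x(1)[OF s] b_sym[of v] by (simp add: v_def)
  qed
  ultimately show ?thesis by simp
qed

text \<open>
  The derivative of \<open>|z|\<^sup>2 / h\<^sup>2\<close> is \<open>2 b(h z' - h' z, z) / h\<^sup>3\<close>.
\<close>

lemma norm_ratio_nonincreasing:
  fixes y y' :: "'n \<Rightarrow> real \<Rightarrow> real ^ 'n"
  assumes y: "\<And>j. solution (y j) (y' j)"
    and inj: "\<And>s c. s \<in> {0..a} \<Longrightarrow> (\<Sum>j\<in>UNIV. c $ j *\<^sub>R y j s) = 0 \<Longrightarrow> c = (0 :: real ^ 'n)"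
    and z: "solution z z'" and z_V: "\<And>s. s \<in> {0..a} \<Longrightarrow> z s \<in> V"
    and super: "\<And>s v. s \<in> {0..a} \<Longrightarrow> v \<in> V \<Longrightarrow> 0 \<le> h s * b (R s v) v + h'' s * b v v"
    and s: "s \<in> {0..a}"
  shows "b (z s) (z s) / (h s)\<^sup>2 \<le> b (z 0) (z 0) / (h 0)\<^sup>2"
proof (rule nonincreasing_within[where f = "\<lambda>s. b (z s) (z s) / (h s)\<^sup>2" and
      f' = "\<lambda>r. 2 * b (conormal z z' r) (z r) / (h r) ^ 3" and a = 0 and b = a])
  fix r assume r: "r \<in> {0..a}"
  have dz: "(z has_vector_derivative z' r) (at r within {0..a})" using z r by (simp add: solution_def)
  have hr: "h r > 0" by (rule h_pos[OF r])
  let ?d = "2 * b (conormal z z' r) (z r) / (h r) ^ 3"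
  have "((\<lambda>s. b (z s) (z s) / (h s)\<^sup>2) has_real_derivative
      ((b (z' r) (z r) + b (z r) (z' r)) * (h r)\<^sup>2 - b (z r) (z r) * (2 * h r * h' r)) / ((h r)\<^sup>2 * (h r)\<^sup>2)) (at r within {0..a})"
    by (rule DERIV_divide[OF bilinear_has_vector_derivative[OF bil dz dz]])
      (use hr in \<open>auto intro!: derivative_eq_intros h_deriv[OF r] simp: power2_eq_square\<close>)
  moreover have "((b (z' r) (z r) + b (z r) (z' r)) * (h r)\<^sup>2 - b (z r) (z r) * (2 * h r * h' r)) / ((h r)\<^sup>2 * (h r)\<^sup>2) = ?d"
    using hr b_sym[of "z r" "z' r"]
    by (simp add: conormal_def bilinear_lsub[OF bil] bilinear_lmul[OF bil] field_simps power2_eq_square power3_eq_cube)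
  ultimately show "((\<lambda>s. b (z s) (z s) / (h s)\<^sup>2) has_real_derivative ?d) (at r within {0..a})" by simp
  show "?d \<le> 0"
    using conormal_nonpositive[OF y inj z z_V super r] hr by (simp add: divide_nonpos_pos mult_nonneg_nonpos)
qed (use s in auto)

end

text \<open>
  Cauchy-Schwarz, \<open>b(y', y)\<^sup>2 \<le> |y'|\<^sup>2 |y|\<^sup>2\<close>, gives \<open>w'' \<ge> - \<kappa> w\<close> for \<open>w = |y|\<close> and \<open>\<kappa> = b(R y, y) / |y|\<^sup>2\<close>. With
  \<open>\<tau>' = w(0)\<^sup>2 / w\<^sup>2\<close> the function \<open>h = w e\<^bsup>\<delta>\<tau>\<^esup>\<close> satisfies
  \<open>h'' = e\<^bsup>\<delta>\<tau>\<^esup> (w'' + \<delta> (2 w' \<tau>' + w \<tau>'') + \<delta>\<^sup>2 w \<tau>'\<^sup>2)\<close>, where the middle term vanishes since \<open>w\<^sup>2 \<tau>'\<close> is constant and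
  the last one is nonnegative. So the inequality survives, while \<open>\<tau>'(0) = 1\<close> raises the logarithmic derivative at \<open>0\<close>
  by \<open>\<delta>\<close>.
\<close>

lemma norm_supersolution:
  fixes b :: "real ^ 'n \<Rightarrow> real ^ 'n \<Rightarrow> real" and y y' :: "real \<Rightarrow> real ^ 'n" and \<delta> \<mu> a :: real
  assumes a: "0 \<le> a" and bil: "bilinear b" and b_sym: "\<And>x y. b x y = b y x" and pos: "\<And>x. x \<noteq> 0 \<Longrightarrow> b x x > 0"
    and y: "\<And>s. s \<in> {0..a} \<Longrightarrow> (y has_vector_derivative y' s) (at s within {0..a})"
    and y': "\<And>s. s \<in> {0..a} \<Longrightarrow> (y' has_vector_derivative - R s (y s)) (at s within {0..a})"
    and ne: "\<And>s. s \<in> {0..a} \<Longrightarrow> y s \<noteq> 0" and init: "y' 0 = - \<mu> *\<^sub>R y 0"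
  defines "w \<equiv> \<lambda>s. sqrt (b (y s) (y s))"
  defines "h \<equiv> \<lambda>s. w s * exp (\<delta> * integral {0..s} (\<lambda>\<xi>. (w 0)\<^sup>2 / (w \<xi>)\<^sup>2))"
  obtains h' h'' where "\<And>s. s \<in> {0..a} \<Longrightarrow> h s > 0"
    "\<And>s. s \<in> {0..a} \<Longrightarrow> (h has_real_derivative h' s) (at s within {0..a})"
    "\<And>s. s \<in> {0..a} \<Longrightarrow> (h' has_real_derivative h'' s) (at s within {0..a})"
    "h' 0 = (\<delta> - \<mu>) * h 0"
    "\<And>s. s \<in> {0..a} \<Longrightarrow> 0 \<le> h s * b (R s (y s)) (y s) + h'' s * b (y s) (y s)"
proof -
  have w: "w s > 0" "(w s)\<^sup>2 = b (y s) (y s)" if "s \<in> {0..a}" for s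
    using pos[OF ne[OF that]] by (auto simp: w_def)
  define p where "p s = b (y' s) (y s)" for s
  define w1 where "w1 s = p s / w s" for s
  have dw: "(w has_real_derivative w1 s) (at s within {0..a})" if s: "s \<in> {0..a}" for s
  proof -
    have "((\<lambda>s. b (y s) (y s)) has_real_derivative 2 * p s) (at s within {0..a})"
      using bilinear_has_vector_derivative[OF bil y[OF s] y[OF s]] b_sym[of "y s" "y' s"] by (simp add: p_def)
    from DERIV_chain2[OF DERIV_real_sqrt[OF pos[OF ne[OF s]]] this]
    show ?thesis using w(1)[OF s] unfolding w_def[symmetric] by (simp add: w1_def w_def field_simps)
  qed
  define p1 where "p1 s = - b (R s (y s)) (y s) + b (y' s) (y' s)" for s
  have dp: "(p has_real_derivative p1 s) (at s within {0..a})" if s: "s \<in> {0..a}" for s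
    using bilinear_has_vector_derivative[OF bil y'[OF s] y[OF s]]
    unfolding p_def[abs_def] p1_def by (simp add: bilinear_lneg[OF bil])
  define q where "q s = (w 0)\<^sup>2 / (w s)\<^sup>2" for s
  have contw: "continuous_on {0..a} w"
    unfolding continuous_on_eq_continuous_within using dw DERIV_continuous by blast
  have contq: "continuous_on {0..a} q"
  proof -
    have "\<forall>s\<in>{0..a}. (w s)\<^sup>2 \<noteq> 0" using w(1) by (intro ballI) (metis less_irrefl zero_eq_power2)
    then show ?thesis unfolding q_def[abs_def] by (intro continuous_intros contw)
  qed
  define E where "E s = exp (\<delta> * integral {0..s} q)" for s
  have dE: "(E has_real_derivative E s * (\<delta> * q s)) (at s within {0..a})" if s: "s \<in> {0..a}" for s
    unfolding E_def[abs_def]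
    by (rule derivative_eq_intros integral_has_real_derivative[OF contq s] refl)+ simp
  have h: "h s = w s * E s" for s by (simp add: h_def E_def q_def[abs_def])
  define v where "v s = w1 s + \<delta> * (w 0)\<^sup>2 / w s" for s
  have vE: "w1 s * E s + E s * (\<delta> * q s) * w s = v s * E s" if s: "s \<in> {0..a}" for s
    using w(1)[OF s] by (simp add: v_def q_def field_simps power2_eq_square)
  have dh: "(h has_real_derivative v s * E s) (at s within {0..a})" if s: "s \<in> {0..a}" for s
    unfolding h[abs_def] vE[OF s, symmetric] by (rule DERIV_mult[OF dw[OF s] dE[OF s]])
  define v1 where "v1 s = (p1 s * w s - p s * w1 s) / (w s * w s) - \<delta> * (w 0)\<^sup>2 * w1 s / (w s * w s)" for s
  have dv: "(v has_real_derivative v1 s) (at s within {0..a})" if s: "s \<in> {0..a}" for s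
  proof -
    have nz: "w s \<noteq> 0" using w(1)[OF s] by simp
    note DERIV_add[OF DERIV_divide[OF dp[OF s] dw[OF s] nz] DERIV_minus[OF DERIV_divide[OF DERIV_const dw[OF s] nz]], of "- \<delta> * (w 0)\<^sup>2"]
    then show ?thesis by (simp add: v_def[abs_def] w1_def[abs_def] v1_def)
  qed
  define h2 where "h2 s = v1 s * E s + E s * (\<delta> * q s) * v s" for s
  have dh': "((\<lambda>s. v s * E s) has_real_derivative h2 s) (at s within {0..a})" if s: "s \<in> {0..a}" for s
    unfolding h2_def by (rule DERIV_mult[OF dv[OF s] dE[OF s]])
  have "0 \<in> {0..a}" using a by simp
  note w0 = w[OF this]
  have "v 0 = (\<delta> - \<mu>) * w 0"
    using w0 by (simp add: v_def w1_def p_def init bilinear_lmul[OF bil] bilinear_lneg[OF bil] field_simps power2_eq_square)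
  then have init': "v 0 * E 0 = (\<delta> - \<mu>) * h 0" by (simp add: h)
  have super: "0 \<le> h s * b (R s (y s)) (y s) + h2 s * b (y s) (y s)" if s: "s \<in> {0..a}" for s
  proof -
    have nn: "0 \<le> b x x" for x using pos[of x] bilinear_lzero[OF bil] by (cases "x = 0") auto
    have "(p s)\<^sup>2 \<le> b (y' s) (y' s) * (w s)\<^sup>2"
    proof -
      define r where "r = p s / (w s)\<^sup>2"
      have "0 \<le> b (y' s - r *\<^sub>R y s) (y' s - r *\<^sub>R y s)" by (rule nn)
      also have "\<dots> = b (y' s) (y' s) - 2 * r * p s + r\<^sup>2 * (w s)\<^sup>2"
        unfolding w(2)[OF s] p_def using b_sym[of "y s" "y' s"]
        by (simp add: bilinear_lsub[OF bil] bilinear_rsub[OF bil] bilinear_lmul[OF bil] bilinear_rmul[OF bil]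
            power2_eq_square algebra_simps)
      also have "\<dots> = b (y' s) (y' s) - (p s)\<^sup>2 / (w s)\<^sup>2"
        using w(1)[OF s] by (simp add: r_def field_simps power2_eq_square)
      finally show ?thesis using w(1)[OF s] by (simp add: field_simps)
    qed
    then have cs: "0 \<le> b (y' s) (y' s) * (w s)\<^sup>2 - (p s)\<^sup>2" by simp
    have "h s * b (R s (y s)) (y s) + h2 s * (w s)\<^sup>2
        = E s / w s * (b (y' s) (y' s) * (w s)\<^sup>2 - (p s)\<^sup>2 + \<delta>\<^sup>2 * (w 0) ^ 4)"
      using w(1)[OF s]
      by (simp add: h h2_def v1_def v_def w1_def p1_def q_def divide_simps) (simp add: algebra_simps power2_eq_square power4_eq_xxxx)
    also have "\<dots> \<ge> 0"
      using cs w(1)[OF s] by (intro mult_nonneg_nonneg add_nonneg_nonneg) (auto simp: E_def)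
    finally show ?thesis unfolding w(2)[OF s] .
  qed
  show ?thesis
  proof (rule that[OF _ dh dh' init' super])
    show "h s > 0" if "s \<in> {0..a}" for s using w(1)[OF that] by (simp add: h E_def)
  qed
qed

section \<open>Jacobi fields in the standard parametrization\<close>

text \<open>
  A change of parameter with positive derivative is invertible, with differentiable inverse, also at the end points of the
  interval, where two-sided inverse function theorems do not apply.
\<close>

lemma inverse_parameter:
  fixes f :: "real \<Rightarrow> real"
  assumes T: "0 < T" and f: "\<And>t. t \<in> {0..T} \<Longrightarrow> (f has_real_derivative f' t) (at t within {0..T})"
    and pos: "\<And>t. t \<in> {0..T} \<Longrightarrow> f' t > 0" and f0: "f 0 = 0"
  defines "u \<equiv> inv_into {0..T} f"
  shows "0 < f T" and "\<And>t. t \<in> {0..T} \<Longrightarrow> f t \<in> {0..f T}" and "\<And>t. t \<in> {0..T} \<Longrightarrow> u (f t) = t"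
    and "\<And>s. s \<in> {0..f T} \<Longrightarrow> u s \<in> {0..T}" and "\<And>s. s \<in> {0..f T} \<Longrightarrow> f (u s) = s"
    and "\<And>s. s \<in> {0..f T} \<Longrightarrow> (u has_real_derivative 1 / f' (u s)) (at s within {0..f T})"
proof -
  have less: "f x < f y" if "0 \<le> x" "x < y" "y \<le> T" for x y
  proof -
    have "(f has_derivative (*) (f' t)) (at t within {x..y})" if "x \<le> t" "t \<le> y" for t
      using has_field_derivative_subset[OF f, of t "{x..y}"] that \<open>0 \<le> x\<close> \<open>y \<le> T\<close> by (auto simp: has_field_derivative_def)
    then have "\<exists>t\<in>{x<..<y}. f y - f x = f' t * (y - x)" by (intro mvt_simple[OF that(2)]) auto
    then obtain t where t: "t \<in> {x<..<y}" "f y - f x = f' t * (y - x)" by blast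
    have "f' t * (y - x) > 0" using pos[of t] t(1) that by (intro mult_pos_pos) auto
    then show ?thesis using t(2) by simp
  qed
  show fT: "0 < f T" using less[of 0 T] T f0 by simp
  have cont: "continuous_on {0..T} f"
    unfolding continuous_on_eq_continuous_within using f DERIV_continuous by blast
  have inj: "inj_on f {0..T}"
  proof (rule inj_onI)
    fix x y assume *: "x \<in> {0..T}" "y \<in> {0..T}" "f x = f y"
    show "x = y" using less[of x y] less[of y x] * by (cases x y rule: linorder_cases) auto
  qed
  show im: "f t \<in> {0..f T}" if "t \<in> {0..T}" for t
    using less[of 0 t] less[of t T] that f0 by (cases "t = 0"; cases "t = T") auto
  have surj: "{0..f T} \<subseteq> f ` {0..T}"
  proof
    fix s assume "s \<in> {0..f T}"
    then obtain t where "0 \<le> t" "t \<le> T" "f t = s" using IVT'[of f 0 s T] f0 T cont by auto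
    then show "s \<in> f ` {0..T}" by auto
  qed
  show uf: "u (f t) = t" if "t \<in> {0..T}" for t unfolding u_def by (rule inv_into_f_f[OF inj that])
  show uT: "u s \<in> {0..T}" if "s \<in> {0..f T}" for s unfolding u_def by (rule inv_into_into) (use surj that in blast)
  show fu: "f (u s) = s" if "s \<in> {0..f T}" for s unfolding u_def by (rule f_inv_into_f) (use surj that in blast)
  have "f ` {0..T} = {0..f T}" using surj im by blast
  then have contu: "continuous_on {0..f T} u"
    using continuous_on_inv[OF cont compact_Icc, of u] uf by simp
  show "(u has_real_derivative 1 / f' (u s)) (at s within {0..f T})" if s: "s \<in> {0..f T}" for s
    unfolding has_field_derivative_iff
  proof -
    let ?F = "at s within {0..f T}"
    note x0 = uT[OF s]
    have ev: "\<forall>\<^sub>F y in ?F. y \<in> {0..f T} \<and> y \<noteq> s"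
      by (auto simp: eventually_at_filter)
    have "filterlim u (at (u s) within {0..T}) ?F"
      unfolding filterlim_at
    proof (intro conjI)
      show "(u \<longlongrightarrow> u s) ?F" using contu s by (auto simp: continuous_on_def)
      show "\<forall>\<^sub>F y in ?F. u y \<in> {0..T} \<and> u y \<noteq> u s"
        using ev
      proof eventually_elim
        case (elim y)
        then have "u y \<in> {0..T}" "f (u y) \<noteq> f (u s)" using uT[of y] fu[of y] fu[OF s] by auto
        then show ?case by auto
      qed
    qed
    from filterlim_compose[OF f[OF x0, unfolded has_field_derivative_iff] this]
    have "((\<lambda>y. (f (u y) - f (u s)) / (u y - u s)) \<longlongrightarrow> f' (u s)) ?F" .
    then have "((\<lambda>y. inverse ((f (u y) - f (u s)) / (u y - u s))) \<longlongrightarrow> inverse (f' (u s))) ?F"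
      by (rule tendsto_inverse) (use pos[OF x0] in simp)
    then show "((\<lambda>y. (u y - u s) / (y - s)) \<longlongrightarrow> 1 / f' (u s)) ?F"
      unfolding inverse_eq_divide[of "f' (u s)"]
    proof (rule Lim_transform_eventually)
      show "\<forall>\<^sub>F y in ?F. inverse ((f (u y) - f (u s)) / (u y - u s)) = (u y - u s) / (y - s)"
        using ev
      proof eventually_elim
        case (elim y)
        then have "f (u y) = y" using fu by blast
        then show ?case by (simp add: fu[OF s])
      qed
    qed
  qed
qed

text \<open>
  The geodesic with its standard parameter \<open>s\<close>; \<open>arc s\<close> is the arc length at which the parameter is \<open>s\<close>.
  \<open>\<phi>1\<close> and \<open>\<phi>2\<close> are the first two derivatives of \<open>\<phi>\<close> along the geodesic with respect to arc length.
\<close>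

locale phi_segment = geodesic_segment A g D \<phi> T \<sigma>
  for A :: "('m::{t2_space,second_countable_topology}, 'n::finite) chart set" and g D \<phi> T \<sigma> +
  fixes S :: real and \<gamma> :: "real \<Rightarrow> 'm"
  assumes S: "S = std_parameter \<phi> \<sigma> T"
    and \<gamma>: "\<And>t. t \<in> {0..T} \<Longrightarrow> \<gamma> (std_parameter \<phi> \<sigma> t) = \<sigma> t"
begin

definition \<phi>1 :: "real \<Rightarrow> real" where "\<phi>1 t = dfun A \<phi> (\<sigma> t) (vel t)"
definition \<phi>2 :: "real \<Rightarrow> real" where "\<phi>2 t = vector_derivative \<phi>1 (at t within {0..T})"

lemma \<phi>1_chart: "c \<in> A \<Longrightarrow> t \<in> piece c \<Longrightarrow> \<phi>1 t = d\<phi> c (\<sigma> t) (vel t c)"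
  unfolding \<phi>1_def by (rule dfun_\<phi>[OF _ pieceD(2) vel_T[OF pieceD(1)]])

lemma \<phi>_along:
  assumes t: "t \<in> {0..T}"
  shows "((\<lambda>t. \<phi> (\<sigma> t)) has_real_derivative \<phi>1 t) (at t within {0..T})"
proof -
  obtain c where c: "c \<in> A" "t \<in> piece c" using t by (rule \<sigma>_chartE)
  show ?thesis
    using along_derivative[OF c \<phi>_has_derivative[OF c(1) pieceD(2)[OF c(2)]]]
    by (simp add: \<phi>1_chart[OF c] has_real_derivative_iff_has_vector_derivative)
qed

text \<open>
  Along a geodesic the second derivative of a function is its Hessian on the velocity.
\<close>

lemma \<phi>1_along_chart:
  assumes c: "c \<in> A" "t \<in> piece c"
  shows "(\<phi>1 has_vector_derivative hess\<phi> c (\<sigma> t) (vel t c) (vel t c)) (at t within {0..T})"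
proof -
  note o = openin_piece[OF c(1)] and p = pieceD(2)[OF c(2)] and w = eventually_piece[OF c]
  note C = compatible[OF c(1)]
  have bil: "bilinear (\<lambda>a (x::real). x *\<^sub>R d\<phi> c (\<sigma> r) a)" if "r \<in> piece c" for r
    unfolding bilinear_def
  proof safe
    interpret linear "d\<phi> c (\<sigma> r)" by (rule linear_d\<phi>[OF c(1) pieceD(2)[OF that]])
    show "linear (\<lambda>x. x *\<^sub>R d\<phi> c (\<sigma> r) a)" for a by (rule linearI) (simp_all add: algebra_simps)
    show "linear (\<lambda>a. x *\<^sub>R d\<phi> c (\<sigma> r) a)" for x by (rule linearI) (simp_all add: add scale algebra_simps)
  qed
  let ?D2 = "\<lambda>a. frechet_derivative (\<lambda>u. d\<phi> c (cinv c u) a) (at (cmap c (\<sigma> t))) (vel t c)"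
  have "((\<lambda>r. d\<phi> c (\<sigma> r) a) has_vector_derivative ?D2 a) (at t within {0..T})" for a
    by (rule along_derivative[OF c smooth_on_open_has_derivative[OF open_cmap_cdom[OF C] smooth_d\<phi>[OF c(1)]]])
      (use p in auto)
  then have B': "((\<lambda>r. x *\<^sub>R d\<phi> c (\<sigma> r) a) has_vector_derivative x *\<^sub>R ?D2 a) (at t within piece c)" for a and x :: real
    unfolding w[symmetric] by (rule bounded_linear.has_vector_derivative[OF bounded_linear_scaleR_right])
  have dv: "((\<lambda>r. vel r c) has_vector_derivative - \<Gamma> c (\<sigma> t) (vel t c) (vel t c)) (at t within piece c)"
    using vel_coordinate_derivative[OF cov_vel c] unfolding w .
  have "((\<lambda>r. (1::real) *\<^sub>R d\<phi> c (\<sigma> r) (vel r c)) has_vector_derivative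
      (1::real) *\<^sub>R ?D2 (vel t c) + (1::real) *\<^sub>R d\<phi> c (\<sigma> t) (- \<Gamma> c (\<sigma> t) (vel t c) (vel t c)) + (0::real) *\<^sub>R d\<phi> c (\<sigma> t) (vel t c)) (at t within piece c)"
    by (rule bilinear_field_has_vector_derivative[OF appr_piece[OF o] bil c(2) B' dv has_vector_derivative_const])
  then have "((\<lambda>r. d\<phi> c (\<sigma> r) (vel r c)) has_vector_derivative hess\<phi> c (\<sigma> t) (vel t c) (vel t c)) (at t within piece c)"
    by (simp add: hess\<phi>_def linear_neg[OF linear_d\<phi>[OF c(1) p]])
  then show ?thesis
    unfolding w by (rule has_vector_derivative_transform[OF c(2), rotated]) (simp add: \<phi>1_chart[OF c(1)])
qed

lemma \<phi>2_chart: "c \<in> A \<Longrightarrow> t \<in> piece c \<Longrightarrow> \<phi>2 t = hess\<phi> c (\<sigma> t) (vel t c) (vel t c)"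
  unfolding \<phi>2_def by (rule vector_derivative_within_eq[OF I pieceD(1) \<phi>1_along_chart])

lemma \<phi>1_along:
  assumes t: "t \<in> {0..T}"
  shows "(\<phi>1 has_real_derivative \<phi>2 t) (at t within {0..T})"
proof -
  obtain c where c: "c \<in> A" "t \<in> piece c" using t by (rule \<sigma>_chartE)
  show ?thesis using \<phi>1_along_chart[OF c] \<phi>2_chart[OF c] by (simp add: has_real_derivative_iff_has_vector_derivative)
qed

definition arc :: "real \<Rightarrow> real" where "arc = inv_into {0..T} (std_parameter \<phi> \<sigma>)"

lemma std_parameter_derivative:
  assumes t: "t \<in> {0..T}"
  shows "(std_parameter \<phi> \<sigma> has_real_derivative exp (- 2 * \<phi> (\<sigma> t))) (at t within {0..T})"
proof -
  have "continuous_on {0..T} (\<lambda>t. \<phi> (\<sigma> t))"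
    unfolding continuous_on_eq_continuous_within using \<phi>_along DERIV_continuous by blast
  then have "continuous_on {0..T} (\<lambda>t. exp (- 2 * \<phi> (\<sigma> t)))" by (intro continuous_intros)
  from integral_has_real_derivative[OF this t] show ?thesis unfolding std_parameter_def[abs_def] .
qed

lemma
  shows S_pos: "0 < S"
    and std_in: "t \<in> {0..T} \<Longrightarrow> std_parameter \<phi> \<sigma> t \<in> {0..S}"
    and arc_std: "t \<in> {0..T} \<Longrightarrow> arc (std_parameter \<phi> \<sigma> t) = t"
    and arc_in: "s \<in> {0..S} \<Longrightarrow> arc s \<in> {0..T}"
    and std_arc: "s \<in> {0..S} \<Longrightarrow> std_parameter \<phi> \<sigma> (arc s) = s"
    and arc_derivative': "s \<in> {0..S} \<Longrightarrow> (arc has_real_derivative 1 / exp (- 2 * \<phi> (\<sigma> (arc s)))) (at s within {0..S})"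
proof -
  have z: "std_parameter \<phi> \<sigma> 0 = 0" by (simp add: std_parameter_def)
  note * = inverse_parameter[OF T std_parameter_derivative _ z, folded arc_def S]
  show "0 < S" "t \<in> {0..T} \<Longrightarrow> std_parameter \<phi> \<sigma> t \<in> {0..S}" "t \<in> {0..T} \<Longrightarrow> arc (std_parameter \<phi> \<sigma> t) = t"
    "s \<in> {0..S} \<Longrightarrow> arc s \<in> {0..T}" "s \<in> {0..S} \<Longrightarrow> std_parameter \<phi> \<sigma> (arc s) = s"
    "s \<in> {0..S} \<Longrightarrow> (arc has_real_derivative 1 / exp (- 2 * \<phi> (\<sigma> (arc s)))) (at s within {0..S})"
    by (rule *; simp)+
qed

lemma \<gamma>_arc: "s \<in> {0..S} \<Longrightarrow> \<gamma> s = \<sigma> (arc s)"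
  using \<gamma>[OF arc_in] std_arc by simp

lemma arc_0: "arc 0 = 0"
  using arc_std[OF zero_in] by (simp add: std_parameter_def)

lemma zero_in_S: "0 \<in> {0..S}" using S_pos by simp

lemma \<gamma>_0: "\<gamma> 0 = \<sigma> 0" using \<gamma>_arc[OF zero_in_S] by (simp add: arc_0)

lemma arc_derivative:
  "s \<in> {0..S} \<Longrightarrow> (arc has_real_derivative exp (2 * \<phi> (\<gamma> s))) (at s within {0..S})"
  using arc_derivative' by (simp add: \<gamma>_arc exp_minus field_simps)

lemma compose_arc:
  fixes f :: "real \<Rightarrow> 'b::real_normed_vector"
  assumes s: "s \<in> {0..S}" and f: "(f has_vector_derivative f') (at (arc s) within {0..T})"
  shows "((\<lambda>s. f (arc s)) has_vector_derivative exp (2 * \<phi> (\<gamma> s)) *\<^sub>R f') (at s within {0..S})"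
proof -
  have "arc ` {0..S} \<subseteq> {0..T}" by (rule image_subsetI) (rule arc_in)
  then have "(f has_vector_derivative f') (at (arc s) within arc ` {0..S})"
    using f by (rule has_vector_derivative_within_subset[rotated])
  from vector_diff_chain_within[OF arc_derivative[OF s, unfolded has_real_derivative_iff_has_vector_derivative] this]
  show ?thesis by (simp add: o_def)
qed

lemma velocity_\<gamma>:
  assumes s: "s \<in> {0..S}"
  shows "velocity A {0..S} \<gamma> s = tscale (exp (2 * \<phi> (\<gamma> s))) (vel (arc s))"
proof
  fix c
  show "velocity A {0..S} \<gamma> s c = tscale (exp (2 * \<phi> (\<gamma> s))) (vel (arc s)) c"
  proof (cases "c \<in> A \<and> \<sigma> (arc s) \<in> cdom c")
    case True
    then have c: "c \<in> A" "arc s \<in> piece c" using arc_in[OF s] by (auto simp: piece_def)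
    have "((\<lambda>s. cmap c (\<gamma> s)) has_vector_derivative exp (2 * \<phi> (\<gamma> s)) *\<^sub>R vel (arc s) c) (at s within {0..S})"
      by (rule has_vector_derivative_transform[OF s _ compose_arc[OF s vel_derivative[OF c]]]) (simp add: \<gamma>_arc)
    from vector_derivative_within_eq[OF fully_approachable_Icc[OF S_pos] s this]
    show ?thesis using True \<gamma>_arc[OF s] by (simp add: velocity_def tscale_def o_def)
  next
    case False
    then show ?thesis using \<gamma>_arc[OF s] by (auto simp: velocity_def tscale_def)
  qed
qed

lemma \<phi>_\<gamma>:
  assumes s: "s \<in> {0..S}"
  shows "((\<lambda>s. \<phi> (\<gamma> s)) has_real_derivative exp (2 * \<phi> (\<gamma> s)) * \<phi>1 (arc s)) (at s within {0..S})"
proof -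
  have "((\<lambda>s. \<phi> (\<sigma> (arc s))) has_vector_derivative exp (2 * \<phi> (\<gamma> s)) *\<^sub>R \<phi>1 (arc s)) (at s within {0..S})"
    by (rule compose_arc[OF s \<phi>_along[OF arc_in[OF s], unfolded has_real_derivative_iff_has_vector_derivative]])
  then have "((\<lambda>s. \<phi> (\<gamma> s)) has_vector_derivative exp (2 * \<phi> (\<gamma> s)) *\<^sub>R \<phi>1 (arc s)) (at s within {0..S})"
    by (rule has_vector_derivative_transform[OF s, rotated]) (simp add: \<gamma>_arc)
  then show ?thesis by (simp add: has_real_derivative_iff_has_vector_derivative)
qed

text \<open>
  The operator \<open>V \<mapsto> R(V, \<gamma>')\<gamma>'\<close> of the weighted connection on normal vectors; the factor \<open>e\<^bsup>4\<phi>\<^esup>\<close> comes from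
  \<open>\<gamma>' = e\<^bsup>2\<phi>\<^esup> \<sigma>'\<close>, which enters quadratically.
\<close>

definition Rs :: "real \<Rightarrow> real ^ 'n \<Rightarrow> real ^ 'n" where
  "Rs s x = exp (4 * \<phi> (\<gamma> s)) *\<^sub>R (Rop (arc s) x + (\<phi>2 (arc s) + (\<phi>1 (arc s))\<^sup>2) *\<^sub>R x)"

lemma Rs_sym: "s \<in> {0..S} \<Longrightarrow> b (Rs s x) y = b (Rs s y) x"
  using Rop_sym[OF arc_in, of s x y] b_sym[of x y]
  by (simp add: Rs_def bilinear_lmul[OF bilinear_b] bilinear_ladd[OF bilinear_b])

lemma linear_Rs: "s \<in> {0..S} \<Longrightarrow> linear (Rs s)"
proof -
  assume s: "s \<in> {0..S}"
  interpret linear "Rop (arc s)" by (rule linear_Rop[OF arc_in[OF s]])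
  show ?thesis by (rule linearI) (simp_all add: Rs_def add scale algebra_simps)
qed

lemma weighted_curvature_frame:
  assumes s: "s \<in> {0..S}" and x: "b x e = 0"
  shows "g (\<gamma> s) (curvature_at A (weighted_connection A D \<phi>) (\<gamma> s) (frame (arc s) x)
      (velocity A {0..S} \<gamma> s) (velocity A {0..S} \<gamma> s)) (frame (arc s) x) = b (Rs s x) x"
proof -
  let ?t = "arc s" and ?r = "exp (2 * \<phi> (\<gamma> s))"
  note t = arc_in[OF s]
  obtain c where c: "c \<in> A" "?t \<in> piece c" using t by (rule \<sigma>_chartE)
  note p = pieceD(2)[OF c(2)]
  note V = frame_tangent[OF t, of x] and W = tangent_scale[OF vel_T[OF t], of ?r]
  have vx: "g (\<sigma> ?t) (frame ?t x) (vel ?t) = 0"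
    using frame_metric[OF t, of x e] x by (simp add: vel_frame[OF t])
  have perp: "g (\<sigma> ?t) (frame ?t x) (tscale ?r (vel ?t)) = 0"
    unfolding g_scale_right[OF \<sigma>_points[OF t] V vel_T[OF t]] vx by simp
  have R: "g (\<sigma> ?t) (curvature_at A D (\<sigma> ?t) (frame ?t x) (tscale ?r (vel ?t)) (tscale ?r (vel ?t))) (frame ?t x)
      = ?r\<^sup>2 * b (Rop ?t x) x"
    unfolding curvature_at_scale_right[OF \<sigma>_points[OF t] V V vel_T[OF t]] b_Rop[OF t]
    by (rule g_scale_left[OF \<sigma>_points[OF t] curvature_T[OF t V] V])
  have d: "d\<phi> c (\<sigma> ?t) (tscale ?r (vel ?t) c) = ?r * \<phi>1 ?t"
    using linear_scale[OF linear_d\<phi>[OF c(1) p]] by (simp add: tscale_def \<phi>1_chart[OF c])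
  have H: "hess\<phi> c (\<sigma> ?t) (tscale ?r (vel ?t) c) (tscale ?r (vel ?t) c) = ?r\<^sup>2 * \<phi>2 ?t"
  proof -
    let ?v = "vel ?t c"
    have lin: "linear (\<lambda>y. frechet_derivative (\<lambda>u. d\<phi> c (cinv c u) z) (at (cmap c (\<sigma> ?t))) y)" for z
      using smooth_on_open_has_derivative[OF open_cmap_cdom[OF compatible[OF c(1)]] smooth_d\<phi>[OF c(1)]] p
        has_derivative_linear by blast
    have "((\<lambda>u. d\<phi> c (cinv c u) (?r *\<^sub>R ?v)) has_derivative
        (\<lambda>y. ?r *\<^sub>R frechet_derivative (\<lambda>u. d\<phi> c (cinv c u) ?v) (at (cmap c (\<sigma> ?t))) y)) (at (cmap c (\<sigma> ?t)))"
    proof (rule has_derivative_transform_within_open[OF has_derivative_scaleR_right open_cmap_cdom[OF compatible[OF c(1)]]])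
      show "((\<lambda>u. d\<phi> c (cinv c u) ?v) has_derivative
          frechet_derivative (\<lambda>u. d\<phi> c (cinv c u) ?v) (at (cmap c (\<sigma> ?t)))) (at (cmap c (\<sigma> ?t)))"
        by (rule smooth_on_open_has_derivative[OF open_cmap_cdom[OF compatible[OF c(1)]] smooth_d\<phi>[OF c(1)]]) (use p in simp)
      show "cmap c (\<sigma> ?t) \<in> cmap c ` cdom c" using p by simp
      show "?r *\<^sub>R d\<phi> c (cinv c u) ?v = d\<phi> c (cinv c u) (?r *\<^sub>R ?v)" if "u \<in> cmap c ` cdom c" for u
        using linear_scale[OF linear_d\<phi>[OF c(1) cinv_in[OF compatible[OF c(1)] that]]] by simp
    qed
    from frechet_derivative_eqI[OF this, of "?r *\<^sub>R ?v"] show ?thesis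
      unfolding \<phi>2_chart[OF c] hess\<phi>_def tscale_def linear_scale[OF lin]
      using bilinear_christoffel[OF c(1) p]
      by (simp add: bilinear_lmul bilinear_rmul linear_scale[OF linear_d\<phi>[OF c(1) p]] power2_eq_square algebra_simps)
  qed
  have r2: "?r\<^sup>2 = exp (4 * \<phi> (\<gamma> s))" by (simp add: exp_double[symmetric])
  show ?thesis
    unfolding velocity_\<gamma>[OF s]
    unfolding \<gamma>_arc[OF s] weighted_curvature[OF c(1) p V W[unfolded \<gamma>_arc[OF s]] perp[unfolded \<gamma>_arc[OF s]]]
    using R d H r2 frame_metric[OF t, of x x]
    by (simp add: \<gamma>_arc[OF s] Rs_def bilinear_lmul[OF bilinear_b] bilinear_ladd[OF bilinear_b] algebra_simps)
qed

text \<open>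
  The factor \<open>e\<^bsup>-\<phi>\<^esup>\<close> is the one for which the change of parameter produces no first-order term: from
  \<open>dt/ds = e\<^bsup>2\<phi>\<^esup>\<close> one gets \<open>y' = e\<^bsup>\<phi>\<^esup> (k' - \<phi>\<^sub>1 k)\<close>, and on differentiating again the terms with \<open>k'\<close> cancel.
\<close>

lemma weighted_solution:
  assumes k: "\<And>t. t \<in> {0..T} \<Longrightarrow> (k has_vector_derivative k' t) (at t within {0..T})"
    and k': "\<And>t. t \<in> {0..T} \<Longrightarrow> (k' has_vector_derivative - Rop t (k t)) (at t within {0..T})"
  defines "y \<equiv> \<lambda>s. exp (- \<phi> (\<gamma> s)) *\<^sub>R k (arc s)"
    and "y' \<equiv> \<lambda>s. exp (\<phi> (\<gamma> s)) *\<^sub>R (k' (arc s) - \<phi>1 (arc s) *\<^sub>R k (arc s))"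
  assumes s: "s \<in> {0..S}"
  shows "(y has_vector_derivative y' s) (at s within {0..S})"
    and "(y' has_vector_derivative - Rs s (y s)) (at s within {0..S})"
proof -
  let ?\<phi> = "\<phi> (\<gamma> s)" and ?t = "arc s"
  note t = arc_in[OF s]
  have e2: "exp (- ?\<phi>) * exp (2 * ?\<phi>) = exp ?\<phi>" and e3: "exp ?\<phi> * exp (2 * ?\<phi>) = exp (3 * ?\<phi>)"
    and e4: "exp (4 * ?\<phi>) * exp (- ?\<phi>) = exp (3 * ?\<phi>)"
    by (simp_all add: exp_add[symmetric])
  have dm: "((\<lambda>s. exp (- \<phi> (\<gamma> s))) has_real_derivative exp (- ?\<phi>) * - (exp (2 * ?\<phi>) * \<phi>1 ?t)) (at s within {0..S})"
    by (rule DERIV_chain2[OF DERIV_exp DERIV_minus[OF \<phi>_\<gamma>[OF s]]])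
  have dp: "((\<lambda>s. exp (\<phi> (\<gamma> s))) has_real_derivative exp ?\<phi> * (exp (2 * ?\<phi>) * \<phi>1 ?t)) (at s within {0..S})"
    by (rule DERIV_chain2[OF DERIV_exp \<phi>_\<gamma>[OF s]])
  have "(y has_vector_derivative exp (- ?\<phi>) *\<^sub>R (exp (2 * ?\<phi>) *\<^sub>R k' ?t)
      + (exp (- ?\<phi>) * - (exp (2 * ?\<phi>) * \<phi>1 ?t)) *\<^sub>R k ?t) (at s within {0..S})"
    unfolding y_def by (rule has_vector_derivative_scaleR[OF dm compose_arc[OF s k[OF t]]])
  also have "exp (- ?\<phi>) *\<^sub>R (exp (2 * ?\<phi>) *\<^sub>R k' ?t) + (exp (- ?\<phi>) * - (exp (2 * ?\<phi>) * \<phi>1 ?t)) *\<^sub>R k ?t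
      = (exp (- ?\<phi>) * exp (2 * ?\<phi>)) *\<^sub>R k' ?t - ((exp (- ?\<phi>) * exp (2 * ?\<phi>)) * \<phi>1 ?t) *\<^sub>R k ?t"
    by (simp add: mult.assoc)
  also have "\<dots> = y' s" unfolding e2 by (simp add: y'_def algebra_simps)
  finally show "(y has_vector_derivative y' s) (at s within {0..S})" .
  let ?w = "k' ?t - \<phi>1 ?t *\<^sub>R k ?t"
  have dw: "((\<lambda>t. k' t - \<phi>1 t *\<^sub>R k t) has_vector_derivative
      - Rop ?t (k ?t) - (\<phi>1 ?t *\<^sub>R k' ?t + \<phi>2 ?t *\<^sub>R k ?t)) (at ?t within {0..T})"
    by (intro has_vector_derivative_diff has_vector_derivative_scaleR k k' \<phi>1_along t)
  have "(y' has_vector_derivative exp ?\<phi> *\<^sub>R (exp (2 * ?\<phi>) *\<^sub>R (- Rop ?t (k ?t) - (\<phi>1 ?t *\<^sub>R k' ?t + \<phi>2 ?t *\<^sub>R k ?t)))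
      + (exp ?\<phi> * (exp (2 * ?\<phi>) * \<phi>1 ?t)) *\<^sub>R ?w) (at s within {0..S})"
    unfolding y'_def by (rule has_vector_derivative_scaleR[OF dp compose_arc[OF s dw]])
  also have "exp ?\<phi> *\<^sub>R (exp (2 * ?\<phi>) *\<^sub>R (- Rop ?t (k ?t) - (\<phi>1 ?t *\<^sub>R k' ?t + \<phi>2 ?t *\<^sub>R k ?t)))
      + (exp ?\<phi> * (exp (2 * ?\<phi>) * \<phi>1 ?t)) *\<^sub>R ?w
      = (exp ?\<phi> * exp (2 * ?\<phi>)) *\<^sub>R ((- Rop ?t (k ?t) - (\<phi>1 ?t *\<^sub>R k' ?t + \<phi>2 ?t *\<^sub>R k ?t)) + \<phi>1 ?t *\<^sub>R ?w)"
    by (simp add: mult.assoc scaleR_add_right)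
  also have "\<dots> = - (exp (3 * ?\<phi>) *\<^sub>R (Rop ?t (k ?t) + (\<phi>2 ?t + (\<phi>1 ?t)\<^sup>2) *\<^sub>R k ?t))"
    unfolding e3 by (simp add: algebra_simps power2_eq_square)
  also have "\<dots> = - Rs s (y s)"
    unfolding e4[symmetric] Rs_def y_def linear_scale[OF linear_Rop[OF t]] by (simp add: algebra_simps)
  finally show "(y' has_vector_derivative - Rs s (y s)) (at s within {0..S})" .
qed

text \<open>
  \<open>d\<phi>(\<gamma>'(0))\<close>, the negative of the logarithmic derivative of \<open>e\<^bsup>-\<phi>\<^esup> J\<close> at \<open>0\<close>.
\<close>

definition \<theta>0 :: real where "\<theta>0 = dfun A \<phi> (\<gamma> 0) (velocity A {0..S} \<gamma> 0)"

lemma \<theta>0: "\<theta>0 = exp (2 * \<phi> (\<gamma> 0)) * \<phi>1 0"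
proof -
  note t = tangent_scale[OF vel_T[OF zero_in]]
  show ?thesis
    unfolding \<theta>0_def velocity_\<gamma>[OF zero_in_S] unfolding \<gamma>_0 arc_0 dfun_\<phi>[OF c0 t] \<phi>1_def dfun_\<phi>[OF c0 vel_T[OF zero_in]]
    using linear_scale[OF linear_d\<phi>[OF c0]] by (simp add: tscale_def)
qed

lemma weighted_solution_initial:
  fixes k k' :: "real \<Rightarrow> real ^ 'n"
  assumes "k' 0 = 0"
  shows "exp (\<phi> (\<gamma> 0)) *\<^sub>R (k' (arc 0) - \<phi>1 (arc 0) *\<^sub>R k (arc 0)) = - \<theta>0 *\<^sub>R (exp (- \<phi> (\<gamma> 0)) *\<^sub>R k (arc 0))"
proof -
  have "exp (\<phi> (\<gamma> 0)) = exp (2 * \<phi> (\<gamma> 0)) * exp (- \<phi> (\<gamma> 0))" by (simp add: exp_add[symmetric])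
  then show ?thesis unfolding arc_0 \<theta>0 assms by (simp add: mult.assoc mult.left_commute mult.commute)
qed

lemma unit_normal_frame:
  assumes s: "s \<in> {0..S}" and x: "b x e = 0" "b x x = 1"
  shows "frame (arc s) x \<in> tangent_space A (\<gamma> s)" "gnorm g (\<gamma> s) (frame (arc s) x) = 1"
    "g (\<gamma> s) (frame (arc s) x) (velocity A {0..S} \<gamma> s) = 0"
proof -
  note t = arc_in[OF s]
  show "frame (arc s) x \<in> tangent_space A (\<gamma> s)" using frame_tangent[OF t] by (simp add: \<gamma>_arc[OF s])
  show "gnorm g (\<gamma> s) (frame (arc s) x) = 1" using frame_metric[OF t, of x x] x by (simp add: gnorm_def \<gamma>_arc[OF s])
  show "g (\<gamma> s) (frame (arc s) x) (velocity A {0..S} \<gamma> s) = 0"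
    unfolding velocity_\<gamma>[OF s] unfolding \<gamma>_arc[OF s] g_scale_right[OF \<sigma>_points[OF t] frame_tangent[OF t] vel_T[OF t]]
    using frame_metric[OF t, of x e] x(1) by (simp add: vel_frame[OF t])
qed

text \<open>
  The passage from a perpendicular Jacobi field with derivative \<open>0\<close> at \<open>0\<close> to a solution in \<open>\<real>\<^sup>n\<close>; it is used
  for both manifolds.
\<close>

lemma jacobi_weighted_solution:
  assumes J: "jacobi_field A D {0..T} \<sigma> (in_arc_length \<phi> \<sigma> J)"
    and init: "cov_deriv A D {0..T} \<sigma> (in_arc_length \<phi> \<sigma> J) 0 = 0"
    and perp: "g (\<gamma> 0) (J 0) (velocity A {0..S} \<gamma> 0) = 0"
  obtains y y' where
    "\<And>s. s \<in> {0..S} \<Longrightarrow> (y has_vector_derivative y' s) (at s within {0..S})"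
    "\<And>s. s \<in> {0..S} \<Longrightarrow> (y' has_vector_derivative - Rs s (y s)) (at s within {0..S})"
    "y' 0 = - \<theta>0 *\<^sub>R y 0"
    "\<And>s. s \<in> {0..S} \<Longrightarrow> b (y s) e = 0"
    "\<And>s. s \<in> {0..S} \<Longrightarrow> sqrt (b (y s) (y s)) = weighted_norm g \<phi> \<gamma> J s"
    "\<And>s. s \<in> {0..S} \<Longrightarrow> y s = 0 \<Longrightarrow> J s = 0"
proof -
  let ?J = "in_arc_length \<phi> \<sigma> J"
  define k where "k t = co t (?J t)" for t
  define k' where "k' t = co t (cov ?J t)" for t
  note dk = jacobi_co(1)[OF J, folded k_def[abs_def] k'_def[abs_def] k_def k'_def]
  note dk' = jacobi_co(2)[OF J, folded k_def[abs_def] k'_def[abs_def] k_def k'_def]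
  have JT: "?J t \<in> tangent_space A (\<sigma> t)" if "t \<in> {0..T}" for t
    using J that by (simp add: jacobi_field_def field_along_def)
  have Jarc: "?J (arc s) = J s" if "s \<in> {0..S}" for s by (simp add: in_arc_length_def std_arc[OF that])
  have JT': "J s \<in> tangent_space A (\<sigma> (arc s))" and fk: "frame (arc s) (k (arc s)) = J s" if "s \<in> {0..S}" for s
    using JT[OF arc_in[OF that]] frame_co[OF arc_in[OF that] JT[OF arc_in[OF that]]]
    by (simp_all add: Jarc[OF that] k_def)
  have k'0: "k' 0 = 0" using init co_zero[OF zero_in] by (simp add: k'_def)
  have k0: "b (k 0) e = 0"
  proof -
    have "g (\<sigma> 0) (J 0) (tscale (exp (2 * \<phi> (\<gamma> 0))) (vel 0)) = 0"
      using perp unfolding velocity_\<gamma>[OF zero_in_S] by (simp add: \<gamma>_0 arc_0)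
    then have "g (\<sigma> 0) (J 0) (vel 0) = 0"
      using g_scale_right[OF \<sigma>_points[OF zero_in] _ vel_T[OF zero_in]] JT'[OF zero_in_S] by (simp add: arc_0)
    then show ?thesis
      using frame_metric[OF zero_in, of "k 0" e] fk[OF zero_in_S] by (simp add: arc_0 vel_frame[OF zero_in])
  qed
  define y where "y s = exp (- \<phi> (\<gamma> s)) *\<^sub>R k (arc s)" for s
  define y' where "y' s = exp (\<phi> (\<gamma> s)) *\<^sub>R (k' (arc s) - \<phi>1 (arc s) *\<^sub>R k (arc s))" for s
  note ws = weighted_solution[OF dk dk', folded y_def[abs_def] y'_def[abs_def] y_def y'_def]
  show ?thesis
  proof (rule that[OF ws])
    show "y' 0 = - \<theta>0 *\<^sub>R y 0" unfolding y_def y'_def by (rule weighted_solution_initial[of k' k, OF k'0])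
    fix s assume s: "s \<in> {0..S}"
    show "b (y s) e = 0"
      using jacobi_tangential_component[OF dk dk' k'0 arc_in[OF s]] k0 by (simp add: y_def bilinear_lmul[OF bilinear_b])
    have "b (k (arc s)) (k (arc s)) = g (\<gamma> s) (J s) (J s)"
      using frame_metric[OF arc_in[OF s], of "k (arc s)" "k (arc s)"] by (simp add: fk[OF s] \<gamma>_arc[OF s])
    then have "b (y s) (y s) = (exp (- \<phi> (\<gamma> s)))\<^sup>2 * g (\<gamma> s) (J s) (J s)"
      by (simp add: y_def bilinear_lmul[OF bilinear_b] bilinear_rmul[OF bilinear_b] power2_eq_square)
    then show "sqrt (b (y s) (y s)) = weighted_norm g \<phi> \<gamma> J s"
      by (simp add: weighted_norm_def gnorm_def real_sqrt_mult)
    show "J s = 0" if "y s = 0"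
    proof -
      have "k (arc s) = 0" using that by (simp add: y_def)
      then show ?thesis using fk[OF s] by (auto simp: fun_eq_iff frame_chart)
    qed
  qed
qed

end

section \<open>The comparison of weighted Jacobi fields\<close>

theorem theorem4p7:
  fixes A :: "('m::{t2_space,second_countable_topology}, 'n::finite) chart set"
    and g :: "('m, 'n) metric" and D :: "('m, 'n) connection" and \<phi> :: "'m \<Rightarrow> real"
    and A' :: "('k::{t2_space,second_countable_topology}, 'n) chart set"
    and g' :: "('k, 'n) metric" and D' :: "('k, 'n) connection" and \<phi>' :: "'k \<Rightarrow> real"
    and \<sigma> \<gamma> :: "real \<Rightarrow> 'm" and \<sigma>' \<gamma>' :: "real \<Rightarrow> 'k"
    and J :: "real \<Rightarrow> ('m, 'n) tvec" and J' :: "real \<Rightarrow> ('k, 'n) tvec"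
    and T T' S \<epsilon> :: real
  assumes M: "density_manifold A g D \<phi>"
    and M': "density_manifold A' g' D' \<phi>'"
    and geo: "phi_geodesic A g D \<phi> T \<sigma> S \<gamma>"
    and geo': "phi_geodesic A' g' D' \<phi>' T' \<sigma>' S \<gamma>'"
    and ball: "normal_ball A g D (\<gamma> 0) \<epsilon>"
    and no_focal: "\<And>t. t \<in> {0<..T} \<Longrightarrow>
      \<not> focal_point A g D
          (geodesic_submanifold A g D (\<gamma> 0) (velocity A {0..S} \<gamma> 0) \<epsilon>) {0..T} \<sigma> t"
    and curv: "\<And>s V V'. s \<in> {0..S} \<Longrightarrow>
      V \<in> tangent_space A (\<gamma> s) \<Longrightarrow> gnorm g (\<gamma> s) V = 1 \<Longrightarrow>
      g (\<gamma> s) V (velocity A {0..S} \<gamma> s) = 0 \<Longrightarrow>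
      V' \<in> tangent_space A' (\<gamma>' s) \<Longrightarrow> gnorm g' (\<gamma>' s) V' = 1 \<Longrightarrow>
      g' (\<gamma>' s) V' (velocity A' {0..S} \<gamma>' s) = 0 \<Longrightarrow>
      g (\<gamma> s) (curvature_at A (weighted_connection A D \<phi>) (\<gamma> s) V
          (velocity A {0..S} \<gamma> s) (velocity A {0..S} \<gamma> s)) V
      \<ge> g' (\<gamma>' s) (curvature_at A' (weighted_connection A' D' \<phi>') (\<gamma>' s) V'
          (velocity A' {0..S} \<gamma>' s) (velocity A' {0..S} \<gamma>' s)) V'"
    and jac: "jacobi_field A D {0..T} \<sigma> (in_arc_length \<phi> \<sigma> J)"
    and jac': "jacobi_field A' D' {0..T'} \<sigma>' (in_arc_length \<phi>' \<sigma>' J')"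
    and init: "cov_deriv A D {0..T} \<sigma> (in_arc_length \<phi> \<sigma> J) 0 = 0"
    and init': "cov_deriv A' D' {0..T'} \<sigma>' (in_arc_length \<phi>' \<sigma>' J') 0 = 0"
    and norms: "gnorm g (\<gamma> 0) (J 0) = gnorm g' (\<gamma>' 0) (J' 0)"
    and perp: "g (\<gamma> 0) (J 0) (velocity A {0..S} \<gamma> 0) = 0"
    and perp': "g' (\<gamma>' 0) (J' 0) (velocity A' {0..S} \<gamma>' 0) = 0"
  shows "\<forall>s\<in>{0..S}. (\<forall>\<xi>\<in>{0..s}. J' \<xi> \<noteq> 0) \<longrightarrow>
    exp (\<phi> (\<gamma> 0) - \<phi> (\<gamma> s)) * gnorm g (\<gamma> s) (J s)
    \<le> exp (\<phi>' (\<gamma>' 0) - \<phi>' (\<gamma>' s)) * gnorm g' (\<gamma>' s) (J' s)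
      * exp ((dfun A' \<phi>' (\<gamma>' 0) (velocity A' {0..S} \<gamma>' 0)
               - dfun A \<phi> (\<gamma> 0) (velocity A {0..S} \<gamma> 0))
             * integral {0..s} (\<lambda>\<xi>. (weighted_norm g' \<phi>' \<gamma>' J' 0)\<^sup>2 / (weighted_norm g' \<phi>' \<gamma>' J' \<xi>)\<^sup>2))"
proof (intro ballI impI)
  fix a assume a: "a \<in> {0..S}" and J'_ne: "\<forall>\<xi>\<in>{0..a}. J' \<xi> \<noteq> 0"
  interpret M: phi_segment A g D \<phi> T \<sigma> S \<gamma>
    by unfold_locales (use M geo in \<open>auto simp: density_manifold_def phi_geodesic_def\<close>)
  interpret H: phi_segment A' g' D' \<phi>' T' \<sigma>' S \<gamma>'
    by unfold_locales (use M' geo' in \<open>auto simp: density_manifold_def phi_geodesic_def\<close>)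
  interpret N: normal_ball_segment A g D \<phi> T \<sigma> \<epsilon>
    by unfold_locales (use ball in \<open>simp add: M.\<gamma>_0\<close>)
  obtain z z' where z: "\<And>s. s \<in> {0..S} \<Longrightarrow> (z has_vector_derivative z' s) (at s within {0..S})"
    "\<And>s. s \<in> {0..S} \<Longrightarrow> (z' has_vector_derivative - M.Rs s (z s)) (at s within {0..S})"
    "z' 0 = - M.\<theta>0 *\<^sub>R z 0" "\<And>s. s \<in> {0..S} \<Longrightarrow> M.b (z s) M.e = 0"
    "\<And>s. s \<in> {0..S} \<Longrightarrow> sqrt (M.b (z s) (z s)) = weighted_norm g \<phi> \<gamma> J s"
    using M.jacobi_weighted_solution[OF jac init perp] by metis
  obtain y y' where y: "\<And>s. s \<in> {0..S} \<Longrightarrow> (y has_vector_derivative y' s) (at s within {0..S})"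
    "\<And>s. s \<in> {0..S} \<Longrightarrow> (y' has_vector_derivative - H.Rs s (y s)) (at s within {0..S})"
    "y' 0 = - H.\<theta>0 *\<^sub>R y 0" "\<And>s. s \<in> {0..S} \<Longrightarrow> H.b (y s) H.e = 0"
    "\<And>s. s \<in> {0..S} \<Longrightarrow> sqrt (H.b (y s) (y s)) = weighted_norm g' \<phi>' \<gamma>' J' s"
    "\<And>s. s \<in> {0..S} \<Longrightarrow> y s = 0 \<Longrightarrow> J' s = 0"
    using H.jacobi_weighted_solution[OF jac' init' perp'] by metis
  have sub: "{0..a} \<subseteq> {0..S}" using a by auto
  have y_ne: "y s \<noteq> 0" if "s \<in> {0..a}" for s using y(6)[of s] J'_ne that sub by blast
  define w where "w = weighted_norm g' \<phi>' \<gamma>' J'"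
  \<comment> \<open>With this \<open>\<delta>\<close> the function \<open>h\<close> below has the initial logarithmic derivative \<open>- M.\<theta>0\<close>.\<close>
  define \<delta> where "\<delta> = H.\<theta>0 - M.\<theta>0"
  define E where "E s = exp (\<delta> * integral {0..s} (\<lambda>\<xi>. (w 0)\<^sup>2 / (w \<xi>)\<^sup>2))" for s
  have a0: "0 \<in> {0..a}" and aa: "a \<in> {0..a}" and S0: "0 \<in> {0..S}" using a by auto
  have y_norm: "sqrt (H.b (y s) (y s)) = w s" if "s \<in> {0..a}" for s
    using y(5)[of s] that sub by (auto simp: w_def)
  define h where "h s = sqrt (H.b (y s) (y s)) * exp (\<delta> * integral {0..s} (\<lambda>\<xi>. (sqrt (H.b (y 0) (y 0)))\<^sup>2 / (sqrt (H.b (y \<xi>) (y \<xi>)))\<^sup>2))" for s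
  have h_eq: "h s = w s * E s" if s: "s \<in> {0..a}" for s
  proof -
    have "integral {0..s} (\<lambda>\<xi>. (sqrt (H.b (y 0) (y 0)))\<^sup>2 / (sqrt (H.b (y \<xi>) (y \<xi>)))\<^sup>2)
        = integral {0..s} (\<lambda>\<xi>. (w 0)\<^sup>2 / (w \<xi>)\<^sup>2)"
      by (rule integral_cong) (use s y_norm[OF a0] in \<open>simp add: y_norm\<close>)
    then show ?thesis by (simp add: h_def E_def y_norm[OF s])
  qed
  have h0: "h 0 = w 0" using h_eq[OF a0] by (simp add: E_def)
  have main: "weighted_norm g \<phi> \<gamma> J a * h 0 \<le> weighted_norm g \<phi> \<gamma> J 0 * h a"
  proof (cases "a = 0")
    case False
    then have apos: "0 < a" using a by simp
    note sS = subsetD[OF sub]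
    have ya: "(y has_vector_derivative y' s) (at s within {0..a})"
      and ya': "(y' has_vector_derivative - H.Rs s (y s)) (at s within {0..a})" if s: "s \<in> {0..a}" for s
      by (rule has_vector_derivative_within_subset[OF y(1)[OF sS[OF s]] sub]
          has_vector_derivative_within_subset[OF y(2)[OF sS[OF s]] sub])+
    obtain h' h'' where h: "\<And>s. s \<in> {0..a} \<Longrightarrow> h s > 0"
      "\<And>s. s \<in> {0..a} \<Longrightarrow> (h has_real_derivative h' s) (at s within {0..a})"
      "\<And>s. s \<in> {0..a} \<Longrightarrow> (h' has_real_derivative h'' s) (at s within {0..a})"
      "h' 0 = (\<delta> - H.\<theta>0) * h 0"
      "\<And>s. s \<in> {0..a} \<Longrightarrow> 0 \<le> h s * H.b (H.Rs s (y s)) (y s) + h'' s * H.b (y s) (y s)"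
      by (rule norm_supersolution[of a H.b y y' H.Rs H.\<theta>0 \<delta>,
            OF less_imp_le[OF apos] H.bilinear_b H.b_sym H.b_pos ya ya' y_ne y(3), folded h_def]) (assumption | rule that)+
    interpret C: sturm_comparison M.b M.Rs h h' h'' a
    proof (rule sturm_comparison.intro)
      show "M.b (M.Rs s x) y = M.b (M.Rs s y) x" "linear (M.Rs s)" if "s \<in> {0..a}" for s x y
        by (rule M.Rs_sym[OF sS[OF that]] M.linear_Rs[OF sS[OF that]])+
    qed (fact apos M.bilinear_b | rule M.b_sym | erule M.b_pos | erule h)+
    have h'0: "h' 0 = - M.\<theta>0 * h 0" using h(4) by (simp add: \<delta>_def)
    have sol: "C.solution u u'"
      if u: "\<And>s. s \<in> {0..S} \<Longrightarrow> (u has_vector_derivative u' s) (at s within {0..S})"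
        "\<And>s. s \<in> {0..S} \<Longrightarrow> (u' has_vector_derivative - M.Rs s (u s)) (at s within {0..S})"
        "u' 0 = - M.\<theta>0 *\<^sub>R u 0" for u u'
    proof -
      have "(u has_vector_derivative u' s) (at s within {0..a}) \<and> (u' has_vector_derivative - M.Rs s (u s)) (at s within {0..a})"
        if s: "s \<in> {0..a}" for s
        using has_vector_derivative_within_subset[OF u(1)[OF sS[OF s]] sub]
          has_vector_derivative_within_subset[OF u(2)[OF sS[OF s]] sub] by (rule conjI)
      then show ?thesis unfolding C.solution_def u(3) h'0 by simp
    qed
    \<comment> \<open>The columns of the matrix solution: Jacobi fields with derivative \<open>0\<close> at \<open>0\<close> and initial values
      in the standard basis.\<close>
    have "\<exists>k k'. k 0 = axis j 1 \<and> k' 0 = 0 \<and>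
      (\<forall>t\<in>{0..T}. (k has_vector_derivative k' t) (at t within {0..T})) \<and>
      (\<forall>t\<in>{0..T}. (k' has_vector_derivative - M.Rop t (k t)) (at t within {0..T}))" for j
      using M.jacobi_solution_exists[of "axis j 1"] by metis
    then obtain k k' where k: "\<And>j. k j 0 = axis j (1::real)" "\<And>j. k' j 0 = 0"
      "\<And>j t. t \<in> {0..T} \<Longrightarrow> (k j has_vector_derivative k' j t) (at t within {0..T})"
      "\<And>j t. t \<in> {0..T} \<Longrightarrow> (k' j has_vector_derivative - M.Rop t (k j t)) (at t within {0..T})" by metis
    define u where "u j s = exp (- \<phi> (\<gamma> s)) *\<^sub>R k j (M.arc s)" for j s
    define u' where "u' j s = exp (\<phi> (\<gamma> s)) *\<^sub>R (k' j (M.arc s) - M.\<phi>1 (M.arc s) *\<^sub>R k j (M.arc s))" for j s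
    have u: "C.solution (u j) (u' j)" for j
    proof (rule sol)
      have kj: "(k j has_vector_derivative k' j t) (at t within {0..T})"
        "(k' j has_vector_derivative - M.Rop t (k j t)) (at t within {0..T})" if "t \<in> {0..T}" for t
        using k(3,4) that by blast+
      show "(u j has_vector_derivative u' j s) (at s within {0..S})" if "s \<in> {0..S}" for s
        unfolding u_def[abs_def] u'_def[abs_def]
        by (rule M.weighted_solution(1)[of "k j" "k' j", OF kj]) (assumption | rule that)+
      show "(u' j has_vector_derivative - M.Rs s (u j s)) (at s within {0..S})" if "s \<in> {0..S}" for s
        unfolding u_def[abs_def] u'_def[abs_def]
        by (rule M.weighted_solution(2)[of "k j" "k' j", OF kj]) (assumption | rule that)+
      show "u' j 0 = - M.\<theta>0 *\<^sub>R u j 0"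
        unfolding u_def u'_def by (rule M.weighted_solution_initial[of "k' j" "k j", OF k(2)])
    qed
    \<comment> \<open>A combination of the columns is a Jacobi field with derivative \<open>0\<close> at \<open>0\<close> and initial value \<open>c\<close>. If \<open>c\<close> is normal, it
      has no zero for lack of focal points; otherwise its constant tangential component is not \<open>0\<close>.\<close>
    have inj: "c = 0" if s: "s \<in> {0..a}" and c: "(\<Sum>j\<in>UNIV. c $ j *\<^sub>R u j s) = 0" for s c
    proof (rule ccontr)
      assume "c \<noteq> 0"
      have sS: "s \<in> {0..S}" using s sub by blast
      note t = M.arc_in[OF sS]
      define K where "K t = (\<Sum>j\<in>UNIV. c $ j *\<^sub>R k j t)" for t
      define K' where "K' t = (\<Sum>j\<in>UNIV. c $ j *\<^sub>R k' j t)" for t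
      have "exp (- \<phi> (\<gamma> s)) *\<^sub>R K (M.arc s) = (\<Sum>j\<in>UNIV. c $ j *\<^sub>R u j s)"
        by (simp add: K_def u_def scaleR_sum_right mult.commute)
      then have Kz: "K (M.arc s) = 0" using c by simp
      have dK: "(K has_vector_derivative K' t) (at t within {0..T})" if "t \<in> {0..T}" for t
        unfolding K_def[abs_def] K'_def
        by (intro has_vector_derivative_sum bounded_linear.has_vector_derivative[OF bounded_linear_scaleR_right] k(3) that)
      have dK': "(K' has_vector_derivative - M.Rop t (K t)) (at t within {0..T})" if "t \<in> {0..T}" for t
      proof -
        have "(K' has_vector_derivative (\<Sum>j\<in>UNIV. c $ j *\<^sub>R - M.Rop t (k j t))) (at t within {0..T})"
          unfolding K'_def[abs_def]
          by (intro has_vector_derivative_sum bounded_linear.has_vector_derivative[OF bounded_linear_scaleR_right] k(4) that)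
        then show ?thesis
          by (simp add: K_def linear_sum[OF M.linear_Rop[OF that]] linear_scale[OF M.linear_Rop[OF that]] sum_negf)
      qed
      have K0: "K 0 = c" "K' 0 = 0"
        by (simp_all add: K_def K'_def k(1,2) vec_eq_iff axis_def if_distrib cong: if_cong)
      show False
      proof (cases "M.b c M.e = 0")
        case True
        have n: "g (\<sigma> 0) v (velocity A {0..S} \<gamma> 0) = 0 \<longleftrightarrow> g (\<sigma> 0) v (M.vel 0) = 0" if "v \<in> tangent_space A (\<sigma> 0)" for v
          unfolding M.velocity_\<gamma>[OF S0] M.arc_0 M.g_scale_right[OF M.\<sigma>_points[OF M.zero_in] that M.vel_T[OF M.zero_in]] by simp
        have "K (M.arc s) \<noteq> 0"
          by (rule N.nonvanishing_without_focal_points[OF n no_focal[unfolded M.\<gamma>_0] dK dK' K0(2) _ _ t])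
            (use K0(1) \<open>c \<noteq> 0\<close> True in auto)
        with Kz show False by simp
      next
        case False
        then show False
          using M.jacobi_tangential_component[OF dK dK' K0(2) t] Kz K0(1) bilinear_lzero[OF M.bilinear_b] by simp
      qed
    qed
    \<comment> \<open>The curvature hypothesis, for the normalized vectors \<open>v / |v|\<close> and \<open>y(s) / |y(s)|\<close>.\<close>
    have super: "0 \<le> h s * M.b (M.Rs s v) v + h'' s * M.b v v" if s: "s \<in> {0..a}" and v: "v \<in> {v. M.b v M.e = 0}" for s v
    proof (cases "v = 0")
      case True
      then show ?thesis by (simp add: bilinear_rzero[OF M.bilinear_b])
    next
      case False
      have sS: "s \<in> {0..S}" using s sub by blast
      define r where "r = sqrt (M.b v v)"
      define q where "q = sqrt (H.b (y s) (y s))"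
      have r: "r > 0" "r\<^sup>2 = M.b v v" using M.b_pos[OF False] by (simp_all add: r_def)
      have q: "q > 0" "q\<^sup>2 = H.b (y s) (y s)" using H.b_pos[OF y_ne[OF s]] by (simp_all add: q_def)
      note bM = M.bilinear_b and bH = H.bilinear_b
      have 1: "M.b ((1 / r) *\<^sub>R v) M.e = 0" "M.b ((1 / r) *\<^sub>R v) ((1 / r) *\<^sub>R v) = 1"
        using v r by (simp_all add: bilinear_lmul[OF bM] bilinear_rmul[OF bM] r(2)[symmetric] power2_eq_square)
      have 2: "H.b ((1 / q) *\<^sub>R y s) H.e = 0" "H.b ((1 / q) *\<^sub>R y s) ((1 / q) *\<^sub>R y s) = 1"
        using y(4)[OF sS] q by (simp_all add: bilinear_lmul[OF bH] bilinear_rmul[OF bH] q(2)[symmetric] power2_eq_square)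
      have "H.b (H.Rs s ((1 / q) *\<^sub>R y s)) ((1 / q) *\<^sub>R y s) \<le> M.b (M.Rs s ((1 / r) *\<^sub>R v)) ((1 / r) *\<^sub>R v)"
        using curv[OF sS M.unit_normal_frame[OF sS 1] H.unit_normal_frame[OF sS 2]]
        unfolding M.weighted_curvature_frame[OF sS 1(1)] H.weighted_curvature_frame[OF sS 2(1)] .
      then have "H.b (H.Rs s (y s)) (y s) / q\<^sup>2 \<le> M.b (M.Rs s v) v / r\<^sup>2"
        by (simp add: linear_scale[OF M.linear_Rs[OF sS]] linear_scale[OF H.linear_Rs[OF sS]]
            bilinear_lmul[OF bM] bilinear_rmul[OF bM] bilinear_lmul[OF bH] bilinear_rmul[OF bH] power2_eq_square)
      then have "0 \<le> h s * (M.b (M.Rs s v) v / r\<^sup>2 - H.b (H.Rs s (y s)) (y s) / q\<^sup>2)"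
        using h(1)[OF s] by simp
      moreover have "0 \<le> (h s * H.b (H.Rs s (y s)) (y s) + h'' s * q\<^sup>2) / q\<^sup>2"
        unfolding q(2) by (rule divide_nonneg_nonneg[OF h(5)[OF s] less_imp_le[OF H.b_pos[OF y_ne[OF s]]]])
      ultimately have "0 \<le> h s * (M.b (M.Rs s v) v / r\<^sup>2 - H.b (H.Rs s (y s)) (y s) / q\<^sup>2)
          + (h s * H.b (H.Rs s (y s)) (y s) + h'' s * q\<^sup>2) / q\<^sup>2" by (rule add_nonneg_nonneg)
      also have "\<dots> = h s * M.b (M.Rs s v) v / r\<^sup>2 + h'' s"
        using q(1) r(1) by (simp add: field_simps)
      finally have "0 \<le> (h s * M.b (M.Rs s v) v / r\<^sup>2 + h'' s) * r\<^sup>2" by simp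
      then show ?thesis using r(1) by (simp add: r(2)[symmetric] algebra_simps)
    qed
    have "M.b (z a) (z a) / (h a)\<^sup>2 \<le> M.b (z 0) (z 0) / (h 0)\<^sup>2"
      by (rule C.norm_ratio_nonincreasing[where V = "{v. M.b v M.e = 0}", OF u inj sol[OF z(1-3)] _ super aa])
        (use z(4) sub in auto)
    then have "sqrt (M.b (z a) (z a)) / h a \<le> sqrt (M.b (z 0) (z 0)) / h 0"
      using real_sqrt_le_mono h(1)[OF aa] h(1)[OF a0] by (fastforce simp: real_sqrt_divide)
    then show ?thesis
      using h(1)[OF aa] h(1)[OF a0] z(5)[OF a] z(5)[OF S0] by (simp add: field_simps)
  qed simp
  have Jpos: "gnorm g' (\<gamma>' 0) (J' 0) > 0"
  proof -
    have "sqrt (H.b (y 0) (y 0)) > 0" using H.b_pos[OF y_ne[OF a0]] by simp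
    then show ?thesis using y(5)[OF S0] by (simp add: weighted_norm_def zero_less_mult_iff)
  qed
  let ?R = "gnorm g' (\<gamma>' a) (J' a)" and ?n = "gnorm g' (\<gamma>' 0) (J' 0)" and ?L = "gnorm g (\<gamma> a) (J a)"
  have "(exp (- \<phi> (\<gamma> a)) * ?L) * (exp (- \<phi>' (\<gamma>' 0)) * ?n) \<le> (exp (- \<phi> (\<gamma> 0)) * ?n) * (exp (- \<phi>' (\<gamma>' a)) * ?R * E a)"
    using main unfolding h0 h_eq[OF aa] by (simp add: w_def weighted_norm_def norms)
  then have "(exp (- \<phi> (\<gamma> a)) * ?L * exp (- \<phi>' (\<gamma>' 0))) * ?n
      \<le> (exp (- \<phi> (\<gamma> 0)) * (exp (- \<phi>' (\<gamma>' a)) * ?R * E a)) * ?n"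
    by (simp only: mult_ac)
  from mult_right_le_imp_le[OF this Jpos]
  have "exp (- \<phi> (\<gamma> a)) * ?L * exp (- \<phi>' (\<gamma>' 0)) \<le> exp (- \<phi> (\<gamma> 0)) * (exp (- \<phi>' (\<gamma>' a)) * ?R * E a)" .
  then have "(exp (\<phi> (\<gamma> 0)) * exp (\<phi>' (\<gamma>' 0))) * (exp (- \<phi> (\<gamma> a)) * ?L * exp (- \<phi>' (\<gamma>' 0)))
      \<le> (exp (\<phi> (\<gamma> 0)) * exp (\<phi>' (\<gamma>' 0))) * (exp (- \<phi> (\<gamma> 0)) * (exp (- \<phi>' (\<gamma>' a)) * ?R * E a))"
    by (intro mult_left_mono) simp_all
  then have "exp (\<phi> (\<gamma> 0) - \<phi> (\<gamma> a)) * ?L \<le> exp (\<phi>' (\<gamma>' 0) - \<phi>' (\<gamma>' a)) * ?R * E a"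
    by (simp add: exp_diff exp_minus field_simps)
  then show "exp (\<phi> (\<gamma> 0) - \<phi> (\<gamma> a)) * gnorm g (\<gamma> a) (J a)
    \<le> exp (\<phi>' (\<gamma>' 0) - \<phi>' (\<gamma>' a)) * gnorm g' (\<gamma>' a) (J' a)
      * exp ((dfun A' \<phi>' (\<gamma>' 0) (velocity A' {0..S} \<gamma>' 0)
               - dfun A \<phi> (\<gamma> 0) (velocity A {0..S} \<gamma> 0))
             * integral {0..a} (\<lambda>\<xi>. (weighted_norm g' \<phi>' \<gamma>' J' 0)\<^sup>2 / (weighted_norm g' \<phi>' \<gamma>' J' \<xi>)\<^sup>2))"
    by (simp add: E_def \<delta>_def w_def M.\<theta>0_def H.\<theta>0_def)
qed

end
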